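(* Let $Q$, $\lambda$, $\Pi^\lambda(Q)$, $\Gamma$, $\Gamma'$, $(V_i)_{i\in I}$ and $S_{\mathbb C}$ be as in the context, and let $i\in I$. Then the algebra $e_i\Pi^\lambda(Q)e_i$ is isomorphic to the algebra of polynomial (regular) $\Gamma'$-equivariant maps from $S_{\mathbb C}$ to $\operatorname{End}_{\mathbb C}(V_i)$ (with pointwise operations). Moreover, under this isomorphism the involution on the latter algebra given by $f^*(x)=f(\overline{x})^*$, $x\in S_{\mathbb C}$, coincides with the one induced from the involution $*$ of $e_i\Pi^\lambda(Q)e_i$.
   Context: Let $G$ be an extended Dynkin graph of type $\widetilde{A_n}$, $\widetilde{D_n}$, $\widetilde{E_6}$, $\widetilde{E_7}$ or $\widetilde{E_8}$ which is not a cycle with an odd number of vertices, with vertex set $I$, extending vertex $0\in I$ and minimal imaginary root $\delta=(\delta_i)_{i\in I}$. Split $I$ into even and odd vertices so that $0$ is even and every edge connects an even vertex with an odd one. Let $Q$ be the quiver obtained from $G$ by directing every edge from its odd endpoint to its even endpoint. Let $\lambda_i=\delta_i$ for $i$ even and $\lambda_i=-\delta_i$ for $i$ odd. The double quiver $\overline{Q}$ is obtained from $Q$ by adding a reverse arrow $a^*:j\to i$ for each arrow $a:i\to j$ of $Q$. Its path algebra $\mathbb C\overline{Q}$ has the paths as basis, including a trivial path $e_i$ for each $i\in I$; paths are composed from right to left, so for $a:i\to j$ in $Q$ one has $aa^*\in e_j\mathbb C\overline{Q}e_j$ and $a^*a\in e_i\mathbb C\overline{Q}e_i$. The deformed preprojective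 algebra is $$\Pi^\lambda(Q)=\mathbb C\overline{Q}\Big/\Big(\sum_{a\in Q}(aa^*-a^*a)-\sum_{i\in I}\lambda_ie_i\Big).$$ It carries the antilinear involution $*$ (an antilinear anti-automorphism) determined by $e_i\mapsto e_i$, $a\mapsto a^*$, $a^*\mapsto a$ for $a\in Q$; it restricts to $e_i\Pi^\lambda(Q)e_i$. Let $\Gamma\subset SU(2,\mathbb C)$ be the finite group corresponding to $G$ by the McKay correspondence: there is a bijection $i\leftrightarrow V_i$ between $I$ and the isomorphism classes of irreducible complex representations of $\Gamma$ such that $V_0$ is trivial, $\dim V_i=\delta_i$, and the number of edges between $i$ and $j$ is the multiplicity of $V_i$ in $V\otimes V_j$, where $V=\mathbb C^2$ is the tautological representation. Each $V_i$ is given a hermitian structure making it unitary, which defines the adjoint on $\operatorname{End}_{\mathbb C}(V_i)$. Under the assumptions on $G$ one has $-I\in\Gamma$; put $\Gamma'=\Gamma/\{I,-I\}$. The group $\Gamma'$ acts on $\operatorname{End}_{\mathbb C}(V_i)$ by conjugation, and on $\mathbb R^3$ and $\mathbb C^3$ via the standard homomorphism $SU(2,\mathbb C)\to SO(3,\mathbb R)\subset SO(3,\mathbb C)$. Let $S_{\mathbb C}=\{(x,y,z)\in\mathbb C^3: x^2+y^2+z^2=1\}$, an affine variety preserved by $\Gamma'$; $\overline{x}$ is coordinatewise complex conjugation. *)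

theory Defs
  imports
    "HOL-Algebra.QuotRing"
    "HOL-Library.Poly_Mapping"
    "Graph_Theory.Graph_Theory"
    "Jordan_Normal_Form.Schur_Decomposition"
begin

datatype affine_type = A_tilde nat | D_tilde nat | E6_tilde | E7_tilde | E8_tilde

text \<open>
  The type with index \<open>n\<close> has the \<open>n + 1\<close> vertices \<open>0, \<dots>, n\<close>, and \<open>0\<close> is an extending vertex.
  Edges are listed, so that they can be repeated: \<open>A_tilde 1\<close> is the cycle with two vertices,
  that is, a double edge.
\<close>

fun affine_rank :: "affine_type \<Rightarrow> nat" where
  "affine_rank (A_tilde n) = n"
| "affine_rank (D_tilde n) = n"
| "affine_rank E6_tilde = 6"
| "affine_rank E7_tilde = 7"
| "affine_rank E8_tilde = 8"

fun affine_type_ok :: "affine_type \<Rightarrow> bool" where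
  "affine_type_ok (A_tilde n) \<longleftrightarrow> 1 \<le> n"
| "affine_type_ok (D_tilde n) \<longleftrightarrow> 4 \<le> n"
| "affine_type_ok _ \<longleftrightarrow> True"

fun affine_edges :: "affine_type \<Rightarrow> (nat \<times> nat) list" where
  "affine_edges (A_tilde n) = map (\<lambda>k. (k, Suc k)) [0..<n] @ [(n, 0)]"
| "affine_edges (D_tilde n) =
     [(0, 2), (1, 2)] @ map (\<lambda>k. (k, Suc k)) [2..<n - 2] @ [(n - 2, n - 1), (n - 2, n)]"
| "affine_edges E6_tilde = [(0, 1), (1, 2), (2, 3), (3, 4), (2, 5), (5, 6)]"
| "affine_edges E7_tilde = [(0, 1), (1, 2), (2, 3), (3, 4), (4, 5), (5, 6), (3, 7)]"
| "affine_edges E8_tilde = [(0, 1), (1, 2), (2, 3), (3, 4), (4, 5), (5, 6), (6, 7), (5, 8)]"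

definition affine_edge_count :: "affine_type \<Rightarrow> nat \<Rightarrow> nat \<Rightarrow> nat" where
  "affine_edge_count T k l = length (filter (\<lambda>e. e = (k, l) \<or> e = (l, k)) (affine_edges T))"

definition edge_count :: "('v, 'e) pre_digraph \<Rightarrow> 'v \<Rightarrow> 'v \<Rightarrow> nat" where
  "edge_count Q i j =
     card {a \<in> arcs Q. (tail Q a = i \<and> head Q a = j) \<or> (tail Q a = j \<and> head Q a = i)}"

text \<open>The underlying unoriented multigraph of \<open>Q\<close> is of type \<open>T\<close>, with extending vertex \<open>v0\<close>.\<close>

definition extended_dynkin :: "affine_type \<Rightarrow> ('v, 'e) pre_digraph \<Rightarrow> 'v \<Rightarrow> bool" where
  "extended_dynkin T Q v0 \<longleftrightarrow>
     fin_digraph Q \<and> affine_type_ok T \<and> v0 \<in> verts Q \<and>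
     (\<exists>f. bij_betw f (verts Q) {0..affine_rank T} \<and> f v0 = 0 \<and>
        (\<forall>i\<in>verts Q. \<forall>j\<in>verts Q. edge_count Q i j = affine_edge_count T (f i) (f j)))"

definition tits_form :: "('v, 'e) pre_digraph \<Rightarrow> ('v \<Rightarrow> int) \<Rightarrow> int" where
  "tits_form Q \<alpha> =
     (\<Sum>i\<in>verts Q. \<alpha> i * \<alpha> i) - (\<Sum>a\<in>arcs Q. \<alpha> (tail Q a) * \<alpha> (head Q a))"

text \<open>For extended Dynkin graphs the imaginary roots are the nonzero isotropic integral vectors.\<close>

definition positive_imaginary_root :: "('v, 'e) pre_digraph \<Rightarrow> ('v \<Rightarrow> nat) \<Rightarrow> bool" where
  "positive_imaginary_root Q \<alpha> \<longleftrightarrow>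
     (\<exists>i\<in>verts Q. \<alpha> i \<noteq> 0) \<and> tits_form Q (\<lambda>i. int (\<alpha> i)) = 0"

definition minimal_imaginary_root :: "('v, 'e) pre_digraph \<Rightarrow> ('v \<Rightarrow> nat) \<Rightarrow> bool" where
  "minimal_imaginary_root Q \<delta> \<longleftrightarrow>
     positive_imaginary_root Q \<delta> \<and>
     (\<forall>\<beta>. positive_imaginary_root Q \<beta> \<longrightarrow> (\<forall>i\<in>verts Q. \<delta> i \<le> \<beta> i))"

text \<open>
  Algebras that need not be commutative are records of type \<^typ>\<open>(complex, 'a) module\<close>, which have
  the ring operations and a scalar multiplication (the library locale \<open>algebra\<close> covers
  commutative algebras only).
\<close>

definition algebra_iso :: "(complex, 'a) module \<Rightarrow> (complex, 'b) module \<Rightarrow> ('a \<Rightarrow> 'b) set" where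
  "algebra_iso A B =
     {h \<in> ring_iso A B. \<forall>c. \<forall>x\<in>carrier A. h (c \<odot>\<^bsub>A\<^esub> x) = c \<odot>\<^bsub>B\<^esub> h x}"

definition quotient_algebra :: "(complex, 'a) module \<Rightarrow> 'a set \<Rightarrow> (complex, 'a set) module" where
  "quotient_algebra A J =
     \<lparr>carrier = carrier (A Quot J),
      monoid.mult = (\<otimes>\<^bsub>A Quot J\<^esub>),
      one = \<one>\<^bsub>A Quot J\<^esub>,
      zero = \<zero>\<^bsub>A Quot J\<^esub>,
      add = (\<oplus>\<^bsub>A Quot J\<^esub>),
      module.smult = (\<lambda>c X. \<Union>x\<in>X. J +>\<^bsub>A\<^esub> (c \<odot>\<^bsub>A\<^esub> x))\<rparr>"

definition corner :: "(complex, 'a) module \<Rightarrow> 'a \<Rightarrow> (complex, 'a) module" where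
  "corner A e = A\<lparr>carrier := {e \<otimes>\<^bsub>A\<^esub> x \<otimes>\<^bsub>A\<^esub> e | x. x \<in> carrier A}, one := e\<rparr>"

text \<open>\<open>Inl a\<close> is the arrow \<open>a\<close> itself, and \<open>Inr a\<close> is the reverse arrow \<open>a\<^sup>*\<close>.\<close>

definition double_quiver :: "('v, 'e) pre_digraph \<Rightarrow> ('v, 'e + 'e) pre_digraph" where
  "double_quiver Q =
     \<lparr>verts = verts Q,
      arcs = arcs Q <+> arcs Q,
      tail = case_sum (tail Q) (head Q),
      head = case_sum (head Q) (tail Q)\<rparr>"

text \<open>
  A path is a triple (source, arrows in the order in which they are traversed, target). In a product
  \<open>p q\<close> of paths the path \<open>q\<close> is traversed first.
\<close>

type_synonym ('v, 'b) path = "'v \<times> 'b list \<times> 'v"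

definition paths :: "('v, 'b) pre_digraph \<Rightarrow> ('v, 'b) path set" where
  "paths G = {(u, p, v). pre_digraph.awalk G u p v}"

fun path_product :: "('v, 'b) path \<Rightarrow> ('v, 'b) path \<Rightarrow> (('v, 'b) path \<Rightarrow>\<^sub>0 complex)" where
  "path_product (j, p, k) (i, q, l) = (if j = l then Poly_Mapping.single (i, q @ p, k) 1 else 0)"

definition scale :: "complex \<Rightarrow> ('p \<Rightarrow>\<^sub>0 complex) \<Rightarrow> ('p \<Rightarrow>\<^sub>0 complex)" where
  "scale c f = Poly_Mapping.map (\<lambda>z. c * z) f"

definition path_mult ::
  "(('v, 'b) path \<Rightarrow>\<^sub>0 complex) \<Rightarrow> (('v, 'b) path \<Rightarrow>\<^sub>0 complex) \<Rightarrow> (('v, 'b) path \<Rightarrow>\<^sub>0 complex)" where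
  "path_mult f g = (\<Sum>p\<in>Poly_Mapping.keys f. \<Sum>q\<in>Poly_Mapping.keys g.
     scale (Poly_Mapping.lookup f p * Poly_Mapping.lookup g q) (path_product p q))"

definition trivial_path :: "'v \<Rightarrow> (('v, 'b) path \<Rightarrow>\<^sub>0 complex)" where
  "trivial_path i = Poly_Mapping.single (i, [], i) 1"

definition arrow :: "('v, 'b) pre_digraph \<Rightarrow> 'b \<Rightarrow> (('v, 'b) path \<Rightarrow>\<^sub>0 complex)" where
  "arrow G b = Poly_Mapping.single (tail G b, [b], head G b) 1"

definition path_algebra ::
  "('v, 'b) pre_digraph \<Rightarrow> (complex, ('v, 'b) path \<Rightarrow>\<^sub>0 complex) module" where
  "path_algebra G =
     \<lparr>carrier = {f. Poly_Mapping.keys f \<subseteq> paths G},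
      monoid.mult = path_mult,
      one = (\<Sum>i\<in>verts G. trivial_path i),
      zero = 0,
      add = (+),
      module.smult = scale\<rparr>"

definition preprojective_relation ::
  "('v, 'e) pre_digraph \<Rightarrow> ('v \<Rightarrow> complex) \<Rightarrow> (('v, 'e + 'e) path \<Rightarrow>\<^sub>0 complex)" where
  "preprojective_relation Q lam =
     (let x = (\<lambda>a. arrow (double_quiver Q) (Inl a)); xs = (\<lambda>a. arrow (double_quiver Q) (Inr a)) in
      (\<Sum>a\<in>arcs Q. path_mult (x a) (xs a) - path_mult (xs a) (x a))
      - (\<Sum>i\<in>verts Q. scale (lam i) (trivial_path i)))"

definition preprojective_ideal ::
  "('v, 'e) pre_digraph \<Rightarrow> ('v \<Rightarrow> complex) \<Rightarrow> (('v, 'e + 'e) path \<Rightarrow>\<^sub>0 complex) set" where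
  "preprojective_ideal Q lam =
     Idl\<^bsub>path_algebra (double_quiver Q)\<^esub> {preprojective_relation Q lam}"

definition deformed_preprojective_algebra ::
  "('v, 'e) pre_digraph \<Rightarrow> ('v \<Rightarrow> complex) \<Rightarrow>
   (complex, (('v, 'e + 'e) path \<Rightarrow>\<^sub>0 complex) set) module" where
  "deformed_preprojective_algebra Q lam =
     quotient_algebra (path_algebra (double_quiver Q)) (preprojective_ideal Q lam)"

definition vertex_idempotent ::
  "('v, 'e) pre_digraph \<Rightarrow> ('v \<Rightarrow> complex) \<Rightarrow> 'v \<Rightarrow> (('v, 'e + 'e) path \<Rightarrow>\<^sub>0 complex) set" where
  "vertex_idempotent Q lam i =
     preprojective_ideal Q lam +>\<^bsub>path_algebra (double_quiver Q)\<^esub> trivial_path i"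

fun path_reverse :: "('v, 'e + 'e) path \<Rightarrow> ('v, 'e + 'e) path" where
  "path_reverse (u, p, v) = (v, rev (map (case_sum Inr Inl) p), u)"

definition path_star ::
  "(('v, 'e + 'e) path \<Rightarrow>\<^sub>0 complex) \<Rightarrow> (('v, 'e + 'e) path \<Rightarrow>\<^sub>0 complex)" where
  "path_star f =
     (\<Sum>p\<in>Poly_Mapping.keys f. Poly_Mapping.single (path_reverse p) (cnj (Poly_Mapping.lookup f p)))"

text \<open>The ideal is stable under \<^const>\<open>path_star\<close>, so this sends the class of \<open>x\<close> to that of
  \<open>path_star x\<close>.\<close>

definition preprojective_star ::
  "('v, 'e) pre_digraph \<Rightarrow> ('v \<Rightarrow> complex) \<Rightarrow>
   (('v, 'e + 'e) path \<Rightarrow>\<^sub>0 complex) set \<Rightarrow> (('v, 'e + 'e) path \<Rightarrow>\<^sub>0 complex) set" where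
  "preprojective_star Q lam X =
     (\<Union>x\<in>X. preprojective_ideal Q lam +>\<^bsub>path_algebra (double_quiver Q)\<^esub> path_star x)"

text \<open>A matrix representation is a pair (dimension, homomorphism).\<close>

type_synonym 'g rep = "nat \<times> ('g \<Rightarrow> complex mat)"

definition representation :: "'g monoid \<Rightarrow> 'g rep \<Rightarrow> bool" where
  "representation G R \<longleftrightarrow> snd R \<in> hom G (units_of (ring_mat TYPE(complex) (fst R) ()))"

text \<open>
  A representation space with an invariant hermitian structure is given in an orthonormal basis, so
  that the adjoint of an endomorphism is the conjugate transpose \<^const>\<open>mat_adjoint\<close> of its matrix.
\<close>

definition unitary_rep :: "'g monoid \<Rightarrow> 'g rep \<Rightarrow> bool" where
  "unitary_rep G R \<longleftrightarrow>
     representation G R \<and> (\<forall>g\<in>carrier G. mat_adjoint (snd R g) * snd R g = 1\<^sub>m (fst R))"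

definition irreducible_rep :: "'g monoid \<Rightarrow> 'g rep \<Rightarrow> bool" where
  "irreducible_rep G R \<longleftrightarrow>
     representation G R \<and> 0 < fst R \<and>
     (\<forall>W. subspace class_ring W (module_vec TYPE(complex) (fst R)) \<and>
          (\<forall>g\<in>carrier G. \<forall>w\<in>W. snd R g *\<^sub>v w \<in> W) \<longrightarrow>
          W = {0\<^sub>v (fst R)} \<or> W = carrier_vec (fst R))"

definition rep_iso :: "'g monoid \<Rightarrow> 'g rep \<Rightarrow> 'g rep \<Rightarrow> bool" where
  "rep_iso G R S \<longleftrightarrow>
     fst R = fst S \<and>
     (\<exists>P\<in>Units (ring_mat TYPE(complex) (fst R) ()). \<forall>g\<in>carrier G. P * snd R g = snd S g * P)"

definition kronecker_product :: "complex mat \<Rightarrow> complex mat \<Rightarrow> complex mat" where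
  "kronecker_product A B =
     mat (dim_row A * dim_row B) (dim_col A * dim_col B)
       (\<lambda>(r, c). A $$ (r div dim_row B, c div dim_col B) * B $$ (r mod dim_row B, c mod dim_col B))"

definition tensor_rep :: "'g rep \<Rightarrow> 'g rep \<Rightarrow> 'g rep" where
  "tensor_rep R S = (fst R * fst S, \<lambda>g. kronecker_product (snd R g) (snd S g))"

definition direct_sum_rep :: "'g rep list \<Rightarrow> 'g rep" where
  "direct_sum_rep Rs = (sum_list (map fst Rs), \<lambda>g. diag_block_mat (map (\<lambda>R. snd R g) Rs))"

text \<open>
  \<open>m\<close> is the number of summands isomorphic to the irreducible \<open>W\<close> in a decomposition of \<open>U\<close> into
  irreducibles.
\<close>

definition has_multiplicity :: "'g monoid \<Rightarrow> 'g rep \<Rightarrow> 'g rep \<Rightarrow> nat \<Rightarrow> bool" where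
  "has_multiplicity G W U m \<longleftrightarrow>
     (\<exists>Rs. (\<forall>R\<in>set Rs. irreducible_rep G R) \<and> rep_iso G U (direct_sum_rep Rs) \<and>
           m = length (filter (rep_iso G W) Rs))"

definition SU2 :: "complex mat monoid" where
  "SU2 = \<lparr>carrier = {g \<in> carrier_mat 2 2. mat_adjoint g * g = 1\<^sub>m 2 \<and> det g = 1},
          monoid.mult = (*), one = 1\<^sub>m 2\<rparr>"

abbreviation SU2_sub :: "complex mat set \<Rightarrow> complex mat monoid" where
  "SU2_sub \<Gamma> \<equiv> SU2\<lparr>carrier := \<Gamma>\<rparr>"

definition mckay_correspondence ::
  "('v, 'e) pre_digraph \<Rightarrow> 'v \<Rightarrow> ('v \<Rightarrow> nat) \<Rightarrow> complex mat set \<Rightarrow> ('v \<Rightarrow> complex mat rep) \<Rightarrow> bool"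
  where
  "mckay_correspondence Q v0 \<delta> \<Gamma> V \<longleftrightarrow>
     finite \<Gamma> \<and> subgroup \<Gamma> SU2 \<and>
     (\<forall>i\<in>verts Q. irreducible_rep (SU2_sub \<Gamma>) (V i)) \<and>
     (\<forall>i\<in>verts Q. \<forall>j\<in>verts Q. rep_iso (SU2_sub \<Gamma>) (V i) (V j) \<longrightarrow> i = j) \<and>
     (\<forall>R. irreducible_rep (SU2_sub \<Gamma>) R \<longrightarrow> (\<exists>i\<in>verts Q. rep_iso (SU2_sub \<Gamma>) R (V i))) \<and>
     rep_iso (SU2_sub \<Gamma>) (V v0) (1, \<lambda>g. 1\<^sub>m 1) \<and>
     (\<forall>i\<in>verts Q. fst (V i) = \<delta> i) \<and>
     (\<forall>i\<in>verts Q. \<forall>j\<in>verts Q.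
        has_multiplicity (SU2_sub \<Gamma>) (V i) (tensor_rep (2, \<lambda>g. g) (V j)) (edge_count Q i j))"

definition projective_group :: "complex mat set \<Rightarrow> complex mat set monoid" where
  "projective_group \<Gamma> = SU2_sub \<Gamma> Mod {1\<^sub>m 2, - 1\<^sub>m 2}"

text \<open>The action of a coset is that of any of its elements (all of them act alike).\<close>

definition coset_action :: "('g \<Rightarrow> 'x \<Rightarrow> 'x) \<Rightarrow> 'g set \<Rightarrow> 'x \<Rightarrow> 'x" where
  "coset_action act C x = the_elem ((\<lambda>g. act g x) ` C)"

text \<open>
  The standard homomorphism from SU(2) to SO(3): three-space is identified with the traceless
  2 by 2 matrices (with real points corresponding to hermitian ones) by means of the Pauli matrices,
  and \<open>g\<close> acts by conjugation.
\<close>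

fun pauli :: "complex \<times> complex \<times> complex \<Rightarrow> complex mat" where
  "pauli (x, y, z) = mat_of_rows_list 2 [[z, x - \<i> * y], [x + \<i> * y, - z]]"

definition rotation ::
  "complex mat \<Rightarrow> complex \<times> complex \<times> complex \<Rightarrow> complex \<times> complex \<times> complex" where
  "rotation g p = (THE q. pauli q = g * pauli p * inv\<^bsub>SU2\<^esub> g)"

definition rep_conj :: "complex mat rep \<Rightarrow> complex mat \<Rightarrow> complex mat \<Rightarrow> complex mat" where
  "rep_conj R g M = snd R g * M * snd R (inv\<^bsub>SU2\<^esub> g)"

definition complex_sphere :: "(complex \<times> complex \<times> complex) set" where
  "complex_sphere = {(x, y, z). x\<^sup>2 + y\<^sup>2 + z\<^sup>2 = 1}"

fun cnj3 :: "complex \<times> complex \<times> complex \<Rightarrow> complex \<times> complex \<times> complex" where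
  "cnj3 (x, y, z) = (cnj x, cnj y, cnj z)"

definition polynomial_on ::
  "(complex \<times> complex \<times> complex) set \<Rightarrow> (complex \<times> complex \<times> complex \<Rightarrow> complex) \<Rightarrow> bool" where
  "polynomial_on S f \<longleftrightarrow>
     (\<exists>N a. \<forall>(x, y, z)\<in>S. f (x, y, z) =
        (\<Sum>k\<le>N. \<Sum>l\<le>N. \<Sum>m\<le>N. a (k :: nat) (l :: nat) (m :: nat) * x ^ k * y ^ l * z ^ m))"

definition equivariant_maps ::
  "complex mat set \<Rightarrow> complex mat rep \<Rightarrow> (complex, complex \<times> complex \<times> complex \<Rightarrow> complex mat) module"
  where
  "equivariant_maps \<Gamma> R =
     (let S = complex_sphere; d = fst R in
      \<lparr>carrier = {f \<in> S \<rightarrow>\<^sub>E carrier_mat d d.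
         (\<forall>r<d. \<forall>c<d. polynomial_on S (\<lambda>x. f x $$ (r, c))) \<and>
         (\<forall>C\<in>carrier (projective_group \<Gamma>). \<forall>x\<in>S.
            f (coset_action rotation C x) = coset_action (rep_conj R) C (f x))},
       monoid.mult = (\<lambda>f g. \<lambda>x\<in>S. f x * g x),
       one = (\<lambda>x\<in>S. 1\<^sub>m d),
       zero = (\<lambda>x\<in>S. 0\<^sub>m d d),
       add = (\<lambda>f g. \<lambda>x\<in>S. f x + g x),
       module.smult = (\<lambda>c f. \<lambda>x\<in>S. c \<cdot>\<^sub>m f x)\<rparr>)"

definition maps_star ::
  "(complex \<times> complex \<times> complex \<Rightarrow> complex mat) \<Rightarrow> complex \<times> complex \<times> complex \<Rightarrow> complex mat" where
  "maps_star f = (\<lambda>x\<in>complex_sphere. mat_adjoint (f (cnj3 x)))"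

end

theory Submission
  imports Defs "Jordan_Normal_Form.Spectral_Radius"
begin

text \<open>
  A point of the complex sphere is a rank one idempotent \<open>u v\<^sup>T\<close> of size 2, where \<open>v\<^sup>T u = 1\<close>. Every
  arrow of the double quiver gives a \<open>\<Gamma>\<close>-equivariant map from \<open>V \<otimes> V\<^sub>i\<close> to \<open>V\<^sub>j\<close>, with \<open>V\<close> replaced by
  its dual if \<open>i\<close> is even. Contracting these maps with \<open>u\<close> or \<open>v\<close> turns the loops at \<open>i\<close> into
  \<open>End V\<^sub>i\<close>-valued functions on the sphere. The preprojective relation holds because the maps out of
  \<open>V \<otimes> V\<^sub>i\<close> form a complete orthogonal system; completeness comes from Bessel's inequality and the
  vanishing of the Tits form at \<open>\<delta>\<close>. Conversely, the arrows can be assembled by means of the same maps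
  into two matrices \<open>Z\<^sub>0\<close>, \<open>Z\<^sub>1\<close> over the preprojective algebra with \<open>Z\<^sub>0\<^sup>2 + Z\<^sub>1\<^sup>2 = 1\<close>. Modulo this relation, a
  combination of words of even length is determined by its values on the sphere, which gives
  injectivity; averaging words over \<open>\<Gamma>\<close> gives surjectivity.
\<close>

text \<open>The reverse arrow is sent to the adjoint of the map of the arrow, so that
  \<open>*\<close> becomes the pointwise adjoint. The adjoint of an equivariant map from V \<otimes>
  V_i to V_j is an equivariant map from the dual of V, tensored with V_j, to V_i. This is the reason
  for the dual at even vertices and, with it, for two vectors u and v instead of one. Loops have
  even length because the graph is bipartite; so their matrices contain the coordinates of u and v
  only in products u_k v_l, the entries of the idempotent, and do not depend on how it is factored.
  The obstacle is injectivity, since no basis of the preprojective algebra is at hand. It is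
  overcome by duality: a functional that vanishes on the ideal induces functionals on words in two
  letters that respect the relation, and for these there is a normal form whose terms are separated
  by explicit points. That -I lies in \<Gamma>, so that \<Gamma>' consists of the pairs {g, -g}, is
  not assumed but derived from a character computation.\<close>

definition bool_index :: "bool \<Rightarrow> nat" where
  "bool_index k = (if k then 1 else 0)"

lemma sum_of_bool_mult:
  "(r :: nat) < n \<Longrightarrow> (\<Sum>m<n. of_bool (r = m) * f m) = (f r :: complex)"
  "(r :: nat) < n \<Longrightarrow> (\<Sum>m<n. of_bool (m = r) * f m) = (f r :: complex)"
  "(r :: nat) < n \<Longrightarrow> (\<Sum>m<n. f m * of_bool (r = m)) = (f r :: complex)"
  "(r :: nat) < n \<Longrightarrow> (\<Sum>m<n. f m * of_bool (m = r)) = (f r :: complex)"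
  by (simp_all add: of_bool_def if_distrib if_distribR cong: if_cong)

subsection \<open>Words in two letters whose squares add up to one\<close>

text \<open>The only possibly nonzero entry in the first row of the corresponding product of the 2
  by 2 matrices with zero diagonal and off-diagonal entries \<open>x k\<close> and
  \<open>y k\<close>. The squares of the two matrices add up to the scalar \<Sum> x_k y_k, so the
  pairs with sum 1 are the points at which the relation between the letters holds.\<close>

fun word_value :: "(bool \<Rightarrow> complex) \<Rightarrow> (bool \<Rightarrow> complex) \<Rightarrow> bool list \<Rightarrow> complex" where
  "word_value x y [] = 1"
| "word_value x y (k # w) = x k * word_value y x w"

text \<open>
  Linear functionals on the free algebra in two letters that vanish on the ideal generated by
  \<open>x\<^sub>0\<^sup>2 + x\<^sub>1\<^sup>2 - 1\<close>, given by their values on words. In this quotient the squares of the letters are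
  central, so every word is a polynomial in \<open>x\<^sub>0\<^sup>2\<close> times an alternating word.
\<close>

definition word_model :: "(bool list \<Rightarrow> complex) \<Rightarrow> bool" where
  "word_model L \<longleftrightarrow> (\<forall>u v. L (u @ [False, False] @ v) + L (u @ [True, True] @ v) = L (u @ v))"

fun alternating_word :: "bool \<Rightarrow> nat \<Rightarrow> bool list" where
  "alternating_word k 0 = []"
| "alternating_word k (Suc n) = k # alternating_word (\<not> k) n"

text \<open>The functional \<open>L\<close> at the product of \<open>p\<close>, evaluated at the
  square of the letter \<open>False\<close>, with the word \<open>r\<close>.\<close>

definition eval_word_poly :: "(bool list \<Rightarrow> complex) \<Rightarrow> complex poly \<Rightarrow> bool list \<Rightarrow> complex" where
  "eval_word_poly L p r = (\<Sum>i\<le>degree p. coeff p i * L (replicate (2 * i) False @ r))"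

lemma word_modelD:
  "word_model L \<Longrightarrow> L (u @ False # False # v) + L (u @ True # True # v) = L (u @ v)"
  by (auto simp: word_model_def)

lemma word_model_Cons: "word_model L \<Longrightarrow> word_model (\<lambda>w. L (k # w))"
  unfolding word_model_def by (metis append_Cons)

text \<open>The relation can be applied on either side of \<open>j\<close>, so the sums over both
  squares agree. For the square of \<open>j\<close> itself the two positions give the same word,
  which leaves the equality for the other letter.\<close>

lemma word_model_shift1:
  assumes "word_model L"
  shows "L (u @ k # k # j # v) = L (u @ j # k # k # v)"
proof -
  have 1: "L (u @ False # False # j # v) + L (u @ True # True # j # v) = L (u @ j # v)" for j
    using word_modelD[OF assms, of u "j # v"] .
  have 2: "L (u @ j # False # False # v) + L (u @ j # True # True # v) = L (u @ j # v)" for j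
    using word_modelD[OF assms, of "u @ [j]" "v"] by simp
  have "L (u @ False # False # j # v) + L (u @ True # True # j # v)
      = L (u @ j # False # False # v) + L (u @ j # True # True # v)" unfolding 1 2 ..
  then show ?thesis by (cases k; cases j) simp_all
qed

lemma word_model_shift:
  assumes "word_model L"
  shows "L (u @ k # k # x @ v) = L (u @ x @ k # k # v)"
proof (induction x arbitrary: u)
  case (Cons j x)
  have "L (u @ k # k # j # x @ v) = L ((u @ [j]) @ k # k # x @ v)"
    using word_model_shift1[OF assms] by simp
  also have "\<dots> = L ((u @ [j]) @ x @ k # k # v)" by (rule Cons)
  finally show ?case by simp
qed simp

lemma replicate_Suc_double: "replicate (2 * Suc i) x = replicate (2 * i) x @ [x, x]"
  by (induction i) (auto simp: numeral_2_eq_2)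

lemma word_model_squares:
  assumes "word_model L"
  shows "L (x @ replicate (2 * i) False @ v) = L (replicate (2 * i) False @ x @ v)"
proof (induction i arbitrary: v)
  case (Suc i)
  have "L (x @ replicate (2 * Suc i) False @ v) = L (replicate (2 * i) False @ x @ False # False # v)"
    using Suc[of "False # False # v"] unfolding replicate_Suc_double by simp
  also have "\<dots> = L (replicate (2 * Suc i) False @ x @ v)"
    using word_model_shift[OF assms, of "replicate (2 * i) False" False x v]
    unfolding replicate_Suc_double by simp
  finally show ?case .
qed simp

lemma eval_word_poly_eq:
  "degree p \<le> n \<Longrightarrow> eval_word_poly L p r = (\<Sum>i\<le>n. coeff p i * L (replicate (2 * i) False @ r))"
  unfolding eval_word_poly_def by (rule sum.mono_neutral_left) (auto intro: coeff_eq_0)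

lemma eval_word_poly_add:
  "eval_word_poly L (p + q) r = eval_word_poly L p r + eval_word_poly L q r"
  using eval_word_poly_eq[of p "max (degree p) (degree q)" L r]
    eval_word_poly_eq[of q "max (degree p) (degree q)" L r]
    eval_word_poly_eq[of "p + q" "max (degree p) (degree q)" L r]
  by (simp add: degree_add_le sum.distrib algebra_simps)

lemma eval_word_poly_smult: "eval_word_poly L (smult c p) r = c * eval_word_poly L p r"
  by (cases "c = 0") (auto simp: eval_word_poly_def sum_distrib_left mult.assoc)

lemma eval_word_poly_sum:
  "eval_word_poly L (\<Sum>w\<in>W. f w) r = (\<Sum>w\<in>W. eval_word_poly L (f w) r)"
  by (induction W rule: infinite_finite_induct)
    (auto simp: eval_word_poly_add, auto simp: eval_word_poly_def)

lemma eval_word_poly_pCons: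
  "eval_word_poly L (pCons 0 p) r = eval_word_poly L p (False # False # r)"
proof -
  have "eval_word_poly L (pCons 0 p) r
      = (\<Sum>i\<le>Suc (degree p). coeff (pCons 0 p) i * L (replicate (2 * i) False @ r))"
    by (intro eval_word_poly_eq) (rule degree_pCons_le)
  also have "\<dots> = (\<Sum>i\<le>degree p. coeff p i * L (replicate (2 * Suc i) False @ r))"
    by (subst sum.atMost_Suc_shift) simp
  also have "\<dots> = eval_word_poly L p (False # False # r)"
    unfolding eval_word_poly_def replicate_Suc_double by simp
  finally show ?thesis .
qed

lemma eval_word_poly_Cons:
  assumes "word_model L"
  shows "eval_word_poly (\<lambda>w. L (k # w)) p r = eval_word_poly L p (k # r)"
  unfolding eval_word_poly_def using word_model_squares[OF assms, of "[k]"] by simp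

lemma eval_word_poly_TrueTrue:
  assumes "word_model L"
  shows "eval_word_poly L p (True # True # r) = eval_word_poly L (p - pCons 0 p) r"
proof -
  have "eval_word_poly L p (False # False # r) + eval_word_poly L p (True # True # r) = eval_word_poly L p r"
    unfolding eval_word_poly_def sum.distrib[symmetric] distrib_left[symmetric]
    using word_modelD[OF assms] by simp
  moreover have "eval_word_poly L (p - pCons 0 p) r = eval_word_poly L p r - eval_word_poly L (pCons 0 p) r"
    using eval_word_poly_add[of L "p - pCons 0 p" "pCons 0 p" r] by simp
  ultimately show ?thesis unfolding eval_word_poly_pCons by (metis add_left_cancel diff_add_cancel add.commute)
qed

text \<open>A letter in front of an alternating word either prolongs it or completes a square, and a
  square is absorbed into the polynomial: as the factor X for \<open>False\<close> and 1 - X for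
  \<open>True\<close>. The polynomial serves all word models at once; the parity of the length is
  kept because squares have length two.\<close>

lemma word_normal_form:
  "\<exists>p k n. even (length w + n) \<and>
     (\<forall>L. word_model L \<longrightarrow> L w = eval_word_poly L p (alternating_word k n))"
proof (induction w)
  case Nil
  have "\<forall>L. word_model L \<longrightarrow> L [] = eval_word_poly L 1 (alternating_word True 0)"
    by (simp add: eval_word_poly_def)
  then show ?case by (intro exI[of _ 1] exI[of _ True] exI[of _ 0]) simp
next
  case (Cons j w)
  then obtain p k n where pkn: "even (length w + n)"
    "\<And>L. word_model L \<Longrightarrow> L w = eval_word_poly L p (alternating_word k n)" by blast
  have *: "L (j # w) = eval_word_poly L p (j # alternating_word k n)" if "word_model L" for L
    using pkn(2)[OF word_model_Cons[OF that, of j]] eval_word_poly_Cons[OF that] by simp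
  show ?case
  proof (cases "n = 0 \<or> k \<noteq> j")
    case True
    have "j # alternating_word k n = alternating_word j (Suc n)"
    proof (cases "n = 0")
      case False
      then have "\<not> j \<longleftrightarrow> k" using True by auto
      then show ?thesis by simp
    qed simp
    with * pkn(1) show ?thesis by (intro exI[of _ p] exI[of _ j] exI[of _ "Suc n"]) simp
  next
    case False
    then obtain m where m: "n = Suc m" "k = j" by (cases n) auto
    show ?thesis
    proof (cases j)
      case True
      have "\<forall>L. word_model L \<longrightarrow> L (j # w) = eval_word_poly L (p - pCons 0 p) (alternating_word (\<not> j) m)"
        using * m True eval_word_poly_TrueTrue by simp
      then show ?thesis using pkn(1) m
        by (intro exI[of _ "p - pCons 0 p"] exI[of _ "\<not> j"] exI[of _ "m"]) simp
    next
      case False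
      have "\<forall>L. word_model L \<longrightarrow> L (j # w) = eval_word_poly L (pCons 0 p) (alternating_word (\<not> j) m)"
        using * m False eval_word_poly_pCons by simp
      then show ?thesis using pkn(1) m
        by (intro exI[of _ "pCons 0 p"] exI[of _ "\<not> j"] exI[of _ "m"]) simp
    qed
  qed
qed

text \<open>Even alternating words are powers of the two products of distinct letters. These
  products are inverse to each other up to a polynomial in the central squares, so a single integer
  indexes them, with the sign recording the first letter.\<close>

definition signed_alternating_word :: "int \<Rightarrow> bool list" where
  "signed_alternating_word e = (if 0 \<le> e then alternating_word True (2 * nat e) else alternating_word False (2 * nat (- e)))"

lemma even_word_normal_form:
  assumes "even (length w)"
  shows "\<exists>p e. \<forall>L. word_model L \<longrightarrow> L w = eval_word_poly L p (signed_alternating_word e)"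
proof -
  obtain p k n where pkn: "even (length w + n)"
    "\<And>L. word_model L \<Longrightarrow> L w = eval_word_poly L p (alternating_word k n)" using word_normal_form by blast
  then obtain m where n: "n = 2 * m" using assms by auto
  have "alternating_word k n = signed_alternating_word (if k then int m else - int m)"
    unfolding signed_alternating_word_def n by (cases "m = 0") auto
  with pkn(2) show ?thesis by metis
qed

lemma word_value_append:
  "word_value x y (u @ v) = word_value x y u * (if even (length u) then word_value x y v else word_value y x v)"
  by (induction u arbitrary: x y) auto

lemma word_model_word_value:
  assumes "(\<Sum>k\<in>UNIV. x k * y k) = 1"
  shows "word_model (word_value x y)"
  unfolding word_model_def
proof (intro allI)
  fix u v
  have xy: "x False * y False + x True * y True = 1" using assms by (simp add: UNIV_bool add.commute)
  have *: "a * (p * (q * c)) + a * (r * (s * c)) = a * c" if "p * q + r * s = 1" for a p q r s c :: complex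
  proof -
    have "a * (p * (q * c)) + a * (r * (s * c)) = (p * q + r * s) * (a * c)" by (simp add: algebra_simps)
    then show ?thesis using that by simp
  qed
  have yx: "y False * x False + y True * x True = 1" using xy by (simp add: mult.commute)
  show "word_value x y (u @ [False, False] @ v) + word_value x y (u @ [True, True] @ v) = word_value x y (u @ v)"
    unfolding word_value_append using *[OF xy, of "word_value x y u" "word_value x y v"] *[OF yx, of "word_value x y u" "word_value y x v"]
    by (simp add: mult.assoc)
qed

lemma word_value_squares: "word_value x y (replicate (2 * i) False @ r) = (x False * y False) ^ i * word_value x y r"
proof (induction i)
  case (Suc i)
  have "replicate (2 * Suc i) False @ r = False # False # replicate (2 * i) False @ r" by simp
  with Suc show ?case by (simp del: replicate_Suc)
qed simp

lemma eval_word_poly_word_value: "eval_word_poly (word_value x y) p r = poly p (x False * y False) * word_value x y r"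
  unfolding eval_word_poly_def poly_altdef word_value_squares by (simp add: sum_distrib_right mult.assoc)

lemma word_value_alternating_word: "word_value x y (alternating_word k (2 * m)) = (x k * y (\<not> k)) ^ m"
  by (induction m) auto

lemma poly_eq_0_if_cofinite:
  fixes p :: "complex poly"
  assumes "finite A" "\<And>c. c \<notin> A \<Longrightarrow> poly p c = 0"
  shows "p = 0"
proof (rule ccontr)
  assume "p \<noteq> 0"
  then have "finite {c. poly p c = 0}" by (rule poly_roots_finite)
  moreover have "UNIV = A \<union> {c. poly p c = 0}" using assms(2) by auto
  ultimately have "finite (UNIV :: complex set)" using assms(1) by (metis finite_Un)
  then show False using infinite_UNIV_char_0 by blast
qed

text \<open>Grouped by the exponents of the normal forms, the combination has polynomial
  coefficients \<open>q e\<close>. If it vanishes at all scalar points, every \<open>q e\<close> is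
  zero, and then every word model kills it: scalar points separate the even part of the
  algebra.\<close>

lemma even_words_independent:
  assumes L: "word_model L" and W: "finite W" "\<And>w. w \<in> W \<Longrightarrow> even (length w)"
    and zero: "\<And>x y. (\<Sum>k\<in>UNIV. x k * y k) = 1 \<Longrightarrow> (\<Sum>w\<in>W. t w * word_value x y w) = 0"
  shows "(\<Sum>w\<in>W. t w * L w) = 0"
proof -
  have "\<forall>w\<in>W. \<exists>p e. \<forall>L. word_model L \<longrightarrow> L w = eval_word_poly L p (signed_alternating_word e)"
    using even_word_normal_form W(2) by blast
  then obtain P E where PE: "\<And>w L. w \<in> W \<Longrightarrow> word_model L \<Longrightarrow> L w = eval_word_poly L (P w) (signed_alternating_word (E w))"
    by metis
  define q where "q e = (\<Sum>w | w \<in> W \<and> E w = e. smult (t w) (P w))" for e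
  have expand: "(\<Sum>w\<in>W. t w * L w) = (\<Sum>e\<in>E ` W. eval_word_poly L (q e) (signed_alternating_word e))"
    if "word_model L" for L
  proof -
    have "(\<Sum>w\<in>W. t w * L w) = (\<Sum>w\<in>W. t w * eval_word_poly L (P w) (signed_alternating_word (E w)))"
      using PE that by simp
    also have "\<dots> = (\<Sum>e\<in>E ` W. \<Sum>w | w \<in> W \<and> E w = e. t w * eval_word_poly L (P w) (signed_alternating_word (E w)))"
      using W(1) by (rule sum.image_gen)
    also have "\<dots> = (\<Sum>e\<in>E ` W. eval_word_poly L (q e) (signed_alternating_word e))"
      unfolding q_def eval_word_poly_sum eval_word_poly_smult by (intro sum.cong) auto
    finally show ?thesis .
  qed
  have "q e = 0" if e: "e \<in> E ` W" for e
  proof (rule poly_eq_0_if_cofinite[of "{0, 1}"])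
    fix c :: complex assume c: "c \<notin> {0, 1}"
    define M where "M = Max (E ` W)"
    have M: "e \<le> M" if "e \<in> E ` W" for e using that W(1) by (simp add: M_def)
    \<comment> \<open>On the curve chosen below, the alternating word of exponent e has the value
      \<open>\<kappa> e\<close> times s to the power -e. It is nonzero because c avoids 0 and
      1.\<close>
    define \<kappa> where "\<kappa> e = (if 0 \<le> e then (c * (1 - c)) ^ nat e else 1)" for e
    \<comment> \<open>Multiplication by s^M, with M the largest exponent, clears the negative powers
      of s. Distinct e give distinct degrees M - e, so the coefficients of \<open>R\<close> isolate
      the single exponents.\<close>
    define R where "R = (\<Sum>e\<in>E ` W. monom (poly (q e) c * \<kappa> e) (nat (M - e)))"
    have "R = 0"
    proof (rule poly_eq_0_if_cofinite[of "{0}"])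
      fix s :: complex assume "s \<notin> {0}"
      then have s: "s \<noteq> 0" by simp
      \<comment> \<open>A curve on which the product of the \<open>False\<close> coordinates stays
        equal to c, so that all \<open>q e\<close> are evaluated at the same c while s
        varies.\<close>
      define x y where "x k = (if k then (1 - c) / s else 1)" and "y k = (if k then s else c)" for k
      have xy: "(\<Sum>k\<in>UNIV. x k * y k) = 1" using s by (simp add: UNIV_bool x_def y_def)
      have val: "word_value x y (signed_alternating_word e) * s powi M = \<kappa> e * s ^ nat (M - e)" if "e \<in> E ` W" for e
      proof (cases "0 \<le> e")
        case True
        then have "word_value x y (signed_alternating_word e) = (c * (1 - c)) ^ nat e / s ^ nat e"
          by (simp only: signed_alternating_word_def if_True word_value_alternating_word) (simp add: x_def y_def power_divide mult.commute)
        moreover have "s powi M = s ^ nat (M - e) * s ^ nat e"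
        proof -
          have "s powi M = s powi ((M - e) + e)" by simp
          also have "\<dots> = s powi (M - e) * s powi e" using s by (intro power_int_add) simp
          finally show ?thesis using M[OF that] True by (simp add: power_int_def)
        qed
        ultimately show ?thesis using True s by (simp add: \<kappa>_def)
      next
        case False
        then have "word_value x y (signed_alternating_word e) = s powi (- e)"
          by (simp only: signed_alternating_word_def if_False word_value_alternating_word) (simp add: x_def y_def power_int_def)
        then have "word_value x y (signed_alternating_word e) * s powi M = s powi (M - e)"
          using s power_int_add[of s "- e" M] by (simp add: algebra_simps)
        then show ?thesis using False M[OF that] by (simp add: \<kappa>_def power_int_def)
      qed
      have "(\<Sum>e\<in>E ` W. poly (q e) (x False * y False) * word_value x y (signed_alternating_word e)) = 0"
        using expand[OF word_model_word_value[OF xy]] zero[OF xy] unfolding eval_word_poly_word_value by simp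
      then have "(\<Sum>e\<in>E ` W. poly (q e) c * word_value x y (signed_alternating_word e)) * s powi M = 0"
        by (simp add: x_def y_def)
      then have "(\<Sum>e\<in>E ` W. poly (q e) c * (\<kappa> e * s ^ nat (M - e))) = 0"
        unfolding sum_distrib_right using val by (simp add: mult.assoc)
      then show "poly R s = 0"
        unfolding R_def by (simp add: poly_sum poly_monom mult.assoc)
    qed simp
    have "coeff R (nat (M - e)) = (\<Sum>e'\<in>E ` W. if e' = e then poly (q e') c * \<kappa> e' else 0)"
      unfolding R_def coeff_sum
    proof (rule sum.cong)
      fix e' assume e': "e' \<in> E ` W"
      have "nat (M - e') = nat (M - e) \<longleftrightarrow> e' = e" using M[OF e] M[OF e'] by auto
      then show "coeff (monom (poly (q e') c * \<kappa> e') (nat (M - e'))) (nat (M - e))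
        = (if e' = e then poly (q e') c * \<kappa> e' else 0)" by simp
    qed simp
    then have "poly (q e) c * \<kappa> e = 0" using \<open>R = 0\<close> e W(1) by simp
    moreover have "\<kappa> e \<noteq> 0" using c by (simp add: \<kappa>_def)
    ultimately show "poly (q e) c = 0" by simp
  qed simp
  then show ?thesis unfolding expand[OF L] by (simp add: eval_word_poly_def)
qed

subsection \<open>Path algebras\<close>

lemma lookup_scale [simp]: "Poly_Mapping.lookup (scale c f) p = c * Poly_Mapping.lookup f p"
  by (simp add: scale_def map.rep_eq when_def)

interpretation path_space: vector_space "scale :: complex \<Rightarrow> ('p \<Rightarrow>\<^sub>0 complex) \<Rightarrow> _"
  by unfold_locales (auto intro!: poly_mapping_eqI simp: lookup_add algebra_simps)

lemma scale_single [simp]: "scale c (Poly_Mapping.single p a) = Poly_Mapping.single p (c * a)"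
  by (rule poly_mapping_eqI) (simp add: lookup_single when_def)

lemma keys_scale: "Poly_Mapping.keys (scale c f) \<subseteq> Poly_Mapping.keys f"
  by (auto simp: in_keys_iff)

lemma keys_scale_subset: "Poly_Mapping.keys f \<subseteq> S \<Longrightarrow> Poly_Mapping.keys (scale c f) \<subseteq> S"
  using keys_scale[of c f] by blast

lemma keys_add_subset:
  "Poly_Mapping.keys f \<subseteq> S \<Longrightarrow> Poly_Mapping.keys g \<subseteq> S \<Longrightarrow> Poly_Mapping.keys (f + g) \<subseteq> S"
  using Poly_Mapping.keys_add[of f g] by blast

lemma keys_sum_subset:
  "(\<And>x. x \<in> X \<Longrightarrow> Poly_Mapping.keys (f x) \<subseteq> S) \<Longrightarrow> Poly_Mapping.keys (\<Sum>x\<in>X. f x) \<subseteq> S"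
  by (induction X rule: infinite_finite_induct) (simp_all add: keys_add_subset)

lemma keys_diff_subset:
  fixes f g :: "'p \<Rightarrow>\<^sub>0 complex"
  shows "Poly_Mapping.keys f \<subseteq> S \<Longrightarrow> Poly_Mapping.keys g \<subseteq> S \<Longrightarrow> Poly_Mapping.keys (f - g) \<subseteq> S"
  using keys_add_subset[of f S "- g"] by simp

lemma poly_mapping_expand:
  "f = (\<Sum>p\<in>Poly_Mapping.keys f. scale (Poly_Mapping.lookup f p) (Poly_Mapping.single p 1))"
proof (rule poly_mapping_eqI)
  fix q
  show "Poly_Mapping.lookup f q = Poly_Mapping.lookup
    (\<Sum>p\<in>Poly_Mapping.keys f. scale (Poly_Mapping.lookup f p) (Poly_Mapping.single p 1)) q"
    by (cases "q \<in> Poly_Mapping.keys f")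
      (auto simp: lookup_sum lookup_single when_def in_keys_iff)
qed

lemma linear_induct [consumes 1, case_names zero add scale single]:
  assumes "Poly_Mapping.keys f \<subseteq> S"
    and "P 0" "\<And>f g. P f \<Longrightarrow> P g \<Longrightarrow> P (f + g)" "\<And>c f. P f \<Longrightarrow> P (scale c f)"
    and "\<And>p. p \<in> S \<Longrightarrow> P (Poly_Mapping.single p 1)"
  shows "P f"
proof -
  have "P (\<Sum>p\<in>X. scale (Poly_Mapping.lookup f p) (Poly_Mapping.single p 1))" if "X \<subseteq> S" for X
    using that by (induction X rule: infinite_finite_induct) (auto intro!: assms simp del: scale_single)
  then show ?thesis using poly_mapping_expand[of f] assms(1) by metis
qed

text \<open>The support of a sum is only contained in the union of the supports; summing over a
  common finite superset makes bilinearity visible.\<close>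

lemma path_mult_superset:
  assumes "finite P" "Poly_Mapping.keys f \<subseteq> P" "finite R" "Poly_Mapping.keys g \<subseteq> R"
  shows "path_mult f g = (\<Sum>p\<in>P. \<Sum>q\<in>R.
    scale (Poly_Mapping.lookup f p * Poly_Mapping.lookup g q) (path_product p q))"
proof -
  have "path_mult f g = (\<Sum>p\<in>Poly_Mapping.keys f. \<Sum>q\<in>R.
    scale (Poly_Mapping.lookup f p * Poly_Mapping.lookup g q) (path_product p q))"
    unfolding path_mult_def using assms(3,4)
    by (intro sum.cong refl sum.mono_neutral_left) (auto simp: in_keys_iff)
  also have "\<dots> = (\<Sum>p\<in>P. \<Sum>q\<in>R.
    scale (Poly_Mapping.lookup f p * Poly_Mapping.lookup g q) (path_product p q))"
    using assms(1,2) by (intro sum.mono_neutral_left) (auto simp: in_keys_iff)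
  finally show ?thesis .
qed

lemma path_mult_add_left: "path_mult (f + f') g = path_mult f g + path_mult f' g"
proof -
  let ?P = "Poly_Mapping.keys f \<union> Poly_Mapping.keys f'"
  have "Poly_Mapping.keys (f + f') \<subseteq> ?P" by (rule Poly_Mapping.keys_add)
  then show ?thesis
    by (simp add: path_mult_superset[of ?P _ "Poly_Mapping.keys g"] lookup_add distrib_right
        path_space.scale_left_distrib sum.distrib)
qed

lemma path_mult_add_right: "path_mult f (g + g') = path_mult f g + path_mult f g'"
proof -
  let ?P = "Poly_Mapping.keys g \<union> Poly_Mapping.keys g'"
  have "Poly_Mapping.keys (g + g') \<subseteq> ?P" by (rule Poly_Mapping.keys_add)
  then show ?thesis
    by (simp add: path_mult_superset[of "Poly_Mapping.keys f" _ ?P] lookup_add distrib_left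
        path_space.scale_left_distrib sum.distrib)
qed

lemma path_mult_scale_left [simp]: "path_mult (scale c f) g = scale c (path_mult f g)"
  using keys_scale[of c f]
  by (simp add: path_mult_superset[of "Poly_Mapping.keys f" _ "Poly_Mapping.keys g"]
      path_space.scale_sum_right mult.assoc)

lemma path_mult_scale_right [simp]: "path_mult f (scale c g) = scale c (path_mult f g)"
  using keys_scale[of c g]
  by (simp add: path_mult_superset[of "Poly_Mapping.keys f" _ "Poly_Mapping.keys g"]
      path_space.scale_sum_right mult.left_commute)

lemma path_mult_0 [simp]: "path_mult 0 g = 0" "path_mult f 0 = 0"
  by (auto simp: path_mult_def)

lemma path_mult_sum_left: "path_mult (\<Sum>x\<in>X. f x) g = (\<Sum>x\<in>X. path_mult (f x) g)"
  by (induction X rule: infinite_finite_induct) (auto simp: path_mult_add_left)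

lemma path_mult_sum_right: "path_mult f (\<Sum>x\<in>X. g x) = (\<Sum>x\<in>X. path_mult f (g x))"
  by (induction X rule: infinite_finite_induct) (auto simp: path_mult_add_right)

lemma path_mult_diff_left: "path_mult (f - f') g = path_mult f g - path_mult f' g"
  using path_mult_add_left[of "f - f'" f' g] by simp

lemma path_mult_minus_left: "path_mult (- f) g = - path_mult f g"
  using path_mult_diff_left[of 0 f g] by simp

lemma path_mult_diff_right: "path_mult f (g - g') = path_mult f g - path_mult f g'"
  using path_mult_add_right[of f "g - g'" g'] by simp

lemma path_mult_single:
  "path_mult (Poly_Mapping.single p a) (Poly_Mapping.single q b) = scale (a * b) (path_product p q)"
  by (simp add: path_mult_def)

lemma path_mult_single_single:
  "path_mult (Poly_Mapping.single (j, p, k) a) (Poly_Mapping.single (i, q, l) b)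
    = (if j = l then Poly_Mapping.single (i, q @ p, k) (a * b) else 0)"
  by (simp add: path_mult_single)

lemma path_mult_assoc: "path_mult (path_mult f g) h = path_mult f (path_mult g h)"
proof (rule linear_induct[of f UNIV], goal_cases)
  case (5 p)
  show ?case
  proof (rule linear_induct[of g UNIV], goal_cases)
    case (5 q)
    show ?case
    proof (rule linear_induct[of h UNIV], goal_cases)
      case (5 r)
      show ?case by (cases p; cases q; cases r) (simp add: path_mult_single_single)
    qed (simp_all add: path_mult_add_left path_mult_add_right)
  qed (simp_all add: path_mult_add_left path_mult_add_right)
qed (simp_all add: path_mult_add_left path_mult_add_right)

definition linear_ext :: "('p \<Rightarrow> complex) \<Rightarrow> ('p \<Rightarrow>\<^sub>0 complex) \<Rightarrow> complex" where
  "linear_ext h f = (\<Sum>p\<in>Poly_Mapping.keys f. Poly_Mapping.lookup f p * h p)"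

lemma linear_ext_superset:
  "finite P \<Longrightarrow> Poly_Mapping.keys f \<subseteq> P \<Longrightarrow> linear_ext h f = (\<Sum>p\<in>P. Poly_Mapping.lookup f p * h p)"
  unfolding linear_ext_def by (intro sum.mono_neutral_left) (auto simp: in_keys_iff)

lemma linear_ext_add: "linear_ext h (f + g) = linear_ext h f + linear_ext h g"
  using Poly_Mapping.keys_add[of f g]
  by (simp add: linear_ext_superset[of "Poly_Mapping.keys f \<union> Poly_Mapping.keys g"] lookup_add
      distrib_right sum.distrib)

lemma linear_ext_scale [simp]: "linear_ext h (scale c f) = c * linear_ext h f"
  using keys_scale[of c f]
  by (simp add: linear_ext_superset[of "Poly_Mapping.keys f"] sum_distrib_left mult.assoc)

lemma linear_ext_single [simp]: "linear_ext h (Poly_Mapping.single p a) = a * h p"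
  by (simp add: linear_ext_def)

lemma linear_ext_0 [simp]: "linear_ext h 0 = 0"
  by (simp add: linear_ext_def)

lemma linear_ext_sum: "linear_ext h (\<Sum>x\<in>X. f x) = (\<Sum>x\<in>X. linear_ext h (f x))"
  by (induction X rule: infinite_finite_induct) (auto simp: linear_ext_add)

lemma linear_ext_diff: "linear_ext h (f - g) = linear_ext h f - linear_ext h g"
  using linear_ext_add[of h "f - g" g] by simp

definition hom_paths :: "('v, 'b) pre_digraph \<Rightarrow> 'v \<Rightarrow> 'v \<Rightarrow> (('v, 'b) path \<Rightarrow>\<^sub>0 complex) set" where
  "hom_paths G i j = {f. Poly_Mapping.keys f \<subseteq> {(u, p, v) \<in> paths G. u = i \<and> v = j}}"

lemma hom_paths_carrier: "f \<in> hom_paths G i j \<Longrightarrow> f \<in> carrier (path_algebra G)"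
  by (auto simp: hom_paths_def path_algebra_def)

lemma trivial_path_mult_left:
  "f \<in> hom_paths G i j \<Longrightarrow> path_mult (trivial_path k) f = (if k = j then f else 0)"
proof -
  assume "f \<in> hom_paths G i j"
  then have "Poly_Mapping.keys f \<subseteq> {(u, p, v) \<in> paths G. u = i \<and> v = j}" by (simp add: hom_paths_def)
  then show ?thesis
    by (induction f rule: linear_induct)
      (auto simp: path_mult_add_right trivial_path_def path_mult_single_single)
qed

lemma trivial_path_mult_right:
  "f \<in> hom_paths G i j \<Longrightarrow> path_mult f (trivial_path k) = (if k = i then f else 0)"
proof -
  assume "f \<in> hom_paths G i j"
  then have "Poly_Mapping.keys f \<subseteq> {(u, p, v) \<in> paths G. u = i \<and> v = j}" by (simp add: hom_paths_def)
  then show ?thesis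
    by (induction f rule: linear_induct)
      (auto simp: path_mult_add_left trivial_path_def path_mult_single_single)
qed

lemma path_mult_subset:
  assumes "Poly_Mapping.keys f \<subseteq> S" "Poly_Mapping.keys g \<subseteq> S'"
    and "\<And>j p k i q. (j, p, k) \<in> S \<Longrightarrow> (i, q, j) \<in> S' \<Longrightarrow> (i, q @ p, k) \<in> R"
  shows "Poly_Mapping.keys (path_mult f g) \<subseteq> R"
proof (rule linear_induct[OF assms(1)], goal_cases)
  case (4 p)
  show ?case
  proof (rule linear_induct[OF assms(2)], goal_cases)
    case (4 q)
    show ?case using \<open>p \<in> S\<close> \<open>q \<in> S'\<close> assms(3)
      by (cases p; cases q) (auto simp: path_mult_single_single)
  qed (simp_all add: path_mult_add_right keys_add_subset keys_scale_subset)
qed (simp_all add: path_mult_add_left keys_add_subset keys_scale_subset)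

context wf_digraph
begin

lemma paths_append: "(j, p, k) \<in> paths G \<Longrightarrow> (i, q, j) \<in> paths G \<Longrightarrow> (i, q @ p, k) \<in> paths G"
  by (auto simp: paths_def)

lemma hom_paths_mult:
  "f \<in> hom_paths G j k \<Longrightarrow> g \<in> hom_paths G i j \<Longrightarrow> path_mult f g \<in> hom_paths G i k"
  unfolding hom_paths_def mem_Collect_eq by (erule path_mult_subset) (auto intro: paths_append)

lemma arrow_hom_paths: "b \<in> arcs G \<Longrightarrow> arrow G b \<in> hom_paths G (tail G b) (head G b)"
  by (auto simp: hom_paths_def arrow_def paths_def awalk_def)

lemma trivial_hom_paths: "i \<in> verts G \<Longrightarrow> trivial_path i \<in> hom_paths G i i"
  by (auto simp: hom_paths_def trivial_path_def paths_def awalk_def)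

lemma path_algebra_mult_closed:
  assumes "f \<in> carrier (path_algebra G)" "g \<in> carrier (path_algebra G)"
  shows "path_mult f g \<in> carrier (path_algebra G)"
proof -
  have "Poly_Mapping.keys (path_mult f g) \<subseteq> paths G"
    by (rule path_mult_subset[of f "paths G" g "paths G"])
      (use assms in \<open>auto simp: path_algebra_def intro: paths_append\<close>)
  then show ?thesis by (simp add: path_algebra_def)
qed

end

lemma hom_paths_0 [simp]: "0 \<in> hom_paths G i j"
  by (simp add: hom_paths_def)

lemma hom_paths_scale: "f \<in> hom_paths G i j \<Longrightarrow> scale c f \<in> hom_paths G i j"
  by (simp add: hom_paths_def keys_scale_subset)

lemma hom_paths_add: "f \<in> hom_paths G i j \<Longrightarrow> g \<in> hom_paths G i j \<Longrightarrow> f + g \<in> hom_paths G i j"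
  by (simp add: hom_paths_def keys_add_subset)

lemma hom_paths_diff: "f \<in> hom_paths G i j \<Longrightarrow> g \<in> hom_paths G i j \<Longrightarrow> f - g \<in> hom_paths G i j"
  by (simp add: hom_paths_def keys_diff_subset)

lemma hom_paths_sum: "(\<And>x. x \<in> X \<Longrightarrow> f x \<in> hom_paths G i j) \<Longrightarrow> (\<Sum>x\<in>X. f x) \<in> hom_paths G i j"
  unfolding hom_paths_def by (simp add: keys_sum_subset)

lemma path_algebra_simps [simp]:
  "monoid.mult (path_algebra G) = path_mult"
  "one (path_algebra G) = (\<Sum>i\<in>verts G. trivial_path i)"
  "zero (path_algebra G) = 0"
  "add (path_algebra G) = (+)"
  "module.smult (path_algebra G) = scale"
  "f \<in> carrier (path_algebra G) \<longleftrightarrow> Poly_Mapping.keys f \<subseteq> paths G"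
  by (auto simp: path_algebra_def)

context fin_digraph
begin

lemma path_algebra_unit:
  assumes "Poly_Mapping.keys f \<subseteq> paths G"
  shows "path_mult (\<Sum>i\<in>verts G. trivial_path i) f = f"
    and "path_mult f (\<Sum>i\<in>verts G. trivial_path i) = f"
proof -
  have *: "path_mult (\<Sum>i\<in>verts G. trivial_path i) (Poly_Mapping.single p 1) = Poly_Mapping.single p 1
    \<and> path_mult (Poly_Mapping.single p 1) (\<Sum>i\<in>verts G. trivial_path i) = Poly_Mapping.single p 1"
    if "p \<in> paths G" for p
  proof -
    obtain u q v where p: "p = (u, q, v)" by (cases p)
    have hp: "Poly_Mapping.single p 1 \<in> hom_paths G u v" using that p by (auto simp: hom_paths_def)
    have "u \<in> verts G" "v \<in> verts G" using that p by (auto simp: paths_def)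
    then show ?thesis
      unfolding path_mult_sum_left path_mult_sum_right
        trivial_path_mult_left[OF hp] trivial_path_mult_right[OF hp] by simp
  qed
  show "path_mult (\<Sum>i\<in>verts G. trivial_path i) f = f"
    using assms by (induction f rule: linear_induct) (auto simp: path_mult_add_right *)
  show "path_mult f (\<Sum>i\<in>verts G. trivial_path i) = f"
    using assms by (induction f rule: linear_induct) (auto simp: path_mult_add_left *)
qed

lemma ring_path_algebra: "ring (path_algebra G)"
proof (rule ringI)
  show "abelian_group (path_algebra G)"
  proof (rule abelian_groupI)
    fix f assume f: "f \<in> carrier (path_algebra G)"
    show "\<exists>g\<in>carrier (path_algebra G). g \<oplus>\<^bsub>path_algebra G\<^esub> f = \<zero>\<^bsub>path_algebra G\<^esub>"
      using f by (intro bexI[of _ "- f"]) auto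
  qed (auto simp: keys_add_subset add.assoc add.commute)
  show "Group.monoid (path_algebra G)"
  proof (rule monoidI)
    show "\<one>\<^bsub>path_algebra G\<^esub> \<in> carrier (path_algebra G)"
      using trivial_hom_paths by (auto intro!: keys_sum_subset simp: hom_paths_def)
  qed (use path_algebra_mult_closed in \<open>auto simp: path_mult_assoc path_algebra_unit\<close>)
qed (auto simp: path_mult_add_left path_mult_add_right)

text \<open>Closure under negatives follows by multiplying with minus the unit. The criterion
  recognises sets given by linear conditions as ideals, which then contain the ideal of the relation
  once they contain the relation.\<close>

lemma path_algebra_ideal_iff:
  "ideal J (path_algebra G) \<longleftrightarrow>
    J \<subseteq> carrier (path_algebra G) \<and> 0 \<in> J \<and> (\<forall>x\<in>J. \<forall>y\<in>J. x + y \<in> J) \<and>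
    (\<forall>x\<in>carrier (path_algebra G). \<forall>a\<in>J. path_mult x a \<in> J \<and> path_mult a x \<in> J)"
    (is "_ \<longleftrightarrow> ?R")
proof
  interpret ring "path_algebra G" by (rule ring_path_algebra)
  assume "ideal J (path_algebra G)"
  then interpret ideal J "path_algebra G" .
  show ?R using a_subset zero_closed a_closed I_l_closed I_r_closed by simp
next
  interpret ring "path_algebra G" by (rule ring_path_algebra)
  assume R: ?R
  show "ideal J (path_algebra G)"
  proof (rule idealI)
    show "subgroup J (add_monoid (path_algebra G))"
    proof (rule add.subgroupI)
      fix a assume a: "a \<in> J"
      have "a \<in> carrier (path_algebra G)" using R a by blast
      then have aK: "Poly_Mapping.keys a \<subseteq> paths G" by simp
      have "scale (- 1) \<one>\<^bsub>path_algebra G\<^esub> \<in> carrier (path_algebra G)"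
        using one_closed by (simp add: keys_scale_subset del: path_space.scale_minus_left)
      then have "path_mult (scale (- 1) \<one>\<^bsub>path_algebra G\<^esub>) a \<in> J" using R a by blast
      moreover have "path_mult (scale (- 1) \<one>\<^bsub>path_algebra G\<^esub>) a = - a"
        using path_algebra_unit(1)[OF aK] by (simp add: path_mult_minus_left)
      moreover have "\<ominus>\<^bsub>path_algebra G\<^esub> a = - a"
        using aK by (intro minus_equality) simp_all
      ultimately show "\<ominus>\<^bsub>path_algebra G\<^esub> a \<in> J" by simp
    qed (use R in auto)
  qed (use R ring_path_algebra in auto)
qed

lemma path_algebra_ideal_scale:
  assumes "ideal J (path_algebra G)" "a \<in> J"
  shows "scale c a \<in> J"
proof -
  interpret ring "path_algebra G" by (rule ring_path_algebra)
  have "a \<in> carrier (path_algebra G)"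
    using assms additive_subgroup.a_subset[OF ideal.axioms(1)[OF assms(1)]] by blast
  then have a: "Poly_Mapping.keys a \<subseteq> paths G" by simp
  have "scale c \<one>\<^bsub>path_algebra G\<^esub> \<in> carrier (path_algebra G)"
    using one_closed by (simp add: keys_scale_subset)
  from ideal.I_l_closed[OF assms this] show ?thesis using path_algebra_unit(1)[OF a] by simp
qed

end

lemma path_coset_def: "J +>\<^bsub>path_algebra G\<^esub> x = (\<lambda>j. j + x) ` J"
  by (auto simp: a_r_coset_def')

subsection \<open>Intertwiners and words in the path algebra\<close>

definition words :: "nat \<Rightarrow> bool list set" where
  "words n = {w. length w = n}"

lemma words_0 [simp]: "words 0 = {[]}"
  by (auto simp: words_def)

lemma finite_words [simp]: "finite (words n)"
  unfolding words_def using finite_lists_length_eq[of "UNIV :: bool set" n] by simp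

lemma sum_words_Suc: "(\<Sum>w\<in>words (Suc n). f w) = (\<Sum>k\<in>UNIV. \<Sum>w\<in>words n. f (k # w))"
proof -
  have "words (Suc n) = (\<lambda>(k, w). k # w) ` (UNIV \<times> words n)"
    by (auto simp: words_def length_Suc_conv image_iff)
  moreover have "inj_on (\<lambda>(k, w). k # w) (UNIV \<times> words n)" by (auto simp: inj_on_def)
  ultimately have "(\<Sum>w\<in>words (Suc n). f w) = (\<Sum>(k, w)\<in>UNIV \<times> words n. f (k # w))"
    by (simp add: sum.reindex case_prod_unfold)
  then show ?thesis by (simp add: sum.cartesian_product)
qed

definition reverse_arrow :: "'e + 'e \<Rightarrow> 'e + 'e" where
  "reverse_arrow = case_sum Inr Inl"

lemma reverse_arrow_simps [simp]:
  "reverse_arrow (Inl a) = Inr a" "reverse_arrow (Inr a) = Inl a"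
  by (auto simp: reverse_arrow_def)

lemma reverse_reverse_arrow [simp]: "reverse_arrow (reverse_arrow b) = b"
  by (cases b) auto

lemma path_reverse_eq: "path_reverse (u, p, v) = (v, rev (map reverse_arrow p), u)"
  by (simp add: reverse_arrow_def)

lemma double_quiver_simps [simp]:
  "verts (double_quiver Q) = verts Q"
  "arcs (double_quiver Q) = arcs Q <+> arcs Q"
  "tail (double_quiver Q) (Inl a) = tail Q a"
  "tail (double_quiver Q) (Inr a) = head Q a"
  "head (double_quiver Q) (Inl a) = head Q a"
  "head (double_quiver Q) (Inr a) = tail Q a"
  by (auto simp: double_quiver_def)

lemma double_quiver_reverse [simp]:
  "reverse_arrow b \<in> arcs Q <+> arcs Q \<longleftrightarrow> b \<in> arcs Q <+> arcs Q"
  "tail (double_quiver Q) (reverse_arrow b) = head (double_quiver Q) b"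
  "head (double_quiver Q) (reverse_arrow b) = tail (double_quiver Q) b"
  by (cases b; auto)+

lemma (in fin_digraph) fin_digraph_double_quiver: "fin_digraph (double_quiver G)"
  by unfold_locales auto

text \<open>Under \<open>act_left\<close> and \<open>act_right\<close> the matrix u v^T turns into
  its conjugate by a unitary \<open>g\<close>, and the pairing v^T u is preserved.\<close>

definition act_left :: "complex mat \<Rightarrow> (bool \<Rightarrow> complex) \<Rightarrow> bool \<Rightarrow> complex" where
  "act_left g u k = (\<Sum>l\<in>UNIV. g $$ (bool_index k, bool_index l) * u l)"

definition act_right :: "complex mat \<Rightarrow> (bool \<Rightarrow> complex) \<Rightarrow> bool \<Rightarrow> complex" where
  "act_right g v k = (\<Sum>l\<in>UNIV. cnj (g $$ (bool_index k, bool_index l)) * v l)"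

text \<open>
  \<open>F b k\<close> is the restriction to the \<open>k\<close>-th basis vector of \<open>V\<close> of the equivariant map that belongs
  to the arrow \<open>b\<close>; at even vertices \<open>V\<close> is replaced by its dual.
\<close>

locale intertwiners = fin_digraph Q
  for Q :: "('v, 'e) pre_digraph" +
  fixes Ev :: "'v set" and \<delta> :: "'v \<Rightarrow> nat" and lam :: "'v \<Rightarrow> complex"
    and \<Gamma> :: "complex mat set" and \<rho> :: "'v \<Rightarrow> complex mat \<Rightarrow> nat \<Rightarrow> nat \<Rightarrow> complex"
    and F :: "'e + 'e \<Rightarrow> bool \<Rightarrow> nat \<Rightarrow> nat \<Rightarrow> complex"
  assumes bipartite: "a \<in> arcs Q \<Longrightarrow> tail Q a \<notin> Ev" "a \<in> arcs Q \<Longrightarrow> head Q a \<in> Ev"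
    and dim_pos: "j \<in> verts Q \<Longrightarrow> 0 < \<delta> j"
    and lam: "j \<in> verts Q \<Longrightarrow> lam j = (if j \<in> Ev then of_nat (\<delta> j) else - of_nat (\<delta> j))"
    and finite_group: "finite \<Gamma>" "\<Gamma> \<noteq> {}"
    and unitary: "j \<in> verts Q \<Longrightarrow> g \<in> \<Gamma> \<Longrightarrow> r < \<delta> j \<Longrightarrow> c < \<delta> j \<Longrightarrow>
      (\<Sum>m<\<delta> j. cnj (\<rho> j g m r) * \<rho> j g m c) = of_bool (r = c)"
    and schur: "i \<in> verts Q \<Longrightarrow> j \<in> verts Q \<Longrightarrow> r < \<delta> j \<Longrightarrow> r' < \<delta> j \<Longrightarrow> c < \<delta> i \<Longrightarrow> c' < \<delta> i \<Longrightarrow>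
      (\<Sum>g\<in>\<Gamma>. cnj (\<rho> j g r r') * \<rho> i g c c')
        = of_bool (i = j \<and> r = c \<and> r' = c') * (of_nat (card \<Gamma>) / of_nat (\<delta> j))"
    and F_reverse: "F (reverse_arrow b) k r c = cnj (F b k c r)"
    and F_orthogonal: "b \<in> arcs (double_quiver Q) \<Longrightarrow> b' \<in> arcs (double_quiver Q) \<Longrightarrow>
      tail (double_quiver Q) b = tail (double_quiver Q) b' \<Longrightarrow>
      r < \<delta> (head (double_quiver Q) b) \<Longrightarrow> r' < \<delta> (head (double_quiver Q) b') \<Longrightarrow>
      (\<Sum>k\<in>UNIV. \<Sum>m<\<delta> (tail (double_quiver Q) b). F b k r m * cnj (F b' k r' m))
        = of_bool (b = b' \<and> r = r') * of_nat (\<delta> (tail (double_quiver Q) b))"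
    and F_complete: "i \<in> verts Q \<Longrightarrow> c < \<delta> i \<Longrightarrow> c' < \<delta> i \<Longrightarrow>
      (\<Sum>b | b \<in> arcs (double_quiver Q) \<and> tail (double_quiver Q) b = i.
         \<Sum>m<\<delta> (head (double_quiver Q) b). cnj (F b k m c) * F b l m c')
        = of_bool (k = l \<and> c = c') * of_nat (\<delta> i)"
    and F_equivariant: "b \<in> arcs (double_quiver Q) \<Longrightarrow> g \<in> \<Gamma> \<Longrightarrow>
      r < \<delta> (head (double_quiver Q) b) \<Longrightarrow> c < \<delta> (tail (double_quiver Q) b) \<Longrightarrow>
      (\<Sum>m<\<delta> (head (double_quiver Q) b). \<rho> (head (double_quiver Q) b) g r m * F b k m c)
        = (\<Sum>l\<in>UNIV. \<Sum>m<\<delta> (tail (double_quiver Q) b).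
            (if tail (double_quiver Q) b \<in> Ev then cnj (g $$ (bool_index l, bool_index k))
             else g $$ (bool_index l, bool_index k)) * F b l r m * \<rho> (tail (double_quiver Q) b) g m c)"
begin

abbreviation D where "D \<equiv> double_quiver Q"

sublocale D: fin_digraph D by (rule fin_digraph_double_quiver)

abbreviation out :: "'v \<Rightarrow> ('e + 'e) set" where
  "out i \<equiv> {b \<in> arcs D. tail D b = i}"

lemma finite_out [simp]: "finite (out i)"
  using D.finite_arcs by simp

lemma arc_parity: "b \<in> arcs D \<Longrightarrow> head D b \<in> Ev \<longleftrightarrow> tail D b \<notin> Ev"
  using bipartite by (cases b) auto

section \<open>Matrices attached to paths at a pair of vectors u, v\<close>

definition coord :: "(bool \<Rightarrow> complex) \<Rightarrow> (bool \<Rightarrow> complex) \<Rightarrow> 'v \<Rightarrow> bool \<Rightarrow> complex" where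
  "coord u v i = (if i \<in> Ev then v else u)"

text \<open>An arrow out of an odd vertex is contracted with u and one out of an even vertex with v,
  in accordance with the dual there. Hence the two vectors alternate along a path.\<close>

definition arrow_mat where
  "arrow_mat u v b r c = (\<Sum>k\<in>UNIV. coord u v (tail D b) k * F b k r c)"

fun path_mat where
  "path_mat u v [] r c = of_bool (r = c)"
| "path_mat u v (b # bs) r c = (\<Sum>m<\<delta> (head D b). path_mat u v bs r m * arrow_mat u v b m c)"

text \<open>Paths with other end points count as zero, which makes this linear on the whole path
  algebra and gives the block from \<open>i\<close> to \<open>j\<close> of a representation on all
  vertices together.\<close>

definition rep where
  "rep u v i j f r c = linear_ext (\<lambda>(i', bs, j'). of_bool (i' = i \<and> j' = j) * path_mat u v bs r c) f"

lemma path_mat_append: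
  assumes "pre_digraph.cas D i bs l" "c < \<delta> i"
  shows "path_mat u v (bs @ bs') r c = (\<Sum>m<\<delta> l. path_mat u v bs' r m * path_mat u v bs m c)"
  using assms
proof (induction bs arbitrary: i c)
  case Nil
  then show ?case by (simp add: D.cas.simps sum.delta if_distrib of_bool_def cong: if_cong)
next
  case (Cons b bs)
  then have b: "tail D b = i" "pre_digraph.cas D (head D b) bs l" by (auto simp: D.cas.simps)
  have "path_mat u v ((b # bs) @ bs') r c
      = (\<Sum>m<\<delta> (head D b). \<Sum>m'<\<delta> l. path_mat u v bs' r m' * path_mat u v bs m' m * arrow_mat u v b m c)"
    using Cons.IH[OF b(2)] by (simp add: sum_distrib_right)
  also have "\<dots> = (\<Sum>m'<\<delta> l. path_mat u v bs' r m' * path_mat u v (b # bs) m' c)"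
    by (subst sum.swap) (simp add: sum_distrib_left mult.assoc)
  finally show ?case .
qed

lemma rep_add: "rep u v i j (f + g) r c = rep u v i j f r c + rep u v i j g r c"
  by (simp add: rep_def linear_ext_add)

lemma rep_scale [simp]: "rep u v i j (scale a f) r c = a * rep u v i j f r c"
  by (simp add: rep_def)

lemma rep_0 [simp]: "rep u v i j 0 r c = 0"
  by (simp add: rep_def)

lemma rep_sum: "rep u v i j (\<Sum>x\<in>X. f x) r c = (\<Sum>x\<in>X. rep u v i j (f x) r c)"
  by (simp add: rep_def linear_ext_sum)

lemma rep_diff: "rep u v i j (f - g) r c = rep u v i j f r c - rep u v i j g r c"
  by (simp add: rep_def linear_ext_diff)

lemma rep_single [simp]:
  "rep u v i j (Poly_Mapping.single (i', bs, j') a) r c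
    = of_bool (i' = i \<and> j' = j) * (a * path_mat u v bs r c)"
  by (simp add: rep_def)

lemma rep_mult_single_left:
  assumes "(l, bs, j) \<in> paths D" "Poly_Mapping.keys f \<subseteq> paths D" "c < \<delta> i"
  shows "rep u v i j' (path_mult (Poly_Mapping.single (l, bs, j) 1) f) r c
    = of_bool (j' = j) * (\<Sum>m<\<delta> l. path_mat u v bs r m * rep u v i l f m c)"
  using assms(2)
proof (induction f rule: linear_induct)
  case (single p)
  obtain i1 q l1 where p: "p = (i1, q, l1)" by (cases p)
  with single have q: "pre_digraph.cas D i1 q l1" by (auto simp: paths_def D.awalk_def)
  show ?case
    using path_mat_append[OF q, of c u v bs r] assms(3)
    by (auto simp: p path_mult_single_single)
qed (auto simp: path_mult_add_right rep_add sum.distrib distrib_left sum_distrib_left mult_ac)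

lemma rep_mult_single_right:
  assumes "(i, bs, l) \<in> paths D" "Poly_Mapping.keys f \<subseteq> paths D" "c < \<delta> i'"
  shows "rep u v i' j (path_mult f (Poly_Mapping.single (i, bs, l) 1)) r c
    = of_bool (i' = i) * (\<Sum>m<\<delta> l. rep u v l j f r m * path_mat u v bs m c)"
  using assms(2)
proof (induction f rule: linear_induct)
  case (single p)
  obtain i1 q l1 where p: "p = (i1, q, l1)" by (cases p)
  from assms(1) have q: "pre_digraph.cas D i bs l" by (auto simp: paths_def D.awalk_def)
  show ?case
  proof (cases "i' = i")
    case True
    then show ?thesis
      using path_mat_append[OF q, of c u v q r] assms(3)
      by (auto simp: p path_mult_single_single)
  qed (simp add: p path_mult_single_single)
qed (auto simp: path_mult_add_left rep_add sum.distrib distrib_right distrib_left sum_distrib_left mult_ac)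

lemma rep_mult:
  assumes f: "f \<in> hom_paths D l j" and g: "g \<in> hom_paths D i l" and c: "c < \<delta> i"
  shows "rep u v i j (path_mult f g) r c = (\<Sum>m<\<delta> l. rep u v l j f r m * rep u v i l g m c)"
proof -
  have g': "Poly_Mapping.keys g \<subseteq> paths D" using g by (auto simp: hom_paths_def)
  have "Poly_Mapping.keys f \<subseteq> {(u, p, v) \<in> paths D. u = l \<and> v = j}" using f by (simp add: hom_paths_def)
  then show ?thesis
  proof (induction f rule: linear_induct)
    case (single p)
    then obtain bs where p: "p = (l, bs, j)" "(l, bs, j) \<in> paths D" by auto
    show ?case using rep_mult_single_left[OF p(2) g' c, of u v j r] by (simp add: p(1))
  qed (auto simp: path_mult_add_left rep_add sum.distrib distrib_left distrib_right sum_distrib_left mult_ac)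
qed

lemma rep_arrow:
  "b \<in> arcs D \<Longrightarrow> r < \<delta> (head D b) \<Longrightarrow> rep u v (tail D b) (head D b) (arrow D b) r c = arrow_mat u v b r c"
  by (simp add: arrow_def sum_of_bool_mult)

text \<open>The sign of \<lambda> at a vertex is also the sign with which the round trips there
  enter the preprojective relation. After division by it the relation reads the same at all
  vertices: the round trips along the arrows out of \<open>i\<close> add up to \<delta> i.\<close>

definition local_relation :: "'v \<Rightarrow> (('v, 'e + 'e) path \<Rightarrow>\<^sub>0 complex)" where
  "local_relation i = (\<Sum>b\<in>out i. path_mult (arrow D (reverse_arrow b)) (arrow D b))
     - scale (of_nat (\<delta> i)) (trivial_path i)"

abbreviation J where "J \<equiv> preprojective_ideal Q lam"

lemma preprojective_relation_eq:
  "preprojective_relation Q lam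
    = (\<Sum>i\<in>verts Q. scale (if i \<in> Ev then 1 else - 1) (local_relation i))"
proof -
  let ?s = "\<lambda>i. if i \<in> Ev then 1 else - 1 :: complex"
  let ?g = "\<lambda>b. scale (?s (tail D b)) (path_mult (arrow D (reverse_arrow b)) (arrow D b))"
  have "(\<Sum>i\<in>verts Q. scale (?s i) (local_relation i))
      = (\<Sum>i\<in>verts Q. \<Sum>b\<in>out i. ?g b) - (\<Sum>i\<in>verts Q. scale (?s i * of_nat (\<delta> i)) (trivial_path i))"
    unfolding local_relation_def path_space.scale_right_diff_distrib sum_subtractf path_space.scale_sum_right
    by simp
  also have "(\<Sum>i\<in>verts Q. \<Sum>b\<in>out i. ?g b) = (\<Sum>b\<in>arcs D. ?g b)"
    using D.finite_arcs finite_verts by (intro sum.group) auto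
  also have "\<dots> = (\<Sum>a\<in>arcs Q. ?g (Inl a)) + (\<Sum>a\<in>arcs Q. ?g (Inr a))"
    using finite_arcs by (simp add: sum.Plus)
  also have "\<dots> = (\<Sum>a\<in>arcs Q. ?g (Inl a) + ?g (Inr a))" by (simp add: sum.distrib)
  also have "\<dots> = (\<Sum>a\<in>arcs Q. path_mult (arrow D (Inl a)) (arrow D (Inr a))
      - path_mult (arrow D (Inr a)) (arrow D (Inl a)))"
    using bipartite by (intro sum.cong refl) simp
  also have "(\<Sum>i\<in>verts Q. scale (?s i * of_nat (\<delta> i)) (trivial_path i))
      = (\<Sum>i\<in>verts Q. scale (lam i) (trivial_path i) :: ('v, 'e + 'e) path \<Rightarrow>\<^sub>0 complex)"
    using lam by (intro sum.cong refl) simp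
  finally show ?thesis unfolding preprojective_relation_def Let_def by simp
qed

lemma local_relation_hom_paths: "i \<in> verts Q \<Longrightarrow> local_relation i \<in> hom_paths D i i"
proof -
  assume i: "i \<in> verts Q"
  have "path_mult (arrow D (reverse_arrow b)) (arrow D b) \<in> hom_paths D i i" if "b \<in> out i" for b
    using that D.arrow_hom_paths[of b] D.arrow_hom_paths[of "reverse_arrow b"]
    by (intro D.hom_paths_mult[of _ "head D b"]) auto
  then show ?thesis
    unfolding local_relation_def hom_paths_def mem_Collect_eq
    by (intro keys_diff_subset keys_sum_subset keys_scale_subset)
      (use D.trivial_hom_paths[of i] i in \<open>auto simp: hom_paths_def\<close>)
qed

lemma preprojective_relation_carrier: "preprojective_relation Q lam \<in> carrier (path_algebra D)"
  unfolding preprojective_relation_eq path_algebra_simps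
  by (intro keys_sum_subset keys_scale_subset)
    (use local_relation_hom_paths in \<open>auto simp: hom_paths_def\<close>)

sublocale D: ring "path_algebra D"
  by (rule D.ring_path_algebra)

lemma ideal_J: "ideal J (path_algebra D)"
  unfolding preprojective_ideal_def
  by (rule D.genideal_ideal) (use preprojective_relation_carrier in simp)

lemma relation_in_J: "preprojective_relation Q lam \<in> J"
  unfolding preprojective_ideal_def
  by (rule D.genideal_self') (rule preprojective_relation_carrier)

lemma J_add: "x \<in> J \<Longrightarrow> y \<in> J \<Longrightarrow> x + y \<in> J"
  using additive_subgroup.a_closed[OF ideal.axioms(1)[OF ideal_J]] by simp

lemma J_0: "0 \<in> J"
  using additive_subgroup.zero_closed[OF ideal.axioms(1)[OF ideal_J]] by simp

lemma J_scale: "x \<in> J \<Longrightarrow> scale c x \<in> J"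
  using D.path_algebra_ideal_scale[OF ideal_J] .

lemma J_minus: "x \<in> J \<Longrightarrow> - x \<in> J"
  using J_scale[of x "- 1"] by simp

lemma J_diff: "x \<in> J \<Longrightarrow> y \<in> J \<Longrightarrow> x - y \<in> J"
  using J_add[of x "- y"] J_minus[of y] by simp

lemma J_sum: "(\<And>x. x \<in> X \<Longrightarrow> f x \<in> J) \<Longrightarrow> (\<Sum>x\<in>X. f x) \<in> J"
  by (induction X rule: infinite_finite_induct) (auto intro: J_0 J_add)

lemma J_mult:
  assumes "x \<in> J" "Poly_Mapping.keys y \<subseteq> paths D"
  shows "path_mult y x \<in> J" "path_mult x y \<in> J"
  using ideal.I_l_closed[OF ideal_J assms(1), of y] ideal.I_r_closed[OF ideal_J assms(1), of y] assms(2)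
  by simp_all

lemma J_carrier: "x \<in> J \<Longrightarrow> Poly_Mapping.keys x \<subseteq> paths D"
  using additive_subgroup.a_subset[OF ideal.axioms(1)[OF ideal_J]] path_algebra_simps(6) by blast

text \<open>Multiplication with the trivial path on both sides isolates the summand at
  \<open>i\<close>; its sign disappears when it is applied a second time.\<close>

lemma local_relation_in_J:
  assumes i: "i \<in> verts Q"
  shows "local_relation i \<in> J"
proof -
  let ?s = "if i \<in> Ev then 1 else - 1 :: complex"
  have t: "Poly_Mapping.keys (trivial_path i) \<subseteq> paths D"
    using D.trivial_hom_paths[of i] i by (auto simp: hom_paths_def)
  have "path_mult (trivial_path i) (path_mult (preprojective_relation Q lam) (trivial_path i))
    = (\<Sum>j\<in>verts Q. if j = i then scale ?s (local_relation i) else 0)"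
    unfolding preprojective_relation_eq path_mult_sum_left path_mult_sum_right
  proof (intro sum.cong refl)
    fix j assume "j \<in> verts Q"
    note h = local_relation_hom_paths[OF this]
    show "path_mult (trivial_path i) (path_mult (scale (if j \<in> Ev then 1 else - 1) (local_relation j)) (trivial_path i))
      = (if j = i then scale ?s (local_relation i) else 0)"
    proof (cases "j = i")
      case True
      with trivial_path_mult_left[OF h, of i] trivial_path_mult_right[OF h, of i] show ?thesis by simp
    qed (simp add: trivial_path_mult_right[OF h])
  qed
  also have "\<dots> = scale ?s (local_relation i)" using i finite_verts by simp
  finally have "scale ?s (local_relation i) \<in> J"
    using J_mult[OF _ t] relation_in_J by metis
  then have "scale ?s (scale ?s (local_relation i)) \<in> J" by (rule J_scale)
  then show ?thesis by (simp split: if_splits)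
qed

text \<open>Two consecutive arrows bring in one coordinate of u and one of v. Completeness of
  \<open>F\<close> keeps only the terms with equal indices, and these add up to the pairing of u and
  v, which is 1. This is the local relation in matrix form.\<close>

lemma arrow_mat_complete:
  assumes uv: "(\<Sum>k\<in>UNIV. u k * v k) = 1" and i: "i \<in> verts Q" "r < \<delta> i" "c < \<delta> i"
  shows "(\<Sum>b\<in>out i. \<Sum>m<\<delta> (head D b). arrow_mat u v (reverse_arrow b) r m * arrow_mat u v b m c)
    = of_bool (r = c) * of_nat (\<delta> i)"
proof -
  define y where "y = (if i \<in> Ev then u else v)"
  have xy: "(\<Sum>k\<in>UNIV. y k * coord u v i k) = 1" using uv by (auto simp: y_def coord_def mult.commute)
  have y: "coord u v (head D b) = y" if "b \<in> out i" for b
    using that arc_parity[of b] by (auto simp: y_def coord_def)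
  have "(\<Sum>b\<in>out i. \<Sum>m<\<delta> (head D b). arrow_mat u v (reverse_arrow b) r m * arrow_mat u v b m c)
    = (\<Sum>b\<in>out i. \<Sum>m<\<delta> (head D b). \<Sum>k\<in>UNIV. \<Sum>l\<in>UNIV.
        (y k * coord u v i l) * (cnj (F b k m r) * F b l m c))"
  proof (intro sum.cong refl)
    fix b m assume b: "b \<in> out i"
    show "arrow_mat u v (reverse_arrow b) r m * arrow_mat u v b m c
      = (\<Sum>k\<in>UNIV. \<Sum>l\<in>UNIV. (y k * coord u v i l) * (cnj (F b k m r) * F b l m c))"
      using b y[OF b] by (simp add: arrow_mat_def F_reverse sum_product mult_ac)
  qed
  also have "\<dots> = (\<Sum>k\<in>UNIV. \<Sum>l\<in>UNIV. (y k * coord u v i l) *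
      (\<Sum>b\<in>out i. \<Sum>m<\<delta> (head D b). cnj (F b k m r) * F b l m c))"
    by (simp add: UNIV_bool sum.distrib sum_distrib_left)
  also have "\<dots> = (\<Sum>k\<in>UNIV. \<Sum>l\<in>UNIV. (y k * coord u v i l) * (of_bool (k = l \<and> r = c) * of_nat (\<delta> i)))"
    using F_complete[OF i] by simp
  also have "\<dots> = of_bool (r = c) * of_nat (\<delta> i) * (\<Sum>k\<in>UNIV. y k * coord u v i k)"
    by (auto simp: UNIV_bool algebra_simps)
  finally show ?thesis using xy by simp
qed

end

context intertwiners
begin

lemma path_mult_reverse_arrow:
  "path_mult (arrow D (reverse_arrow b)) (arrow D b)
    = Poly_Mapping.single (tail D b, [b, reverse_arrow b], tail D b) 1"
  by (simp add: arrow_def path_mult_single_single)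

lemma rep_local_relation:
  assumes uv: "(\<Sum>k\<in>UNIV. u k * v k) = 1" and i: "i \<in> verts Q" "r < \<delta> i'" "c < \<delta> j'"
  shows "rep u v j' i' (local_relation i) r c = 0"
proof (cases "j' = i \<and> i' = i")
  case True
  have "rep u v i i (local_relation i) r c
    = (\<Sum>b\<in>out i. path_mat u v [b, reverse_arrow b] r c) - of_nat (\<delta> i) * of_bool (r = c)"
    unfolding local_relation_def rep_diff rep_sum rep_scale path_mult_reverse_arrow rep_single trivial_path_def
    by simp
  also have "(\<Sum>b\<in>out i. path_mat u v [b, reverse_arrow b] r c)
    = (\<Sum>b\<in>out i. \<Sum>m<\<delta> (head D b). arrow_mat u v (reverse_arrow b) r m * arrow_mat u v b m c)"
    using i True by (intro sum.cong refl) (auto simp: sum_of_bool_mult)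
  finally show ?thesis using arrow_mat_complete[OF uv i(1)] i True by simp
next
  case False
  then show ?thesis
    unfolding local_relation_def rep_diff rep_sum rep_scale path_mult_reverse_arrow rep_single trivial_path_def
    by auto
qed

text \<open>The elements whose matrices vanish form an ideal, and completeness puts the
  preprojective relation into it.\<close>

lemma rep_J:
  assumes uv: "(\<Sum>k\<in>UNIV. u k * v k) = 1"
    and z: "z \<in> J" and ij: "i \<in> verts Q" "j \<in> verts Q" "r < \<delta> j" "c < \<delta> i"
  shows "rep u v i j z r c = 0"
proof -
  \<comment> \<open>All pairs of vertices are required at once, because multiplication by a path
    moves the end points.\<close>
  define N where "N = {z. Poly_Mapping.keys z \<subseteq> paths D \<and>
    (\<forall>i\<in>verts Q. \<forall>j\<in>verts Q. \<forall>r<\<delta> j. \<forall>c<\<delta> i. rep u v i j z r c = 0)}"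
  have N_add: "x + y \<in> N" if "x \<in> N" "y \<in> N" for x y
    using that by (simp add: N_def rep_add keys_add_subset)
  have N_scale: "scale a x \<in> N" if "x \<in> N" for x a
    using that by (simp add: N_def keys_scale_subset)
  have N_0: "0 \<in> N" by (simp add: N_def)
  have N_sum: "(\<Sum>x\<in>X. f x) \<in> N" if "\<And>x. x \<in> X \<Longrightarrow> f x \<in> N" for X and f :: "'v \<Rightarrow> _"
    using that by (induction X rule: infinite_finite_induct) (auto intro: N_add N_0)
  have mult: "path_mult x a \<in> N \<and> path_mult a x \<in> N" if x: "Poly_Mapping.keys x \<subseteq> paths D" and a: "a \<in> N" for x a
    using x
  proof (induction x rule: linear_induct)
    case (single p)
    obtain l bs j where p: "p = (l, bs, j)" by (cases p)
    have pp: "(l, bs, j) \<in> paths D" using single p by simp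
    then have lj: "l \<in> verts Q" "j \<in> verts Q" by (auto simp: paths_def dest: D.awalk_hd_in_verts D.awalk_last_in_verts)
    have aK: "Poly_Mapping.keys a \<subseteq> paths D" using a by (simp add: N_def)
    have "Poly_Mapping.keys (path_mult (Poly_Mapping.single p 1) a) \<subseteq> paths D"
      "Poly_Mapping.keys (path_mult a (Poly_Mapping.single p 1)) \<subseteq> paths D"
      using D.path_algebra_mult_closed[of "Poly_Mapping.single p 1" a]
        D.path_algebra_mult_closed[of a "Poly_Mapping.single p 1"] aK single by auto
    then show ?case using a lj
      by (auto simp: N_def p rep_mult_single_left[OF pp aK] rep_mult_single_right[OF pp aK])
  qed (auto simp: path_mult_add_left path_mult_add_right intro: N_add N_scale N_0)
  have "ideal N (path_algebra D)"
    unfolding D.path_algebra_ideal_iff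
  proof (intro conjI ballI)
    show "N \<subseteq> carrier (path_algebra D)" by (auto simp: N_def)
    show "0 \<in> N" by (rule N_0)
    show "x + y \<in> N" if "x \<in> N" "y \<in> N" for x y using that by (rule N_add)
    show "path_mult x a \<in> N" "path_mult a x \<in> N" if "x \<in> carrier (path_algebra D)" "a \<in> N" for x a
      using mult that by simp_all
  qed
  moreover have "preprojective_relation Q lam \<in> N"
    unfolding preprojective_relation_eq
  proof (intro N_sum N_scale)
    fix i assume i: "i \<in> verts Q"
    have "Poly_Mapping.keys (local_relation i) \<subseteq> paths D"
      using local_relation_hom_paths[OF i] by (auto simp: hom_paths_def)
    then show "local_relation i \<in> N" using rep_local_relation[OF uv i] by (simp add: N_def)
  qed
  ultimately have "J \<subseteq> N"
    unfolding preprojective_ideal_def by (intro D.genideal_minimal) auto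
  then show ?thesis using z ij by (auto simp: N_def)
qed

text \<open>
  The entry \<open>(r, c)\<close> of a word in the matrices \<open>Z\<^sub>k = \<Sum>\<^sub>b (F b k)\<^sup>* b / \<delta>\<close> over the path algebra.
\<close>

fun word_elt :: "bool list \<Rightarrow> 'v \<Rightarrow> nat \<Rightarrow> 'v \<Rightarrow> nat \<Rightarrow> (('v, 'e + 'e) path \<Rightarrow>\<^sub>0 complex)" where
  "word_elt [] j r i c = (if j = i \<and> r = c then trivial_path i else 0)"
| "word_elt (k # w) j r i c = (\<Sum>b\<in>out i. \<Sum>m<\<delta> (head D b).
     scale (cnj (F b k m c) / of_nat (\<delta> i)) (path_mult (word_elt w j r (head D b) m) (arrow D b)))"

lemma word_elt_hom_paths: "i \<in> verts Q \<Longrightarrow> word_elt w j r i c \<in> hom_paths D i j"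
proof (induction w arbitrary: i c)
  case Nil
  then show ?case using D.trivial_hom_paths[of i] by auto
next
  case (Cons k w)
  have "path_mult (word_elt w j r (head D b) m) (arrow D b) \<in> hom_paths D i j" if b: "b \<in> out i" for b m
  proof -
    have "head D b \<in> verts Q" using b D.head_in_verts[of b] by simp
    then show ?thesis using Cons.IH D.arrow_hom_paths[of b] b D.hom_paths_mult by blast
  qed
  then show ?case by (simp del: path_mult_scale_left) (intro hom_paths_sum hom_paths_scale; blast)
qed

lemma coord_head: "b \<in> out i \<Longrightarrow> coord u v (head D b) = coord v u i"
  using arc_parity[of b] by (auto simp: coord_def)

text \<open>Contraction moves the matrix of \<open>g\<close> from the tensor factor, or its dual,
  onto the vectors u and v.\<close>

lemma arrow_mat_equivariant:
  assumes b: "b \<in> arcs D" and g: "g \<in> \<Gamma>" and r: "r < \<delta> (head D b)" and c: "c < \<delta> (tail D b)"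
  shows "(\<Sum>m<\<delta> (head D b). \<rho> (head D b) g r m * arrow_mat u v b m c)
    = (\<Sum>m<\<delta> (tail D b). arrow_mat (act_left g u) (act_right g v) b r m * \<rho> (tail D b) g m c)"
proof -
  let ?i = "tail D b"
  let ?G = "\<lambda>l k. if ?i \<in> Ev then cnj (g $$ (bool_index l, bool_index k)) else g $$ (bool_index l, bool_index k)"
  have coord: "coord (act_left g u) (act_right g v) ?i l = (\<Sum>k\<in>UNIV. ?G l k * coord u v ?i k)" for l
    by (simp add: coord_def act_left_def act_right_def)
  have "(\<Sum>m<\<delta> (head D b). \<rho> (head D b) g r m * arrow_mat u v b m c)
    = (\<Sum>k\<in>UNIV. coord u v ?i k * (\<Sum>m<\<delta> (head D b). \<rho> (head D b) g r m * F b k m c))"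
    unfolding arrow_mat_def sum_distrib_left by (subst sum.swap) (simp add: mult_ac)
  also have "\<dots> = (\<Sum>k\<in>UNIV. coord u v ?i k * (\<Sum>l\<in>UNIV. \<Sum>m<\<delta> ?i. ?G l k * F b l r m * \<rho> ?i g m c))"
    using F_equivariant[OF b g r c] by simp
  also have "\<dots> = (\<Sum>m<\<delta> ?i. \<Sum>l\<in>UNIV. (\<Sum>k\<in>UNIV. ?G l k * coord u v ?i k) * F b l r m * \<rho> ?i g m c)"
    by (simp add: UNIV_bool sum.distrib sum_distrib_left algebra_simps)
  also have "\<dots> = (\<Sum>m<\<delta> ?i. arrow_mat (act_left g u) (act_right g v) b r m * \<rho> ?i g m c)"
    unfolding arrow_mat_def coord by (simp add: sum_distrib_right)
  finally show ?thesis .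
qed

lemma path_mat_equivariant:
  assumes "pre_digraph.cas D i bs j" "set bs \<subseteq> arcs D" "g \<in> \<Gamma>" "r < \<delta> j" "c < \<delta> i"
  shows "(\<Sum>m<\<delta> j. \<rho> j g r m * path_mat u v bs m c)
    = (\<Sum>m<\<delta> i. path_mat (act_left g u) (act_right g v) bs r m * \<rho> i g m c)"
  using assms
proof (induction bs arbitrary: i c)
  case Nil
  then show ?case by (simp add: D.cas.simps sum_of_bool_mult)
next
  case (Cons b bs)
  then have b: "tail D b = i" "pre_digraph.cas D (head D b) bs j" "b \<in> arcs D" "set bs \<subseteq> arcs D"
    by (auto simp: D.cas.simps)
  let ?u = "act_left g u" and ?v = "act_right g v"
  have "(\<Sum>m<\<delta> j. \<rho> j g r m * path_mat u v (b # bs) m c)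
    = (\<Sum>s<\<delta> (head D b). (\<Sum>m<\<delta> j. \<rho> j g r m * path_mat u v bs m s) * arrow_mat u v b s c)"
    by (simp add: sum_distrib_left sum_distrib_right mult.assoc) (rule sum.swap)
  also have "\<dots> = (\<Sum>s<\<delta> (head D b). (\<Sum>m<\<delta> (head D b). path_mat ?u ?v bs r m * \<rho> (head D b) g m s) * arrow_mat u v b s c)"
    using Cons.IH[OF b(2,4) Cons.prems(3,4)] by simp
  also have "\<dots> = (\<Sum>m<\<delta> (head D b). path_mat ?u ?v bs r m * (\<Sum>s<\<delta> (head D b). \<rho> (head D b) g m s * arrow_mat u v b s c))"
    by (simp add: sum_distrib_left sum_distrib_right mult.assoc) (rule sum.swap)
  also have "\<dots> = (\<Sum>m<\<delta> (head D b). path_mat ?u ?v bs r m * (\<Sum>n<\<delta> i. arrow_mat ?u ?v b m n * \<rho> i g n c))"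
    using arrow_mat_equivariant[OF b(3) Cons.prems(3)] b(1) Cons.prems(5) by simp
  also have "\<dots> = (\<Sum>n<\<delta> i. path_mat ?u ?v (b # bs) r n * \<rho> i g n c)"
    by (simp add: sum_distrib_left sum_distrib_right mult.assoc) (rule sum.swap)
  finally show ?case .
qed

text \<open>By completeness, the combination of arrows that makes up the letter \<open>k\<close>
  acts as the scalar coordinate \<open>k\<close>. The factor \<delta> i is cancelled by the
  denominator in \<open>word_elt\<close>.\<close>

lemma F_arrow_mat:
  assumes "i \<in> verts Q" "c < \<delta> i" "n < \<delta> i"
  shows "(\<Sum>b\<in>out i. \<Sum>m<\<delta> (head D b). cnj (F b k m c) * arrow_mat u v b m n)
    = of_bool (c = n) * (of_nat (\<delta> i) * coord u v i k)"
proof -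
  have "(\<Sum>b\<in>out i. \<Sum>m<\<delta> (head D b). cnj (F b k m c) * arrow_mat u v b m n)
    = (\<Sum>b\<in>out i. \<Sum>m<\<delta> (head D b). \<Sum>l\<in>UNIV. coord u v i l * (cnj (F b k m c) * F b l m n))"
    by (intro sum.cong refl) (auto simp: arrow_mat_def sum_distrib_left mult_ac)
  also have "\<dots> = (\<Sum>l\<in>UNIV. coord u v i l * (\<Sum>b\<in>out i. \<Sum>m<\<delta> (head D b). cnj (F b k m c) * F b l m n))"
    by (simp add: UNIV_bool sum.distrib sum_distrib_left)
  also have "\<dots> = (\<Sum>l\<in>UNIV. coord u v i l * (of_bool (k = l \<and> c = n) * of_nat (\<delta> i)))"
    using F_complete[OF assms] by simp
  finally show ?thesis by (auto simp: UNIV_bool)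
qed

text \<open>A word goes to the projection of a matrix unit times the word onto the equivariant maps.\<close>

lemma rep_word_elt:
  assumes "i \<in> verts Q" "j \<in> verts Q" "r < \<delta> j" "r' < \<delta> j" "c < \<delta> i" "c' < \<delta> i"
  shows "rep u v i j (word_elt w j r i c) r' c' = of_nat (\<delta> j) / of_nat (card \<Gamma>) *
    (\<Sum>g\<in>\<Gamma>. cnj (\<rho> j g r r') * \<rho> i g c c' *
      word_value (coord (act_left g u) (act_right g v) i) (coord (act_right g v) (act_left g u) i) w)"
  using assms
proof (induction w arbitrary: i c c')
  case Nil
  have "card \<Gamma> \<noteq> 0" using finite_group by simp
  moreover have "\<delta> j \<noteq> 0" using dim_pos[OF Nil(2)] by simp
  \<comment> \<open>For the empty word the claim is Schur orthogonality.\<close>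
  ultimately show ?case using schur[OF Nil(1,2,3,4,5,6)] by (auto simp: trivial_path_def)
next
  case (Cons k w)
  note i = \<open>i \<in> verts Q\<close>
  let ?K = "of_nat (\<delta> j) / of_nat (card \<Gamma>) :: complex"
  let ?u = "\<lambda>g. act_left g u" and ?v = "\<lambda>g. act_right g v"
  define Y where "Y g = word_value (coord (?v g) (?u g) i) (coord (?u g) (?v g) i) w" for g
  have step: "rep u v i j (path_mult (word_elt w j r (head D b) m) (arrow D b)) r' c'
    = ?K * (\<Sum>g\<in>\<Gamma>. cnj (\<rho> j g r r') * Y g * (\<Sum>n<\<delta> i. arrow_mat (?u g) (?v g) b m n * \<rho> i g n c'))"
    if b: "b \<in> out i" and m: "m < \<delta> (head D b)" for b m
  proof -
    have h: "head D b \<in> verts Q" and ba: "b \<in> arcs D" "tail D b = i"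
      using b D.head_in_verts[of b] by simp_all
    have "arrow D b \<in> hom_paths D i (head D b)" using D.arrow_hom_paths[of b] b by simp
    then have "rep u v i j (path_mult (word_elt w j r (head D b) m) (arrow D b)) r' c'
      = (\<Sum>s<\<delta> (head D b). rep u v (head D b) j (word_elt w j r (head D b) m) r' s * rep u v i (head D b) (arrow D b) s c')"
      by (rule rep_mult[OF word_elt_hom_paths[OF h] _ Cons.prems(6)])
    also have "\<dots> = (\<Sum>s<\<delta> (head D b). (?K * (\<Sum>g\<in>\<Gamma>. cnj (\<rho> j g r r') * \<rho> (head D b) g m s * Y g)) * arrow_mat u v b s c')"
      using Cons.IH[OF h Cons.prems(2-4) m] rep_arrow[OF ba(1), of _ u v c'] ba(2) coord_head[OF b]
      by (simp add: Y_def)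
    also have "\<dots> = (\<Sum>s<\<delta> (head D b). \<Sum>g\<in>\<Gamma>. ?K * (cnj (\<rho> j g r r') * Y g * (\<rho> (head D b) g m s * arrow_mat u v b s c')))"
      by (simp add: sum_distrib_left sum_distrib_right mult_ac)
    also have "\<dots> = ?K * (\<Sum>g\<in>\<Gamma>. cnj (\<rho> j g r r') * Y g * (\<Sum>s<\<delta> (head D b). \<rho> (head D b) g m s * arrow_mat u v b s c'))"
      by (subst sum.swap) (simp add: sum_distrib_left)
    \<comment> \<open>Equivariance carries \<open>g\<close> across the arrow: the representation at
      the head becomes the one at \<open>i\<close>, and u, v become their transforms.\<close>
    also have "\<dots> = ?K * (\<Sum>g\<in>\<Gamma>. cnj (\<rho> j g r r') * Y g * (\<Sum>n<\<delta> i. arrow_mat (?u g) (?v g) b m n * \<rho> i g n c'))"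
      using arrow_mat_equivariant[OF ba(1) _ m, of _ c' u v] Cons.prems(6) ba(2) by simp
    finally show ?thesis .
  qed
  have "rep u v i j (word_elt (k # w) j r i c) r' c'
    = (\<Sum>b\<in>out i. \<Sum>m<\<delta> (head D b). cnj (F b k m c) / of_nat (\<delta> i) *
        (?K * (\<Sum>g\<in>\<Gamma>. cnj (\<rho> j g r r') * Y g * (\<Sum>n<\<delta> i. arrow_mat (?u g) (?v g) b m n * \<rho> i g n c'))))"
    unfolding word_elt.simps rep_sum rep_scale using step by simp
  also have "\<dots> = (\<Sum>b\<in>out i. \<Sum>m<\<delta> (head D b). \<Sum>g\<in>\<Gamma>. \<Sum>n<\<delta> i. ?K / of_nat (\<delta> i) *
        (cnj (\<rho> j g r r') * Y g * (\<rho> i g n c' * (cnj (F b k m c) * arrow_mat (?u g) (?v g) b m n))))"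
    by (simp add: sum_distrib_left mult_ac)
  also have "\<dots> = (\<Sum>g\<in>\<Gamma>. \<Sum>n<\<delta> i. \<Sum>b\<in>out i. \<Sum>m<\<delta> (head D b). ?K / of_nat (\<delta> i) *
        (cnj (\<rho> j g r r') * Y g * (\<rho> i g n c' * (cnj (F b k m c) * arrow_mat (?u g) (?v g) b m n))))"
    unfolding sum.swap[where B = \<Gamma>] unfolding sum.swap[where B = "{..<\<delta> i}" and A = "{..<\<delta> (head D b)}" for b]
      sum.swap[where B = "{..<\<delta> i}" and A = "out i"] ..
  \<comment> \<open>Summed over all arrows out of \<open>i\<close>, the transformed matrices
    collapse to the scalar coordinate \<open>k\<close>, which is the value of the new
    letter.\<close>
  also have "\<dots> = (\<Sum>g\<in>\<Gamma>. \<Sum>n<\<delta> i. ?K / of_nat (\<delta> i) * (cnj (\<rho> j g r r') * Y g * (\<rho> i g n c' *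
        (of_bool (c = n) * (of_nat (\<delta> i) * coord (?u g) (?v g) i k)))))"
    unfolding sum_distrib_left[symmetric]
    by (intro arg_cong2[where f = "(*)"] sum.cong refl F_arrow_mat[OF i Cons.prems(5)]) auto
  also have "\<dots> = (\<Sum>g\<in>\<Gamma>. ?K / of_nat (\<delta> i) * (cnj (\<rho> j g r r') * Y g * (\<rho> i g c c' *
        (of_nat (\<delta> i) * coord (?u g) (?v g) i k))))"
  proof (intro sum.cong refl)
    fix g
    have "(\<Sum>n<\<delta> i. ?K / of_nat (\<delta> i) * (cnj (\<rho> j g r r') * Y g * (\<rho> i g n c' *
        (of_bool (c = n) * (of_nat (\<delta> i) * coord (?u g) (?v g) i k)))))
      = (\<Sum>n<\<delta> i. of_bool (c = n) * (?K / of_nat (\<delta> i) * (cnj (\<rho> j g r r') * Y g * (\<rho> i g n c' *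
        (of_nat (\<delta> i) * coord (?u g) (?v g) i k)))))"
      by (intro sum.cong refl) (simp add: mult_ac)
    then show "(\<Sum>n<\<delta> i. ?K / of_nat (\<delta> i) * (cnj (\<rho> j g r r') * Y g * (\<rho> i g n c' *
        (of_bool (c = n) * (of_nat (\<delta> i) * coord (?u g) (?v g) i k)))))
      = ?K / of_nat (\<delta> i) * (cnj (\<rho> j g r r') * Y g * (\<rho> i g c c' * (of_nat (\<delta> i) * coord (?u g) (?v g) i k)))"
      by (rule trans[OF _ sum_of_bool_mult(1)[OF Cons.prems(5)]])
  qed
  also have "\<dots> = ?K * (\<Sum>g\<in>\<Gamma>. cnj (\<rho> j g r r') * \<rho> i g c c' *
      word_value (coord (act_left g u) (act_right g v) i) (coord (act_right g v) (act_left g u) i) (k # w))"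
    using dim_pos[OF i] by (simp add: sum_distrib_left Y_def mult_ac)
  finally show ?case .
qed

end

section \<open>Rearrangement of finite sums, and separation by linear functionals\<close>

lemma sum_swap_pairs:
  "(\<Sum>b\<in>B. \<Sum>n\<in>N b. \<Sum>l\<in>L. \<Sum>m\<in>M l. G b n l m)
    = (\<Sum>l\<in>L. \<Sum>m\<in>M l. \<Sum>b\<in>B. \<Sum>n\<in>N b. G b n l m)"
proof -
  have "(\<Sum>b\<in>B. \<Sum>n\<in>N b. \<Sum>l\<in>L. \<Sum>m\<in>M l. G b n l m) = (\<Sum>b\<in>B. \<Sum>l\<in>L. \<Sum>n\<in>N b. \<Sum>m\<in>M l. G b n l m)"
    by (intro sum.cong refl sum.swap)
  also have "\<dots> = (\<Sum>l\<in>L. \<Sum>b\<in>B. \<Sum>n\<in>N b. \<Sum>m\<in>M l. G b n l m)" by (rule sum.swap)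
  also have "\<dots> = (\<Sum>l\<in>L. \<Sum>b\<in>B. \<Sum>m\<in>M l. \<Sum>n\<in>N b. G b n l m)"
    by (intro sum.cong refl sum.swap)
  also have "\<dots> = (\<Sum>l\<in>L. \<Sum>m\<in>M l. \<Sum>b\<in>B. \<Sum>n\<in>N b. G b n l m)"
    by (intro sum.cong refl sum.swap)
  finally show ?thesis .
qed

lemma sum_product_rearrange:
  fixes p f :: "_ \<Rightarrow> _ \<Rightarrow> 'a :: comm_semiring_0"
  shows "(\<Sum>m\<in>M. (\<Sum>w\<in>W. p w m * z w) * (\<Sum>k\<in>K. x k * f k m))
    = (\<Sum>k\<in>K. \<Sum>w\<in>W. (\<Sum>m\<in>M. p w m * f k m) * (x k * z w))"
proof -
  have "(\<Sum>m\<in>M. (\<Sum>w\<in>W. p w m * z w) * (\<Sum>k\<in>K. x k * f k m))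
    = (\<Sum>m\<in>M. \<Sum>w\<in>W. \<Sum>k\<in>K. p w m * f k m * (x k * z w))"
    by (simp add: sum_product mult_ac)
  also have "\<dots> = (\<Sum>w\<in>W. \<Sum>m\<in>M. \<Sum>k\<in>K. p w m * f k m * (x k * z w))" by (rule sum.swap)
  also have "\<dots> = (\<Sum>w\<in>W. \<Sum>k\<in>K. \<Sum>m\<in>M. p w m * f k m * (x k * z w))"
    by (intro sum.cong refl sum.swap)
  also have "\<dots> = (\<Sum>k\<in>K. \<Sum>w\<in>W. \<Sum>m\<in>M. p w m * f k m * (x k * z w))" by (rule sum.swap)
  finally show ?thesis by (simp add: sum_distrib_right)
qed

lemma sum_scale_rearrange:
  fixes X :: "'b \<Rightarrow> nat \<Rightarrow> ('p \<Rightarrow>\<^sub>0 complex)"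
  shows "(\<Sum>k\<in>K. \<Sum>c\<in>C. scale (\<Sum>m\<in>M. a m * f k m c) (\<Sum>b\<in>B. \<Sum>n\<in>N b. scale (g k b n c) (X b n)))
    = (\<Sum>b\<in>B. \<Sum>n\<in>N b. scale (\<Sum>m\<in>M. a m * (\<Sum>k\<in>K. \<Sum>c\<in>C. f k m c * g k b n c)) (X b n))"
proof -
  have 1: "(\<Sum>m\<in>M. a m * (\<Sum>k\<in>K. \<Sum>c\<in>C. f k m c * g k b n c))
    = (\<Sum>k\<in>K. \<Sum>c\<in>C. (\<Sum>m\<in>M. a m * f k m c) * g k b n c)" for b n
    unfolding sum_distrib_left sum_distrib_right
    by (subst sum.swap, intro sum.cong refl, subst sum.swap) (simp add: mult.assoc)
  show ?thesis
    unfolding 1 path_space.scale_sum_left path_space.scale_sum_right path_space.scale_scale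
    by (rule sum_swap_pairs)
qed

lemma sum_delta_pair:
  fixes X :: "'v \<Rightarrow> nat \<Rightarrow> 'a :: comm_monoid_add"
  assumes "finite L" "i \<in> L" "c < d i"
  shows "(\<Sum>l\<in>L. \<Sum>m<d l. if l = i \<and> m = c then X l m else 0) = X i c"
proof -
  have "(\<Sum>l\<in>L. \<Sum>m<d l. if l = i \<and> m = c then X l m else 0)
    = (\<Sum>l\<in>L. if l = i then X i c else 0)"
    using assms(3) by (intro sum.cong refl) auto
  then show ?thesis using assms(1,2) by simp
qed

text \<open>A basis of \<open>J\<close> together with \<open>z\<close> stays independent, so a
  functional can be prescribed as 0 on the former and 1 on the latter. This turns membership in
  \<open>J\<close> into a statement about functionals, to which word models apply.\<close>

lemma exists_separating_functional:
  fixes J :: "('p \<Rightarrow>\<^sub>0 complex) set"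
  assumes J: "0 \<in> J" "\<And>x y. x \<in> J \<Longrightarrow> y \<in> J \<Longrightarrow> x + y \<in> J" "\<And>c x. x \<in> J \<Longrightarrow> scale c x \<in> J"
    and z: "z \<notin> J"
  obtains l :: "('p \<Rightarrow>\<^sub>0 complex) \<Rightarrow> complex" where "\<And>x y. l (x + y) = l x + l y"
    "\<And>c x. l (scale c x) = c * l x" "\<And>x. x \<in> J \<Longrightarrow> l x = 0" "l z \<noteq> 0"
proof -
  interpret C: vector_space "(*) :: complex \<Rightarrow> complex \<Rightarrow> complex"
    by unfold_locales (auto simp: algebra_simps)
  interpret P: vector_space_pair "scale :: complex \<Rightarrow> ('p \<Rightarrow>\<^sub>0 complex) \<Rightarrow> _" "(*) :: complex \<Rightarrow> complex \<Rightarrow> complex"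
    by unfold_locales
  have sub: "path_space.subspace J" using J by (auto simp: path_space.subspace_def)
  obtain B where B: "B \<subseteq> J" "path_space.independent B" "J \<subseteq> path_space.span B"
    using path_space.maximal_independent_subset[of J] by blast
  have "path_space.span B \<subseteq> J" using path_space.span_minimal[OF B(1) sub] .
  then have zB: "z \<notin> path_space.span B" using z by auto
  then have "path_space.independent (insert z B)" using B(2) by (simp add: path_space.independent_insert)
  from P.linear_independent_extend[OF this, of "\<lambda>x. if x = z then 1 else 0"]
  obtain l where l: "Vector_Spaces.linear scale (*) l" "\<forall>x\<in>insert z B. l x = (if x = z then 1 else 0)"
    by blast
  interpret l: Vector_Spaces.linear scale "(*)" l by (rule l(1))
  have "l x = 0" if "x \<in> J" for x
  proof -
    have "x \<in> path_space.span B" using that B(3) by blast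
    then show ?thesis
    proof (rule l.eq_0_on_span[rotated])
      fix y assume "y \<in> B"
      moreover from this have "y \<noteq> z" using zB path_space.span_base by blast
      ultimately show "l y = 0" using l(2) by simp
    qed
  qed
  with l(2) show ?thesis by (intro that[of l]) (auto simp: l.add l.scale)
qed

section \<open>Translation between paths and words, and injectivity\<close>

context intertwiners
begin

text \<open>The composite of the maps \<open>F\<close> along the path, with basis vectors of V or
  its dual prescribed by the letters: the coefficient of the word \<open>w\<close> in the matrix of
  the path \<open>bs\<close>.\<close>

fun path_tensor :: "bool list \<Rightarrow> ('e + 'e) list \<Rightarrow> nat \<Rightarrow> nat \<Rightarrow> complex" where
  "path_tensor [] [] r c = of_bool (r = c)"
| "path_tensor (k # w) (b # bs) r c = (\<Sum>m<\<delta> (head D b). path_tensor w bs r m * F b k m c)"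
| "path_tensor _ _ r c = 0"

lemma path_tensor_length: "length w \<noteq> length bs \<Longrightarrow> path_tensor w bs r c = 0"
  by (induction w bs r c rule: path_tensor.induct) auto

lemma path_mat_expand:
  assumes "pre_digraph.cas D i bs j" "set bs \<subseteq> arcs D"
  shows "path_mat u v bs r c
    = (\<Sum>w\<in>words (length bs). path_tensor w bs r c * word_value (coord u v i) (coord v u i) w)"
  using assms
proof (induction bs arbitrary: i c)
  case (Cons b bs)
  then have b: "tail D b = i" "pre_digraph.cas D (head D b) bs j" "b \<in> out i" "set bs \<subseteq> arcs D"
    by (auto simp: D.cas.simps)
  have "path_mat u v (b # bs) r c = (\<Sum>m<\<delta> (head D b).
      (\<Sum>w\<in>words (length bs). path_tensor w bs r m * word_value (coord v u i) (coord u v i) w)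
        * (\<Sum>k\<in>UNIV. coord u v i k * F b k m c))"
    using Cons.IH[OF b(2,4)] by (simp add: coord_head[OF b(3)] arrow_mat_def b(1))
  also have "\<dots> = (\<Sum>k\<in>UNIV. \<Sum>w\<in>words (length bs). (\<Sum>m<\<delta> (head D b). path_tensor w bs r m * F b k m c)
      * (coord u v i k * word_value (coord v u i) (coord u v i) w))"
    by (rule sum_product_rearrange)
  finally show ?case by (simp add: sum_words_Suc)
qed simp

text \<open>Contraction of the letters with the tensors of \<open>bs\<close> extracts this path from
  the word elements: at each letter, orthogonality of the maps out of a vertex singles out one
  arrow. What remains at the end is the trace of an identity matrix, whence the factor \<delta>
  j.\<close>

lemma sum_path_tensor_word_elt:
  assumes "i \<in> verts Q" "j \<in> verts Q" "pre_digraph.cas D i bs j" "set bs \<subseteq> arcs D"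
  shows "(\<Sum>w\<in>words (length bs). \<Sum>r<\<delta> j. \<Sum>c<\<delta> i. scale (path_tensor w bs r c) (word_elt w j r i c))
    = Poly_Mapping.single (i, bs, j) (of_nat (\<delta> j))"
  using assms
proof (induction bs arbitrary: i)
  case Nil
  then have ij: "i = j" by (simp add: D.cas.simps)
  have "(\<Sum>r<\<delta> j. \<Sum>c<\<delta> j. scale (path_tensor [] [] r c) (word_elt [] j r j c))
    = (\<Sum>r<\<delta> j. \<Sum>c<\<delta> j. if c = r then trivial_path j else 0)"
    by (intro sum.cong refl) auto
  also have "\<dots> = (\<Sum>r<\<delta> j. trivial_path j)"
    by (intro sum.cong refl) simp
  also have "\<dots> = Poly_Mapping.single (j, [], j) (of_nat (\<delta> j))"
    by (subst path_space.sum_constant_scale) (simp add: trivial_path_def)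
  finally show ?case by (simp add: ij)
next
  case (Cons b bs)
  then have b: "tail D b = i" "pre_digraph.cas D (head D b) bs j" "b \<in> arcs D" "set bs \<subseteq> arcs D"
    by (auto simp: D.cas.simps)
  then have hv: "head D b \<in> verts Q" using D.head_in_verts[of b] by simp
  have di: "of_nat (\<delta> i) \<noteq> (0 :: complex)" using dim_pos[OF Cons.prems(1)] by simp
  let ?X = "\<lambda>w r b' m'. path_mult (word_elt w j r (head D b') m') (arrow D b')"
  have inner: "(\<Sum>k\<in>UNIV. \<Sum>c<\<delta> i. scale (path_tensor (k # w) (b # bs) r c) (word_elt (k # w) j r i c))
    = path_mult (\<Sum>m<\<delta> (head D b). scale (path_tensor w bs r m) (word_elt w j r (head D b) m)) (arrow D b)"
    for w r
  proof -
    have orth: "(\<Sum>k\<in>UNIV. \<Sum>c<\<delta> i. F b k m c * (cnj (F b' k m' c) / of_nat (\<delta> i)))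
      = of_bool (b' = b \<and> m = m')"
      if "b' \<in> out i" "m < \<delta> (head D b)" "m' < \<delta> (head D b')" for b' m m'
      using F_orthogonal[of b b' m m'] that b di
      by (auto simp: sum_divide_distrib[symmetric])
    have "(\<Sum>k\<in>UNIV. \<Sum>c<\<delta> i. scale (path_tensor (k # w) (b # bs) r c) (word_elt (k # w) j r i c))
      = (\<Sum>b'\<in>out i. \<Sum>m'<\<delta> (head D b'). scale (\<Sum>m<\<delta> (head D b). path_tensor w bs r m *
          (\<Sum>k\<in>UNIV. \<Sum>c<\<delta> i. F b k m c * (cnj (F b' k m' c) / of_nat (\<delta> i)))) (?X w r b' m'))"
      unfolding path_tensor.simps word_elt.simps by (rule sum_scale_rearrange)
    also have "\<dots> = (\<Sum>b'\<in>out i. if b' = b then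
        (\<Sum>m'<\<delta> (head D b). scale (path_tensor w bs r m') (?X w r b m')) else 0)"
    proof (intro sum.cong refl)
      fix b' assume b': "b' \<in> out i"
      show "(\<Sum>m'<\<delta> (head D b'). scale (\<Sum>m<\<delta> (head D b). path_tensor w bs r m *
          (\<Sum>k\<in>UNIV. \<Sum>c<\<delta> i. F b k m c * (cnj (F b' k m' c) / of_nat (\<delta> i)))) (?X w r b' m'))
        = (if b' = b then (\<Sum>m'<\<delta> (head D b). scale (path_tensor w bs r m') (?X w r b m')) else 0)"
      proof (cases "b' = b")
        case True
        have "(\<Sum>m<\<delta> (head D b). path_tensor w bs r m *
            (\<Sum>k\<in>UNIV. \<Sum>c<\<delta> i. F b k m c * (cnj (F b k m' c) / of_nat (\<delta> i)))) = path_tensor w bs r m'"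
          if m': "m' < \<delta> (head D b)" for m'
        proof -
          have "(\<Sum>m<\<delta> (head D b). path_tensor w bs r m *
              (\<Sum>k\<in>UNIV. \<Sum>c<\<delta> i. F b k m c * (cnj (F b k m' c) / of_nat (\<delta> i))))
            = (\<Sum>m<\<delta> (head D b). path_tensor w bs r m * of_bool (m = m'))"
            using orth[of b _ m'] m' b' True by (intro sum.cong refl) simp
          also have "\<dots> = path_tensor w bs r m'" by (rule sum_of_bool_mult(4)[OF m'])
          finally show ?thesis .
        qed
        then show ?thesis using True by simp
      next
        case False
        then show ?thesis using orth[OF b'] by simp
      qed
    qed
    also have "\<dots> = (\<Sum>m'<\<delta> (head D b). scale (path_tensor w bs r m') (?X w r b m'))"
      using b finite_out[of i] by (subst sum.delta) auto
    finally show ?thesis by (simp add: path_mult_sum_left)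
  qed
  have "(\<Sum>w\<in>words (length (b # bs)). \<Sum>r<\<delta> j. \<Sum>c<\<delta> i. scale (path_tensor w (b # bs) r c) (word_elt w j r i c))
    = (\<Sum>k\<in>UNIV. \<Sum>w\<in>words (length bs). \<Sum>r<\<delta> j. \<Sum>c<\<delta> i.
        scale (path_tensor (k # w) (b # bs) r c) (word_elt (k # w) j r i c))"
    unfolding list.size add_0_right Suc_eq_plus1[symmetric] by (simp only: sum_words_Suc add_Suc_right add_0_right)
  also have "\<dots> = (\<Sum>w\<in>words (length bs). \<Sum>r<\<delta> j. \<Sum>k\<in>UNIV. \<Sum>c<\<delta> i.
        scale (path_tensor (k # w) (b # bs) r c) (word_elt (k # w) j r i c))"
    by (subst sum.swap, intro sum.cong refl sum.swap)
  also have "\<dots> = path_mult (\<Sum>w\<in>words (length bs). \<Sum>r<\<delta> j. \<Sum>m<\<delta> (head D b).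
      scale (path_tensor w bs r m) (word_elt w j r (head D b) m)) (arrow D b)"
    unfolding inner path_mult_sum_left ..
  also have "\<dots> = Poly_Mapping.single (i, b # bs, j) (of_nat (\<delta> j))"
    unfolding Cons.IH[OF hv Cons.prems(2) b(2,4)] by (simp add: arrow_def path_mult_single_single b(1))
  finally show ?case .
qed

text \<open>The word elements are the entries of products of matrices over the path algebra whose
  rows and columns are indexed by a vertex and a basis index. Letters at the front of the word act
  first, so they form the right factor.\<close>

lemma word_elt_append:
  assumes "i \<in> verts Q" "c < \<delta> i"
  shows "word_elt (u @ w) j r i c
    = (\<Sum>l\<in>verts Q. \<Sum>m<\<delta> l. path_mult (word_elt w j r l m) (word_elt u l m i c))"
  using assms
proof (induction u arbitrary: i c)
  case Nil
  have "(\<Sum>l\<in>verts Q. \<Sum>m<\<delta> l. path_mult (word_elt w j r l m) (word_elt [] l m i c))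
    = (\<Sum>l\<in>verts Q. \<Sum>m<\<delta> l. if l = i \<and> m = c then path_mult (word_elt w j r l m) (trivial_path i) else 0)"
    by (intro sum.cong refl) auto
  also have "\<dots> = path_mult (word_elt w j r i c) (trivial_path i)"
    using Nil finite_verts by (intro sum_delta_pair)
  also have "\<dots> = word_elt w j r i c"
    using trivial_path_mult_right[OF word_elt_hom_paths[OF Nil(1)]] by simp
  finally show ?case by simp
next
  case (Cons k u)
  have "word_elt ((k # u) @ w) j r i c = (\<Sum>b\<in>out i. \<Sum>n<\<delta> (head D b).
    scale (cnj (F b k n c) / of_nat (\<delta> i))
      (path_mult (\<Sum>l\<in>verts Q. \<Sum>m<\<delta> l. path_mult (word_elt w j r l m) (word_elt u l m (head D b) n)) (arrow D b)))"
    unfolding append_Cons word_elt.simps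
  proof (intro sum.cong refl)
    fix b n assume b: "b \<in> out i" and n: "n \<in> {..<\<delta> (head D b)}"
    then have "head D b \<in> verts Q" using D.head_in_verts[of b] by simp
    from Cons.IH[OF this] n
    show "scale (cnj (F b k n c) / of_nat (\<delta> i)) (path_mult (word_elt (u @ w) j r (head D b) n) (arrow D b))
      = scale (cnj (F b k n c) / of_nat (\<delta> i)) (path_mult
        (\<Sum>l\<in>verts Q. \<Sum>m<\<delta> l. path_mult (word_elt w j r l m) (word_elt u l m (head D b) n)) (arrow D b))"
      by simp
  qed
  also have "\<dots> = (\<Sum>b\<in>out i. \<Sum>n<\<delta> (head D b). \<Sum>l\<in>verts Q. \<Sum>m<\<delta> l.
    scale (cnj (F b k n c) / of_nat (\<delta> i))
      (path_mult (word_elt w j r l m) (path_mult (word_elt u l m (head D b) n) (arrow D b))))"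
    by (simp add: path_mult_sum_left path_mult_assoc path_space.scale_sum_right)
  also have "\<dots> = (\<Sum>l\<in>verts Q. \<Sum>m<\<delta> l. \<Sum>b\<in>out i. \<Sum>n<\<delta> (head D b).
    scale (cnj (F b k n c) / of_nat (\<delta> i))
      (path_mult (word_elt w j r l m) (path_mult (word_elt u l m (head D b) n) (arrow D b))))"
    by (rule sum_swap_pairs)
  also have "\<dots> = (\<Sum>l\<in>verts Q. \<Sum>m<\<delta> l. path_mult (word_elt w j r l m) (word_elt (k # u) l m i c))"
    by (simp add: path_mult_sum_right)
  finally show ?case .
qed

text \<open>Orthogonality leaves only the round trips along an arrow and back, on the diagonal and
  all with coefficient 1 / \<delta> i. Their difference from the trivial path is the local relation
  divided by \<delta> i.\<close>

lemma word_elt_square: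
  assumes i: "i \<in> verts Q" and j: "j \<in> verts Q" "r < \<delta> j" and c: "c < \<delta> i"
  shows "(\<Sum>k\<in>UNIV. word_elt [k, k] j r i c) - word_elt [] j r i c \<in> J"
proof -
  let ?d = "\<lambda>i. of_nat (\<delta> i) :: complex"
  have one: "word_elt [k] j r (head D b) m
    = (\<Sum>b'\<in>out (head D b). if head D b' = j then scale (cnj (F b' k r m) / ?d (head D b)) (arrow D b') else 0)"
    if b: "b \<in> arcs D" for k b m
    unfolding word_elt.simps
  proof (intro sum.cong refl)
    fix b' assume b': "b' \<in> out (head D b)"
    have h: "arrow D b' \<in> hom_paths D (tail D b') (head D b')" using b' D.arrow_hom_paths[of b'] by simp
    have "(\<Sum>m'<\<delta> (head D b'). scale (cnj (F b' k m' m) / ?d (head D b))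
        (path_mult (if j = head D b' \<and> r = m' then trivial_path (head D b') else 0) (arrow D b')))
      = (\<Sum>m'<\<delta> (head D b'). if m' = r then
          (if head D b' = j then scale (cnj (F b' k r m) / ?d (head D b)) (arrow D b') else 0) else 0)"
      using trivial_path_mult_left[OF h] by (intro sum.cong refl) auto
    then show "(\<Sum>m'<\<delta> (head D b'). scale (cnj (F b' k m' m) / ?d (head D b))
        (path_mult (if j = head D b' \<and> r = m' then trivial_path (head D b') else 0) (arrow D b')))
      = (if head D b' = j then scale (cnj (F b' k r m) / ?d (head D b)) (arrow D b') else 0)"
      using j(2) by auto
  qed
  have inner: "(\<Sum>k\<in>UNIV. \<Sum>m<\<delta> (head D b). scale (cnj (F b k m c) / ?d i) (path_mult (word_elt [k] j r (head D b) m) (arrow D b)))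
    = (if j = i \<and> r = c then scale (1 / ?d i) (path_mult (arrow D (reverse_arrow b)) (arrow D b)) else 0)"
    if b: "b \<in> out i" for b
  proof -
    have ba: "b \<in> arcs D" "tail D b = i" using b by auto
    then have hv: "head D b \<in> verts Q" using D.head_in_verts[of b] by simp
    have rb: "reverse_arrow b \<in> out (head D b)" using ba by simp
    let ?X = "\<lambda>b'. path_mult (arrow D b') (arrow D b)"
    have orth: "(\<Sum>k\<in>UNIV. \<Sum>m<\<delta> (head D b). cnj (F b k m c) / ?d i * (cnj (F b' k r m) / ?d (head D b)))
      = (if b' = reverse_arrow b then of_bool (r = c) / ?d i else 0)" if b': "b' \<in> out (head D b)" "head D b' = j" for b'
    proof -
      \<comment> \<open>Conjugation turns \<open>F b\<close> into
        \<open>F (reverse_arrow b)\<close>, which starts at the same vertex as \<open>b'\<close>; so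
        orthogonality out of that vertex applies.\<close>
      have "(\<Sum>k\<in>UNIV. \<Sum>m<\<delta> (head D b). cnj (F b k m c) * cnj (F b' k r m))
        = of_bool (reverse_arrow b = b' \<and> c = r) * ?d (head D b)"
        using F_orthogonal[of "reverse_arrow b" b' c r] ba b' c j(2) by (simp add: F_reverse)
      then have "(\<Sum>k\<in>UNIV. \<Sum>m<\<delta> (head D b). cnj (F b k m c) * cnj (F b' k r m)) / (?d i * ?d (head D b))
        = (if b' = reverse_arrow b then of_bool (r = c) / ?d i else 0)"
        using dim_pos[OF hv] by auto
      then show ?thesis by (simp add: sum_divide_distrib)
    qed
    have "(\<Sum>k\<in>UNIV. \<Sum>m<\<delta> (head D b). scale (cnj (F b k m c) / ?d i) (path_mult (word_elt [k] j r (head D b) m) (arrow D b)))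
      = (\<Sum>k\<in>UNIV. \<Sum>m<\<delta> (head D b). \<Sum>b'\<in>out (head D b). if head D b' = j then
          scale (cnj (F b k m c) / ?d i * (cnj (F b' k r m) / ?d (head D b))) (?X b') else 0)"
      unfolding one[OF ba(1)] path_mult_sum_left path_space.scale_sum_right
      by (intro sum.cong refl) simp
    also have "\<dots> = (\<Sum>b'\<in>out (head D b). \<Sum>k\<in>UNIV. \<Sum>m<\<delta> (head D b). if head D b' = j then
          scale (cnj (F b k m c) / ?d i * (cnj (F b' k r m) / ?d (head D b))) (?X b') else 0)"
      unfolding sum.swap[where B = "out (head D b)"] ..
    also have "\<dots> = (\<Sum>b'\<in>out (head D b). if b' = reverse_arrow b then
        (if j = i \<and> r = c then scale (1 / ?d i) (?X (reverse_arrow b)) else 0) else 0)"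
    proof (intro sum.cong refl)
      fix b' assume b': "b' \<in> out (head D b)"
      show "(\<Sum>k\<in>UNIV. \<Sum>m<\<delta> (head D b). if head D b' = j then
          scale (cnj (F b k m c) / ?d i * (cnj (F b' k r m) / ?d (head D b))) (?X b') else 0)
        = (if b' = reverse_arrow b then (if j = i \<and> r = c then scale (1 / ?d i) (?X (reverse_arrow b)) else 0) else 0)"
      proof (cases "head D b' = j")
        case True
        then show ?thesis using orth[OF b' True] ba(2)
          by (auto simp: path_space.scale_sum_left[symmetric])
      next
        case False
        then show ?thesis using ba(2) by auto
      qed
    qed
    finally show ?thesis using rb by simp
  qed
  have "(\<Sum>k\<in>UNIV. word_elt [k, k] j r i c) = (\<Sum>k\<in>UNIV. \<Sum>b\<in>out i. \<Sum>m<\<delta> (head D b).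
      scale (cnj (F b k m c) / ?d i) (path_mult (word_elt [k] j r (head D b) m) (arrow D b)))"
    by (simp only: word_elt.simps(2)[of _ "[_]"])
  also have "\<dots> = (\<Sum>b\<in>out i. if j = i \<and> r = c then scale (1 / ?d i) (path_mult (arrow D (reverse_arrow b)) (arrow D b)) else 0)"
    by (subst sum.swap) (intro sum.cong refl inner)
  finally have eq: "(\<Sum>k\<in>UNIV. word_elt [k, k] j r i c) = (\<Sum>b\<in>out i.
    if j = i \<and> r = c then scale (1 / ?d i) (path_mult (arrow D (reverse_arrow b)) (arrow D b)) else 0)" .
  show ?thesis
  proof (cases "j = i \<and> r = c")
    case True
    then have "(\<Sum>k\<in>UNIV. word_elt [k, k] j r i c) - word_elt [] j r i c = scale (1 / ?d i) (local_relation i)"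
      unfolding eq using dim_pos[OF i]
      by (simp add: local_relation_def path_space.scale_right_diff_distrib path_space.scale_sum_right)
    then show ?thesis using J_scale[OF local_relation_in_J[OF i]] by metis
  next
    case False
    show ?thesis
      unfolding eq word_elt.simps(1) if_not_P[OF False] sum.neutral_const diff_self by (rule J_0)
  qed
qed

lemma word_elt_carrier: "i \<in> verts Q \<Longrightarrow> Poly_Mapping.keys (word_elt w j r i c) \<subseteq> paths D"
  using word_elt_hom_paths[of i w j r c] by (auto simp: hom_paths_def)

lemma word_elt_reduce_left:
  assumes i: "i \<in> verts Q" "c < \<delta> i" and j: "j \<in> verts Q" "r < \<delta> j"
  shows "(\<Sum>k\<in>UNIV. word_elt ([k, k] @ v) j r i c) - word_elt v j r i c \<in> J"
proof -
  have "(\<Sum>k\<in>UNIV. word_elt ([k, k] @ v) j r i c) = (\<Sum>l\<in>verts Q. \<Sum>m<\<delta> l.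
      path_mult (word_elt v j r l m) (\<Sum>k\<in>UNIV. word_elt [k, k] l m i c))"
    unfolding word_elt_append[OF i] by (simp only: UNIV_bool) (simp add: path_mult_add_right sum.distrib)
  moreover have "word_elt v j r i c
    = (\<Sum>l\<in>verts Q. \<Sum>m<\<delta> l. path_mult (word_elt v j r l m) (word_elt [] l m i c))"
    using word_elt_append[OF i, of "[]" v j r] by simp
  ultimately have "(\<Sum>k\<in>UNIV. word_elt ([k, k] @ v) j r i c) - word_elt v j r i c
    = (\<Sum>l\<in>verts Q. \<Sum>m<\<delta> l.
      path_mult (word_elt v j r l m) ((\<Sum>k\<in>UNIV. word_elt [k, k] l m i c) - word_elt [] l m i c))"
    by (simp only: path_mult_diff_right sum_subtractf)
  also have "\<dots> \<in> J"
  proof (intro J_sum)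
    fix l m assume "l \<in> verts Q" "m \<in> {..<\<delta> l}"
    then show "path_mult (word_elt v j r l m) ((\<Sum>k\<in>UNIV. word_elt [k, k] l m i c) - word_elt [] l m i c) \<in> J"
      by (intro J_mult(1) word_elt_square word_elt_carrier i) auto
  qed
  finally show ?thesis .
qed

text \<open>Words multiply like matrices and \<open>J\<close> is two-sided, so the relation for two
  letters propagates into longer words. Modulo \<open>J\<close> this is the defining property of a
  word model.\<close>

lemma word_elt_reduce:
  assumes i: "i \<in> verts Q" "c < \<delta> i" and j: "j \<in> verts Q" "r < \<delta> j"
  shows "(\<Sum>k\<in>UNIV. word_elt (u @ [k, k] @ v) j r i c) - word_elt (u @ v) j r i c \<in> J"
proof -
  have "(\<Sum>k\<in>UNIV. word_elt (u @ [k, k] @ v) j r i c) - word_elt (u @ v) j r i c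
    = (\<Sum>l\<in>verts Q. \<Sum>m<\<delta> l.
      path_mult ((\<Sum>k\<in>UNIV. word_elt ([k, k] @ v) j r l m) - word_elt v j r l m) (word_elt u l m i c))"
    unfolding word_elt_append[OF i, of u]
    by (simp only: UNIV_bool) (simp add: path_mult_diff_left path_mult_add_left sum.distrib sum_subtractf)
  also have "\<dots> \<in> J"
    by (intro J_sum J_mult(2) word_elt_reduce_left word_elt_carrier i j) auto
  finally show ?thesis .
qed

lemma cas_parity:
  "pre_digraph.cas D i bs j \<Longrightarrow> set bs \<subseteq> arcs D \<Longrightarrow> even (length bs) \<longleftrightarrow> (i \<in> Ev \<longleftrightarrow> j \<in> Ev)"
proof (induction bs arbitrary: i)
  case (Cons b bs)
  then show ?case using arc_parity[of b] by (auto simp: D.cas.simps)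
qed (simp add: D.cas.simps)

lemma hom_paths_key:
  "z \<in> hom_paths D i j \<Longrightarrow> q \<in> Poly_Mapping.keys z \<Longrightarrow>
    \<exists>bs. q = (i, bs, j) \<and> pre_digraph.cas D i bs j \<and> set bs \<subseteq> arcs D"
  by (auto simp: hom_paths_def paths_def D.awalk_def)

text \<open>
  A functional that vanishes on \<open>J\<close> turns the elements \<open>word_elt w i r i c\<close> into a word model.
\<close>

lemma in_J_if_rep_zero:
  assumes i: "i \<in> verts Q" and z: "z \<in> hom_paths D i i"
    and zero: "\<And>u v r c. (\<Sum>k\<in>UNIV. u k * v k) = 1 \<Longrightarrow> r < \<delta> i \<Longrightarrow> c < \<delta> i \<Longrightarrow> rep u v i i z r c = 0"
  shows "z \<in> J"
proof (rule ccontr)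
  assume zJ: "z \<notin> J"
  obtain l :: "(('v, 'e + 'e) path \<Rightarrow>\<^sub>0 complex) \<Rightarrow> complex" where l: "\<And>x y. l (x + y) = l x + l y"
    "\<And>c x. l (scale c x) = c * l x" "\<And>x. x \<in> J \<Longrightarrow> l x = 0" "l z \<noteq> 0"
    by (rule exists_separating_functional[OF J_0 J_add J_scale zJ]) blast+
  have l_sum: "l (\<Sum>x\<in>X. f x) = (\<Sum>x\<in>X. l (f x))" for X and f :: "'x \<Rightarrow> _"
    using l(3)[OF J_0] by (induction X rule: infinite_finite_induct) (auto simp: l(1))
  let ?bs = "\<lambda>p :: ('v, 'e + 'e) path. fst (snd p)"
  let ?K = "Poly_Mapping.keys z"
  have key: "\<exists>bs. p = (i, bs, i) \<and> pre_digraph.cas D i bs i \<and> set bs \<subseteq> arcs D" if "p \<in> ?K" for p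
    by (rule hom_paths_key[OF z that])
  \<comment> \<open>All words as long as some path in the support of \<open>z\<close>. These paths
    are loops, so their length is even.\<close>
  define W where "W = (\<Union>p\<in>?K. words (length (?bs p)))"
  have W: "finite W" by (simp add: W_def)
  have even_W: "even (length w)" if "w \<in> W" for w
    using that key cas_parity by (fastforce simp: W_def words_def)
  have to_W: "(\<Sum>w\<in>words (length (?bs p)). path_tensor w (?bs p) r c * f w)
    = (\<Sum>w\<in>W. path_tensor w (?bs p) r c * f w)" if "p \<in> ?K" for p r c f
    using that W path_tensor_length[of _ "?bs p" r c]
    by (intro sum.mono_neutral_left) (auto simp: W_def words_def)
  \<comment> \<open>The coefficient of \<open>w\<close> in the entry (r, c) of the matrix of
    \<open>z\<close>. The same coefficients express \<open>l z\<close> through the values of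
    \<open>l\<close> at word elements, which connects the hypothesis with the claim.\<close>
  define t where "t r c w = (\<Sum>p\<in>?K. Poly_Mapping.lookup z p * path_tensor w (?bs p) r c)" for r c w
  have vanish: "(\<Sum>w\<in>W. t r c w * l (word_elt w i r i c)) = 0" if rc: "r < \<delta> i" "c < \<delta> i" for r c
  proof (rule even_words_independent[OF _ W even_W])
    show "word_model (\<lambda>w. l (word_elt w i r i c))"
      unfolding word_model_def
    proof (intro allI)
      fix u v
      have "l ((\<Sum>k\<in>UNIV. word_elt (u @ [k, k] @ v) i r i c) - word_elt (u @ v) i r i c) = 0"
        by (intro l(3) word_elt_reduce i rc)
      then have "l (\<Sum>k\<in>UNIV. word_elt (u @ [k, k] @ v) i r i c) = l (word_elt (u @ v) i r i c)"
        using l(1)[of "(\<Sum>k\<in>UNIV. word_elt (u @ [k, k] @ v) i r i c) - word_elt (u @ v) i r i c" "word_elt (u @ v) i r i c"]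
        by simp
      then show "l (word_elt (u @ [False, False] @ v) i r i c) + l (word_elt (u @ [True, True] @ v) i r i c)
        = l (word_elt (u @ v) i r i c)"
        unfolding l_sum by (simp only: UNIV_bool) (simp add: add.commute)
    qed
    fix x y :: "bool \<Rightarrow> complex" assume xy: "(\<Sum>k\<in>UNIV. x k * y k) = 1"
    \<comment> \<open>The roles are exchanged at an even vertex in order that the first letter of a
      word is read by x in either case.\<close>
    define u v where "u = (if i \<in> Ev then y else x)" and "v = (if i \<in> Ev then x else y)"
    have coord: "coord u v i = x" "coord v u i = y" by (auto simp: coord_def u_def v_def)
    have uv: "(\<Sum>k\<in>UNIV. u k * v k) = 1" using xy by (simp add: u_def v_def mult.commute)
    have "(\<Sum>w\<in>W. t r c w * word_value x y w)
      = (\<Sum>p\<in>?K. Poly_Mapping.lookup z p * (\<Sum>w\<in>W. path_tensor w (?bs p) r c * word_value x y w))"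
      unfolding t_def sum_distrib_left sum_distrib_right by (subst sum.swap) (simp add: mult.assoc)
    also have "\<dots> = (\<Sum>p\<in>?K. Poly_Mapping.lookup z p * path_mat u v (?bs p) r c)"
    proof (intro sum.cong refl)
      fix p assume p: "p \<in> ?K"
      then obtain bs where bs: "p = (i, bs, i)" "pre_digraph.cas D i bs i" "set bs \<subseteq> arcs D"
        using key by blast
      show "Poly_Mapping.lookup z p * (\<Sum>w\<in>W. path_tensor w (?bs p) r c * word_value x y w)
        = Poly_Mapping.lookup z p * path_mat u v (?bs p) r c"
        using to_W[OF p, of r c "word_value x y"] path_mat_expand[OF bs(2,3), of u v r c] bs(1) coord by simp
    qed
    also have "\<dots> = rep u v i i z r c"
      unfolding rep_def linear_ext_def using key by (intro sum.cong refl) fastforce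
    finally show "(\<Sum>w\<in>W. t r c w * word_value x y w) = 0" using zero[OF uv rc] by simp
  qed
  \<comment> \<open>The multiple \<delta> i is what \<open>sum_path_tensor_word_elt\<close> produces
    for each path; it is nonzero, so \<open>l z\<close> itself vanishes.\<close>
  have "of_nat (\<delta> i) * l z = l (scale (of_nat (\<delta> i)) z)" by (simp add: l(2))
  also have "scale (of_nat (\<delta> i)) z
    = (\<Sum>p\<in>?K. scale (Poly_Mapping.lookup z p) (Poly_Mapping.single p (of_nat (\<delta> i))))"
    by (subst poly_mapping_expand[of z]) (simp add: path_space.scale_sum_right mult.commute)
  also have "l \<dots> = (\<Sum>p\<in>?K. Poly_Mapping.lookup z p *
      (\<Sum>w\<in>W. \<Sum>r<\<delta> i. \<Sum>c<\<delta> i. path_tensor w (?bs p) r c * l (word_elt w i r i c)))"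
    unfolding l_sum l(2)
  proof (intro sum.cong refl)
    fix p assume p: "p \<in> ?K"
    then obtain bs where bs: "p = (i, bs, i)" "pre_digraph.cas D i bs i" "set bs \<subseteq> arcs D"
      using key by blast
    have "l (Poly_Mapping.single p (of_nat (\<delta> i)))
      = (\<Sum>w\<in>words (length bs). \<Sum>r<\<delta> i. \<Sum>c<\<delta> i. path_tensor w bs r c * l (word_elt w i r i c))"
      unfolding bs(1) sum_path_tensor_word_elt[OF i i bs(2,3), symmetric] l_sum l(2) ..
    also have "\<dots> = (\<Sum>r<\<delta> i. \<Sum>c<\<delta> i. \<Sum>w\<in>words (length bs). path_tensor w bs r c * l (word_elt w i r i c))"
      unfolding sum.swap[where A = "words (length bs)"] ..
    also have "\<dots> = (\<Sum>r<\<delta> i. \<Sum>c<\<delta> i. \<Sum>w\<in>W. path_tensor w bs r c * l (word_elt w i r i c))"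
      using to_W[OF p] bs(1) by simp
    also have "\<dots> = (\<Sum>w\<in>W. \<Sum>r<\<delta> i. \<Sum>c<\<delta> i. path_tensor w bs r c * l (word_elt w i r i c))"
      unfolding sum.swap[where B = W] ..
    finally show "Poly_Mapping.lookup z p * l (Poly_Mapping.single p (of_nat (\<delta> i))) = Poly_Mapping.lookup z p *
      (\<Sum>w\<in>W. \<Sum>r<\<delta> i. \<Sum>c<\<delta> i. path_tensor w (?bs p) r c * l (word_elt w i r i c))"
      using bs(1) by simp
  qed
  also have "\<dots> = (\<Sum>w\<in>W. \<Sum>r<\<delta> i. \<Sum>c<\<delta> i. t r c w * l (word_elt w i r i c))"
    unfolding t_def sum_distrib_left sum_distrib_right sum.swap[where A = ?K] by (simp add: mult.assoc)
  also have "\<dots> = (\<Sum>r<\<delta> i. \<Sum>c<\<delta> i. \<Sum>w\<in>W. t r c w * l (word_elt w i r i c))"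
    unfolding sum.swap[where A = W] ..
  also have "\<dots> = 0" using vanish by simp
  finally show False using l(4) dim_pos[OF i] by simp
qed

section \<open>Reversed paths and adjoint matrices\<close>

lemma cas_reverse:
  "pre_digraph.cas D i bs j \<Longrightarrow> pre_digraph.cas D j (rev (map reverse_arrow bs)) i"
proof (induction bs arbitrary: i)
  case (Cons b bs)
  then have "pre_digraph.cas D j (rev (map reverse_arrow bs)) (head D b)" "tail D b = i"
    by (auto simp: D.cas.simps)
  then show ?case by (simp add: D.cas_append_iff D.cas.simps D.awlast_if_cas)
qed (simp add: D.cas.simps)

text \<open>The reverse arrow starts at a vertex of the other parity and is therefore contracted
  with the other vector. So taking adjoints exchanges u and v besides conjugating them.\<close>

lemma arrow_mat_reverse:
  assumes "b \<in> arcs D"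
  shows "arrow_mat (\<lambda>k. cnj (v k)) (\<lambda>k. cnj (u k)) (reverse_arrow b) r m = cnj (arrow_mat u v b m r)"
  unfolding arrow_mat_def using arc_parity[OF assms] by (simp add: F_reverse coord_def)

lemma path_mat_reverse:
  assumes "pre_digraph.cas D i bs j" "set bs \<subseteq> arcs D" "r < \<delta> i" "c < \<delta> j"
  shows "path_mat (\<lambda>k. cnj (v k)) (\<lambda>k. cnj (u k)) (rev (map reverse_arrow bs)) r c = cnj (path_mat u v bs c r)"
  using assms
proof (induction bs arbitrary: i r)
  case (Cons b bs)
  then have b: "tail D b = i" "pre_digraph.cas D (head D b) bs j" "b \<in> arcs D" "set bs \<subseteq> arcs D"
    by (auto simp: D.cas.simps)
  have "path_mat (\<lambda>k. cnj (v k)) (\<lambda>k. cnj (u k)) (rev (map reverse_arrow bs) @ [reverse_arrow b]) r c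
    = (\<Sum>m<\<delta> (head D b). path_mat (\<lambda>k. cnj (v k)) (\<lambda>k. cnj (u k)) [reverse_arrow b] r m
        * path_mat (\<lambda>k. cnj (v k)) (\<lambda>k. cnj (u k)) (rev (map reverse_arrow bs)) m c)"
    by (rule path_mat_append[OF cas_reverse[OF b(2)] Cons.prems(4)])
  also have "\<dots> = (\<Sum>m<\<delta> (head D b). cnj (arrow_mat u v b m r) * cnj (path_mat u v bs c m))"
    using Cons.IH[OF b(2,4) _ Cons.prems(4)] Cons.prems(3) b(1)
    by (simp add: arrow_mat_reverse[OF b(3)] sum_of_bool_mult)
  finally show ?case by (simp add: mult.commute)
qed (auto simp: D.cas.simps)

end

subsection \<open>Unitary representations and Schur's lemma\<close>

lemma mult_mat_index:
  fixes A B :: "complex mat"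
  assumes "A \<in> carrier_mat n m" "B \<in> carrier_mat m k" "i < n" "j < k"
  shows "(A * B) $$ (i, j) = (\<Sum>l<m. A $$ (i, l) * B $$ (l, j))"
  using assms by (auto simp: scalar_prod_def atLeast0LessThan intro!: sum.cong)

lemma mat_adjoint_carrier [simp]: "A \<in> carrier_mat n m \<Longrightarrow> mat_adjoint A \<in> carrier_mat m n"
  by (auto simp: mat_adjoint_def)

lemma mat_adjoint_dim [simp]:
  "dim_row (mat_adjoint A) = dim_col A" "dim_col (mat_adjoint A) = dim_row A"
  by (auto simp: mat_adjoint_def)

lemma mat_adjoint_index [simp]:
  fixes A :: "complex mat"
  shows "i < dim_col A \<Longrightarrow> j < dim_row A \<Longrightarrow> mat_adjoint A $$ (i, j) = cnj (A $$ (j, i))"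
  by (simp add: mat_adjoint_def mat_of_rows_index)

lemma mat_adjoint_adjoint [simp]: "mat_adjoint (mat_adjoint A) = (A :: complex mat)"
  by (rule eq_matI) auto

lemma mat_adjoint_mult:
  fixes A B :: "complex mat"
  assumes "A \<in> carrier_mat n m" "B \<in> carrier_mat m k"
  shows "mat_adjoint (A * B) = mat_adjoint B * mat_adjoint A"
proof (rule eq_matI)
  fix i j assume "i < dim_row (mat_adjoint B * mat_adjoint A)" "j < dim_col (mat_adjoint B * mat_adjoint A)"
  then have ij: "i < k" "j < n" using assms by auto
  have "mat_adjoint (A * B) $$ (i, j) = cnj ((A * B) $$ (j, i))" using ij assms by simp
  also have "\<dots> = (\<Sum>l<m. cnj (A $$ (j, l)) * cnj (B $$ (l, i)))"
    unfolding mult_mat_index[OF assms ij(2,1)] by simp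
  also have "\<dots> = (mat_adjoint B * mat_adjoint A) $$ (i, j)"
    using ij assms
    by (subst mult_mat_index[OF mat_adjoint_carrier[OF assms(2)] mat_adjoint_carrier[OF assms(1)]])
      (auto intro!: sum.cong)
  finally show "mat_adjoint (A * B) $$ (i, j) = (mat_adjoint B * mat_adjoint A) $$ (i, j)" .
qed (use assms in auto)

lemma mat_adjoint_one [simp]: "mat_adjoint (1\<^sub>m n :: complex mat) = 1\<^sub>m n"
  by (rule eq_matI) auto

lemma mat_adjoint_zero [simp]: "mat_adjoint (0\<^sub>m n m :: complex mat) = 0\<^sub>m m n"
  by (rule eq_matI) auto

lemma mat_adjoint_smult: "mat_adjoint (c \<cdot>\<^sub>m A) = cnj c \<cdot>\<^sub>m mat_adjoint (A :: complex mat)"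
  by (rule eq_matI) auto

definition unitary_map :: "complex mat set \<Rightarrow> nat \<Rightarrow> (complex mat \<Rightarrow> complex mat) \<Rightarrow> bool" where
  "unitary_map \<Gamma> n \<tau> \<longleftrightarrow> (\<forall>g\<in>\<Gamma>. \<tau> g \<in> carrier_mat n n \<and> mat_adjoint (\<tau> g) * \<tau> g = 1\<^sub>m n)"

lemma unitary_mapD:
  assumes "unitary_map \<Gamma> n \<tau>" "g \<in> \<Gamma>"
  shows "\<tau> g \<in> carrier_mat n n" "mat_adjoint (\<tau> g) * \<tau> g = 1\<^sub>m n" "\<tau> g * mat_adjoint (\<tau> g) = 1\<^sub>m n"
  using assms mat_mult_left_right_inverse[of "mat_adjoint (\<tau> g)" n "\<tau> g"]
  by (auto simp: unitary_map_def)

definition intertwiner where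
  "intertwiner \<Gamma> m \<sigma> n \<tau> A \<longleftrightarrow> A \<in> carrier_mat m n \<and> (\<forall>g\<in>\<Gamma>. A * \<tau> g = \<sigma> g * (A :: complex mat))"

lemma intertwiner_carrier: "intertwiner \<Gamma> m \<sigma> n \<tau> A \<Longrightarrow> A \<in> carrier_mat m n"
  by (simp add: intertwiner_def)

text \<open>The adjoint of the intertwining relation involves the adjoints of
  \<open>\<sigma> g\<close> and \<open>\<tau> g\<close>; these are inverses, so multiplying by
  \<open>\<tau> g\<close> on the left and by \<open>\<sigma> g\<close> on the right gives the
  relation for the adjoint of \<open>A\<close>.\<close>

lemma intertwiner_adjoint:
  assumes A: "intertwiner \<Gamma> m \<sigma> n \<tau> A" and \<sigma>: "unitary_map \<Gamma> m \<sigma>" and \<tau>: "unitary_map \<Gamma> n \<tau>"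
  shows "intertwiner \<Gamma> n \<tau> m \<sigma> (mat_adjoint A)"
  unfolding intertwiner_def
proof (intro conjI ballI)
  have Ac: "A \<in> carrier_mat m n" using A by (rule intertwiner_carrier)
  then show B: "mat_adjoint A \<in> carrier_mat n m" by simp
  fix g assume g: "g \<in> \<Gamma>"
  note s = unitary_mapD[OF \<sigma> g] and t = unitary_mapD[OF \<tau> g]
  have "A * \<tau> g = \<sigma> g * A" using A g by (auto simp: intertwiner_def)
  then have eq: "mat_adjoint (\<tau> g) * mat_adjoint A = mat_adjoint A * mat_adjoint (\<sigma> g)"
    using mat_adjoint_mult[OF Ac t(1)] mat_adjoint_mult[OF s(1) Ac] by simp
  have "mat_adjoint A * \<sigma> g = (\<tau> g * mat_adjoint (\<tau> g)) * mat_adjoint A * \<sigma> g"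
    using left_mult_one_mat[OF B] by (simp add: t(3))
  also have "\<dots> = \<tau> g * (mat_adjoint (\<tau> g) * mat_adjoint A) * \<sigma> g"
    using B t(1) by (simp add: assoc_mult_mat[of _ n n _ n _ m])
  also have "\<dots> = \<tau> g * (mat_adjoint A * mat_adjoint (\<sigma> g)) * \<sigma> g" by (simp add: eq)
  also have "\<dots> = \<tau> g * (mat_adjoint A * (mat_adjoint (\<sigma> g) * \<sigma> g))"
  proof -
    have c: "mat_adjoint A * mat_adjoint (\<sigma> g) \<in> carrier_mat n m" using B s(1) by simp
    show ?thesis using B s(1) t(1) c
      by (simp add: assoc_mult_mat[OF t(1) c s(1)] assoc_mult_mat[OF B mat_adjoint_carrier[OF s(1)] s(1)])
  qed
  also have "\<dots> = \<tau> g * mat_adjoint A" using right_mult_one_mat[OF B] by (simp add: s(2))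
  finally show "mat_adjoint A * \<sigma> g = \<tau> g * mat_adjoint A" .
qed

lemma intertwiner_mult:
  assumes A: "intertwiner \<Gamma> m \<sigma> n \<tau> A" and B: "intertwiner \<Gamma> n \<tau> k \<upsilon> B"
    and c: "\<And>g. g \<in> \<Gamma> \<Longrightarrow> \<sigma> g \<in> carrier_mat m m" "\<And>g. g \<in> \<Gamma> \<Longrightarrow> \<tau> g \<in> carrier_mat n n"
      "\<And>g. g \<in> \<Gamma> \<Longrightarrow> \<upsilon> g \<in> carrier_mat k k"
  shows "intertwiner \<Gamma> m \<sigma> k \<upsilon> (A * B)"
  unfolding intertwiner_def
proof (intro conjI ballI)
  have Ac: "A \<in> carrier_mat m n" and Bc: "B \<in> carrier_mat n k"
    using A B by (auto intro: intertwiner_carrier)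
  then show "A * B \<in> carrier_mat m k" by simp
  fix g assume g: "g \<in> \<Gamma>"
  have "A * B * \<upsilon> g = A * (\<tau> g * B)"
    using assoc_mult_mat[OF Ac Bc c(3)[OF g]] B g by (simp add: intertwiner_def)
  also have "\<dots> = A * \<tau> g * B" using assoc_mult_mat[OF Ac c(2)[OF g] Bc] by simp
  also have "\<dots> = \<sigma> g * (A * B)"
    using A g assoc_mult_mat[OF c(1)[OF g] Ac Bc] by (simp add: intertwiner_def)
  finally show "A * B * \<upsilon> g = \<sigma> g * (A * B)" .
qed

lemma intertwiner_smult:
  assumes A: "intertwiner \<Gamma> m \<sigma> n \<tau> A" and c: "\<And>g. g \<in> \<Gamma> \<Longrightarrow> \<sigma> g \<in> carrier_mat m m"
      "\<And>g. g \<in> \<Gamma> \<Longrightarrow> \<tau> g \<in> carrier_mat n n"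
  shows "intertwiner \<Gamma> m \<sigma> n \<tau> (x \<cdot>\<^sub>m A)"
proof -
  have Ac: "A \<in> carrier_mat m n" using A by (rule intertwiner_carrier)
  show ?thesis
    unfolding intertwiner_def
  proof (intro conjI ballI)
    fix g assume g: "g \<in> \<Gamma>"
    show "x \<cdot>\<^sub>m A * \<tau> g = \<sigma> g * (x \<cdot>\<^sub>m A)"
      using A g mult_smult_distrib[OF c(1)[OF g] Ac] mult_smult_assoc_mat[OF Ac c(2)[OF g]]
      by (simp add: intertwiner_def)
  qed (use Ac in simp)
qed

lemma intertwiner_diff:
  assumes A: "intertwiner \<Gamma> m \<sigma> n \<tau> A" and B: "intertwiner \<Gamma> m \<sigma> n \<tau> B"
    and c: "\<And>g. g \<in> \<Gamma> \<Longrightarrow> \<sigma> g \<in> carrier_mat m m" "\<And>g. g \<in> \<Gamma> \<Longrightarrow> \<tau> g \<in> carrier_mat n n"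
  shows "intertwiner \<Gamma> m \<sigma> n \<tau> (A - B)"
proof -
  have Ac: "A \<in> carrier_mat m n" "B \<in> carrier_mat m n" using A B by (auto intro: intertwiner_carrier)
  show ?thesis
    unfolding intertwiner_def
  proof (intro conjI ballI)
    fix g assume g: "g \<in> \<Gamma>"
    show "(A - B) * \<tau> g = \<sigma> g * (A - B)"
      using A B g minus_mult_distrib_mat[OF Ac c(2)[OF g]] mult_minus_distrib_mat[OF c(1)[OF g] Ac]
      by (simp add: intertwiner_def)
  qed (rule minus_carrier_mat[OF Ac(2)])
qed

lemma subspace_module_vecI:
  assumes "W \<subseteq> carrier_vec n" "0\<^sub>v n \<in> W" "\<And>v w. v \<in> W \<Longrightarrow> w \<in> W \<Longrightarrow> v + w \<in> W"
    "\<And>c v. v \<in> W \<Longrightarrow> c \<cdot>\<^sub>v v \<in> W"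
  shows "subspace class_ring W (module_vec TYPE(complex) n)"
proof (rule subspace.intro)
  show "vectorspace class_ring (module_vec TYPE(complex) n)" by (rule vec_vs)
  show "submodule class_ring W (module_vec TYPE(complex) n)"
    using assms by (intro submodule.intro vec_module) (auto simp: module_vec_def)
qed

text \<open>The kernel is an invariant subspace, hence everything as soon as it contains a nonzero
  vector.\<close>

lemma irreducible_rep_kernel:
  assumes irr: "irreducible_rep G (n, \<tau>)" and G: "carrier G = \<Gamma>"
    and A: "intertwiner \<Gamma> m \<sigma> n \<tau> A" and \<tau>: "\<And>g. g \<in> \<Gamma> \<Longrightarrow> \<tau> g \<in> carrier_mat n n"
    and \<sigma>: "\<And>g. g \<in> \<Gamma> \<Longrightarrow> \<sigma> g \<in> carrier_mat m m"
    and w: "w \<in> carrier_vec n" "w \<noteq> 0\<^sub>v n" "A *\<^sub>v w = 0\<^sub>v m"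
  shows "A = 0\<^sub>m m n"
proof -
  have Ac: "A \<in> carrier_mat m n" using A by (rule intertwiner_carrier)
  define W where "W = {v \<in> carrier_vec n. A *\<^sub>v v = 0\<^sub>v m}"
  have "subspace class_ring W (module_vec TYPE(complex) n)"
    by (rule subspace_module_vecI)
      (use Ac in \<open>auto simp: W_def mult_add_distrib_mat_vec[OF Ac] mult_mat_vec[OF Ac]\<close>)
  moreover have "\<tau> g *\<^sub>v v \<in> W" if g: "g \<in> \<Gamma>" and v: "v \<in> W" for g v
  proof -
    have v': "v \<in> carrier_vec n" "A *\<^sub>v v = 0\<^sub>v m" using v by (auto simp: W_def)
    have "A *\<^sub>v (\<tau> g *\<^sub>v v) = (A * \<tau> g) *\<^sub>v v"
      using assoc_mult_mat_vec[OF Ac \<tau>[OF g] v'(1)] by simp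
    also have "\<dots> = (\<sigma> g * A) *\<^sub>v v" using A g by (simp add: intertwiner_def)
    also have "\<dots> = \<sigma> g *\<^sub>v 0\<^sub>v m" using assoc_mult_mat_vec[OF \<sigma>[OF g] Ac v'(1)] v'(2) by simp
    also have "\<dots> = 0\<^sub>v m" using \<sigma>[OF g] by auto
    finally show ?thesis using \<tau>[OF g] v' by (auto simp: W_def)
  qed
  ultimately have "W = {0\<^sub>v n} \<or> W = carrier_vec n"
    using irr G unfolding irreducible_rep_def by simp
  moreover have "w \<in> W" using w by (simp add: W_def)
  ultimately have W: "W = carrier_vec n" using w(2) by auto
  show ?thesis
  proof (rule eq_matI)
    fix i j assume ij: "i < dim_row (0\<^sub>m m n)" "j < dim_col (0\<^sub>m m n)"
    then have "unit_vec n j \<in> W" using W by simp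
    then have "(A *\<^sub>v unit_vec n j) $ i = 0" using ij by (simp add: W_def)
    moreover have "(A *\<^sub>v unit_vec n j) $ i = A $$ (i, j)"
      using ij Ac by (simp add: scalar_prod_right_unit)
    ultimately show "A $$ (i, j) = 0\<^sub>m m n $$ (i, j)" using ij by simp
  qed (use Ac in auto)
qed

text \<open>A complex matrix of positive size has an eigenvalue, and subtracting it leaves an
  intertwiner with a nontrivial kernel.\<close>

lemma schur_scalar:
  assumes irr: "irreducible_rep G (n, \<tau>)" and G: "carrier G = \<Gamma>"
    and A: "intertwiner \<Gamma> n \<tau> n \<tau> A" and \<tau>: "\<And>g. g \<in> \<Gamma> \<Longrightarrow> \<tau> g \<in> carrier_mat n n"
  obtains c where "A = c \<cdot>\<^sub>m 1\<^sub>m n"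
proof -
  have Ac: "A \<in> carrier_mat n n" using A by (rule intertwiner_carrier)
  have n: "0 < n" using irr by (simp add: irreducible_rep_def)
  obtain c where "c \<in> spectrum A" using spectrum_non_empty[OF Ac n] by blast
  then obtain w where w: "w \<in> carrier_vec n" "w \<noteq> 0\<^sub>v n" "A *\<^sub>v w = c \<cdot>\<^sub>v w"
    using Ac by (auto simp: spectrum_def eigenvalue_def eigenvector_def)
  have one: "intertwiner \<Gamma> n \<tau> n \<tau> (1\<^sub>m n)" using left_mult_one_mat[OF \<tau>] right_mult_one_mat[OF \<tau>] by (simp add: intertwiner_def)
  have B: "intertwiner \<Gamma> n \<tau> n \<tau> (A - c \<cdot>\<^sub>m 1\<^sub>m n)"
    using A \<tau> by (intro intertwiner_diff intertwiner_smult one) auto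
  have "(A - c \<cdot>\<^sub>m 1\<^sub>m n) *\<^sub>v w = A *\<^sub>v w - (c \<cdot>\<^sub>m 1\<^sub>m n) *\<^sub>v w"
    using Ac w by (intro minus_mult_distrib_mat_vec) auto
  also have "(c \<cdot>\<^sub>m 1\<^sub>m n) *\<^sub>v w = c \<cdot>\<^sub>v w" using w(1) by (auto intro!: eq_vecI)
  finally have "(A - c \<cdot>\<^sub>m 1\<^sub>m n) *\<^sub>v w = 0\<^sub>v n" using w by simp
  from irreducible_rep_kernel[OF irr G B \<tau> \<tau> w(1,2) this]
  have eq: "A - c \<cdot>\<^sub>m 1\<^sub>m n = 0\<^sub>m n n" by simp
  have "A = c \<cdot>\<^sub>m 1\<^sub>m n"
  proof (rule eq_matI)
    fix i j assume ij: "i < dim_row (c \<cdot>\<^sub>m 1\<^sub>m n)" "j < dim_col (c \<cdot>\<^sub>m 1\<^sub>m n)"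
    have "(A - c \<cdot>\<^sub>m 1\<^sub>m n) $$ (i, j) = 0" using ij eq by simp
    then show "A $$ (i, j) = (c \<cdot>\<^sub>m 1\<^sub>m n) $$ (i, j)" using ij Ac by simp
  qed (use Ac in auto)
  then show ?thesis by (rule that)
qed

lemma mult_adjoint_diag:
  fixes A :: "complex mat"
  assumes "A \<in> carrier_mat m n" "i < m"
  shows "(A * mat_adjoint A) $$ (i, i) = of_real (\<Sum>j<n. (cmod (A $$ (i, j)))\<^sup>2)"
  using assms unfolding mult_mat_index[OF assms(1) mat_adjoint_carrier[OF assms(1)] assms(2) assms(2)]
  by (simp add: of_real_sum complex_norm_square del: of_real_power)

text \<open>Both products of \<open>A\<close> with its adjoint are scalar by
  \<open>schur_scalar\<close>. If \<open>A\<close> is nonzero, the scalars are nonzero and equal,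
  equality of the traces forces equal dimensions, and then a multiple of the adjoint inverts
  \<open>A\<close>, contrary to inequivalence.\<close>

lemma schur_zero:
  assumes irr: "irreducible_rep G (n, \<tau>)" "irreducible_rep G (m, \<sigma>)" and G: "carrier G = \<Gamma>"
    and A: "intertwiner \<Gamma> m \<sigma> n \<tau> A" and \<tau>: "unitary_map \<Gamma> n \<tau>" and \<sigma>: "unitary_map \<Gamma> m \<sigma>"
    and ni: "\<not> rep_iso G (n, \<tau>) (m, \<sigma>)"
  shows "A = 0\<^sub>m m n"
proof (rule ccontr)
  assume A0: "A \<noteq> 0\<^sub>m m n"
  have Ac: "A \<in> carrier_mat m n" using A by (rule intertwiner_carrier)
  let ?B = "mat_adjoint A"
  have Bc: "?B \<in> carrier_mat n m" using Ac by simp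
  note B = intertwiner_adjoint[OF A \<sigma> \<tau>]
  have "intertwiner \<Gamma> m \<sigma> m \<sigma> (A * ?B)" "intertwiner \<Gamma> n \<tau> n \<tau> (?B * A)"
    using A B unitary_mapD(1)[OF \<sigma>] unitary_mapD(1)[OF \<tau>] by (auto intro: intertwiner_mult)
  then obtain c d where c: "A * ?B = c \<cdot>\<^sub>m 1\<^sub>m m" and d: "?B * A = d \<cdot>\<^sub>m 1\<^sub>m n"
    using schur_scalar[OF irr(1) G] schur_scalar[OF irr(2) G] unitary_mapD(1)[OF \<sigma>] unitary_mapD(1)[OF \<tau>]
    by metis
  obtain i j where ij: "i < m" "j < n" "A $$ (i, j) \<noteq> 0"
    using A0 Ac by (metis carrier_matD eq_matI index_zero_mat)
  have c0: "c \<noteq> 0"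
  proof
    assume "c = 0"
    then have "(A * ?B) $$ (i, i) = 0" using c ij by simp
    then have "(\<Sum>j<n. (cmod (A $$ (i, j)))\<^sup>2) = 0"
      using mult_adjoint_diag[OF Ac ij(1)] by (metis of_real_eq_0_iff)
    then have "cmod (A $$ (i, j)) ^ 2 = 0" using ij(2) by (subst (asm) sum_nonneg_eq_0_iff) auto
    then show False using ij(3) by simp
  qed
  have "A * ?B * A = A * (?B * A)" using assoc_mult_mat[OF Ac Bc Ac] .
  then have "c \<cdot>\<^sub>m A = d \<cdot>\<^sub>m A"
    using c d Ac mult_smult_distrib[OF Ac, of "1\<^sub>m n" n d] mult_smult_assoc_mat[of "1\<^sub>m m" m m A n c] by simp
  then have "(c \<cdot>\<^sub>m A) $$ (i, j) = (d \<cdot>\<^sub>m A) $$ (i, j)" by simp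
  then have cd: "c = d" using ij Ac by simp
  \<comment> \<open>Both traces are the sum of the squared absolute values of all entries of
    \<open>A\<close>.\<close>
  have "(\<Sum>i<m. (A * ?B) $$ (i, i)) = (\<Sum>i<m. \<Sum>j<n. A $$ (i, j) * cnj (A $$ (i, j)))"
    using Ac by (intro sum.cong refl, subst mult_mat_index[OF Ac Bc]) auto
  moreover have "(\<Sum>j<n. (?B * A) $$ (j, j)) = (\<Sum>j<n. \<Sum>i<m. A $$ (i, j) * cnj (A $$ (i, j)))"
    using Ac by (intro sum.cong refl, subst mult_mat_index[OF Bc Ac]) (auto simp: mult.commute)
  moreover have "(\<Sum>i<m. (A * ?B) $$ (i, i)) = of_nat m * c" by (simp add: c)
  moreover have "(\<Sum>j<n. (?B * A) $$ (j, j)) = of_nat n * c" by (simp add: d cd)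
  ultimately have "of_nat m * c = of_nat n * c"
    using sum.swap[of "\<lambda>i j. A $$ (i, j) * cnj (A $$ (i, j))" "{..<n}" "{..<m}"] by simp
  then have mn: "m = n" using c0 by simp
  let ?P = "(1 / c) \<cdot>\<^sub>m ?B"
  have "A * ?P = 1\<^sub>m n" "?P * A = 1\<^sub>m n"
    using c d cd c0 mn Ac Bc mult_smult_distrib[OF Ac Bc, of "1 / c"] mult_smult_assoc_mat[OF Bc Ac, of "1 / c"]
    by (auto intro!: eq_matI)
  then have "A \<in> Units (ring_mat TYPE(complex) n ())"
    unfolding Units_def using Ac Bc mn by (auto simp: ring_mat_simps intro!: bexI[of _ ?P])
  then have "rep_iso G (n, \<tau>) (m, \<sigma>)"
    unfolding rep_iso_def using A mn G by (auto simp: intertwiner_def)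
  then show False using ni by simp
qed

lemma mult_assoc3:
  assumes "A \<in> carrier_mat n m" "B \<in> carrier_mat m k" "C \<in> carrier_mat k l" "E \<in> carrier_mat l p"
  shows "(A * B) * (C * E) = A * ((B * C) * (E :: complex mat))"
  using assoc_mult_mat[of A n m B k "C * E" p] assoc_mult_mat[of B m k C l E p] assms by simp

lemma Units_ring_mat:
  assumes "P \<in> Units (ring_mat TYPE(complex) n ())"
  obtains P' where "P \<in> carrier_mat n n" "P' \<in> carrier_mat n n" "P' * P = 1\<^sub>m n" "P * P' = 1\<^sub>m n"
  using assms by (auto simp: Units_def ring_mat_simps)

lemma intertwiner_inverse:
  assumes P: "P \<in> carrier_mat n n" "P' \<in> carrier_mat n n" "P' * P = 1\<^sub>m n" "P * P' = 1\<^sub>m n"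
    and eq: "\<And>g. g \<in> \<Gamma> \<Longrightarrow> P * \<sigma> g = \<tau> g * P"
    and c: "\<And>g. g \<in> \<Gamma> \<Longrightarrow> \<sigma> g \<in> carrier_mat n n" "\<And>g. g \<in> \<Gamma> \<Longrightarrow> \<tau> g \<in> carrier_mat n n"
  shows "intertwiner \<Gamma> n \<sigma> n \<tau> P'"
  unfolding intertwiner_def
proof (intro conjI ballI)
  fix g assume g: "g \<in> \<Gamma>"
  note s = c(1)[OF g] and t = c(2)[OF g]
  have "P' * \<tau> g = (P' * \<tau> g) * (P * P')"
    using P right_mult_one_mat[of "P' * \<tau> g" n n] t by simp
  also have "\<dots> = P' * ((\<tau> g * P) * P')" by (rule mult_assoc3[OF P(2) t P(1,2)])
  also have "\<dots> = (P' * P) * (\<sigma> g * P')"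
    unfolding eq[OF g, symmetric] by (rule mult_assoc3[OF P(2,1) s P(2), symmetric])
  also have "\<dots> = \<sigma> g * P'" using P left_mult_one_mat[of "\<sigma> g * P'" n n] s by simp
  finally show "P' * \<tau> g = \<sigma> g * P'" .
qed (rule P(2))

section \<open>Intertwiners onto the summands of a direct sum\<close>

definition proj_left :: "nat \<Rightarrow> nat \<Rightarrow> complex mat" where
  "proj_left r n = mat r (r + n) (\<lambda>(i, j). of_bool (i = j))"

definition proj_right :: "nat \<Rightarrow> nat \<Rightarrow> complex mat" where
  "proj_right r n = mat n (r + n) (\<lambda>(i, j). of_bool (r + i = j))"

lemma proj_carrier [simp]:
  "proj_left r n \<in> carrier_mat r (r + n)" "proj_right r n \<in> carrier_mat n (r + n)"
  by (auto simp: proj_left_def proj_right_def)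

lemma proj_dim [simp]:
  "dim_row (proj_left r n) = r" "dim_col (proj_left r n) = r + n"
  "dim_row (proj_right r n) = n" "dim_col (proj_right r n) = r + n"
  by (auto simp: proj_left_def proj_right_def)

lemma proj_left_mult:
  assumes "X \<in> carrier_mat (r + n) k" "i < r" "j < k"
  shows "(proj_left r n * X) $$ (i, j) = X $$ (i, j)"
  unfolding mult_mat_index[OF proj_carrier(1) assms]
  using assms sum_of_bool_mult(1)[of i "r + n" "\<lambda>l. X $$ (l, j)"]
  by (simp add: proj_left_def)

lemma proj_right_mult:
  assumes "X \<in> carrier_mat (r + n) k" "i < n" "j < k"
  shows "(proj_right r n * X) $$ (i, j) = X $$ (r + i, j)"
  unfolding mult_mat_index[OF proj_carrier(2) assms]
  using assms sum_of_bool_mult(1)[of "r + i" "r + n" "\<lambda>l. X $$ (l, j)"]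
  by (simp add: proj_right_def)

lemma proj_mult_eq:
  assumes "X \<in> carrier_mat (r + n) k"
  shows "proj_left r n * X = mat r k (\<lambda>(i, j). X $$ (i, j))"
    and "proj_right r n * X = mat n k (\<lambda>(i, j). X $$ (r + i, j))"
  using assms proj_left_mult[OF assms] proj_right_mult[OF assms] proj_carrier[of r n]
  by (auto intro!: eq_matI simp del: index_mult_mat(1))

lemma proj_adjoint:
  "proj_left r n * mat_adjoint (proj_left r n) = 1\<^sub>m r"
  "proj_right r n * mat_adjoint (proj_right r n) = 1\<^sub>m n"
  "proj_left r n * mat_adjoint (proj_right r n) = 0\<^sub>m r n"
  "proj_right r n * mat_adjoint (proj_left r n) = 0\<^sub>m n r"
  unfolding proj_mult_eq[OF mat_adjoint_carrier[OF proj_carrier(1)]]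
    proj_mult_eq[OF mat_adjoint_carrier[OF proj_carrier(2)]]
  by (rule eq_matI; auto simp: proj_left_def proj_right_def)+

lemma intertwiner_proj:
  assumes A: "\<And>g. g \<in> \<Gamma> \<Longrightarrow> A g \<in> carrier_mat r r" and B: "\<And>g. g \<in> \<Gamma> \<Longrightarrow> B g \<in> carrier_mat n n"
  shows "intertwiner \<Gamma> r A (r + n) (\<lambda>g. four_block_mat (A g) (0\<^sub>m r n) (0\<^sub>m n r) (B g)) (proj_left r n)"
    and "intertwiner \<Gamma> n B (r + n) (\<lambda>g. four_block_mat (A g) (0\<^sub>m r n) (0\<^sub>m n r) (B g)) (proj_right r n)"
proof -
  let ?D = "\<lambda>g. four_block_mat (A g) (0\<^sub>m r n) (0\<^sub>m n r) (B g)"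
  have D: "?D g \<in> carrier_mat (r + n) (r + n)" if "g \<in> \<Gamma>" for g using A[OF that] B[OF that] by simp
  have "proj_left r n * ?D g = A g * proj_left r n" if g: "g \<in> \<Gamma>" for g
  proof (rule eq_matI)
    fix i j assume "i < dim_row (A g * proj_left r n)" "j < dim_col (A g * proj_left r n)"
    then have ij: "i < r" "j < r + n" using A[OF g] by (auto simp: proj_left_def)
    have "(A g * proj_left r n) $$ (i, j) = (\<Sum>l<r. A g $$ (i, l) * of_bool (l = j))"
      unfolding mult_mat_index[OF A[OF g] proj_carrier(1) ij] using ij by (simp add: proj_left_def)
    also have "\<dots> = (if j < r then A g $$ (i, j) else 0)"
      using sum_of_bool_mult(4)[of j r] by (auto intro!: sum.neutral)
    also have "\<dots> = ?D g $$ (i, j)" using A[OF g] B[OF g] ij by auto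
    finally show "(proj_left r n * ?D g) $$ (i, j) = (A g * proj_left r n) $$ (i, j)"
      using proj_left_mult[OF D[OF g] ij] by simp
  qed (use A[OF g] B[OF g] in \<open>auto simp: proj_left_def\<close>)
  then show "intertwiner \<Gamma> r A (r + n) ?D (proj_left r n)" by (simp add: intertwiner_def)
  have "proj_right r n * ?D g = B g * proj_right r n" if g: "g \<in> \<Gamma>" for g
  proof (rule eq_matI)
    fix i j assume "i < dim_row (B g * proj_right r n)" "j < dim_col (B g * proj_right r n)"
    then have ij: "i < n" "j < r + n" using B[OF g] by (auto simp: proj_right_def)
    have "(B g * proj_right r n) $$ (i, j) = (\<Sum>l<n. B g $$ (i, l) * of_bool (r + l = j))"
      unfolding mult_mat_index[OF B[OF g] proj_carrier(2) ij] using ij by (simp add: proj_right_def)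
    also have "\<dots> = (\<Sum>l<n. B g $$ (i, l) * of_bool (r \<le> j \<and> l = j - r))"
      by (intro sum.cong refl arg_cong2[where f = "(*)"]) (auto simp: of_bool_def)
    also have "\<dots> = (if r \<le> j then B g $$ (i, j - r) else 0)"
      using sum_of_bool_mult(4)[of "j - r" n] ij by (auto intro!: sum.neutral)
    also have "\<dots> = ?D g $$ (r + i, j)" using A[OF g] B[OF g] ij by auto
    finally show "(proj_right r n * ?D g) $$ (i, j) = (B g * proj_right r n) $$ (i, j)"
      using proj_right_mult[OF D[OF g] ij] by simp
  qed (use A[OF g] B[OF g] in \<open>auto simp: proj_right_def\<close>)
  then show "intertwiner \<Gamma> n B (r + n) ?D (proj_right r n)" by (simp add: intertwiner_def)
qed

lemma direct_sum_rep_carrier: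
  "(\<And>R. R \<in> set Rs \<Longrightarrow> snd R g \<in> carrier_mat (fst R) (fst R)) \<Longrightarrow>
    snd (direct_sum_rep Rs) g \<in> carrier_mat (fst (direct_sum_rep Rs)) (fst (direct_sum_rep Rs))"
  by (induction Rs) (auto simp: direct_sum_rep_def Let_def)

lemma direct_sum_rep_Cons:
  assumes "snd R g \<in> carrier_mat (fst R) (fst R)"
    "\<And>R. R \<in> set Rs \<Longrightarrow> snd R g \<in> carrier_mat (fst R) (fst R)"
  shows "snd (direct_sum_rep (R # Rs)) g = four_block_mat (snd R g) (0\<^sub>m (fst R) (fst (direct_sum_rep Rs)))
    (0\<^sub>m (fst (direct_sum_rep Rs)) (fst R)) (snd (direct_sum_rep Rs) g)"
  using direct_sum_rep_carrier[of Rs g] assms by (auto simp: direct_sum_rep_def Let_def)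

text \<open>Intertwiners \<open>X s\<close> onto one representation, with plain matrices
  \<open>Y s\<close> dual to them. The dual system certifies independence in a form that survives
  direct sums and isomorphisms, and the orthogonalisation relies on it to avoid a zero map.\<close>

definition dual_intertwiners where
  "dual_intertwiners \<Gamma> d \<sigma> n \<tau> m X Y \<longleftrightarrow> (\<forall>s<(m :: nat). intertwiner \<Gamma> d \<sigma> n \<tau> (X s) \<and> Y s \<in> carrier_mat n d \<and>
    (\<forall>t<m. X s * Y t = (if s = t then 1\<^sub>m d else 0\<^sub>m d (d :: nat) :: complex mat)))"

text \<open>Every summand isomorphic to \<sigma> contributes the projection onto it followed by the
  inverse of the isomorphism; the dual matrix is the isomorphism followed by the inclusion.\<close>

lemma direct_sum_dual_intertwiners:
  assumes \<sigma>: "\<And>g. g \<in> \<Gamma> \<Longrightarrow> \<sigma> g \<in> carrier_mat d d" and G: "carrier G = \<Gamma>"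
    and Rs: "\<And>R g. R \<in> set Rs \<Longrightarrow> g \<in> \<Gamma> \<Longrightarrow> snd R g \<in> carrier_mat (fst R) (fst R)"
  shows "\<exists>X Y. dual_intertwiners \<Gamma> d \<sigma> (fst (direct_sum_rep Rs)) (snd (direct_sum_rep Rs))
    (length (filter (rep_iso G (d, \<sigma>)) Rs)) X Y"
  using Rs
proof (induction Rs)
  case Nil
  then show ?case by (simp add: dual_intertwiners_def)
next
  case (Cons R Rs)
  let ?r = "fst R" and ?n = "fst (direct_sum_rep Rs)" and ?D = "snd (direct_sum_rep Rs)"
  let ?D' = "snd (direct_sum_rep (R # Rs))" and ?E0 = "proj_left (fst R) (fst (direct_sum_rep Rs))"
    and ?E1 = "proj_right (fst R) (fst (direct_sum_rep Rs))"
  obtain X Y where "dual_intertwiners \<Gamma> d \<sigma> ?n ?D (length (filter (rep_iso G (d, \<sigma>)) Rs)) X Y"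
    using Cons by auto
  then have XY: "\<And>s. s < length (filter (rep_iso G (d, \<sigma>)) Rs) \<Longrightarrow> intertwiner \<Gamma> d \<sigma> ?n ?D (X s)"
    "\<And>s. s < length (filter (rep_iso G (d, \<sigma>)) Rs) \<Longrightarrow> Y s \<in> carrier_mat ?n d"
    "\<And>s t. s < length (filter (rep_iso G (d, \<sigma>)) Rs) \<Longrightarrow> t < length (filter (rep_iso G (d, \<sigma>)) Rs) \<Longrightarrow>
      X s * Y t = (if s = t then 1\<^sub>m d else 0\<^sub>m d d)"
    by (auto simp: dual_intertwiners_def)
  note Xc = intertwiner_carrier[OF XY(1)]
  have R: "g \<in> \<Gamma> \<Longrightarrow> snd R g \<in> carrier_mat ?r ?r" for g using Cons.prems by simp
  have Dc: "g \<in> \<Gamma> \<Longrightarrow> ?D g \<in> carrier_mat ?n ?n" for g using Cons.prems direct_sum_rep_carrier[of Rs g] by simp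
  have D': "?D' g = four_block_mat (snd R g) (0\<^sub>m ?r ?n) (0\<^sub>m ?n ?r) (?D g)" if "g \<in> \<Gamma>" for g
    using direct_sum_rep_Cons[of R g Rs] Cons.prems that by simp
  have D'c: "g \<in> \<Gamma> \<Longrightarrow> ?D' g \<in> carrier_mat (?r + ?n) (?r + ?n)" for g
    using D' R Dc by simp
  have E: "intertwiner \<Gamma> ?r (snd R) (?r + ?n) ?D' ?E0" "intertwiner \<Gamma> ?n ?D (?r + ?n) ?D' ?E1"
    using intertwiner_proj[of \<Gamma> "snd R" ?r ?D ?n] R Dc D' by (auto simp: intertwiner_def)
  have n': "fst (direct_sum_rep (R # Rs)) = ?r + ?n" by (simp add: direct_sum_rep_def)
  let ?E0a = "mat_adjoint ?E0" and ?E1a = "mat_adjoint ?E1"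
  have Ea: "?E0a \<in> carrier_mat (?r + ?n) ?r" "?E1a \<in> carrier_mat (?r + ?n) ?n" by simp_all
  have X1: "intertwiner \<Gamma> d \<sigma> (?r + ?n) ?D' (X s * ?E1)" "?E1a * Y s \<in> carrier_mat (?r + ?n) d"
    if "s < length (filter (rep_iso G (d, \<sigma>)) Rs)" for s
    using intertwiner_mult[OF XY(1)[OF that] E(2) \<sigma> Dc D'c] mult_carrier_mat[OF Ea(2) XY(2)[OF that]] by simp_all
  have X1Y1: "(X s * ?E1) * (?E1a * Y t) = (if s = t then 1\<^sub>m d else 0\<^sub>m d d)"
    if "s < length (filter (rep_iso G (d, \<sigma>)) Rs)" "t < length (filter (rep_iso G (d, \<sigma>)) Rs)" for s t
    using mult_assoc3[OF Xc[OF that(1)] proj_carrier(2) Ea(2) XY(2)[OF that(2)]] XY(2)[OF that(2)] XY(3)[OF that]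
    by (simp add: proj_adjoint)
  show ?case
  proof (cases "rep_iso G (d, \<sigma>) R")
    case False
    then show ?thesis
      using X1 X1Y1 unfolding n' dual_intertwiners_def
      by (intro exI[of _ "\<lambda>s. X s * ?E1"] exI[of _ "\<lambda>s. ?E1a * Y s"]) auto
  next
    case True
    have dr: "?r = d" using True by (simp add: rep_iso_def)
    obtain P where P: "P \<in> Units (ring_mat TYPE(complex) d ())" "\<forall>g\<in>\<Gamma>. P * \<sigma> g = snd R g * P"
      using True unfolding rep_iso_def G fst_conv snd_conv by blast
    from P(1) obtain P' where P': "P \<in> carrier_mat d d" "P' \<in> carrier_mat d d" "P' * P = 1\<^sub>m d" "P * P' = 1\<^sub>m d"
      by (rule Units_ring_mat)
    have iP': "intertwiner \<Gamma> d \<sigma> d (snd R) P'"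
    proof (rule intertwiner_inverse[OF P'])
      fix g assume g: "g \<in> \<Gamma>"
      show "P * \<sigma> g = snd R g * P" using P(2) g by blast
      show "\<sigma> g \<in> carrier_mat d d" by (rule \<sigma>[OF g])
      show "snd R g \<in> carrier_mat d d" using R[OF g] unfolding dr .
    qed
    have E0: "?E0 \<in> carrier_mat d (d + ?n)" "?E0a \<in> carrier_mat (d + ?n) d" "?E1a \<in> carrier_mat (d + ?n) ?n"
      "?E1 \<in> carrier_mat ?n (d + ?n)"
      using proj_carrier[of ?r ?n] Ea dr by simp_all
    have X0: "intertwiner \<Gamma> d \<sigma> (?r + ?n) ?D' (P' * ?E0)"
    proof (rule intertwiner_mult[OF iP'])
      show "intertwiner \<Gamma> d (snd R) (?r + ?n) ?D' ?E0" using E(1) unfolding dr .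
      fix g assume g: "g \<in> \<Gamma>"
      show "\<sigma> g \<in> carrier_mat d d" by (rule \<sigma>[OF g])
      show "snd R g \<in> carrier_mat d d" using R[OF g] unfolding dr .
      show "?D' g \<in> carrier_mat (?r + ?n) (?r + ?n)" by (rule D'c[OF g])
    qed
    have Y0: "?E0a * P \<in> carrier_mat (?r + ?n) d"
      using mult_carrier_mat[OF E0(2) P'(1)] by (simp only: dr)
    have 00: "(P' * ?E0) * (?E0a * P) = 1\<^sub>m d"
      using mult_assoc3[OF P'(2) E0(1,2) P'(1)] proj_adjoint(1)[of ?r ?n] dr P' by simp
    have 01: "(P' * ?E0) * (?E1a * Y t) = 0\<^sub>m d d" if "t < length (filter (rep_iso G (d, \<sigma>)) Rs)" for t
      using mult_assoc3[OF P'(2) E0(1,3) XY(2)[OF that]] proj_adjoint(3)[of ?r ?n] dr P' XY(2)[OF that] by simp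
    have 10: "(X s * ?E1) * (?E0a * P) = 0\<^sub>m d d" if "s < length (filter (rep_iso G (d, \<sigma>)) Rs)" for s
      using mult_assoc3[OF Xc[OF that] E0(4,2) P'(1)] proj_adjoint(4)[of ?r ?n] dr P' Xc[OF that] by simp
    \<comment> \<open>The new pair takes the index 0, and the earlier pairs move up by one.\<close>
    show ?thesis
      using True X1 X1Y1 X0 Y0 00 01 10 unfolding n' dual_intertwiners_def
      by (intro exI[of _ "\<lambda>s. case s of 0 \<Rightarrow> P' * ?E0 | Suc s \<Rightarrow> X s * ?E1"]
          exI[of _ "\<lambda>s. case s of 0 \<Rightarrow> ?E0a * P | Suc s \<Rightarrow> ?E1a * Y s"])
        (auto split: nat.split)
  qed
qed

lemma has_multiplicity_dual_intertwiners:
  assumes m: "has_multiplicity G (d, \<sigma>) (n, \<tau>) m" and G: "carrier G = \<Gamma>"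
    and \<sigma>: "\<And>g. g \<in> \<Gamma> \<Longrightarrow> \<sigma> g \<in> carrier_mat d d" and \<tau>: "\<And>g. g \<in> \<Gamma> \<Longrightarrow> \<tau> g \<in> carrier_mat n n"
  shows "\<exists>X Y. dual_intertwiners \<Gamma> d \<sigma> n \<tau> m X Y"
proof -
  obtain Rs where Rs: "\<And>R. R \<in> set Rs \<Longrightarrow> irreducible_rep G R" "rep_iso G (n, \<tau>) (direct_sum_rep Rs)"
    "m = length (filter (rep_iso G (d, \<sigma>)) Rs)"
    using m by (auto simp: has_multiplicity_def)
  have Rc: "snd R g \<in> carrier_mat (fst R) (fst R)" if "R \<in> set Rs" "g \<in> \<Gamma>" for R g
  proof -
    have "snd R g \<in> Units (ring_mat TYPE(complex) (fst R) ())"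
      using Rs(1)[OF that(1)] that(2) G by (auto simp: irreducible_rep_def representation_def hom_def units_of_def)
    then show ?thesis by (auto simp: Units_def ring_mat_simps)
  qed
  let ?D = "snd (direct_sum_rep Rs)"
  have nD: "fst (direct_sum_rep Rs) = n" using Rs(2) by (simp add: rep_iso_def)
  have "\<exists>X Y. dual_intertwiners \<Gamma> d \<sigma> (fst (direct_sum_rep Rs)) ?D
      (length (filter (rep_iso G (d, \<sigma>)) Rs)) X Y"
    by (rule direct_sum_dual_intertwiners) (use \<sigma> G Rc in auto)
  then obtain X Y where XY: "dual_intertwiners \<Gamma> d \<sigma> n ?D m X Y"
    using nD Rs(3) by auto
  obtain P where P: "P \<in> Units (ring_mat TYPE(complex) n ())" "\<forall>g\<in>\<Gamma>. P * \<tau> g = ?D g * P"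
    using Rs(2) G by (auto simp: rep_iso_def)
  from P(1) obtain P' where P': "P \<in> carrier_mat n n" "P' \<in> carrier_mat n n" "P' * P = 1\<^sub>m n" "P * P' = 1\<^sub>m n"
    by (rule Units_ring_mat)
  have Dc: "?D g \<in> carrier_mat n n" if "g \<in> \<Gamma>" for g
    using direct_sum_rep_carrier[of Rs g] Rc that nD by simp
  have iP: "intertwiner \<Gamma> n ?D n \<tau> P" using P(2) P'(1) by (simp add: intertwiner_def)
  have "dual_intertwiners \<Gamma> d \<sigma> n \<tau> m (\<lambda>s. X s * P) (\<lambda>s. P' * Y s)"
    unfolding dual_intertwiners_def
  proof (intro allI impI conjI)
    fix s assume s: "s < m"
    show "intertwiner \<Gamma> d \<sigma> n \<tau> (X s * P)"
      using XY s intertwiner_mult[OF _ iP \<sigma> Dc \<tau>] by (simp add: dual_intertwiners_def)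
    have c: "X s \<in> carrier_mat d n" "Y s \<in> carrier_mat n d"
      using XY s by (auto simp: dual_intertwiners_def intertwiner_def)
    then show "P' * Y s \<in> carrier_mat n d" using P' by simp
    fix t assume t: "t < m"
    have Yt: "Y t \<in> carrier_mat n d" using XY t by (auto simp: dual_intertwiners_def)
    have "X s * P * (P' * Y t) = X s * Y t"
      using mult_assoc3[OF c(1) P'(1,2) Yt] Yt P'(4) by simp
    then show "X s * P * (P' * Y t) = (if s = t then 1\<^sub>m d else 0\<^sub>m d d)"
      using XY s t by (simp add: dual_intertwiners_def)
  qed
  then show ?thesis by blast
qed

section \<open>Gram-Schmidt orthogonalisation of intertwiners\<close>

lemma smult_mult_smult:
  assumes "A \<in> carrier_mat n m" "B \<in> carrier_mat m k"
  shows "(a \<cdot>\<^sub>m A) * (b \<cdot>\<^sub>m B) = (a * b) \<cdot>\<^sub>m (A * (B :: complex mat))"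
proof -
  have "(a \<cdot>\<^sub>m A) * (b \<cdot>\<^sub>m B) = a \<cdot>\<^sub>m (A * (b \<cdot>\<^sub>m B))" using assms by (intro mult_smult_assoc_mat) auto
  also have "A * (b \<cdot>\<^sub>m B) = b \<cdot>\<^sub>m (A * B)" using assms by (intro mult_smult_distrib)
  finally show ?thesis by (auto intro!: eq_matI)
qed

lemma scalar_mult_adjoint_pos:
  fixes A :: "complex mat"
  assumes A: "A \<in> carrier_mat d n" "A \<noteq> 0\<^sub>m d n" and c: "A * mat_adjoint A = c \<cdot>\<^sub>m 1\<^sub>m d"
  obtains x where "0 < x" "c = of_real x"
proof -
  obtain i j where ij: "i < d" "j < n" "A $$ (i, j) \<noteq> 0"
    using A by (metis carrier_matD eq_matI index_zero_mat)
  have "c = (A * mat_adjoint A) $$ (i, i)" using c ij by simp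
  also have "\<dots> = of_real (\<Sum>j<n. (cmod (A $$ (i, j)))\<^sup>2)" by (rule mult_adjoint_diag[OF A(1) ij(1)])
  finally have "c = of_real (\<Sum>j<n. (cmod (A $$ (i, j)))\<^sup>2)" .
  moreover have "0 < (\<Sum>j<n. (cmod (A $$ (i, j)))\<^sup>2)"
    using ij by (intro sum_pos2[of _ j]) auto
  ultimately show ?thesis by (rule that[rotated])
qed

text \<open>By Schur's lemma the product of \<open>A\<close> with the adjoint of \<open>Z j\<close>
  is a scalar c, so subtracting c times \<open>Z j\<close> makes it zero. The products with
  \<open>Y t\<close> do not change because \<open>Z j\<close> annihilates \<open>Y t\<close>; so a
  product that was nonzero before keeps the result from vanishing.\<close>

lemma intertwiner_orthogonalize:
  fixes Z :: "nat \<Rightarrow> complex mat"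
  assumes irr: "irreducible_rep G (d, \<sigma>)" and G: "carrier G = \<Gamma>"
    and \<sigma>: "unitary_map \<Gamma> d \<sigma>" and \<tau>: "unitary_map \<Gamma> n \<tau>"
    and Z: "\<And>s. s < k \<Longrightarrow> intertwiner \<Gamma> d \<sigma> n \<tau> (Z s)"
      "\<And>s t. s < k \<Longrightarrow> t < k \<Longrightarrow> Z s * mat_adjoint (Z t) = (if s = t then 1\<^sub>m d else 0\<^sub>m d d)"
    and B: "intertwiner \<Gamma> d \<sigma> n \<tau> B"
    and Y: "\<And>s t. s < k \<Longrightarrow> t \<in> T \<Longrightarrow> Z s * Y t = 0\<^sub>m d d" "\<And>t. t \<in> T \<Longrightarrow> Y t \<in> carrier_mat n d"
    and j: "j \<le> k"
  shows "\<exists>A. intertwiner \<Gamma> d \<sigma> n \<tau> A \<and> (\<forall>s<j. A * mat_adjoint (Z s) = 0\<^sub>m d d) \<and> (\<forall>t\<in>T. A * Y t = B * Y t)"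
  using j
proof (induction j)
  case 0
  then show ?case using B by (intro exI[of _ B]) simp
next
  case (Suc j)
  then obtain A where A: "intertwiner \<Gamma> d \<sigma> n \<tau> A" "\<forall>s<j. A * mat_adjoint (Z s) = 0\<^sub>m d d"
    "\<forall>t\<in>T. A * Y t = B * Y t" by auto
  note \<sigma>c = unitary_mapD(1)[OF \<sigma>] and \<tau>c = unitary_mapD(1)[OF \<tau>]
  have jk: "j < k" using Suc.prems by simp
  note Zj = Z(1)[OF jk]
  have "intertwiner \<Gamma> d \<sigma> d \<sigma> (A * mat_adjoint (Z j))"
    using intertwiner_mult[OF A(1) intertwiner_adjoint[OF Zj \<sigma> \<tau>]] \<sigma>c \<tau>c by blast
  then obtain c where c: "A * mat_adjoint (Z j) = c \<cdot>\<^sub>m 1\<^sub>m d"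
    using schur_scalar[OF irr G] \<sigma>c by metis
  let ?A = "A - c \<cdot>\<^sub>m Z j"
  have Ac: "A \<in> carrier_mat d n" and Zjc: "Z j \<in> carrier_mat d n" "c \<cdot>\<^sub>m Z j \<in> carrier_mat d n"
    using A(1) Zj by (auto simp: intertwiner_def)
  have mult: "?A * X = A * X - c \<cdot>\<^sub>m (Z j * X)" if "X \<in> carrier_mat n d" for X
    using minus_mult_distrib_mat[OF Ac Zjc(2) that] mult_smult_assoc_mat[OF Zjc(1) that] by simp
  have "intertwiner \<Gamma> d \<sigma> n \<tau> ?A"
    using A(1) Zj \<sigma>c \<tau>c by (intro intertwiner_diff intertwiner_smult) auto
  moreover have "?A * mat_adjoint (Z s) = 0\<^sub>m d d" if s: "s < Suc j" for s
  proof -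
    have sk: "s < k" using s jk by simp
    have Zs: "mat_adjoint (Z s) \<in> carrier_mat n d"
      using intertwiner_carrier[OF Z(1)[OF sk]] by simp
    show ?thesis
      using mult[OF Zs] Z(2)[OF jk sk] A(2) c s by (cases "s = j") (auto intro!: eq_matI)
  qed
  moreover have "?A * Y t = B * Y t" if t: "t \<in> T" for t
  proof -
    have "B * Y t \<in> carrier_mat d d" using intertwiner_carrier[OF B] Y(2)[OF t] by simp
    moreover have "M - 0\<^sub>m d d = M" if "M \<in> carrier_mat d d" for M :: "complex mat"
      using that by (auto intro!: eq_matI)
    moreover have "c \<cdot>\<^sub>m 0\<^sub>m d d = 0\<^sub>m d d" by (auto intro!: eq_matI)
    ultimately show ?thesis
      using mult[OF Y(2)[OF t]] Y(1)[OF jk t] A(3) t by simp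
  qed
  ultimately show ?case by blast
qed

text \<open>The induction keeps the additional invariant that the maps found so far annihilate the
  dual matrices still to be treated.\<close>

lemma orthonormal_intertwiners:
  assumes irr: "irreducible_rep G (d, \<sigma>)" and G: "carrier G = \<Gamma>"
    and \<sigma>: "unitary_map \<Gamma> d \<sigma>" and \<tau>: "unitary_map \<Gamma> n \<tau>"
    and XY: "dual_intertwiners \<Gamma> d \<sigma> n \<tau> m X Y"
  shows "\<exists>Z. \<forall>s<m. intertwiner \<Gamma> d \<sigma> n \<tau> (Z s) \<and>
    (\<forall>t<m. Z s * mat_adjoint (Z t) = (if s = t then 1\<^sub>m d else 0\<^sub>m d d))"
proof -
  have X: "intertwiner \<Gamma> d \<sigma> n \<tau> (X s)" and Y: "Y s \<in> carrier_mat n d" if "s < m" for s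
    using XY that by (auto simp: dual_intertwiners_def)
  have XYst: "X s * Y t = (if s = t then 1\<^sub>m d else 0\<^sub>m d d)" if "s < m" "t < m" for s t
    using XY that by (auto simp: dual_intertwiners_def)
  note \<sigma>c = unitary_mapD(1)[OF \<sigma>] and \<tau>c = unitary_mapD(1)[OF \<tau>]
  have d: "0 < d" using irr by (simp add: irreducible_rep_def)
  have "\<exists>Z. (\<forall>s<k. intertwiner \<Gamma> d \<sigma> n \<tau> (Z s)) \<and>
    (\<forall>s<k. \<forall>t<k. Z s * mat_adjoint (Z t) = (if s = t then 1\<^sub>m d else 0\<^sub>m d d)) \<and>
    (\<forall>s<k. \<forall>t\<in>{k..<m}. Z s * Y t = 0\<^sub>m d d)" if "k \<le> m" for k
    using that
  proof (induction k)
    case 0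
    then show ?case by simp
  next
    case (Suc k)
    then have km: "k < m" by simp
    obtain Z where Z0: "(\<forall>s<k. intertwiner \<Gamma> d \<sigma> n \<tau> (Z s)) \<and>
      (\<forall>s<k. \<forall>t<k. Z s * mat_adjoint (Z t) = (if s = t then 1\<^sub>m d else 0\<^sub>m d d)) \<and>
      (\<forall>s<k. \<forall>t\<in>{k..<m}. Z s * Y t = 0\<^sub>m d d)"
      using Suc.IH[OF less_imp_le[OF km]] by (elim exE)
    have Z: "\<And>s. s < k \<Longrightarrow> intertwiner \<Gamma> d \<sigma> n \<tau> (Z s)"
      "\<And>s t. s < k \<Longrightarrow> t < k \<Longrightarrow> Z s * mat_adjoint (Z t) = (if s = t then 1\<^sub>m d else 0\<^sub>m d d)"
      "\<And>s t. s < k \<Longrightarrow> t \<in> {k..<m} \<Longrightarrow> Z s * Y t = 0\<^sub>m d d"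
      using Z0 by blast+
    have "\<exists>A. intertwiner \<Gamma> d \<sigma> n \<tau> A \<and> (\<forall>s<k. A * mat_adjoint (Z s) = 0\<^sub>m d d)
      \<and> (\<forall>t\<in>{k..<m}. A * Y t = X k * Y t)"
      using Y by (intro intertwiner_orthogonalize[OF irr G \<sigma> \<tau> Z(1,2) X[OF km] Z(3)]) auto
    then obtain A where A: "intertwiner \<Gamma> d \<sigma> n \<tau> A" "\<And>s. s < k \<Longrightarrow> A * mat_adjoint (Z s) = 0\<^sub>m d d"
      "\<And>t. t \<in> {k..<m} \<Longrightarrow> A * Y t = X k * Y t" by auto
    have Ac: "A \<in> carrier_mat d n" using A(1) by (rule intertwiner_carrier)
    \<comment> \<open>Orthogonalisation preserved the product with \<open>Y k\<close>, which is the
      identity.\<close>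
    have "A \<noteq> 0\<^sub>m d n"
    proof
      assume "A = 0\<^sub>m d n"
      then have "1\<^sub>m d = (0\<^sub>m d d :: complex mat)" using A(3)[of k] km XYst[OF km km] Y[OF km] by simp
      then have "(1\<^sub>m d :: complex mat) $$ (0, 0) = 0\<^sub>m d d $$ (0, 0)" by simp
      then show False using d by simp
    qed
    moreover have "intertwiner \<Gamma> d \<sigma> d \<sigma> (A * mat_adjoint A)"
      using intertwiner_mult[OF A(1) intertwiner_adjoint[OF A(1) \<sigma> \<tau>]] \<sigma>c \<tau>c by blast
    then obtain c where c: "A * mat_adjoint A = c \<cdot>\<^sub>m 1\<^sub>m d"
      using schur_scalar[OF irr G] \<sigma>c by metis
    ultimately obtain x where x: "0 < x" "c = of_real x"
      using scalar_mult_adjoint_pos[OF Ac] by blast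
    let ?a = "of_real (1 / sqrt x) :: complex"
    define N where "N = ?a \<cdot>\<^sub>m A"
    have Nc: "N \<in> carrier_mat d n" using Ac by (simp add: N_def)
    have N: "intertwiner \<Gamma> d \<sigma> n \<tau> N"
      unfolding N_def using A(1) \<sigma>c \<tau>c by (intro intertwiner_smult) auto
    have "?a * ?a * c = 1"
      using x by (simp add: of_real_mult[symmetric] del: of_real_mult)
    then have NN: "N * mat_adjoint N = 1\<^sub>m d"
      unfolding N_def mat_adjoint_smult complex_cnj_complex_of_real
        smult_mult_smult[OF Ac mat_adjoint_carrier[OF Ac]] c
      by (auto intro!: eq_matI simp: mult.assoc)
    have Zc: "Z s \<in> carrier_mat d n" if "s < k" for s using intertwiner_carrier[OF Z(1)[OF that]] .
    have NZ: "N * mat_adjoint (Z s) = 0\<^sub>m d d" if "s < k" for s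
      unfolding N_def using mult_smult_assoc_mat[OF Ac mat_adjoint_carrier[OF Zc[OF that]]] A(2)[OF that]
      by (auto intro!: eq_matI)
    have ZN: "Z s * mat_adjoint N = 0\<^sub>m d d" if "s < k" for s
    proof -
      have "Z s * mat_adjoint N = mat_adjoint (N * mat_adjoint (Z s))"
        using mat_adjoint_mult[OF Nc mat_adjoint_carrier[OF Zc[OF that]]] by simp
      then show ?thesis using NZ[OF that] by simp
    qed
    have NY: "N * Y t = 0\<^sub>m d d" if "t \<in> {Suc k..<m}" for t
    proof -
      have t: "t < m" "t \<in> {k..<m}" "t \<noteq> k" using that by auto
      show ?thesis
        unfolding N_def using mult_smult_assoc_mat[OF Ac Y[OF t(1)]] A(3)[OF t(2)] XYst[OF km t(1)] t(3)
        by (auto intro!: eq_matI)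
    qed
    show ?case
      using Z N NN NZ ZN NY
      by (intro exI[of _ "\<lambda>s. if s < k then Z s else N"]) (auto simp: less_Suc_eq)
  qed
  from this[OF order_refl] show ?thesis by blast
qed

section \<open>Tensor products with a two-dimensional space\<close>

lemma sum_double_index:
  "(\<Sum>q<2 * n. f q) = (\<Sum>k\<in>UNIV. \<Sum>m<n. f (bool_index k * n + m) :: complex)"
proof -
  have "(\<Sum>q<2 * n. f q) = (\<Sum>q<n. f q) + (\<Sum>q\<in>{n..<n + n}. f q)"
    using sum.atLeastLessThan_concat[of 0 n "n + n" f] by (simp add: atLeast0LessThan mult_2)
  also have "(\<Sum>q\<in>{n..<n + n}. f q) = (\<Sum>m<n. f (n + m))"
    using sum.shift_bounds_nat_ivl[of f 0 n n] by (simp add: atLeast0LessThan add.commute)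
  finally show ?thesis by (simp add: UNIV_bool bool_index_def add.commute)
qed

lemma double_indexE:
  assumes "q < 2 * (n :: nat)"
  obtains k m where "q = bool_index k * n + m" "m < n"
proof (cases "q < n")
  case True
  then show ?thesis using that[of False q] by (simp add: bool_index_def)
next
  case False
  then show ?thesis using that[of True "q - n"] assms by (simp add: bool_index_def)
qed

lemma double_index_bound: "m < n \<Longrightarrow> bool_index k * n + m < 2 * n"
  by (auto simp: bool_index_def)

lemma double_index_eq_iff:
  "m < n \<Longrightarrow> m' < n \<Longrightarrow> bool_index k * n + m = bool_index l * n + m' \<longleftrightarrow> k = l \<and> m = m'"
  by (auto simp: bool_index_def split: if_splits)

lemma bool_index_less [simp]: "bool_index k < 2"
  by (simp add: bool_index_def)

lemma bool_index_eq_iff [simp]: "bool_index k = bool_index l \<longleftrightarrow> k = l"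
  by (auto simp: bool_index_def)

lemma kronecker_product_carrier:
  "A \<in> carrier_mat 2 2 \<Longrightarrow> B \<in> carrier_mat n n \<Longrightarrow> kronecker_product A B \<in> carrier_mat (2 * n) (2 * n)"
  by (auto simp: kronecker_product_def)

lemma kronecker_product_index:
  assumes "A \<in> carrier_mat 2 2" "B \<in> carrier_mat n n" "r < n" "c < n"
  shows "kronecker_product A B $$ (bool_index k * n + r, bool_index l * n + c)
    = A $$ (bool_index k, bool_index l) * B $$ (r, c)"
  using assms double_index_bound[of r n k] double_index_bound[of c n l]
  by (simp add: kronecker_product_def)

lemma unitary_map_kronecker:
  assumes \<gamma>: "unitary_map \<Gamma> 2 \<gamma>" and \<tau>: "unitary_map \<Gamma> n \<tau>"
  shows "unitary_map \<Gamma> (2 * n) (\<lambda>g. kronecker_product (\<gamma> g) (\<tau> g))"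
  unfolding unitary_map_def
proof (intro ballI conjI)
  fix g assume g: "g \<in> \<Gamma>"
  note c = unitary_mapD(1)[OF \<gamma> g] and t = unitary_mapD(1)[OF \<tau> g]
  let ?K = "kronecker_product (\<gamma> g) (\<tau> g)"
  show K: "?K \<in> carrier_mat (2 * n) (2 * n)" by (rule kronecker_product_carrier[OF c t])
  have K': "mat_adjoint ?K \<in> carrier_mat (2 * n) (2 * n)" using K by simp
  show "mat_adjoint ?K * ?K = 1\<^sub>m (2 * n)"
  proof (rule eq_matI)
    fix i j assume "i < dim_row (1\<^sub>m (2 * n))" "j < dim_col (1\<^sub>m (2 * n))"
    then have ij: "i < 2 * n" "j < 2 * n" by simp_all
    obtain k r where i: "i = bool_index k * n + r" "r < n" using ij(1) by (rule double_indexE)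
    obtain l s where j: "j = bool_index l * n + s" "s < n" using ij(2) by (rule double_indexE)
    have "(mat_adjoint ?K * ?K) $$ (i, j) = (\<Sum>p\<in>UNIV. \<Sum>m<n. cnj (?K $$ (bool_index p * n + m, i)) * ?K $$ (bool_index p * n + m, j))"
      unfolding mult_mat_index[OF K' K ij] sum_double_index using K ij double_index_bound
      by (intro sum.cong refl) auto
    also have "\<dots> = (\<Sum>p\<in>UNIV. \<Sum>m<n. (cnj (\<gamma> g $$ (bool_index p, bool_index k)) * \<gamma> g $$ (bool_index p, bool_index l))
        * (cnj (\<tau> g $$ (m, r)) * \<tau> g $$ (m, s)))"
      unfolding i j using kronecker_product_index[OF c t] i(2) j(2) by (intro sum.cong refl) simp
    also have "\<dots> = (\<Sum>p\<in>UNIV. cnj (\<gamma> g $$ (bool_index p, bool_index k)) * \<gamma> g $$ (bool_index p, bool_index l))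
        * (\<Sum>m<n. cnj (\<tau> g $$ (m, r)) * \<tau> g $$ (m, s))"
      by (simp add: sum_product)
    also have "(\<Sum>m<n. cnj (\<tau> g $$ (m, r)) * \<tau> g $$ (m, s)) = (mat_adjoint (\<tau> g) * \<tau> g) $$ (r, s)"
      unfolding mult_mat_index[OF mat_adjoint_carrier[OF t] t i(2) j(2)]
      using t i(2) by (intro sum.cong refl) simp
    also have "(\<Sum>p\<in>UNIV. cnj (\<gamma> g $$ (bool_index p, bool_index k)) * \<gamma> g $$ (bool_index p, bool_index l))
      = (mat_adjoint (\<gamma> g) * \<gamma> g) $$ (bool_index k, bool_index l)"
      unfolding mult_mat_index[OF mat_adjoint_carrier[OF c] c bool_index_less bool_index_less]
      using c sum_double_index[of "\<lambda>p. mat_adjoint (\<gamma> g) $$ (bool_index k, p) * \<gamma> g $$ (p, bool_index l)" 1]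
      by simp
    finally show "(mat_adjoint ?K * ?K) $$ (i, j) = 1\<^sub>m (2 * n) $$ (i, j)"
      using unitary_mapD(2)[OF \<gamma> g] unitary_mapD(2)[OF \<tau> g] ij i j double_index_eq_iff[of r n s k l]
      by simp
  qed (use K in auto)
qed

subsection \<open>The McKay correspondence\<close>

lemma SU2_carrier:
  "g \<in> carrier SU2 \<longleftrightarrow> g \<in> carrier_mat 2 2 \<and> mat_adjoint g * g = 1\<^sub>m 2 \<and> det g = 1"
  by (simp add: SU2_def)

lemma SU2_simps [simp]: "monoid.mult SU2 = (*)" "one SU2 = 1\<^sub>m 2"
  by (simp_all add: SU2_def)

lemma SU2_adjoint:
  assumes "g \<in> carrier SU2"
  shows "mat_adjoint g \<in> carrier SU2" "g * mat_adjoint g = 1\<^sub>m 2"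
proof -
  have g: "g \<in> carrier_mat 2 2" "mat_adjoint g * g = 1\<^sub>m 2" "det g = 1"
    using assms by (auto simp: SU2_carrier)
  then show gg: "g * mat_adjoint g = 1\<^sub>m 2"
    by (intro mat_mult_left_right_inverse[OF mat_adjoint_carrier]) auto
  have "det (mat_adjoint g) * det g = 1"
    using det_mult[OF mat_adjoint_carrier[OF g(1)] g(1)] g(2) by simp
  then show "mat_adjoint g \<in> carrier SU2" using g gg by (simp add: SU2_carrier)
qed

lemma group_SU2: "Group.group SU2"
proof (rule groupI)
  fix g h assume gh: "g \<in> carrier SU2" "h \<in> carrier SU2"
  then have c: "g \<in> carrier_mat 2 2" "h \<in> carrier_mat 2 2" by (auto simp: SU2_carrier)
  have "mat_adjoint (g * h) * (g * h) = mat_adjoint h * ((mat_adjoint g * g) * h)"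
    unfolding mat_adjoint_mult[OF c]
    by (rule mult_assoc3[OF mat_adjoint_carrier[OF c(2)] mat_adjoint_carrier[OF c(1)] c])
  then show "g \<otimes>\<^bsub>SU2\<^esub> h \<in> carrier SU2"
    using gh c det_mult[OF c] by (simp add: SU2_carrier)
next
  fix g assume g: "g \<in> carrier SU2"
  then show "\<exists>h\<in>carrier SU2. h \<otimes>\<^bsub>SU2\<^esub> g = \<one>\<^bsub>SU2\<^esub>"
    using SU2_adjoint[OF g] by (intro bexI[of _ "mat_adjoint g"]) (auto simp: SU2_carrier)
next
  fix f g h assume "f \<in> carrier SU2" "g \<in> carrier SU2" "h \<in> carrier SU2"
  then show "f \<otimes>\<^bsub>SU2\<^esub> g \<otimes>\<^bsub>SU2\<^esub> h = f \<otimes>\<^bsub>SU2\<^esub> (g \<otimes>\<^bsub>SU2\<^esub> h)"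
    by (simp add: SU2_carrier assoc_mult_mat[of f 2 2 g 2 h 2])
qed (auto simp: SU2_carrier)

lemma SU2_inv: "g \<in> carrier SU2 \<Longrightarrow> inv\<^bsub>SU2\<^esub> g = mat_adjoint g"
  using group.inv_equality[OF group_SU2, of "mat_adjoint g" g] SU2_adjoint[of g]
  by (simp add: SU2_carrier)

text \<open>For unitary \<open>g\<close> this is the inverse transpose, hence the action on the dual
  space.\<close>

definition conj_mat :: "complex mat \<Rightarrow> complex mat" where
  "conj_mat g = map_mat cnj g"

lemma conj_mat_unitary:
  assumes g: "g \<in> carrier_mat 2 2" and u: "mat_adjoint g * g = 1\<^sub>m 2"
  shows "conj_mat g \<in> carrier_mat 2 2" "mat_adjoint (conj_mat g) * conj_mat g = 1\<^sub>m 2"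
proof -
  show c: "conj_mat g \<in> carrier_mat 2 2" using g by (simp add: conj_mat_def)
  show "mat_adjoint (conj_mat g) * conj_mat g = 1\<^sub>m 2"
  proof (rule eq_matI)
    fix i j assume "i < dim_row (1\<^sub>m 2 :: complex mat)" "j < dim_col (1\<^sub>m 2 :: complex mat)"
    then have ij: "i < 2" "j < 2" by simp_all
    have "(mat_adjoint (conj_mat g) * conj_mat g) $$ (i, j) = (\<Sum>l<2. g $$ (l, i) * cnj (g $$ (l, j)))"
      unfolding mult_mat_index[OF mat_adjoint_carrier[OF c] c ij]
      using g c ij by (intro sum.cong refl) (simp add: conj_mat_def)
    also have "\<dots> = cnj ((mat_adjoint g * g) $$ (i, j))"
      unfolding mult_mat_index[OF mat_adjoint_carrier[OF g] g ij] using g ij by simp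
    finally show "(mat_adjoint (conj_mat g) * conj_mat g) $$ (i, j) = 1\<^sub>m 2 $$ (i, j)"
      using u ij by simp
  qed (use c in auto)
qed

locale mckay_data =
  fixes Q :: "('v, 'e) pre_digraph" and T :: affine_type and v0 :: 'v and Ev :: "'v set"
    and \<delta> :: "'v \<Rightarrow> nat" and lam :: "'v \<Rightarrow> complex" and \<Gamma> :: "complex mat set"
    and V :: "'v \<Rightarrow> complex mat rep"
  assumes dynkin: "extended_dynkin T Q v0"
    and root: "minimal_imaginary_root Q \<delta>"
    and v0_even: "v0 \<in> Ev"
    and bip: "\<forall>a\<in>arcs Q. tail Q a \<notin> Ev \<and> head Q a \<in> Ev"
    and lam_eq: "\<forall>j\<in>verts Q. lam j = (if j \<in> Ev then of_nat (\<delta> j) else - of_nat (\<delta> j))"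
    and mckay: "mckay_correspondence Q v0 \<delta> \<Gamma> V"
    and unitary_reps: "\<forall>j\<in>verts Q. unitary_rep (SU2_sub \<Gamma>) (V j)"
begin

sublocale fin_digraph Q
  using dynkin by (simp add: extended_dynkin_def)

abbreviation G where "G \<equiv> SU2_sub \<Gamma>"

abbreviation D where "D \<equiv> double_quiver Q"

abbreviation \<tau> where "\<tau> j \<equiv> snd (V j)"

lemma v0_vert: "v0 \<in> verts Q"
  using dynkin by (simp add: extended_dynkin_def)

lemma finite_group: "finite \<Gamma>" and subgroup_group: "subgroup \<Gamma> SU2"
  using mckay by (auto simp: mckay_correspondence_def)

lemma group_SU2D:
  assumes "g \<in> \<Gamma>"
  shows "g \<in> carrier SU2" "g \<in> carrier_mat 2 2" "mat_adjoint g * g = 1\<^sub>m 2" "det g = 1"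
    "mat_adjoint g \<in> \<Gamma>" "g * mat_adjoint g = 1\<^sub>m 2"
proof -
  show c: "g \<in> carrier SU2" using subgroup.mem_carrier[OF subgroup_group assms] .
  then show "g \<in> carrier_mat 2 2" "mat_adjoint g * g = 1\<^sub>m 2" "det g = 1" by (auto simp: SU2_carrier)
  show "mat_adjoint g \<in> \<Gamma>" using subgroup.m_inv_closed[OF subgroup_group assms] SU2_inv[OF c] by simp
  show "g * mat_adjoint g = 1\<^sub>m 2" by (rule SU2_adjoint[OF c])
qed

lemma one_in_group: "1\<^sub>m 2 \<in> \<Gamma>"
  using subgroup.one_closed[OF subgroup_group] by simp

lemma mult_in_group: "g \<in> \<Gamma> \<Longrightarrow> h \<in> \<Gamma> \<Longrightarrow> g * h \<in> \<Gamma>"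
  using subgroup.m_closed[OF subgroup_group] by simp

lemma mckayD:
  "j \<in> verts Q \<Longrightarrow> irreducible_rep G (V j)"
  "j \<in> verts Q \<Longrightarrow> fst (V j) = \<delta> j"
  "i \<in> verts Q \<Longrightarrow> j \<in> verts Q \<Longrightarrow> rep_iso G (V i) (V j) \<Longrightarrow> i = j"
  "i \<in> verts Q \<Longrightarrow> j \<in> verts Q \<Longrightarrow>
    has_multiplicity G (V i) (tensor_rep (2, \<lambda>g. g) (V j)) (edge_count Q i j)"
  "rep_iso G (V v0) (1, \<lambda>g. 1\<^sub>m 1)"
  using mckay unfolding mckay_correspondence_def by blast+

lemma V_eq: "j \<in> verts Q \<Longrightarrow> (\<delta> j, \<tau> j) = V j"
  by (simp add: prod_eq_iff mckayD(2))

lemma irreducible: "j \<in> verts Q \<Longrightarrow> irreducible_rep G (\<delta> j, \<tau> j)"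
  by (simp only: V_eq mckayD(1))

lemma not_iso: "i \<in> verts Q \<Longrightarrow> j \<in> verts Q \<Longrightarrow> i \<noteq> j \<Longrightarrow> \<not> rep_iso G (\<delta> i, \<tau> i) (\<delta> j, \<tau> j)"
  using mckayD(3) by (simp only: V_eq) blast

lemma dim_pos: "j \<in> verts Q \<Longrightarrow> 0 < \<delta> j"
  using irreducible by (simp add: irreducible_rep_def)

lemma unitary: "j \<in> verts Q \<Longrightarrow> unitary_map \<Gamma> (\<delta> j) (\<tau> j)"
proof -
  assume j: "j \<in> verts Q"
  then have u: "unitary_rep G (\<delta> j, \<tau> j)" using unitary_reps by (simp only: V_eq)
  have "\<tau> j g \<in> carrier_mat (\<delta> j) (\<delta> j)" if "g \<in> \<Gamma>" for g
  proof -
    have "\<tau> j g \<in> Units (ring_mat TYPE(complex) (\<delta> j) ())"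
      using u that by (auto simp: unitary_rep_def representation_def hom_def units_of_def)
    then show ?thesis by (auto simp: Units_def ring_mat_simps)
  qed
  then show ?thesis using u by (auto simp: unitary_map_def unitary_rep_def)
qed

lemmas rep_carrier = unitary_mapD(1)[OF unitary]

lemma rep_mult: "j \<in> verts Q \<Longrightarrow> g \<in> \<Gamma> \<Longrightarrow> h \<in> \<Gamma> \<Longrightarrow> \<tau> j (g * h) = \<tau> j g * \<tau> j h"
proof -
  assume j: "j \<in> verts Q" and gh: "g \<in> \<Gamma>" "h \<in> \<Gamma>"
  have "representation G (\<delta> j, \<tau> j)" using irreducible[OF j] by (simp add: irreducible_rep_def)
  then show ?thesis
    using gh hom_mult[of "\<tau> j" G "units_of (ring_mat TYPE(complex) (\<delta> j) ())" g h]
    by (simp add: representation_def units_of_def ring_mat_simps)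
qed

lemma rep_one: "j \<in> verts Q \<Longrightarrow> \<tau> j (1\<^sub>m 2) = 1\<^sub>m (\<delta> j)"
proof -
  assume j: "j \<in> verts Q"
  let ?e = "\<tau> j (1\<^sub>m 2)"
  note c = rep_carrier[OF j one_in_group] and u = unitary_mapD[OF unitary[OF j] one_in_group]
  have "?e * ?e = ?e" using rep_mult[OF j one_in_group one_in_group] by simp
  then have "mat_adjoint ?e * (?e * ?e) = 1\<^sub>m (\<delta> j)" using u by simp
  then show ?thesis
    using assoc_mult_mat[OF mat_adjoint_carrier[OF c] c c] u left_mult_one_mat[OF c] by simp
qed

lemma rep_adjoint: "j \<in> verts Q \<Longrightarrow> g \<in> \<Gamma> \<Longrightarrow> \<tau> j (mat_adjoint g) = mat_adjoint (\<tau> j g)"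
proof -
  assume j: "j \<in> verts Q" and g: "g \<in> \<Gamma>"
  let ?X = "\<tau> j (mat_adjoint g)"
  note c = rep_carrier[OF j g] and x = rep_carrier[OF j group_SU2D(5)[OF g]]
    and u = unitary_mapD[OF unitary[OF j] g]
  have "?X * \<tau> j g = 1\<^sub>m (\<delta> j)"
    using rep_mult[OF j group_SU2D(5)[OF g] g] rep_one[OF j] group_SU2D(3)[OF g] by simp
  then have "?X * \<tau> j g * mat_adjoint (\<tau> j g) = mat_adjoint (\<tau> j g)"
    using left_mult_one_mat[OF mat_adjoint_carrier[OF c]] by simp
  moreover have "?X * \<tau> j g * mat_adjoint (\<tau> j g) = ?X"
    using assoc_mult_mat[OF x c mat_adjoint_carrier[OF c]] u right_mult_one_mat[OF x] by simp
  ultimately show ?thesis by simp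
qed

lemma unitary_std: "unitary_map \<Gamma> 2 (\<lambda>g. g)" "unitary_map \<Gamma> 2 conj_mat"
  using group_SU2D conj_mat_unitary by (auto simp: unitary_map_def)

section \<open>Orthonormal intertwiners attached to the arrows\<close>

abbreviation arc_orthonormal where
  "arc_orthonormal Z a \<equiv>
    intertwiner \<Gamma> (\<delta> (head Q a)) (\<tau> (head Q a)) (2 * \<delta> (tail Q a))
      (\<lambda>g. kronecker_product g (\<tau> (tail Q a) g)) (Z a) \<and>
    (\<forall>b\<in>arcs Q. tail Q b = tail Q a \<longrightarrow> head Q b = head Q a \<longrightarrow>
      Z a * mat_adjoint (Z b) = (if a = b then 1\<^sub>m (\<delta> (head Q a)) else 0\<^sub>m (\<delta> (head Q a)) (\<delta> (head Q a))))"

text \<open>The arrows from i to j are as many as the copies of V_j in V \<otimes> V_i, so an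
  orthonormal system of intertwiners can be distributed among them. Orthogonality among parallel
  arrows matters for the double edge of \<open>A_tilde 1\<close>.\<close>

lemma ex_arc_map: "\<exists>Z. \<forall>a\<in>arcs Q. arc_orthonormal Z a"
proof -
  have ex: "\<exists>Z. \<forall>a\<in>arcs Q. tail Q a = i \<longrightarrow> head Q a = j \<longrightarrow> arc_orthonormal Z a" for i j
  proof -
    define A where "A = {a \<in> arcs Q. tail Q a = i \<and> head Q a = j}"
    show ?thesis
    proof (cases "A = {}")
      case True
      then show ?thesis by (auto simp: A_def)
    next
      case False
      then have ij: "i \<in> verts Q" "j \<in> verts Q" "j \<in> Ev" using bip by (auto simp: A_def)
      \<comment> \<open>The edge count includes both directions, but j is even and no arrow starts
        at an even vertex.\<close>
      have "{a \<in> arcs Q. (tail Q a = j \<and> head Q a = i) \<or> (tail Q a = i \<and> head Q a = j)} = A"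
        using bip ij(3) by (auto simp: A_def)
      then have "edge_count Q j i = card A" by (simp add: edge_count_def)
      then have m: "has_multiplicity G (\<delta> j, \<tau> j) (2 * \<delta> i, \<lambda>g. kronecker_product g (\<tau> i g)) (card A)"
        using mckayD(4)[OF ij(2,1)] by (simp add: V_eq[OF ij(2)] tensor_rep_def mckayD(2)[OF ij(1)])
      have u: "unitary_map \<Gamma> (2 * \<delta> i) (\<lambda>g. kronecker_product g (\<tau> i g))"
        using unitary_map_kronecker[OF unitary_std(1) unitary[OF ij(1)]] .
      have "\<exists>X Y. dual_intertwiners \<Gamma> (\<delta> j) (\<tau> j) (2 * \<delta> i) (\<lambda>g. kronecker_product g (\<tau> i g)) (card A) X Y"
        by (rule has_multiplicity_dual_intertwiners[OF m])
          (use rep_carrier[OF ij(2)] unitary_mapD(1)[OF u] in auto)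
      then obtain Z where Z: "\<forall>s<card A. intertwiner \<Gamma> (\<delta> j) (\<tau> j) (2 * \<delta> i) (\<lambda>g. kronecker_product g (\<tau> i g)) (Z s) \<and>
        (\<forall>t<card A. Z s * mat_adjoint (Z t) = (if s = t then 1\<^sub>m (\<delta> j) else 0\<^sub>m (\<delta> j) (\<delta> j)))"
        using orthonormal_intertwiners[OF irreducible[OF ij(2)] _ unitary[OF ij(2)] u] by fastforce
      have "finite A" using finite_arcs by (simp add: A_def)
      then obtain f where f: "bij_betw f A {0..<card A}" using ex_bij_betw_finite_nat by blast
      then have f1: "f a < card A" if "a \<in> A" for a using that bij_betwE by fastforce
      have f2: "f a = f b \<longleftrightarrow> a = b" if "a \<in> A" "b \<in> A" for a b
        using f that by (auto simp: bij_betw_def inj_on_def)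
      show ?thesis
        using Z f1 f2 by (intro exI[of _ "\<lambda>a. Z (f a)"]) (auto simp: A_def)
    qed
  qed
  have "\<exists>Z. \<forall>i j. \<forall>a\<in>arcs Q. tail Q a = i \<longrightarrow> head Q a = j \<longrightarrow> arc_orthonormal (Z i j) a"
    by (intro choice allI) (rule ex)
  then obtain Z where Z: "\<And>i j a. a \<in> arcs Q \<Longrightarrow> tail Q a = i \<Longrightarrow> head Q a = j \<Longrightarrow> arc_orthonormal (Z i j) a"
    by blast
  show ?thesis
  proof (rule exI[where x = "\<lambda>a. Z (tail Q a) (head Q a) a"], rule ballI)
    fix a assume "a \<in> arcs Q"
    from Z[OF this refl refl] show "arc_orthonormal (\<lambda>a. Z (tail Q a) (head Q a) a) a" by simp
  qed
qed

definition arc_map where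
  "arc_map = (SOME Z. \<forall>a\<in>arcs Q. arc_orthonormal Z a)"

lemma arc_map: "a \<in> arcs Q \<Longrightarrow> arc_orthonormal arc_map a"
  unfolding arc_map_def using someI_ex[OF ex_arc_map] by blast

text \<open>The factor is the one for which an arrow and its reverse are normalised alike, each
  having as Gram matrix the dimension at its own starting vertex. For the reverse arrow the trace
  \<delta> (tail) \<delta> (head) is spread over \<delta> (tail) diagonal entries, which leaves
  \<delta> (head).\<close>

definition F :: "'e + 'e \<Rightarrow> bool \<Rightarrow> nat \<Rightarrow> nat \<Rightarrow> complex" where
  "F b k r c = (case b of
     Inl a \<Rightarrow> of_real (sqrt (\<delta> (tail Q a))) * arc_map a $$ (r, bool_index k * \<delta> (tail Q a) + c)
   | Inr a \<Rightarrow> cnj (of_real (sqrt (\<delta> (tail Q a))) * arc_map a $$ (c, bool_index k * \<delta> (tail Q a) + r)))"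

lemma F_reverse: "F (reverse_arrow b) k r c = cnj (F b k c r)"
  by (cases b) (simp_all add: F_def)

lemma arc_verts: "a \<in> arcs Q \<Longrightarrow> tail Q a \<in> verts Q" "a \<in> arcs Q \<Longrightarrow> head Q a \<in> verts Q"
  by auto

lemma arc_map_carrier: "a \<in> arcs Q \<Longrightarrow> arc_map a \<in> carrier_mat (\<delta> (head Q a)) (2 * \<delta> (tail Q a))"
  using arc_map[of a] by (auto intro: intertwiner_carrier)

text \<open>For equal heads this is the choice of the orthonormal system, for different heads it is
  Schur's lemma for inequivalent irreducibles. The right-hand side carries the square of the
  normalising factor.\<close>

lemma F_Inl_orthogonal:
  assumes a: "a \<in> arcs Q" and a': "a' \<in> arcs Q" "tail Q a' = tail Q a"
    and r: "r < \<delta> (head Q a)" "r' < \<delta> (head Q a')"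
  shows "(\<Sum>k\<in>UNIV. \<Sum>m<\<delta> (tail Q a). F (Inl a) k r m * cnj (F (Inl a') k r' m))
    = of_bool (a = a' \<and> r = r') * of_nat (\<delta> (tail Q a))"
proof -
  let ?n = "\<delta> (tail Q a)" and ?A = "arc_map a" and ?B = "arc_map a'"
  have Ac: "?A \<in> carrier_mat (\<delta> (head Q a)) (2 * ?n)" and Bc: "?B \<in> carrier_mat (\<delta> (head Q a')) (2 * ?n)"
    using arc_map_carrier[OF a] arc_map_carrier[OF a'(1)] a'(2) by simp_all
  have A: "intertwiner \<Gamma> (\<delta> (head Q a)) (\<tau> (head Q a)) (2 * ?n) (\<lambda>g. kronecker_product g (\<tau> (tail Q a) g)) ?A"
    using arc_map[OF a] by simp
  have B: "intertwiner \<Gamma> (\<delta> (head Q a')) (\<tau> (head Q a')) (2 * ?n) (\<lambda>g. kronecker_product g (\<tau> (tail Q a) g)) ?B"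
    using arc_map[OF a'(1)] a'(2) by simp
  have u: "unitary_map \<Gamma> (2 * ?n) (\<lambda>g. kronecker_product g (\<tau> (tail Q a) g))"
    using unitary_map_kronecker[OF unitary_std(1) unitary[OF arc_verts(1)[OF a]]] .
  note ua = unitary[OF arc_verts(2)[OF a]] and ub = unitary[OF arc_verts(2)[OF a'(1)]]
  have "(?A * mat_adjoint ?B) $$ (r, r') = of_bool (a = a' \<and> r = r')"
  proof (cases "head Q a' = head Q a")
    case True
    have eq: "?A * mat_adjoint ?B = (if a = a' then 1\<^sub>m (\<delta> (head Q a)) else 0\<^sub>m (\<delta> (head Q a)) (\<delta> (head Q a)))"
      using arc_map[OF a] a' True by blast
    have r': "r' < \<delta> (head Q a)" using r(2) unfolding True .
    show ?thesis unfolding eq using r(1) r' by (cases "a = a'") simp_all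
  next
    case False
    have "intertwiner \<Gamma> (\<delta> (head Q a)) (\<tau> (head Q a)) (\<delta> (head Q a')) (\<tau> (head Q a')) (?A * mat_adjoint ?B)"
      using intertwiner_mult[OF A intertwiner_adjoint[OF B ub u]] unitary_mapD(1)[OF ua]
        unitary_mapD(1)[OF ub] unitary_mapD(1)[OF u] by blast
    then have "?A * mat_adjoint ?B = 0\<^sub>m (\<delta> (head Q a)) (\<delta> (head Q a'))"
    proof (rule schur_zero[OF irreducible[OF arc_verts(2)[OF a'(1)]] irreducible[OF arc_verts(2)[OF a]] _ _ ub ua
            not_iso[OF arc_verts(2)[OF a'(1)] arc_verts(2)[OF a]], rotated])
      show "head Q a' \<noteq> head Q a" by (rule False)
    qed simp
    then have "(?A * mat_adjoint ?B) $$ (r, r') = 0\<^sub>m (\<delta> (head Q a)) (\<delta> (head Q a')) $$ (r, r')" by (rule arg_cong)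
    moreover have "a \<noteq> a'" using False by blast
    ultimately show ?thesis using r by simp
  qed
  moreover have "(?A * mat_adjoint ?B) $$ (r, r')
    = (\<Sum>k\<in>UNIV. \<Sum>m<?n. ?A $$ (r, bool_index k * ?n + m) * cnj (?B $$ (r', bool_index k * ?n + m)))"
    unfolding mult_mat_index[OF Ac mat_adjoint_carrier[OF Bc] r] sum_double_index
    using Bc r double_index_bound by (intro sum.cong refl) auto
  moreover have "(\<Sum>k\<in>UNIV. \<Sum>m<?n. F (Inl a) k r m * cnj (F (Inl a') k r' m))
    = of_nat ?n * (\<Sum>k\<in>UNIV. \<Sum>m<?n. ?A $$ (r, bool_index k * ?n + m) * cnj (?B $$ (r', bool_index k * ?n + m)))"
  proof -
    have "of_real (sqrt ?n) * of_real (sqrt ?n) = (of_nat ?n :: complex)"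
      by (simp flip: of_real_mult)
    then have *: "(of_real (sqrt ?n) * x) * cnj (of_real (sqrt ?n) * y) = of_nat ?n * (x * cnj y)" for x y :: complex
      by (simp add: algebra_simps)
    show ?thesis unfolding F_def sum.case a'(2) * by (simp add: sum_distrib_left)
  qed
  ultimately show ?thesis by simp
qed

lemma F_Inl_equivariant:
  assumes a: "a \<in> arcs Q" and g: "g \<in> \<Gamma>" and r: "r < \<delta> (head Q a)" and c: "c < \<delta> (tail Q a)"
  shows "(\<Sum>m<\<delta> (head Q a). \<tau> (head Q a) g $$ (r, m) * F (Inl a) k m c)
    = (\<Sum>l\<in>UNIV. \<Sum>m<\<delta> (tail Q a). g $$ (bool_index l, bool_index k) * F (Inl a) l r m * \<tau> (tail Q a) g $$ (m, c))"
proof -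
  let ?n = "\<delta> (tail Q a)" and ?A = "arc_map a" and ?K = "kronecker_product g (\<tau> (tail Q a) g)"
  note Ac = arc_map_carrier[OF a] and hc = rep_carrier[OF arc_verts(2)[OF a] g]
    and tc = rep_carrier[OF arc_verts(1)[OF a] g] and gc = group_SU2D(2)[OF g]
  have Kc: "?K \<in> carrier_mat (2 * ?n) (2 * ?n)" by (rule kronecker_product_carrier[OF gc tc])
  have q: "bool_index k * ?n + c < 2 * ?n" using c by (rule double_index_bound)
  have "?A * ?K = \<tau> (head Q a) g * ?A" using arc_map[OF a] g by (simp add: intertwiner_def)
  then have "(\<tau> (head Q a) g * ?A) $$ (r, bool_index k * ?n + c) = (?A * ?K) $$ (r, bool_index k * ?n + c)" by simp
  then have "(\<Sum>m<\<delta> (head Q a). \<tau> (head Q a) g $$ (r, m) * ?A $$ (m, bool_index k * ?n + c))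
    = (\<Sum>l\<in>UNIV. \<Sum>m<?n. ?A $$ (r, bool_index l * ?n + m) * (g $$ (bool_index l, bool_index k) * \<tau> (tail Q a) g $$ (m, c)))"
    unfolding mult_mat_index[OF hc Ac r q] mult_mat_index[OF Ac Kc r q] sum_double_index
    using kronecker_product_index[OF gc tc _ c] by simp
  then have "of_real (sqrt ?n) * (\<Sum>m<\<delta> (head Q a). \<tau> (head Q a) g $$ (r, m) * ?A $$ (m, bool_index k * ?n + c))
    = of_real (sqrt ?n) * (\<Sum>l\<in>UNIV. \<Sum>m<?n. ?A $$ (r, bool_index l * ?n + m) * (g $$ (bool_index l, bool_index k) * \<tau> (tail Q a) g $$ (m, c)))"
    by simp
  then show ?thesis
    unfolding sum_distrib_left F_def sum.case by (simp add: mult_ac)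
qed

end

text \<open>The matrix subtracted from the identity is the orthogonal projection onto the span of
  the conjugated rows of \<open>\<Psi>\<close>. The left-hand side is the squared Hilbert-Schmidt
  norm of the complementary projection, hence its trace. So the defect card C - card R is
  nonnegative, and it is zero only if the rows are complete.\<close>

lemma bessel:
  fixes \<Psi> :: "'r \<Rightarrow> 'c \<Rightarrow> complex"
  assumes "finite R" "finite C" and d: "0 < (d :: nat)"
    and orth: "\<And>r r'. r \<in> R \<Longrightarrow> r' \<in> R \<Longrightarrow> (\<Sum>c\<in>C. \<Psi> r c * cnj (\<Psi> r' c)) = of_bool (r = r') * of_nat d"
  shows "(\<Sum>c\<in>C. \<Sum>c'\<in>C. (cmod (of_bool (c = c') - (\<Sum>r\<in>R. cnj (\<Psi> r c) * \<Psi> r c') / of_nat d))\<^sup>2)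
    = real (card C) - real (card R)"
proof -
  define P where "P c c' = (\<Sum>r\<in>R. cnj (\<Psi> r c) * \<Psi> r c')" for c c'
  have diag: "(\<Sum>c\<in>C. P c c) = of_nat (card R) * of_nat d"
  proof -
    have "(\<Sum>c\<in>C. P c c) = (\<Sum>r\<in>R. \<Sum>c\<in>C. \<Psi> r c * cnj (\<Psi> r c))"
      unfolding P_def by (subst sum.swap) (simp add: mult.commute)
    then show ?thesis by (simp add: orth)
  qed
  have sq: "(\<Sum>c\<in>C. \<Sum>c'\<in>C. P c c' * cnj (P c c')) = of_nat (card R) * (of_nat d)\<^sup>2"
  proof -
    have "(\<Sum>c\<in>C. \<Sum>c'\<in>C. P c c' * cnj (P c c'))
      = (\<Sum>c\<in>C. \<Sum>c'\<in>C. \<Sum>r\<in>R. \<Sum>r'\<in>R. (\<Psi> r' c * cnj (\<Psi> r c)) * (\<Psi> r c' * cnj (\<Psi> r' c')))"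
      unfolding P_def cnj_sum sum_product by (intro sum.cong refl) (simp add: mult_ac)
    also have "\<dots> = (\<Sum>r\<in>R. \<Sum>r'\<in>R. \<Sum>c\<in>C. \<Sum>c'\<in>C. (\<Psi> r' c * cnj (\<Psi> r c)) * (\<Psi> r c' * cnj (\<Psi> r' c')))"
      by (rule sum_swap_pairs)
    also have "\<dots> = (\<Sum>r\<in>R. \<Sum>r'\<in>R. (of_bool (r' = r) * of_nat d) * (of_bool (r = r') * of_nat d))"
      using orth by (simp add: sum_product[symmetric])
    also have "\<dots> = (\<Sum>r\<in>R. \<Sum>r'\<in>R. if r' = r then (of_nat d)\<^sup>2 else 0)"
      by (intro sum.cong refl) (auto simp: power2_eq_square)
    also have "\<dots> = of_nat (card R) * (of_nat d)\<^sup>2" using assms(1) by simp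
    finally show ?thesis .
  qed
  have "of_real (\<Sum>c\<in>C. \<Sum>c'\<in>C. (cmod (of_bool (c = c') - P c c' / of_nat d))\<^sup>2)
    = (\<Sum>c\<in>C. \<Sum>c'\<in>C. (of_bool (c = c') - P c c' / of_nat d) * cnj (of_bool (c = c') - P c c' / of_nat d))"
    by (simp add: of_real_sum complex_norm_square del: of_real_power)
  also have "\<dots> = (\<Sum>c\<in>C. \<Sum>c'\<in>C. (if c' = c then 1 - P c c' / of_nat d - cnj (P c c') / of_nat d else 0)
      + P c c' * cnj (P c c') / (of_nat d)\<^sup>2)"
    by (intro sum.cong refl) (auto simp: algebra_simps power2_eq_square)
  also have "\<dots> = (\<Sum>c\<in>C. 1 - P c c / of_nat d - cnj (P c c) / of_nat d)
      + (\<Sum>c\<in>C. \<Sum>c'\<in>C. P c c' * cnj (P c c')) / (of_nat d)\<^sup>2"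
    using assms(2) by (simp add: sum.distrib sum_divide_distrib)
  also have "\<dots> = of_nat (card C) - (\<Sum>c\<in>C. P c c) / of_nat d - cnj (\<Sum>c\<in>C. P c c) / of_nat d
      + (\<Sum>c\<in>C. \<Sum>c'\<in>C. P c c' * cnj (P c c')) / (of_nat d)\<^sup>2"
    by (simp add: sum_subtractf sum_divide_distrib)
  also have "\<dots> = of_nat (card C) - of_nat (card R)"
    unfolding diag sq using d by simp
  finally have "of_real (\<Sum>c\<in>C. \<Sum>c'\<in>C. (cmod (of_bool (c = c') - P c c' / of_nat d))\<^sup>2)
    = (of_real (real (card C) - real (card R)) :: complex)" by simp
  then show ?thesis unfolding P_def of_real_eq_iff .
qed

section \<open>Entries of matrices in SU(2)\<close>

lemma det_2x2:
  assumes A: "A \<in> carrier_mat 2 2"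
  shows "det A = A $$ (0, 0) * A $$ (1, 1) - A $$ (0, 1) * A $$ (1, 0)"
proof -
  have d: "det (mat_delete A i j) = mat_delete A i j $$ (0, 0)" for i j
    using mat_delete_carrier[OF A, of i j] by (intro det_single) simp
  have m: "mat_delete A 0 0 $$ (0, 0) = A $$ (1, 1)" "mat_delete A 1 0 $$ (0, 0) = A $$ (0, 1)"
    using A by (auto simp: mat_delete_def)
  have two: "{..<2} = {0, 1 :: nat}" by auto
  have "det A = (\<Sum>i<2. A $$ (i, 0) * cofactor A i 0)" using A by (rule laplace_expansion_column) simp
  then show ?thesis unfolding two cofactor_def d using m by simp
qed

lemma SU2_entries:
  assumes "g \<in> carrier SU2"
  shows "g $$ (1, 1) = cnj (g $$ (0, 0))" "cnj (g $$ (0, 0)) * g $$ (0, 0) + cnj (g $$ (1, 0)) * g $$ (1, 0) = 1"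
    "g $$ (0, 1) = - cnj (g $$ (1, 0))"
proof -
  have g: "g \<in> carrier_mat 2 2" "mat_adjoint g * g = 1\<^sub>m 2" "det g = 1" using assms by (auto simp: SU2_carrier)
  have e: "(mat_adjoint g * g) $$ (i, j) = cnj (g $$ (0, i)) * g $$ (0, j) + cnj (g $$ (1, i)) * g $$ (1, j)"
    if "i < 2" "j < 2" for i j
    unfolding mult_mat_index[OF mat_adjoint_carrier[OF g(1)] g(1) that]
    using g(1) that by (simp add: numeral_2_eq_2)
  show 1: "cnj (g $$ (0, 0)) * g $$ (0, 0) + cnj (g $$ (1, 0)) * g $$ (1, 0) = 1"
    using e[of 0 0] g(2) by simp
  have 2: "cnj (g $$ (0, 0)) * g $$ (0, 1) + cnj (g $$ (1, 0)) * g $$ (1, 1) = 0"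
    using e[of 0 1] g(2) by simp
  have 3: "g $$ (0, 0) * g $$ (1, 1) - g $$ (0, 1) * g $$ (1, 0) = 1"
    using g(3) det_2x2[OF g(1)] by simp
  \<comment> \<open>Multiply by the determinant, which is 1, and regroup according to the
    orthonormality relations of the columns.\<close>
  have "cnj (g $$ (0, 0)) = cnj (g $$ (0, 0)) * (g $$ (0, 0) * g $$ (1, 1) - g $$ (0, 1) * g $$ (1, 0))"
    using 3 by simp
  also have "\<dots> = g $$ (1, 1) * (cnj (g $$ (0, 0)) * g $$ (0, 0) + cnj (g $$ (1, 0)) * g $$ (1, 0))
      - g $$ (1, 0) * (cnj (g $$ (0, 0)) * g $$ (0, 1) + cnj (g $$ (1, 0)) * g $$ (1, 1))"
    by (simp add: algebra_simps)
  finally show "g $$ (1, 1) = cnj (g $$ (0, 0))" unfolding 1 2 by simp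
  have "cnj (g $$ (1, 0)) = cnj (g $$ (1, 0)) * (g $$ (0, 0) * g $$ (1, 1) - g $$ (0, 1) * g $$ (1, 0))"
    using 3 by simp
  also have "\<dots> = g $$ (0, 0) * (cnj (g $$ (0, 0)) * g $$ (0, 1) + cnj (g $$ (1, 0)) * g $$ (1, 1))
      - g $$ (0, 1) * (cnj (g $$ (0, 0)) * g $$ (0, 0) + cnj (g $$ (1, 0)) * g $$ (1, 0))"
    by (simp add: algebra_simps)
  finally show "g $$ (0, 1) = - cnj (g $$ (1, 0))" unfolding 1 2 by simp
qed

text \<open>The trace is twice the real part of the upper left entry, which is therefore -1. The
  first column has length 1, so nothing else in it survives, and it determines the second
  column.\<close>

lemma SU2_trace_minus_two:
  assumes g: "g \<in> carrier SU2" and tr: "g $$ (0, 0) + g $$ (1, 1) = - 2"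
  shows "g = - 1\<^sub>m 2"
proof -
  note e = SU2_entries[OF g]
  have re: "Re (g $$ (0, 0)) = - 1" using tr e(1) by (simp add: complex_eq_iff)
  have "(cmod (g $$ (0, 0)))\<^sup>2 + (cmod (g $$ (1, 0)))\<^sup>2 = 1"
  proof -
    have "of_real ((cmod (g $$ (0, 0)))\<^sup>2 + (cmod (g $$ (1, 0)))\<^sup>2) = (of_real 1 :: complex)"
      using e(2) unfolding of_real_add complex_norm_square by (simp add: mult.commute)
    then show ?thesis unfolding of_real_eq_iff .
  qed
  then have "1 + (Im (g $$ (0, 0)))\<^sup>2 + (cmod (g $$ (1, 0)))\<^sup>2 = 1"
    using re by (simp add: cmod_power2)
  then have "(Im (g $$ (0, 0)))\<^sup>2 = 0" "(cmod (g $$ (1, 0)))\<^sup>2 = 0"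
    using zero_le_power2[of "Im (g $$ (0, 0))"] zero_le_power2[of "cmod (g $$ (1, 0))"] by linarith+
  then have "g $$ (0, 0) = - 1" "g $$ (1, 0) = 0" using re by (auto simp: complex_eq_iff)
  moreover from this have "g $$ (1, 1) = - 1" "g $$ (0, 1) = 0" using e by auto
  moreover have "g \<in> carrier_mat 2 2" using g by (simp add: SU2_carrier)
  ultimately show ?thesis
    by (intro eq_matI) (auto simp: less_2_cases_iff)
qed

section \<open>Equivariance, orthogonality and completeness over the double quiver\<close>

context mckay_data
begin

definition twist :: "'v \<Rightarrow> complex mat \<Rightarrow> complex mat" where
  "twist i g = (if i \<in> Ev then conj_mat g else g)"

lemma unitary_twist: "unitary_map \<Gamma> 2 (twist i)"
  using unitary_std by (auto simp: unitary_map_def twist_def)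

lemma twist_index:
  "g \<in> \<Gamma> \<Longrightarrow> twist i g $$ (bool_index l, bool_index k) =
    (if i \<in> Ev then cnj (g $$ (bool_index l, bool_index k)) else g $$ (bool_index l, bool_index k))"
  using group_SU2D(2)[of g] by (simp add: twist_def conj_mat_def)

lemma column_orthonormal:
  assumes "g \<in> \<Gamma>"
  shows "(\<Sum>p\<in>UNIV. cnj (g $$ (bool_index p, bool_index l)) * g $$ (bool_index p, bool_index k)) = of_bool (l = k)"
proof -
  note c = group_SU2D(2)[OF assms]
  have "(\<Sum>p\<in>UNIV. cnj (g $$ (bool_index p, bool_index l)) * g $$ (bool_index p, bool_index k))
    = (mat_adjoint g * g) $$ (bool_index l, bool_index k)"
    unfolding mult_mat_index[OF mat_adjoint_carrier[OF c] c bool_index_less bool_index_less]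
    using c sum_double_index[of "\<lambda>p. mat_adjoint g $$ (bool_index l, p) * g $$ (p, bool_index k)" 1]
    by simp
  then show ?thesis using group_SU2D(3)[OF assms] by simp
qed

text \<open>Conjugate the equivariance of the arrow at the inverse of \<open>g\<close>, and use the
  orthonormal columns of \<open>g\<close> to bring its matrix to the other side. It arrives there
  conjugated, that is, as the action on the dual.\<close>

lemma F_Inr_equivariant:
  assumes a: "a \<in> arcs Q" and g: "g \<in> \<Gamma>" and r: "r < \<delta> (tail Q a)" and c: "c < \<delta> (head Q a)"
  shows "(\<Sum>m<\<delta> (tail Q a). \<tau> (tail Q a) g $$ (r, m) * F (Inr a) k m c)
    = (\<Sum>l\<in>UNIV. \<Sum>m<\<delta> (head Q a). cnj (g $$ (bool_index l, bool_index k)) * F (Inr a) l r m * \<tau> (head Q a) g $$ (m, c))"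
proof -
  let ?f = "F (Inl a)"
  have Inr: "F (Inr a) k m c = cnj (?f k c m)" for k m c using F_reverse[of "Inl a"] by simp
  define S where "S l = (\<Sum>s<\<delta> (tail Q a). ?f l c s * cnj (\<tau> (tail Q a) g $$ (r, s)))" for l
  have star: "(\<Sum>m<\<delta> (head Q a). cnj (\<tau> (head Q a) g $$ (m, c)) * ?f p m r)
    = (\<Sum>l\<in>UNIV. cnj (g $$ (bool_index p, bool_index l)) * S l)" for p
  proof -
    have g': "mat_adjoint g \<in> \<Gamma>" by (rule group_SU2D(5)[OF g])
    have h: "\<tau> (head Q a) (mat_adjoint g) $$ (c, m) = cnj (\<tau> (head Q a) g $$ (m, c))" if "m < \<delta> (head Q a)" for m
      using rep_adjoint[OF arc_verts(2)[OF a] g] rep_carrier[OF arc_verts(2)[OF a] g] c that by simp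
    have t: "\<tau> (tail Q a) (mat_adjoint g) $$ (s, r) = cnj (\<tau> (tail Q a) g $$ (r, s))" if "s < \<delta> (tail Q a)" for s
      using rep_adjoint[OF arc_verts(1)[OF a] g] rep_carrier[OF arc_verts(1)[OF a] g] r that by simp
    have b: "mat_adjoint g $$ (bool_index l, bool_index p) = cnj (g $$ (bool_index p, bool_index l))" for l
      using group_SU2D(2)[OF g] by simp
    show ?thesis
      using F_Inl_equivariant[OF a g' c r, of p] h t b by (simp add: S_def sum_distrib_left mult_ac)
  qed
  have "(\<Sum>p\<in>UNIV. g $$ (bool_index p, bool_index k) * (\<Sum>m<\<delta> (head Q a). cnj (\<tau> (head Q a) g $$ (m, c)) * ?f p m r))
    = (\<Sum>l\<in>UNIV. (\<Sum>p\<in>UNIV. cnj (g $$ (bool_index p, bool_index l)) * g $$ (bool_index p, bool_index k)) * S l)"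
    unfolding star sum_distrib_left sum_distrib_right by (subst sum.swap) (simp add: mult_ac)
  also have "\<dots> = S k" unfolding column_orthonormal[OF g] by (cases k) (simp_all add: UNIV_bool)
  finally have "cnj (S k) = (\<Sum>p\<in>UNIV. \<Sum>m<\<delta> (head Q a). cnj (g $$ (bool_index p, bool_index k)) * (\<tau> (head Q a) g $$ (m, c) * cnj (?f p m r)))"
    by (metis (no_types, lifting) cnj_sum complex_cnj_cnj complex_cnj_mult sum.cong sum_distrib_left)
  then show ?thesis by (simp add: S_def Inr mult_ac)
qed

lemma F_equivariant:
  assumes "b \<in> arcs D" "g \<in> \<Gamma>" "r < \<delta> (head D b)" "c < \<delta> (tail D b)"
  shows "(\<Sum>m<\<delta> (head D b). \<tau> (head D b) g $$ (r, m) * F b k m c)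
    = (\<Sum>l\<in>UNIV. \<Sum>m<\<delta> (tail D b). twist (tail D b) g $$ (bool_index l, bool_index k) * F b l r m * \<tau> (tail D b) g $$ (m, c))"
  using assms bip
  by (cases b) (auto simp: F_Inl_equivariant F_Inr_equivariant twist_index)

text \<open>\<open>F b\<close> as one matrix on the tensor product, in the column order of
  \<open>kronecker_product\<close>: the first block of columns belongs to \<open>False\<close>. In
  this form Schur's lemma applies to it.\<close>

definition block_mat :: "'e + 'e \<Rightarrow> complex mat" where
  "block_mat b = mat (\<delta> (head D b)) (2 * \<delta> (tail D b))
    (\<lambda>(r, q). F b (\<delta> (tail D b) \<le> q) r (q mod \<delta> (tail D b)))"

lemma block_mat_carrier: "block_mat b \<in> carrier_mat (\<delta> (head D b)) (2 * \<delta> (tail D b))"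
  by (simp add: block_mat_def)

lemma block_mat_index:
  assumes "r < \<delta> (head D b)" "m < \<delta> (tail D b)"
  shows "block_mat b $$ (r, bool_index k * \<delta> (tail D b) + m) = F b k r m"
  using assms double_index_bound[OF assms(2), of k]
  by (cases k) (simp_all add: block_mat_def bool_index_def)

lemma D_verts: "b \<in> arcs D \<Longrightarrow> tail D b \<in> verts Q \<and> head D b \<in> verts Q"
  using arc_verts by (cases b) auto

lemma unitary_block: "i \<in> verts Q \<Longrightarrow> unitary_map \<Gamma> (2 * \<delta> i) (\<lambda>g. kronecker_product (twist i g) (\<tau> i g))"
  using unitary_map_kronecker[OF unitary_twist unitary] .

lemma block_mat_intertwiner:
  assumes b: "b \<in> arcs D"
  shows "intertwiner \<Gamma> (\<delta> (head D b)) (\<tau> (head D b)) (2 * \<delta> (tail D b))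
    (\<lambda>g. kronecker_product (twist (tail D b) g) (\<tau> (tail D b) g)) (block_mat b)"
  unfolding intertwiner_def
proof (intro conjI ballI)
  fix g assume g: "g \<in> \<Gamma>"
  let ?n = "\<delta> (tail D b)" and ?i = "tail D b"
  have v: "?i \<in> verts Q" "head D b \<in> verts Q" using D_verts[OF b] by auto
  note hc = rep_carrier[OF v(2) g] and tc = rep_carrier[OF v(1) g] and gc = unitary_mapD(1)[OF unitary_twist g]
    and Kc = unitary_mapD(1)[OF unitary_block[OF v(1)] g]
  show "block_mat b * kronecker_product (twist ?i g) (\<tau> ?i g) = \<tau> (head D b) g * block_mat b"
  proof (rule eq_matI)
    fix r q assume "r < dim_row (\<tau> (head D b) g * block_mat b)" "q < dim_col (\<tau> (head D b) g * block_mat b)"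
    then have rq: "r < \<delta> (head D b)" "q < 2 * ?n" using hc block_mat_carrier[of b] by auto
    obtain k c where q: "q = bool_index k * ?n + c" "c < ?n" using rq(2) by (rule double_indexE)
    have "(block_mat b * kronecker_product (twist ?i g) (\<tau> ?i g)) $$ (r, q)
      = (\<Sum>l\<in>UNIV. \<Sum>m<?n. F b l r m * (twist ?i g $$ (bool_index l, bool_index k) * \<tau> ?i g $$ (m, c)))"
      unfolding mult_mat_index[OF block_mat_carrier Kc rq] sum_double_index unfolding q(1)
      using kronecker_product_index[OF gc tc _ q(2)] block_mat_index[OF rq(1)] by (intro sum.cong refl) simp
    also have "\<dots> = (\<Sum>m<\<delta> (head D b). \<tau> (head D b) g $$ (r, m) * F b k m c)"
      using F_equivariant[OF b g rq(1) q(2), of k] by (simp add: mult_ac)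
    also have "\<dots> = (\<tau> (head D b) g * block_mat b) $$ (r, q)"
      unfolding mult_mat_index[OF hc block_mat_carrier rq] unfolding q(1)
      using block_mat_index[OF _ q(2)] by (intro sum.cong refl) simp
    finally show "(block_mat b * kronecker_product (twist ?i g) (\<tau> ?i g)) $$ (r, q)
      = (\<tau> (head D b) g * block_mat b) $$ (r, q)" .
  qed (use hc Kc block_mat_carrier[of b] in auto)
qed (rule block_mat_carrier)

lemma block_mat_gram:
  assumes "tail D b' = tail D b" "r < \<delta> (head D b)" "r' < \<delta> (head D b')"
  shows "(block_mat b * mat_adjoint (block_mat b')) $$ (r, r')
    = (\<Sum>k\<in>UNIV. \<Sum>m<\<delta> (tail D b). F b k r m * cnj (F b' k r' m))"
proof -
  have c: "block_mat b' \<in> carrier_mat (\<delta> (head D b')) (2 * \<delta> (tail D b))"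
    using block_mat_carrier[of b'] assms(1) by simp
  have "cnj (block_mat b' $$ (r', bool_index k * \<delta> (tail D b) + m)) = cnj (F b' k r' m)"
    if "m < \<delta> (tail D b)" for k m
    using block_mat_index[OF assms(3), of m k] assms(1) that by simp
  then show ?thesis
    unfolding mult_mat_index[OF block_mat_carrier mat_adjoint_carrier[OF c] assms(2,3)] sum_double_index
    using c assms double_index_bound block_mat_index[OF assms(2)]
    by (intro sum.cong refl) simp
qed

lemma block_mat_gram_intertwiner:
  assumes "b \<in> arcs D" "b' \<in> arcs D" "tail D b' = tail D b"
  shows "intertwiner \<Gamma> (\<delta> (head D b)) (\<tau> (head D b)) (\<delta> (head D b')) (\<tau> (head D b'))
    (block_mat b * mat_adjoint (block_mat b'))"
proof -
  have v: "tail D b \<in> verts Q" "head D b \<in> verts Q" "head D b' \<in> verts Q" using D_verts assms by auto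
  have "intertwiner \<Gamma> (\<delta> (head D b')) (\<tau> (head D b')) (2 * \<delta> (tail D b))
    (\<lambda>g. kronecker_product (twist (tail D b) g) (\<tau> (tail D b) g)) (block_mat b')"
    using block_mat_intertwiner[OF assms(2)] assms(3) by simp
  from intertwiner_mult[OF block_mat_intertwiner[OF assms(1)] intertwiner_adjoint[OF this unitary[OF v(3)] unitary_block[OF v(1)]]]
  show ?thesis using rep_carrier[OF v(2)] rep_carrier[OF v(3)] unitary_mapD(1)[OF unitary_block[OF v(1)]] by blast
qed

text \<open>The Gram matrix is an intertwiner, hence zero for different tails and scalar for equal
  ones. The scalar is found from the trace, in which interchanging the sums leads back to the
  orthogonality of the arrows themselves.\<close>

lemma F_Inr_orthogonal:
  assumes a: "a \<in> arcs Q" and a': "a' \<in> arcs Q" "head Q a' = head Q a"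
    and r: "r < \<delta> (tail Q a)" "r' < \<delta> (tail Q a')"
  shows "(\<Sum>k\<in>UNIV. \<Sum>m<\<delta> (head Q a). F (Inr a) k r m * cnj (F (Inr a') k r' m))
    = of_bool (a = a' \<and> r = r') * of_nat (\<delta> (head Q a))"
proof -
  let ?M = "block_mat (Inr a) * mat_adjoint (block_mat (Inr a'))"
  have M: "intertwiner \<Gamma> (\<delta> (tail Q a)) (\<tau> (tail Q a)) (\<delta> (tail Q a')) (\<tau> (tail Q a')) ?M"
    using block_mat_gram_intertwiner[of "Inr a" "Inr a'"] a a' by auto
  have gram: "?M $$ (r, r') = (\<Sum>k\<in>UNIV. \<Sum>m<\<delta> (head Q a). F (Inr a) k r m * cnj (F (Inr a') k r' m))"
    if "r < \<delta> (tail Q a)" "r' < \<delta> (tail Q a')" for r r'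
    using block_mat_gram[of "Inr a'" "Inr a" r r'] a' that by simp
  note v = arc_verts(1)[OF a] arc_verts(1)[OF a'(1)]
  have "?M $$ (r, r') = of_bool (a = a' \<and> r = r') * of_nat (\<delta> (head Q a))"
  proof (cases "tail Q a' = tail Q a")
    case False
    have "?M = 0\<^sub>m (\<delta> (tail Q a)) (\<delta> (tail Q a'))"
      by (rule schur_zero[OF irreducible[OF v(2)] irreducible[OF v(1)] _ M unitary[OF v(2)] unitary[OF v(1)]
            not_iso[OF v(2,1) False]]) simp
    moreover have "a \<noteq> a'" using False by blast
    ultimately show ?thesis using r by simp
  next
    case True
    have M': "intertwiner \<Gamma> (\<delta> (tail Q a)) (\<tau> (tail Q a)) (\<delta> (tail Q a)) (\<tau> (tail Q a)) ?M"
      using M True by simp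
    obtain x where x: "?M = x \<cdot>\<^sub>m 1\<^sub>m (\<delta> (tail Q a))"
      by (rule schur_scalar[OF irreducible[OF v(1)] _ M']) (use rep_carrier[OF v(1)] in auto)
    have Inr: "F (Inr a) k m c = cnj (F (Inl a) k c m)" for a k m c using F_reverse[of "Inl a"] by simp
    have "of_nat (\<delta> (tail Q a)) * x = (\<Sum>r<\<delta> (tail Q a). ?M $$ (r, r))" by (simp add: x)
    also have "\<dots> = (\<Sum>r<\<delta> (tail Q a). \<Sum>k\<in>UNIV. \<Sum>m<\<delta> (head Q a). F (Inl a') k m r * cnj (F (Inl a) k m r))"
      using gram True by (intro sum.cong refl) (simp add: Inr mult.commute)
    also have "\<dots> = (\<Sum>m<\<delta> (head Q a). \<Sum>k\<in>UNIV. \<Sum>r<\<delta> (tail Q a). F (Inl a') k m r * cnj (F (Inl a) k m r))"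
      unfolding sum.swap[of _ "{..<\<delta> (tail Q a)}" UNIV] sum.swap[of _ "{..<\<delta> (head Q a)}" UNIV]
      by (intro sum.cong refl sum.swap)
    also have "\<dots> = (\<Sum>m<\<delta> (head Q a). of_bool (a' = a) * of_nat (\<delta> (tail Q a)))"
    proof (intro sum.cong refl)
      fix m assume "m \<in> {..<\<delta> (head Q a)}"
      then show "(\<Sum>k\<in>UNIV. \<Sum>r<\<delta> (tail Q a). F (Inl a') k m r * cnj (F (Inl a) k m r))
        = of_bool (a' = a) * of_nat (\<delta> (tail Q a))"
        using F_Inl_orthogonal[OF a'(1) a True[symmetric], of m m] a'(2) True by simp
    qed
    finally have "of_nat (\<delta> (tail Q a)) * x = of_nat (\<delta> (tail Q a)) * (of_bool (a = a') * of_nat (\<delta> (head Q a)))"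
      by (auto simp: mult_ac)
    then have "x = of_bool (a = a') * of_nat (\<delta> (head Q a))"
      using dim_pos[OF v(1)] by simp
    then show ?thesis using x r True by auto
  qed
  then show ?thesis using gram[OF r] by simp
qed

lemma F_orthogonal:
  assumes b: "b \<in> arcs D" "b' \<in> arcs D" "tail D b = tail D b'"
    and r: "r < \<delta> (head D b)" "r' < \<delta> (head D b')"
  shows "(\<Sum>k\<in>UNIV. \<Sum>m<\<delta> (tail D b). F b k r m * cnj (F b' k r' m))
    = of_bool (b = b' \<and> r = r') * of_nat (\<delta> (tail D b))"
proof (cases b; cases b')
  fix a a' assume "b = Inl a" "b' = Inl a'"
  then show ?thesis using F_Inl_orthogonal[of a a' r r'] b r by auto
next
  fix a a' assume "b = Inr a" "b' = Inr a'"
  then show ?thesis using F_Inr_orthogonal[of a a' r r'] b r by auto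
next
  \<comment> \<open>An arrow starts at an odd vertex and a reversed arrow at an even one, so the
    mixed cases cannot occur.\<close>
  fix a a' assume "b = Inl a" "b' = Inr a'"
  then have "a \<in> arcs Q" "a' \<in> arcs Q" "tail Q a = head Q a'" using b by auto
  then show ?thesis using bip by metis
next
  fix a a' assume "b = Inr a" "b' = Inl a'"
  then have "a \<in> arcs Q" "a' \<in> arcs Q" "head Q a = tail Q a'" using b by auto
  then show ?thesis using bip by metis
qed

abbreviation out where "out i \<equiv> {b \<in> arcs D. tail D b = i}"

lemma sum_out_arcs: "(\<Sum>i\<in>verts Q. \<Sum>b\<in>out i. f b) = (\<Sum>b\<in>arcs D. f b)"
  using finite_verts D_verts by (intro sum.group) auto

lemma tits_zero: "(\<Sum>i\<in>verts Q. real (\<delta> i) * (2 * real (\<delta> i) - real (\<Sum>b\<in>out i. \<delta> (head D b)))) = 0"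
proof -
  have "tits_form Q (\<lambda>i. int (\<delta> i)) = 0"
    using root by (simp add: minimal_imaginary_root_def positive_imaginary_root_def)
  then have "int (\<Sum>i\<in>verts Q. \<delta> i * \<delta> i) = int (\<Sum>a\<in>arcs Q. \<delta> (tail Q a) * \<delta> (head Q a))"
    by (simp add: tits_form_def)
  then have t: "(\<Sum>i\<in>verts Q. \<delta> i * \<delta> i) = (\<Sum>a\<in>arcs Q. \<delta> (tail Q a) * \<delta> (head Q a))"
    by (simp only: of_nat_eq_iff)
  have "(\<Sum>i\<in>verts Q. \<delta> i * (\<Sum>b\<in>out i. \<delta> (head D b))) = (\<Sum>i\<in>verts Q. \<Sum>b\<in>out i. \<delta> (tail D b) * \<delta> (head D b))"
    by (simp add: sum_distrib_left)
  also have "\<dots> = (\<Sum>b\<in>arcs D. \<delta> (tail D b) * \<delta> (head D b))" by (rule sum_out_arcs)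
  also have "\<dots> = 2 * (\<Sum>a\<in>arcs Q. \<delta> (tail Q a) * \<delta> (head Q a))"
    using finite_arcs by (simp add: sum.Plus mult.commute)
  finally have "real (\<Sum>i\<in>verts Q. \<delta> i * (\<Sum>b\<in>out i. \<delta> (head D b))) = 2 * real (\<Sum>i\<in>verts Q. \<delta> i * \<delta> i)"
    unfolding t[symmetric] by simp
  then show ?thesis by (simp add: right_diff_distrib sum_subtractf sum_distrib_left mult_ac)
qed

text \<open>
  Bessel's inequality bounds the total dimension of the neighbours of every vertex \<open>i\<close> by \<open>2 \<delta>\<^sub>i\<close>, and
  the defects, weighted by \<open>\<delta>\<^sub>i\<close>, add up to twice the Tits form, which is zero.
\<close>

lemma out_dims_and_complete:
  assumes i: "i \<in> verts Q"
  shows "(\<Sum>b\<in>out i. \<delta> (head D b)) = 2 * \<delta> i"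
    and "c < \<delta> i \<Longrightarrow> c' < \<delta> i \<Longrightarrow> (\<Sum>b\<in>out i. \<Sum>m<\<delta> (head D b). cnj (F b k m c) * F b l m c')
      = of_bool (k = l \<and> c = c') * of_nat (\<delta> i)"
proof -
  define R where "R i = Sigma (out i) (\<lambda>b. {..<\<delta> (head D b)})" for i
  define C where "C i = (UNIV :: bool set) \<times> {..<\<delta> i}" for i
  define \<Psi> where "\<Psi> = (\<lambda>(b, r) (k, c). F b k r c)"
  define N where "N i = (\<Sum>c\<in>C i. \<Sum>c'\<in>C i.
    (cmod (of_bool (c = c') - (\<Sum>r\<in>R i. cnj (\<Psi> r c) * \<Psi> r c') / of_nat (\<delta> i)))\<^sup>2)" for i
  have fin: "finite (R i)" "finite (C i)" for i by (simp_all add: R_def C_def)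
  have N: "N i = 2 * real (\<delta> i) - real (\<Sum>b\<in>out i. \<delta> (head D b))" if i: "i \<in> verts Q" for i
  proof -
    have "N i = real (card (C i)) - real (card (R i))"
      unfolding N_def
    proof (rule bessel[OF fin dim_pos[OF i]])
      fix p q assume pq: "p \<in> R i" "q \<in> R i"
      obtain b r b' r' where p: "p = (b, r)" and q: "q = (b', r')" by (cases p, cases q)
      have br: "b \<in> arcs D" "b' \<in> arcs D" "tail D b = i" "tail D b' = i" "r < \<delta> (head D b)" "r' < \<delta> (head D b')"
        using pq by (auto simp: p q R_def)
      have "(\<Sum>c\<in>C i. \<Psi> p c * cnj (\<Psi> q c)) = (\<Sum>(k, m)\<in>UNIV \<times> {..<\<delta> i}. F b k r m * cnj (F b' k r' m))"
        by (simp add: C_def \<Psi>_def p q case_prod_unfold)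
      also have "\<dots> = (\<Sum>k\<in>UNIV. \<Sum>m<\<delta> i. F b k r m * cnj (F b' k r' m))"
        by (rule sum.cartesian_product[symmetric])
      also have "\<dots> = of_bool (p = q) * of_nat (\<delta> i)"
        using F_orthogonal[of b b' r r'] br by (simp add: p q)
      finally show "(\<Sum>c\<in>C i. \<Psi> p c * cnj (\<Psi> q c)) = of_bool (p = q) * of_nat (\<delta> i)" .
    qed
    then show ?thesis by (simp add: C_def R_def card_cartesian_product card_SigmaI)
  qed
  have N0: "0 \<le> N i" for i unfolding N_def by (intro sum_nonneg) simp
  have "(\<Sum>i\<in>verts Q. real (\<delta> i) * N i) = 0" using tits_zero N by simp
  then have "\<forall>i\<in>verts Q. real (\<delta> i) * N i = 0"
    using N0 finite_verts by (subst (asm) sum_nonneg_eq_0_iff) auto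
  then have Ni: "N i = 0" using i dim_pos[OF i] by auto
  have "real (\<Sum>b\<in>out i. \<delta> (head D b)) = real (2 * \<delta> i)" using N[OF i] Ni by simp
  then show "(\<Sum>b\<in>out i. \<delta> (head D b)) = 2 * \<delta> i" by (simp only: of_nat_eq_iff)
  assume c: "c < \<delta> i" "c' < \<delta> i"
  \<comment> \<open>The defect is itself a sum of squares; where it vanishes, each entry of the
    complementary projection does, and this is completeness.\<close>
  have "\<forall>p\<in>C i. (\<Sum>c'\<in>C i. (cmod (of_bool (p = c') - (\<Sum>r\<in>R i. cnj (\<Psi> r p) * \<Psi> r c') / of_nat (\<delta> i)))\<^sup>2) = 0"
    using Ni fin unfolding N_def by (subst (asm) sum_nonneg_eq_0_iff) (auto intro: sum_nonneg)
  then have "\<forall>p\<in>C i. \<forall>q\<in>C i. (cmod (of_bool (p = q) - (\<Sum>r\<in>R i. cnj (\<Psi> r p) * \<Psi> r q) / of_nat (\<delta> i)))\<^sup>2 = 0"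
    using fin by (subst (asm) sum_nonneg_eq_0_iff) auto
  moreover have "(k, c) \<in> C i" "(l, c') \<in> C i" using c by (auto simp: C_def)
  ultimately have "(cmod (of_bool ((k, c) = (l, c')) - (\<Sum>r\<in>R i. cnj (\<Psi> r (k, c)) * \<Psi> r (l, c')) / of_nat (\<delta> i)))\<^sup>2 = 0"
    by blast
  then have "(\<Sum>r\<in>R i. cnj (\<Psi> r (k, c)) * \<Psi> r (l, c')) = of_bool (k = l \<and> c = c') * of_nat (\<delta> i)"
    using dim_pos[OF i] by (simp add: field_simps)
  moreover have "(\<Sum>b\<in>out i. \<Sum>m<\<delta> (head D b). cnj (F b k m c) * F b l m c')
    = (\<Sum>(b, m)\<in>R i. cnj (F b k m c) * F b l m c')"
    unfolding R_def by (rule sum.Sigma) auto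
  moreover have "\<dots> = (\<Sum>r\<in>R i. cnj (\<Psi> r (k, c)) * \<Psi> r (l, c'))"
    by (intro sum.cong refl) (auto simp: \<Psi>_def)
  ultimately show "(\<Sum>b\<in>out i. \<Sum>m<\<delta> (head D b). cnj (F b k m c) * F b l m c')
      = of_bool (k = l \<and> c = c') * of_nat (\<delta> i)" by simp
qed

end

section \<open>Characters of the group and its element -1\<close>

context mckay_data
begin

lemma group_inverse:
  assumes "h \<in> \<Gamma>" "g \<in> \<Gamma>"
  shows "g * h * mat_adjoint h = g" "g * mat_adjoint h * h = g"
proof -
  have c: "g \<in> carrier_mat 2 2" "h \<in> carrier_mat 2 2" "mat_adjoint h \<in> carrier_mat 2 2"
    using group_SU2D assms by auto
  show "g * h * mat_adjoint h = g"
    using assoc_mult_mat[OF c(1,2,3)] group_SU2D(6)[OF assms(1)] right_mult_one_mat[OF c(1)] by simp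
  show "g * mat_adjoint h * h = g"
    using assoc_mult_mat[OF c(1,3,2)] group_SU2D(3)[OF assms(1)] right_mult_one_mat[OF c(1)] by simp
qed

lemma sum_group_shift: "h \<in> \<Gamma> \<Longrightarrow> (\<Sum>g\<in>\<Gamma>. f (g * h)) = (\<Sum>g\<in>\<Gamma>. f g)"
  by (rule sum.reindex_bij_witness[where i = "\<lambda>g. g * mat_adjoint h" and j = "\<lambda>g. g * h"])
    (auto simp: group_inverse mult_in_group group_SU2D(5))

lemma rep_unitary_index:
  assumes j: "j \<in> verts Q" and g: "g \<in> \<Gamma>" and r: "r < \<delta> j" "c < \<delta> j"
  shows "(\<Sum>m<\<delta> j. cnj (\<tau> j g $$ (m, r)) * \<tau> j g $$ (m, c)) = of_bool (r = c)"
    and "(\<Sum>m<\<delta> j. cnj (\<tau> j g $$ (r, m)) * \<tau> j g $$ (c, m)) = of_bool (r = c)"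
proof -
  note u = unitary_mapD[OF unitary[OF j] g]
  have "(mat_adjoint (\<tau> j g) * \<tau> j g) $$ (r, c) = (\<Sum>m<\<delta> j. cnj (\<tau> j g $$ (m, r)) * \<tau> j g $$ (m, c))"
    unfolding mult_mat_index[OF mat_adjoint_carrier[OF u(1)] u(1) r]
    using u(1) r by (intro sum.cong refl) simp
  then show "(\<Sum>m<\<delta> j. cnj (\<tau> j g $$ (m, r)) * \<tau> j g $$ (m, c)) = of_bool (r = c)"
    using u(2) r by auto
  have "(\<tau> j g * mat_adjoint (\<tau> j g)) $$ (c, r) = (\<Sum>m<\<delta> j. cnj (\<tau> j g $$ (r, m)) * \<tau> j g $$ (c, m))"
    unfolding mult_mat_index[OF u(1) mat_adjoint_carrier[OF u(1)] r(2,1)]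
    using u(1) r by (intro sum.cong refl) (simp add: mult.commute)
  then show "(\<Sum>m<\<delta> j. cnj (\<tau> j g $$ (r, m)) * \<tau> j g $$ (c, m)) = of_bool (r = c)"
    using u(3) r by auto
qed

text \<open>\<open>M\<close> is the sum over \<Gamma> of the adjoint of \<open>\<tau> j g\<close>
  times a matrix unit times \<open>\<tau> i g\<close>. Summing over the group makes it an
  intertwiner; it is zero for i \<noteq> j, and for i = j it is a scalar determined by its
  trace.\<close>

lemma schur_orthogonality:
  assumes i: "i \<in> verts Q" and j: "j \<in> verts Q" and r: "r < \<delta> j" "r' < \<delta> j" and c: "c < \<delta> i" "c' < \<delta> i"
  shows "(\<Sum>g\<in>\<Gamma>. cnj (\<tau> j g $$ (r, r')) * \<tau> i g $$ (c, c'))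
    = of_bool (i = j \<and> r = c \<and> r' = c') * (of_nat (card \<Gamma>) / of_nat (\<delta> j))"
proof -
  define M where "M = mat (\<delta> j) (\<delta> i) (\<lambda>(a, b). \<Sum>g\<in>\<Gamma>. cnj (\<tau> j g $$ (r, a)) * \<tau> i g $$ (c, b))"
  have Mc: "M \<in> carrier_mat (\<delta> j) (\<delta> i)" by (simp add: M_def)
  have Mi: "M $$ (a, b) = (\<Sum>g\<in>\<Gamma>. cnj (\<tau> j g $$ (r, a)) * \<tau> i g $$ (c, b))" if "a < \<delta> j" "b < \<delta> i" for a b
    using that by (simp add: M_def)
  have M: "intertwiner \<Gamma> (\<delta> j) (\<tau> j) (\<delta> i) (\<tau> i) M"
    unfolding intertwiner_def
  proof (intro conjI ballI Mc)
    fix h assume h: "h \<in> \<Gamma>"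
    note hi = rep_carrier[OF i h] and hj = rep_carrier[OF j h]
    show "M * \<tau> i h = \<tau> j h * M"
    proof (rule eq_matI)
      fix a b assume "a < dim_row (\<tau> j h * M)" "b < dim_col (\<tau> j h * M)"
      then have ab: "a < \<delta> j" "b < \<delta> i" using hj Mc by auto
      have col: "(\<Sum>m<\<delta> j. \<tau> j h $$ (a, m) * cnj (\<tau> j (g * h) $$ (r, m))) = cnj (\<tau> j g $$ (r, a))"
        if g: "g \<in> \<Gamma>" for g
      proof -
        note gj = rep_carrier[OF j g]
        have "(\<Sum>m<\<delta> j. \<tau> j h $$ (a, m) * cnj (\<tau> j (g * h) $$ (r, m)))
          = (\<Sum>m<\<delta> j. \<tau> j h $$ (a, m) * (\<Sum>p<\<delta> j. cnj (\<tau> j g $$ (r, p)) * cnj (\<tau> j h $$ (p, m))))"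
          using rep_mult[OF j g h] r(1) by (intro sum.cong refl) (simp add: mult_mat_index[OF gj hj] del: index_mult_mat)
        also have "\<dots> = (\<Sum>p<\<delta> j. cnj (\<tau> j g $$ (r, p)) * (\<Sum>m<\<delta> j. cnj (\<tau> j h $$ (p, m)) * \<tau> j h $$ (a, m)))"
          unfolding sum_distrib_left by (subst sum.swap) (simp add: mult_ac)
        also have "\<dots> = (\<Sum>p<\<delta> j. cnj (\<tau> j g $$ (r, p)) * of_bool (p = a))"
          using rep_unitary_index(2)[OF j h] ab by simp
        also have "\<dots> = cnj (\<tau> j g $$ (r, a))" by (rule sum_of_bool_mult(4)[OF ab(1)])
        finally show ?thesis .
      qed
      \<comment> \<open>The sum over the group is shifted by \<open>h\<close>, after which unitarity
        absorbs the factor \<open>\<tau> j h\<close>.\<close>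
      have "(\<tau> j h * M) $$ (a, b) = (\<Sum>m<\<delta> j. \<tau> j h $$ (a, m) * (\<Sum>g\<in>\<Gamma>. cnj (\<tau> j (g * h) $$ (r, m)) * \<tau> i (g * h) $$ (c, b)))"
        unfolding mult_mat_index[OF hj Mc ab]
        using Mi ab sum_group_shift[OF h, of "\<lambda>g. cnj (\<tau> j g $$ (r, _)) * \<tau> i g $$ (c, b)"] by simp
      also have "\<dots> = (\<Sum>g\<in>\<Gamma>. (\<Sum>m<\<delta> j. \<tau> j h $$ (a, m) * cnj (\<tau> j (g * h) $$ (r, m))) * \<tau> i (g * h) $$ (c, b))"
        unfolding sum_distrib_left sum_distrib_right by (subst sum.swap) (simp add: mult_ac)
      also have "\<dots> = (\<Sum>g\<in>\<Gamma>. cnj (\<tau> j g $$ (r, a)) * (\<Sum>m<\<delta> i. \<tau> i g $$ (c, m) * \<tau> i h $$ (m, b)))"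
        using col rep_mult[OF i _ h] mult_mat_index[OF rep_carrier[OF i] hi c(1) ab(2)] by simp
      also have "\<dots> = (\<Sum>m<\<delta> i. (\<Sum>g\<in>\<Gamma>. cnj (\<tau> j g $$ (r, a)) * \<tau> i g $$ (c, m)) * \<tau> i h $$ (m, b))"
        unfolding sum_distrib_left sum_distrib_right by (subst sum.swap) (simp add: mult_ac)
      also have "\<dots> = (M * \<tau> i h) $$ (a, b)"
        unfolding mult_mat_index[OF Mc hi ab] using Mi ab by simp
      finally show "(M * \<tau> i h) $$ (a, b) = (\<tau> j h * M) $$ (a, b)" ..
    qed (use Mc hi hj in auto)
  qed
  show ?thesis
  proof (cases "i = j")
    case False
    have "M = 0\<^sub>m (\<delta> j) (\<delta> i)"
      by (rule schur_zero[OF irreducible[OF i] irreducible[OF j] _ M unitary[OF i] unitary[OF j] not_iso[OF i j False]]) simp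
    then have "M $$ (r', c') = 0" using r c by simp
    then show ?thesis using Mi r c False by simp
  next
    case True
    have M': "intertwiner \<Gamma> (\<delta> j) (\<tau> j) (\<delta> j) (\<tau> j) M" using M True by simp
    obtain x where x: "M = x \<cdot>\<^sub>m 1\<^sub>m (\<delta> j)"
      by (rule schur_scalar[OF irreducible[OF j] _ M']) (use rep_carrier[OF j] in auto)
    have cj: "c < \<delta> j" "c' < \<delta> j" using c True by simp_all
    have "of_nat (\<delta> j) * x = (\<Sum>a<\<delta> j. M $$ (a, a))" by (simp add: x)
    also have "\<dots> = (\<Sum>g\<in>\<Gamma>. \<Sum>a<\<delta> j. cnj (\<tau> j g $$ (r, a)) * \<tau> j g $$ (c, a))"
      using Mi True by (subst sum.swap) simp
    also have "\<dots> = of_nat (card \<Gamma>) * of_bool (r = c)"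
      using rep_unitary_index(2)[OF j _ r(1) cj(1)] by simp
    finally have "x = of_bool (r = c) * (of_nat (card \<Gamma>) / of_nat (\<delta> j))"
      using dim_pos[OF j] by (simp add: field_simps)
    moreover have "(\<Sum>g\<in>\<Gamma>. cnj (\<tau> j g $$ (r, r')) * \<tau> i g $$ (c, c')) = x * of_bool (r' = c')"
      using Mi[of r' c'] r c cj True x by (cases "r' = c'") auto
    ultimately show ?thesis using True by auto
  qed
qed

sublocale I: intertwiners Q Ev \<delta> lam \<Gamma> "\<lambda>j g r c. \<tau> j g $$ (r, c)" F
proof unfold_locales
  show "\<And>a. a \<in> arcs Q \<Longrightarrow> tail Q a \<notin> Ev" "\<And>a. a \<in> arcs Q \<Longrightarrow> head Q a \<in> Ev" using bip by auto
  show "\<And>j. j \<in> verts Q \<Longrightarrow> 0 < \<delta> j" by (rule dim_pos)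
  show "\<And>j. j \<in> verts Q \<Longrightarrow> lam j = (if j \<in> Ev then of_nat (\<delta> j) else - of_nat (\<delta> j))" using lam_eq by blast
  show "finite \<Gamma>" by (rule finite_group)
  show "\<Gamma> \<noteq> {}" using one_in_group by blast
next
  fix j g r c assume "j \<in> verts Q" "g \<in> \<Gamma>" "r < \<delta> j" "c < \<delta> j"
  then show "(\<Sum>m<\<delta> j. cnj (\<tau> j g $$ (m, r)) * \<tau> j g $$ (m, c)) = of_bool (r = c)"
    by (rule rep_unitary_index)
next
  fix i j r r' c c' assume "i \<in> verts Q" "j \<in> verts Q" "r < \<delta> j" "r' < \<delta> j" "c < \<delta> i" "c' < \<delta> i"
  then show "(\<Sum>g\<in>\<Gamma>. cnj (\<tau> j g $$ (r, r')) * \<tau> i g $$ (c, c'))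
    = of_bool (i = j \<and> r = c \<and> r' = c') * (of_nat (card \<Gamma>) / of_nat (\<delta> j))"
    by (rule schur_orthogonality)
next
  fix b k r c show "F (reverse_arrow b) k r c = cnj (F b k c r)" by (rule F_reverse)
next
  fix b b' r r' assume "b \<in> arcs D" "b' \<in> arcs D" "tail D b = tail D b'" "r < \<delta> (head D b)" "r' < \<delta> (head D b')"
  then show "(\<Sum>k\<in>UNIV. \<Sum>m<\<delta> (tail D b). F b k r m * cnj (F b' k r' m))
    = of_bool (b = b' \<and> r = r') * of_nat (\<delta> (tail D b))" by (rule F_orthogonal)
next
  fix i c c' k l assume "i \<in> verts Q" "c < \<delta> i" "c' < \<delta> i"
  then show "(\<Sum>b | b \<in> arcs D \<and> tail D b = i. \<Sum>m<\<delta> (head D b). cnj (F b k m c) * F b l m c')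
    = of_bool (k = l \<and> c = c') * of_nat (\<delta> i)" by (rule out_dims_and_complete(2))
next
  fix b g r c k assume b: "b \<in> arcs D" "g \<in> \<Gamma>" "r < \<delta> (head D b)" "c < \<delta> (tail D b)"
  show "(\<Sum>m<\<delta> (head D b). \<tau> (head D b) g $$ (r, m) * F b k m c)
    = (\<Sum>l\<in>UNIV. \<Sum>m<\<delta> (tail D b). (if tail D b \<in> Ev then cnj (g $$ (bool_index l, bool_index k))
        else g $$ (bool_index l, bool_index k)) * F b l r m * \<tau> (tail D b) g $$ (m, c))"
    using F_equivariant[OF b, of k] twist_index[OF b(2), of "tail D b"] by simp
qed

definition character :: "'v \<Rightarrow> complex mat \<Rightarrow> complex" where
  "character i g = (\<Sum>r<\<delta> i. \<tau> i g $$ (r, r))"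

text \<open>V \<otimes> V_i is the sum of the neighbours of V_i. In terms of \<open>F\<close>:
  orthogonality inserts a unit at each neighbour, equivariance moves \<open>g\<close> to the side of
  \<open>i\<close>, and completeness evaluates the sum over the arrows.\<close>

lemma character_mult:
  assumes i: "i \<in> verts Q" and g: "g \<in> \<Gamma>"
  shows "(\<Sum>k\<in>UNIV. g $$ (bool_index k, bool_index k)) * character i g = (\<Sum>b\<in>out i. character (head D b) g)"
proof -
  let ?w = "\<lambda>l k. twist i g $$ (bool_index l, bool_index k)"
  \<comment> \<open>Traces in SU(2) are real, so V and its dual have the same character.\<close>
  have "g $$ (1, 1) = cnj (g $$ (0, 0))" using SU2_entries(1)[OF group_SU2D(1)[OF g]] .
  then have tr: "(\<Sum>k\<in>UNIV. g $$ (bool_index k, bool_index k)) = (\<Sum>k\<in>UNIV. ?w k k)"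
    unfolding twist_index[OF g] by (simp add: UNIV_bool bool_index_def)
  have one: "of_nat (\<delta> i) * character (head D b) g
    = (\<Sum>r<\<delta> (head D b). \<Sum>k\<in>UNIV. \<Sum>c<\<delta> i. \<Sum>l\<in>UNIV. \<Sum>m<\<delta> i.
        ?w l k * \<tau> i g $$ (m, c) * (cnj (F b k r c) * F b l r m))" if b: "b \<in> out i" for b
  proof -
    have b': "b \<in> arcs D" "tail D b = i" using b by auto
    have "of_nat (\<delta> i) * character (head D b) g = (\<Sum>r<\<delta> (head D b). \<Sum>m'<\<delta> (head D b). \<tau> (head D b) g $$ (r, m') *
        (\<Sum>k\<in>UNIV. \<Sum>c<\<delta> i. F b k m' c * cnj (F b k r c)))"
    proof -
      have "(\<Sum>m'<\<delta> (head D b). \<tau> (head D b) g $$ (r, m') * (\<Sum>k\<in>UNIV. \<Sum>c<\<delta> i. F b k m' c * cnj (F b k r c)))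
        = of_nat (\<delta> i) * \<tau> (head D b) g $$ (r, r)" if r: "r < \<delta> (head D b)" for r
      proof -
        have "(\<Sum>m'<\<delta> (head D b). \<tau> (head D b) g $$ (r, m') * (\<Sum>k\<in>UNIV. \<Sum>c<\<delta> i. F b k m' c * cnj (F b k r c)))
          = (\<Sum>m'<\<delta> (head D b). (\<tau> (head D b) g $$ (r, m') * of_nat (\<delta> i)) * of_bool (m' = r))"
          using F_orthogonal[OF b'(1) b'(1) refl _ r] b'(2) by (intro sum.cong refl) simp
        also have "\<dots> = \<tau> (head D b) g $$ (r, r) * of_nat (\<delta> i)" by (rule sum_of_bool_mult(4)[OF r])
        finally show ?thesis by simp
      qed
      then show ?thesis by (simp add: character_def sum_distrib_left)
    qed
    also have "\<dots> = (\<Sum>r<\<delta> (head D b). \<Sum>k\<in>UNIV. \<Sum>c<\<delta> i. (\<Sum>m'<\<delta> (head D b). \<tau> (head D b) g $$ (r, m') * F b k m' c) * cnj (F b k r c))"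
    proof (intro sum.cong refl)
      fix r
      show "(\<Sum>m'<\<delta> (head D b). \<tau> (head D b) g $$ (r, m') * (\<Sum>k\<in>UNIV. \<Sum>c<\<delta> i. F b k m' c * cnj (F b k r c)))
        = (\<Sum>k\<in>UNIV. \<Sum>c<\<delta> i. (\<Sum>m'<\<delta> (head D b). \<tau> (head D b) g $$ (r, m') * F b k m' c) * cnj (F b k r c))"
        unfolding sum_distrib_left sum_distrib_right mult.assoc
        by (rule trans[OF sum.swap]) (intro sum.cong refl sum.swap)
    qed
    also have "\<dots> = (\<Sum>r<\<delta> (head D b). \<Sum>k\<in>UNIV. \<Sum>c<\<delta> i. (\<Sum>l\<in>UNIV. \<Sum>m<\<delta> i. ?w l k * F b l r m * \<tau> i g $$ (m, c)) * cnj (F b k r c))"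
      using F_equivariant[OF b'(1) g] b'(2) by simp
    finally show ?thesis by (simp add: sum_distrib_left sum_distrib_right mult_ac)
  qed
  have "of_nat (\<delta> i) * (\<Sum>b\<in>out i. character (head D b) g)
    = (\<Sum>b\<in>out i. \<Sum>r<\<delta> (head D b). \<Sum>k\<in>UNIV. \<Sum>c<\<delta> i. \<Sum>l\<in>UNIV. \<Sum>m<\<delta> i.
        ?w l k * \<tau> i g $$ (m, c) * (cnj (F b k r c) * F b l r m))"
    unfolding sum_distrib_left using one by simp
  also have "\<dots> = (\<Sum>k\<in>UNIV. \<Sum>c<\<delta> i. \<Sum>b\<in>out i. \<Sum>r<\<delta> (head D b). \<Sum>l\<in>UNIV. \<Sum>m<\<delta> i.
        ?w l k * \<tau> i g $$ (m, c) * (cnj (F b k r c) * F b l r m))"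
    by (rule sum_swap_pairs)
  also have "\<dots> = (\<Sum>k\<in>UNIV. \<Sum>c<\<delta> i. \<Sum>l\<in>UNIV. \<Sum>m<\<delta> i. ?w l k * \<tau> i g $$ (m, c) *
        (\<Sum>b\<in>out i. \<Sum>r<\<delta> (head D b). cnj (F b k r c) * F b l r m))"
    unfolding sum_distrib_left by (intro sum.cong refl sum_swap_pairs)
  also have "\<dots> = (\<Sum>k\<in>UNIV. \<Sum>c<\<delta> i. \<Sum>l\<in>UNIV. \<Sum>m<\<delta> i. ?w l k * \<tau> i g $$ (m, c) *
        (of_bool (k = l \<and> c = m) * of_nat (\<delta> i)))"
    using out_dims_and_complete(2)[OF i] by simp
  also have "\<dots> = (\<Sum>k\<in>UNIV. \<Sum>c<\<delta> i. \<Sum>l\<in>UNIV. \<Sum>m<\<delta> i. if l = k \<and> m = c then of_nat (\<delta> i) * (?w k k * \<tau> i g $$ (c, c)) else 0)"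
    by (intro sum.cong refl) auto
  also have "\<dots> = (\<Sum>k\<in>UNIV. \<Sum>c<\<delta> i. of_nat (\<delta> i) * (?w k k * \<tau> i g $$ (c, c)))"
    by (intro sum.cong refl sum_delta_pair[where d = "\<lambda>_. \<delta> i"]) auto
  also have "\<dots> = of_nat (\<delta> i) * ((\<Sum>k\<in>UNIV. ?w k k) * character i g)"
    unfolding character_def sum_product unfolding sum_distrib_left ..
  finally show ?thesis using dim_pos[OF i] unfolding tr by simp
qed

lemma v0_trivial: "\<delta> v0 = 1" "g \<in> \<Gamma> \<Longrightarrow> \<tau> v0 g $$ (0, 0) = 1"
proof -
  show d: "\<delta> v0 = 1" using mckayD(5) mckayD(2)[OF v0_vert] by (simp add: rep_iso_def)
  assume g: "g \<in> \<Gamma>"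
  obtain P where P: "P \<in> Units (ring_mat TYPE(complex) 1 ())" "\<forall>g\<in>\<Gamma>. P * \<tau> v0 g = 1\<^sub>m 1 * P"
    using mckayD(5) mckayD(2)[OF v0_vert] d by (auto simp: rep_iso_def)
  from P(1) obtain P' where P': "P \<in> carrier_mat 1 1" "P' \<in> carrier_mat 1 1" "P' * P = 1\<^sub>m 1"
    by (rule Units_ring_mat)
  have t: "\<tau> v0 g \<in> carrier_mat 1 1" using rep_carrier[OF v0_vert g] d by simp
  have "P' * (P * \<tau> v0 g) = P' * P" using P(2) g P'(1) left_mult_one_mat[OF P'(1)] by simp
  then have "\<tau> v0 g = 1\<^sub>m 1"
    using assoc_mult_mat[OF P'(2,1) t] P'(3) left_mult_one_mat[OF t] by simp
  then show "\<tau> v0 g $$ (0, 0) = 1" by simp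
qed

text \<open>
  The class function \<open>\<Sum> \<plusminus> \<delta>\<^sub>i \<chi>\<^sub>i\<close>, with the sign of the parity of \<open>i\<close>, has nonzero mean, and
  multiplying it by the character of the tautological representation amounts to multiplying it
  by \<open>- 2\<close>, because the McKay graph is bipartite. So some element has trace \<open>- 2\<close>.
\<close>

lemma minus_one_in_group: "- 1\<^sub>m 2 \<in> \<Gamma>"
proof -
  let ?s = "\<lambda>i. if i \<in> Ev then 1 else - 1 :: complex"
  define \<chi> where "\<chi> g = (\<Sum>i\<in>verts Q. ?s i * of_nat (\<delta> i) * character i g)" for g
  have tr: "(\<Sum>k\<in>UNIV. g $$ (bool_index k, bool_index k)) * \<chi> g = - 2 * \<chi> g" if g: "g \<in> \<Gamma>" for g
  proof -
    have "(\<Sum>k\<in>UNIV. g $$ (bool_index k, bool_index k)) * \<chi> g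
      = (\<Sum>i\<in>verts Q. ?s i * of_nat (\<delta> i) * ((\<Sum>k\<in>UNIV. g $$ (bool_index k, bool_index k)) * character i g))"
      unfolding \<chi>_def sum_distrib_left[of "\<Sum>k\<in>UNIV. g $$ (bool_index k, bool_index k)"] by (simp only: mult_ac)
    also have "\<dots> = (\<Sum>i\<in>verts Q. \<Sum>b\<in>out i. ?s (tail D b) * of_nat (\<delta> (tail D b)) * character (head D b) g)"
      using character_mult[OF _ g] by (simp add: sum_distrib_left)
    also have "\<dots> = (\<Sum>b\<in>arcs D. ?s (tail D b) * of_nat (\<delta> (tail D b)) * character (head D b) g)"
      by (rule sum_out_arcs)
    \<comment> \<open>Reversal of arrows exchanges tail and head. The two ends have opposite signs
      and the dimensions of the neighbours of i add up to 2 \<delta> i, whence the factor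
      -2.\<close>
    also have "\<dots> = (\<Sum>b\<in>arcs D. ?s (head D b) * of_nat (\<delta> (head D b)) * character (tail D b) g)"
      by (rule sum.reindex_bij_witness[where i = reverse_arrow and j = reverse_arrow]) auto
    also have "\<dots> = (\<Sum>b\<in>arcs D. - (?s (tail D b) * of_nat (\<delta> (head D b)) * character (tail D b) g))"
      using I.arc_parity by (intro sum.cong refl) simp
    also have "\<dots> = (\<Sum>i\<in>verts Q. \<Sum>b\<in>out i. - (?s (tail D b) * of_nat (\<delta> (head D b)) * character (tail D b) g))"
      by (rule sum_out_arcs[symmetric])
    also have "\<dots> = (\<Sum>i\<in>verts Q. - (?s i * of_nat (\<Sum>b\<in>out i. \<delta> (head D b)) * character i g))"
      by (simp add: sum_negf sum_distrib_left sum_distrib_right)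
    also have "\<dots> = - 2 * \<chi> g"
      using out_dims_and_complete(1) by (simp add: \<chi>_def sum_negf sum_distrib_left mult_ac)
    finally show ?thesis .
  qed
  \<comment> \<open>The mean of a character is its product with the trivial character, so only
    \<open>v0\<close> contributes.\<close>
  have mean: "(\<Sum>g\<in>\<Gamma>. character i g) = of_bool (i = v0) * of_nat (card \<Gamma>)" if i: "i \<in> verts Q" for i
  proof -
    have "(\<Sum>g\<in>\<Gamma>. character i g) = (\<Sum>c<\<delta> i. \<Sum>g\<in>\<Gamma>. cnj (\<tau> v0 g $$ (0, 0)) * \<tau> i g $$ (c, c))"
      unfolding character_def by (subst sum.swap) (simp add: v0_trivial(2))
    also have "\<dots> = (\<Sum>c<\<delta> i. of_bool (i = v0 \<and> 0 = c) * of_nat (card \<Gamma>))"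
      using schur_orthogonality[OF i v0_vert] v0_trivial(1) by (intro sum.cong refl) simp
    also have "\<dots> = of_bool (i = v0) * of_nat (card \<Gamma>)" using v0_trivial(1) by (cases "i = v0") simp_all
    finally show ?thesis .
  qed
  have "(\<Sum>g\<in>\<Gamma>. \<chi> g) = (\<Sum>i\<in>verts Q. ?s i * of_nat (\<delta> i) * (\<Sum>g\<in>\<Gamma>. character i g))"
    unfolding \<chi>_def sum_distrib_left by (rule sum.swap)
  also have "\<dots> = (\<Sum>i\<in>verts Q. if i = v0 then of_nat (card \<Gamma>) else 0)"
    by (intro sum.cong refl) (simp add: mean v0_even v0_trivial(1))
  also have "\<dots> = of_nat (card \<Gamma>)" using v0_vert finite_verts by simp
  finally have "(\<Sum>g\<in>\<Gamma>. \<chi> g) \<noteq> 0" using finite_group one_in_group by auto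
  then obtain g where g: "g \<in> \<Gamma>" "\<chi> g \<noteq> 0" by (meson sum.neutral)
  have "(\<Sum>k\<in>UNIV. g $$ (bool_index k, bool_index k)) = - 2"
    using tr[OF g(1)] g(2) by (metis mult_cancel_right)
  then have "g $$ (0, 0) + g $$ (1, 1) = - 2" by (simp add: UNIV_bool bool_index_def add.commute)
  from SU2_trace_minus_two[OF group_SU2D(1)[OF g(1)] this] g(1) show ?thesis by simp
qed

end

subsection \<open>Polynomial functions on the complex sphere\<close>

text \<open>The entries of (1 + pauli p) / 2, with \<open>False\<close> as the first index. On the
  sphere the square of \<open>pauli p\<close> is 1, so this is the idempotent of the point
  \<open>p\<close>.\<close>

fun sphere_proj :: "complex \<times> complex \<times> complex \<Rightarrow> bool \<Rightarrow> bool \<Rightarrow> complex" where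
  "sphere_proj (x, y, z) k l =
    (if k then (if l then (1 - z) / 2 else (x + \<i> * y) / 2) else (if l then (x - \<i> * y) / 2 else (1 + z) / 2))"

definition represents :: "complex \<times> complex \<times> complex \<Rightarrow> (bool \<Rightarrow> complex) \<Rightarrow> (bool \<Rightarrow> complex) \<Rightarrow> bool" where
  "represents p u v \<longleftrightarrow> (\<forall>k l. u k * v l = sphere_proj p k l)"

lemma sphere_proj_inj: "(\<And>k l. sphere_proj p k l = sphere_proj q k l) \<Longrightarrow> p = q"
proof -
  assume eq: "\<And>k l. sphere_proj p k l = sphere_proj q k l"
  obtain x y z x' y' z' where pq: "p = (x, y, z)" "q = (x', y', z')" by (cases p, cases q)
  have a: "x + \<i> * y = x' + \<i> * y'" "x - \<i> * y = x' - \<i> * y'" "1 + z = 1 + z'"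
  proof -
    have "(x + \<i> * y) / 2 = (x' + \<i> * y') / 2" "(x - \<i> * y) / 2 = (x' - \<i> * y') / 2" "(1 + z) / 2 = (1 + z') / 2"
      using eq[of True False] eq[of False True] eq[of False False]
      unfolding pq sphere_proj.simps if_True if_False .
    then show "x + \<i> * y = x' + \<i> * y'" "x - \<i> * y = x' - \<i> * y'" "1 + z = 1 + z'"
      unfolding divide_cancel_right by simp_all
  qed
  have "2 * x = (x + \<i> * y) + (x - \<i> * y)" by simp
  also have "\<dots> = 2 * x'" unfolding a(1,2) by simp
  finally have "x = x'" by simp
  then have "y = y'" using a(1) by simp
  then show ?thesis using \<open>x = x'\<close> a(3) by (simp add: pq)
qed

lemma represents_sum: "represents p u v \<Longrightarrow> (\<Sum>k\<in>UNIV. u k * v k) = 1"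
  by (cases p) (simp add: represents_def UNIV_bool add_divide_distrib[symmetric])

text \<open>The equation of the sphere says that the matrix has determinant 0, so it factors as a
  column times a row. The factorisation by the first column divides by 1 + z, so z = -1 is treated
  separately; there one off-diagonal entry vanishes.\<close>

lemma represents_ex:
  assumes "p \<in> complex_sphere"
  shows "\<exists>u v. represents p u v"
proof -
  obtain x y z where p: "p = (x, y, z)" by (cases p)
  have "x\<^sup>2 + y\<^sup>2 + z\<^sup>2 = 1" using assms by (simp add: complex_sphere_def p)
  then have xy: "(x + \<i> * y) * (x - \<i> * y) = (1 + z) * (1 - z)"
    by (simp add: algebra_simps power2_eq_square)
  show ?thesis
  proof (cases "1 + z = 0")
    case False
    then have "represents p (\<lambda>k. if k then (x + \<i> * y) / 2 else (1 + z) / 2)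
      (\<lambda>k. if k then (x - \<i> * y) / (1 + z) else 1)"
      using xy by (auto simp: represents_def p)
    then show ?thesis by blast
  next
    case True
    then have z: "z = - 1" by (simp add: add_eq_0_iff)
    then have "(x + \<i> * y) * (x - \<i> * y) = 0" using xy by simp
    then have "represents p (\<lambda>k. if k then 1 else (x - \<i> * y) / 2) (\<lambda>k. if k then 1 else (x + \<i> * y) / 2)"
      by (auto simp: represents_def p z)
    then show ?thesis by blast
  qed
qed

lemma represents_point:
  assumes uv: "(\<Sum>k\<in>UNIV. u k * v k) = 1"
  shows "\<exists>p\<in>complex_sphere. represents p u v"
proof -
  have s: "u False * v False + u True * v True = 1" using uv by (simp add: UNIV_bool add.commute)
  \<comment> \<open>The Pauli coordinates of 2 u v^T - 1; the sum of their squares is the square of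
    the pairing of u and v.\<close>
  define x y z where "x = u False * v True + u True * v False"
    and "y = \<i> * (u False * v True - u True * v False)" and "z = u False * v False - u True * v True"
  have "x\<^sup>2 + y\<^sup>2 + z\<^sup>2 = (u False * v False + u True * v True)\<^sup>2"
    by (simp add: x_def y_def z_def power2_eq_square algebra_simps)
  then have "(x, y, z) \<in> complex_sphere" unfolding s by (simp add: complex_sphere_def)
  moreover have iy: "\<i> * y = u True * v False - u False * v True"
    by (simp add: y_def flip: mult.assoc)
  have "1 + z = 2 * (u False * v False)" "1 - z = 2 * (u True * v True)"
    unfolding s[symmetric] z_def by simp_all
  then have "represents (x, y, z) u v"
    unfolding represents_def sphere_proj.simps iy by (auto simp: x_def)
  ultimately show ?thesis by blast
qed

text \<open>Conjugating the point replaces the idempotent by its adjoint, and the adjoint of u v^T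
  is the product of the conjugates in the opposite order.\<close>

lemma represents_cnj3: "represents p u v \<Longrightarrow> represents (cnj3 p) (\<lambda>k. cnj (v k)) (\<lambda>k. cnj (u k))"
proof -
  assume p: "represents p u v"
  have "sphere_proj (cnj3 p) k l = cnj (sphere_proj p l k)" for k l
    by (cases p; cases k; cases l) simp_all
  then show ?thesis using p unfolding represents_def by (metis complex_cnj_mult mult.commute)
qed

lemma cnj3_sphere: "p \<in> complex_sphere \<Longrightarrow> cnj3 p \<in> complex_sphere"
proof -
  assume p: "p \<in> complex_sphere"
  obtain x y z where xyz: "p = (x, y, z)" by (cases p)
  then have "cnj (x\<^sup>2 + y\<^sup>2 + z\<^sup>2) = 1" using p by (simp add: complex_sphere_def)
  then show ?thesis by (simp add: complex_sphere_def xyz)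
qed

lemma pauli_index:
  "pauli p $$ (bool_index k, bool_index l) = 2 * sphere_proj p k l - of_bool (k = l)"
  "pauli p \<in> carrier_mat 2 2"
  by (cases p; cases k; cases l; auto simp: mat_of_rows_list_def bool_index_def diff_divide_distrib add_divide_distrib)+

lemma mat_2_eqI:
  assumes "A \<in> carrier_mat 2 2" "B \<in> carrier_mat 2 2"
    "\<And>k l. A $$ (bool_index k, bool_index l) = B $$ (bool_index k, bool_index l)"
  shows "A = B"
proof (rule eq_matI)
  fix i j assume "i < dim_row B" "j < dim_col B"
  then have "i < 2" "j < 2" using assms by auto
  then have "i = bool_index (i = 1)" "j = bool_index (j = 1)" by (auto simp: bool_index_def)
  then show "A $$ (i, j) = B $$ (i, j)" using assms(3) by metis
qed (use assms in auto)

lemma pauli_inj: "pauli p = pauli q \<Longrightarrow> p = q"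
  by (rule sphere_proj_inj) (metis pauli_index(1) add_diff_cancel_right' diff_eq_eq mult_cancel_left zero_neq_numeral)

lemma act_product:
  assumes p: "represents p u v" and g: "g \<in> carrier SU2"
  shows "(g * pauli p * mat_adjoint g) $$ (bool_index k, bool_index l)
    = 2 * (act_left g u k * act_right g v l) - of_bool (k = l)"
proof -
  have c: "g \<in> carrier_mat 2 2" using g by (simp add: SU2_carrier)
  have two: "(\<Sum>i<2. f i) = (\<Sum>a\<in>UNIV. f (bool_index a) :: complex)" for f
    using sum_double_index[of f 1] by simp
  have gg: "(\<Sum>a\<in>UNIV. g $$ (bool_index k, bool_index a) * cnj (g $$ (bool_index l, bool_index a))) = of_bool (k = l)"
  proof -
    have "(g * mat_adjoint g) $$ (bool_index k, bool_index l)
      = (\<Sum>a\<in>UNIV. g $$ (bool_index k, bool_index a) * cnj (g $$ (bool_index l, bool_index a)))"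
      unfolding mult_mat_index[OF c mat_adjoint_carrier[OF c] bool_index_less bool_index_less] two
      using c by simp
    moreover have "(g * mat_adjoint g) $$ (bool_index k, bool_index l) = of_bool (k = l)"
      using SU2_adjoint(2)[OF g] by simp
    ultimately show ?thesis by (rule trans[OF sym])
  qed
  have "(g * pauli p * mat_adjoint g) $$ (bool_index k, bool_index l)
    = (\<Sum>b\<in>UNIV. (\<Sum>a\<in>UNIV. g $$ (bool_index k, bool_index a) * pauli p $$ (bool_index a, bool_index b))
        * cnj (g $$ (bool_index l, bool_index b)))"
    unfolding mult_mat_index[OF mult_carrier_mat[OF c pauli_index(2)] mat_adjoint_carrier[OF c] bool_index_less bool_index_less]
      two mult_mat_index[OF c pauli_index(2) bool_index_less bool_index_less]
    using c by simp
  also have "\<dots> = (\<Sum>b\<in>UNIV. (\<Sum>a\<in>UNIV. g $$ (bool_index k, bool_index a) * (2 * (u a * v b) - of_bool (a = b)))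
        * cnj (g $$ (bool_index l, bool_index b)))"
    using p by (simp add: pauli_index(1) represents_def)
  also have "\<dots> = 2 * (act_left g u k * act_right g v l)
      - (\<Sum>a\<in>UNIV. g $$ (bool_index k, bool_index a) * cnj (g $$ (bool_index l, bool_index a)))"
    by (simp add: act_left_def act_right_def UNIV_bool algebra_simps)
  finally show ?thesis unfolding gg .
qed

text \<open>Conjugation by \<open>g\<close> turns u v^T into the product of the transformed vectors,
  whose pairing is still 1 because \<open>g\<close> is unitary. The point it belongs to is the
  rotated one, since \<open>pauli\<close> is injective.\<close>

lemma represents_rotation:
  assumes p: "represents p u v" and g: "g \<in> carrier SU2"
  shows "represents (rotation g p) (act_left g u) (act_right g v)" "rotation g p \<in> complex_sphere"
proof -
  have c: "g \<in> carrier_mat 2 2" using g by (simp add: SU2_carrier)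
  let ?A = "g * pauli p * mat_adjoint g"
  have Ac: "?A \<in> carrier_mat 2 2" using c by (meson mat_adjoint_carrier mult_carrier_mat pauli_index(2))
  have "?A $$ (bool_index False, bool_index False) + ?A $$ (bool_index True, bool_index True)
    = 2 * (\<Sum>k\<in>UNIV. act_left g u k * act_right g v k) - 2"
    unfolding act_product[OF p g] by (simp add: UNIV_bool algebra_simps)
  moreover have "(\<Sum>k\<in>UNIV. act_left g u k * act_right g v k) = 1"
  proof -
    have col: "(\<Sum>k\<in>UNIV. cnj (g $$ (bool_index k, bool_index b)) * g $$ (bool_index k, bool_index a)) = of_bool (b = a)" for a b
    proof -
      have "(mat_adjoint g * g) $$ (bool_index b, bool_index a)
        = (\<Sum>k\<in>UNIV. cnj (g $$ (bool_index k, bool_index b)) * g $$ (bool_index k, bool_index a))"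
        unfolding mult_mat_index[OF mat_adjoint_carrier[OF c] c bool_index_less bool_index_less]
        using c sum_double_index[of "\<lambda>i. mat_adjoint g $$ (bool_index b, i) * g $$ (i, bool_index a)" 1] by simp
      moreover have "(mat_adjoint g * g) $$ (bool_index b, bool_index a) = of_bool (b = a)"
        using g by (simp add: SU2_carrier)
      ultimately show ?thesis by (rule trans[OF sym])
    qed
    have "(\<Sum>k\<in>UNIV. act_left g u k * act_right g v k) = (\<Sum>a\<in>UNIV. \<Sum>b\<in>UNIV. u a * v b *
        (\<Sum>k\<in>UNIV. cnj (g $$ (bool_index k, bool_index b)) * g $$ (bool_index k, bool_index a)))"
      by (simp add: act_left_def act_right_def UNIV_bool algebra_simps)
    also have "\<dots> = (\<Sum>k\<in>UNIV. u k * v k)" unfolding col by (simp add: UNIV_bool)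
    finally show ?thesis using represents_sum[OF p] by simp
  qed
  then obtain q where q: "q \<in> complex_sphere" "represents q (act_left g u) (act_right g v)"
    using represents_point by blast
  have "pauli q = ?A"
    by (rule mat_2_eqI[OF pauli_index(2) Ac])
      (use q(2) in \<open>simp add: act_product[OF p g] pauli_index(1) represents_def\<close>)
  then have "rotation g p = q"
    unfolding rotation_def SU2_inv[OF g] using pauli_inj by (intro the_equality) auto
  then show "represents (rotation g p) (act_left g u) (act_right g v)" "rotation g p \<in> complex_sphere"
    using q by simp_all
qed

lemma rotation_uminus:
  assumes "p \<in> complex_sphere" "g \<in> carrier SU2" "- g \<in> carrier SU2"
  shows "rotation (- g) p = rotation g p"
proof -
  obtain u v where p: "represents p u v" using represents_ex[OF assms(1)] by blast
  have c: "g \<in> carrier_mat 2 2" using assms(2) by (simp add: SU2_carrier)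
  have "act_left (- g) u k = - act_left g u k" "act_right (- g) v k = - act_right g v k" for k
    using c by (simp_all add: act_left_def act_right_def UNIV_bool)
  then show ?thesis
    using represents_rotation(1)[OF p assms(2)] represents_rotation(1)[OF p assms(3)]
    by (intro sphere_proj_inj) (simp add: represents_def)
qed

section \<open>Closure properties of polynomial functions, and words as functions\<close>

lemma polynomial_on_cong:
  "polynomial_on S f \<Longrightarrow> (\<And>p. p \<in> S \<Longrightarrow> g p = f p) \<Longrightarrow> polynomial_on S g"
  unfolding polynomial_on_def by (force simp: case_prod_unfold)

lemma polynomial_on_monomial: "polynomial_on S (\<lambda>(x, y, z). c * x ^ K * y ^ L * z ^ M)"
  unfolding polynomial_on_def
proof (intro exI ballI)
  let ?N = "max K (max L M)"
  fix p :: "complex \<times> complex \<times> complex"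
  obtain x y z where p: "p = (x, y, z)" by (cases p)
  have "(\<Sum>m\<le>?N. (if k = K then if l = L then if m = M then c else 0 else 0 else 0) * x ^ k * y ^ l * z ^ m)
    = (if l = L then if k = K then c * x ^ K * y ^ L * z ^ M else 0 else 0)" for k l
  proof -
    have "(\<Sum>m\<le>?N. (if k = K then if l = L then if m = M then c else 0 else 0 else 0) * x ^ k * y ^ l * z ^ m)
      = (\<Sum>m\<le>?N. if m = M then (if l = L then if k = K then c * x ^ K * y ^ L * z ^ M else 0 else 0) else 0)"
      by (intro sum.cong refl) simp
    then show ?thesis by (simp add: le_max_iff_disj)
  qed
  then have "(\<Sum>k\<le>?N. \<Sum>l\<le>?N. \<Sum>m\<le>?N. (if k = K then if l = L then if m = M then c else 0 else 0 else 0) * x ^ k * y ^ l * z ^ m)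
    = c * x ^ K * y ^ L * z ^ M"
    by (simp add: le_max_iff_disj)
  then show "case p of (x, y, z) \<Rightarrow> (case (x, y, z) of (x, y, z) \<Rightarrow> c * x ^ K * y ^ L * z ^ M)
    = (\<Sum>k\<le>?N. \<Sum>l\<le>?N. \<Sum>m\<le>?N. (if k = K then if l = L then if m = M then c else 0 else 0 else 0) * x ^ k * y ^ l * z ^ m)"
    by (simp only: p prod.case)
qed

lemma sum_atMost_truncate:
  "N \<le> N' \<Longrightarrow> (\<Sum>k\<le>(N' :: nat). if k \<le> N then h k else 0) = (\<Sum>k\<le>N. h k :: complex)"
  by (rule sum.mono_neutral_cong_right) auto

lemma polynomial_on_mono_degree:
  assumes "N \<le> N'"
  shows "(\<Sum>k\<le>N. \<Sum>l\<le>N. \<Sum>m\<le>N. a k l m * x ^ k * y ^ l * z ^ m :: complex)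
    = (\<Sum>k\<le>N'. \<Sum>l\<le>N'. \<Sum>m\<le>N'. (if k \<le> N then if l \<le> N then if m \<le> N then a k l m else 0 else 0 else 0) * x ^ k * y ^ l * z ^ m)"
proof -
  have "(\<Sum>k\<le>N'. \<Sum>l\<le>N'. \<Sum>m\<le>N'. (if k \<le> N then if l \<le> N then if m \<le> N then a k l m else 0 else 0 else 0) * x ^ k * y ^ l * z ^ m)
    = (\<Sum>k\<le>N'. if k \<le> N then (\<Sum>l\<le>N'. if l \<le> N then (\<Sum>m\<le>N'. if m \<le> N then a k l m * x ^ k * y ^ l * z ^ m else 0) else 0) else 0)"
    by (intro sum.cong refl) (auto intro!: sum.cong)
  also have "\<dots> = (\<Sum>k\<le>N. \<Sum>l\<le>N. \<Sum>m\<le>N. a k l m * x ^ k * y ^ l * z ^ m)"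
    unfolding sum_atMost_truncate[OF assms] ..
  finally show ?thesis ..
qed

lemma polynomial_on_add:
  assumes "polynomial_on S f" "polynomial_on S g"
  shows "polynomial_on S (\<lambda>p. f p + g p)"
proof -
  obtain N a where f: "\<forall>(x, y, z)\<in>S. f (x, y, z) = (\<Sum>k\<le>N. \<Sum>l\<le>N. \<Sum>m\<le>N. a k l m * x ^ k * y ^ l * z ^ m)"
    using assms(1) by (auto simp: polynomial_on_def)
  obtain N' b where g: "\<forall>(x, y, z)\<in>S. g (x, y, z) = (\<Sum>k\<le>N'. \<Sum>l\<le>N'. \<Sum>m\<le>N'. b k l m * x ^ k * y ^ l * z ^ m)"
    using assms(2) by (auto simp: polynomial_on_def)
  let ?M = "max N N'"
  let ?t = "\<lambda>N a k l m. if k \<le> N then if l \<le> N then if m \<le> N then a k l m else 0 else 0 else (0 :: complex)"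
  have "f (x, y, z) + g (x, y, z) = (\<Sum>k\<le>?M. \<Sum>l\<le>?M. \<Sum>m\<le>?M. (?t N a k l m + ?t N' b k l m) * x ^ k * y ^ l * z ^ m)"
    if "(x, y, z) \<in> S" for x y z
  proof -
    have "f (x, y, z) = (\<Sum>k\<le>?M. \<Sum>l\<le>?M. \<Sum>m\<le>?M. ?t N a k l m * x ^ k * y ^ l * z ^ m)"
      using f that polynomial_on_mono_degree[of N ?M a x y z] by fastforce
    moreover have "g (x, y, z) = (\<Sum>k\<le>?M. \<Sum>l\<le>?M. \<Sum>m\<le>?M. ?t N' b k l m * x ^ k * y ^ l * z ^ m)"
      using g that polynomial_on_mono_degree[of N' ?M b x y z] by fastforce
    ultimately show ?thesis by (simp only: sum.distrib distrib_right)
  qed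
  then show ?thesis
    unfolding polynomial_on_def
    by (intro exI[of _ ?M] exI[of _ "\<lambda>k l m. ?t N a k l m + ?t N' b k l m"]) auto
qed

lemma polynomial_on_const: "polynomial_on S (\<lambda>p. c)"
  using polynomial_on_monomial[of S c 0 0 0] by (rule polynomial_on_cong) auto

lemma polynomial_on_sum:
  "(\<And>i. i \<in> I \<Longrightarrow> polynomial_on S (f i)) \<Longrightarrow> polynomial_on S (\<lambda>p. \<Sum>i\<in>I. f i p)"
  by (induction I rule: infinite_finite_induct) (auto intro: polynomial_on_add polynomial_on_const)

lemma polynomial_on_mult_monomial:
  assumes "polynomial_on S f"
  shows "polynomial_on S (\<lambda>(x, y, z). (c * x ^ K * y ^ L * z ^ M) * f (x, y, z))"
proof -
  obtain N a where f: "\<forall>(x, y, z)\<in>S. f (x, y, z) = (\<Sum>k\<le>N. \<Sum>l\<le>N. \<Sum>m\<le>N. a k l m * x ^ k * y ^ l * z ^ m)"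
    using assms by (auto simp: polynomial_on_def)
  have "polynomial_on S (\<lambda>p. \<Sum>k\<le>N. \<Sum>l\<le>N. \<Sum>m\<le>N. (\<lambda>(x, y, z). (c * a k l m) * x ^ (K + k) * y ^ (L + l) * z ^ (M + m)) p)"
    by (intro polynomial_on_sum polynomial_on_monomial)
  then show ?thesis
    by (rule polynomial_on_cong) (use f in \<open>auto simp: sum_distrib_left power_add mult_ac\<close>)
qed

lemma polynomial_on_cmult: "polynomial_on S f \<Longrightarrow> polynomial_on S (\<lambda>p. c * f p)"
  by (rule polynomial_on_cong[OF polynomial_on_mult_monomial[of S f c 0 0 0]]) auto

lemma polynomial_on_mult_sphere_proj:
  assumes f: "polynomial_on S f"
  shows "polynomial_on S (\<lambda>p. sphere_proj p k l * f p)"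
proof -
  \<comment> \<open>The coefficients of 1, x, y and z in the entry (k, l), which is affine in the
    coordinates.\<close>
  define a b c d :: complex where "a = (if k = l then 1 / 2 else 0)" and "b = (if k = l then 0 else 1 / 2)"
    and "c = (if k = l then 0 else if k then \<i> / 2 else - \<i> / 2)"
    and "d = (if k = l then (if k then - 1 / 2 else 1 / 2) else 0)"
  have "polynomial_on S (\<lambda>p. (((\<lambda>(x, y, z). (a * x ^ 0 * y ^ 0 * z ^ 0) * f (x, y, z)) p
      + (\<lambda>(x, y, z). (b * x ^ 1 * y ^ 0 * z ^ 0) * f (x, y, z)) p)
      + (\<lambda>(x, y, z). (c * x ^ 0 * y ^ 1 * z ^ 0) * f (x, y, z)) p)
      + (\<lambda>(x, y, z). (d * x ^ 0 * y ^ 0 * z ^ 1) * f (x, y, z)) p)"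
    by (intro polynomial_on_add polynomial_on_mult_monomial f)
  then show ?thesis
    by (rule polynomial_on_cong) (cases k; cases l; auto simp: a_def b_def c_def d_def field_simps)
qed

text \<open>The words spelled on loops at an even (\<open>e = True\<close>) or odd vertex, as functions on the sphere.\<close>

fun sphere_word :: "bool \<Rightarrow> complex \<times> complex \<times> complex \<Rightarrow> bool list \<Rightarrow> complex" where
  "sphere_word e p [] = 1"
| "sphere_word e p [k] = 0"
| "sphere_word e p (k # l # w) = (if e then sphere_proj p l k else sphere_proj p k l) * sphere_word e p w"

text \<open>In an even word the letters pair up into products of one coordinate of u and one of v.
  At an even vertex v reads the first letter of each pair, which transposes the entry.\<close>

lemma word_value_sphere_word:
  assumes "represents p u v" "even (length w)"
  shows "word_value (if e then v else u) (if e then u else v) w = sphere_word e p w"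
  using assms(2)
proof (induction w rule: induct_list012)
  case (3 k l w)
  have "u k * v l = sphere_proj p k l" "u l * v k = sphere_proj p l k"
    using assms(1) by (simp_all add: represents_def)
  with 3 show ?case by (simp del: sphere_proj.simps add: mult.assoc[symmetric] mult.commute[of "v _"])
qed simp_all

lemma polynomial_on_sphere_word: "polynomial_on S (\<lambda>p. sphere_word e p w)"
proof (induction w rule: induct_list012)
  case (3 k l w)
  then show ?case by (cases e) (auto intro: polynomial_on_mult_sphere_proj)
qed (auto intro: polynomial_on_const)

text \<open>The functions on the sphere that are combinations of even words. Polynomial functions
  turn out to be of this kind, which is the input for surjectivity.\<close>

definition word_span :: "bool \<Rightarrow> (complex \<times> complex \<times> complex \<Rightarrow> complex) \<Rightarrow> bool" where
  "word_span e f \<longleftrightarrow> (\<exists>W t. finite W \<and> (\<forall>w\<in>W. even (length w)) \<and>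
    (\<forall>p\<in>complex_sphere. f p = (\<Sum>w\<in>W. t w * sphere_word e p w)))"

lemma word_spanE:
  assumes "word_span e f"
  obtains W t where "finite W" "\<forall>w\<in>W. even (length w)"
    "\<forall>p\<in>complex_sphere. f p = (\<Sum>w\<in>W. t w * sphere_word e p w)"
  using assms by (auto simp: word_span_def)

lemma word_span_cong: "word_span e f \<Longrightarrow> (\<And>p. p \<in> complex_sphere \<Longrightarrow> g p = f p) \<Longrightarrow> word_span e g"
  unfolding word_span_def by auto

lemma word_span_const: "word_span e (\<lambda>p. c)"
  unfolding word_span_def by (intro exI[of _ "{[]}"] exI[of _ "\<lambda>_. c"]) simp

lemma word_span_add:
  assumes "word_span e f" "word_span e g"
  shows "word_span e (\<lambda>p. f p + g p)"
proof -
  obtain W t where W: "finite W" "\<forall>w\<in>W. even (length w)"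
    "\<forall>p\<in>complex_sphere. f p = (\<Sum>w\<in>W. t w * sphere_word e p w)"
    using assms(1) by (rule word_spanE)
  obtain W' t' where W': "finite W'" "\<forall>w\<in>W'. even (length w)"
    "\<forall>p\<in>complex_sphere. g p = (\<Sum>w\<in>W'. t' w * sphere_word e p w)"
    using assms(2) by (rule word_spanE)
  let ?t = "\<lambda>w. (if w \<in> W then t w else 0) + (if w \<in> W' then t' w else 0)"
  have "f p + g p = (\<Sum>w\<in>W \<union> W'. ?t w * sphere_word e p w)" if "p \<in> complex_sphere" for p
  proof -
    have "(\<Sum>w\<in>W. t w * sphere_word e p w) = (\<Sum>w\<in>W \<union> W'. (if w \<in> W then t w else 0) * sphere_word e p w)"
      "(\<Sum>w\<in>W'. t' w * sphere_word e p w) = (\<Sum>w\<in>W \<union> W'. (if w \<in> W' then t' w else 0) * sphere_word e p w)"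
      using W(1) W'(1) by (auto intro!: sum.mono_neutral_cong_left)
    then show ?thesis using bspec[OF W(3) that] bspec[OF W'(3) that] by (simp add: distrib_right sum.distrib)
  qed
  then show ?thesis
    unfolding word_span_def using W W' by (intro exI[of _ "W \<union> W'"] exI[of _ ?t]) auto
qed

lemma word_span_cmult:
  assumes "word_span e f"
  shows "word_span e (\<lambda>p. c * f p)"
proof -
  obtain W t where W: "finite W" "\<forall>w\<in>W. even (length w)"
    "\<forall>p\<in>complex_sphere. f p = (\<Sum>w\<in>W. t w * sphere_word e p w)"
    using assms by (rule word_spanE)
  then show ?thesis
    unfolding word_span_def
    by (intro exI[of _ W] exI[of _ "\<lambda>w. c * t w"]) (auto simp: sum_distrib_left mult.assoc)
qed

lemma word_span_mult_sphere_proj: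
  assumes "word_span e f"
  shows "word_span e (\<lambda>p. sphere_proj p k l * f p)"
proof -
  obtain W t where W: "finite W" "\<forall>w\<in>W. even (length w)"
    "\<forall>p\<in>complex_sphere. f p = (\<Sum>w\<in>W. t w * sphere_word e p w)"
    using assms by (rule word_spanE)
  \<comment> \<open>Prefixing two letters multiplies by an entry of the idempotent; at an even
    vertex they have to be spelled in the opposite order.\<close>
  define h where "h w = (if e then l # k # w else k # l # w)" for w :: "bool list"
  have inj: "inj_on h W" by (auto simp: inj_on_def h_def split: if_splits)
  have h: "sphere_word e p (h w) = sphere_proj p k l * sphere_word e p w" for p w
    by (simp add: h_def)
  have "sphere_proj p k l * f p = (\<Sum>w\<in>h ` W. t (inv_into W h w) * sphere_word e p w)"
    if "p \<in> complex_sphere" for p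
    unfolding sum.reindex[OF inj] using bspec[OF W(3) that]
    by (auto simp: h inv_into_f_f[OF inj] sum_distrib_left mult_ac intro!: sum.cong)
  then show ?thesis
    unfolding word_span_def using W
    by (intro exI[of _ "h ` W"] exI[of _ "\<lambda>w. t (inv_into W h w)"]) (auto simp: h_def)
qed

text \<open>The coordinates are combinations of the entries of the idempotent: x is the sum of the
  off-diagonal ones, y is i times the upper right entry minus the lower left one, and z is the
  difference of the diagonal ones.\<close>

lemma word_span_mult_coordinates:
  assumes f: "word_span e f"
  shows "word_span e (\<lambda>(x, y, z). x * f (x, y, z))"
    and "word_span e (\<lambda>(x, y, z). y * f (x, y, z))"
    and "word_span e (\<lambda>(x, y, z). z * f (x, y, z))"
proof -
  note P = word_span_mult_sphere_proj[OF f]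
  show "word_span e (\<lambda>(x, y, z). x * f (x, y, z))"
    using word_span_add[OF P[of True False] P[of False True]]
    by (rule word_span_cong) (auto simp: field_simps)
  show "word_span e (\<lambda>(x, y, z). y * f (x, y, z))"
    using word_span_add[OF word_span_cmult[OF P[of True False], of "- \<i>"] word_span_cmult[OF P[of False True], of "\<i>"]]
    by (rule word_span_cong) (auto simp: field_simps)
  show "word_span e (\<lambda>(x, y, z). z * f (x, y, z))"
    using word_span_add[OF P[of False False] word_span_cmult[OF P[of True True], of "- 1"]]
    by (rule word_span_cong) (auto simp: field_simps)
qed

lemma word_span_monomial: "word_span e (\<lambda>(x, y, z). c * x ^ K * y ^ L * z ^ M)"
proof (induction K)
  case 0
  show ?case
  proof (induction L)
    case 0
    show ?case
    proof (induction M)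
      case 0
      show ?case using word_span_const[of e c] by (rule word_span_cong) auto
    next
      case (Suc M)
      show ?case using word_span_mult_coordinates(3)[OF Suc] by (rule word_span_cong) (auto simp: mult_ac)
    qed
  next
    case (Suc L)
    show ?case using word_span_mult_coordinates(2)[OF Suc] by (rule word_span_cong) (auto simp: mult_ac)
  qed
next
  case (Suc K)
  show ?case using word_span_mult_coordinates(1)[OF Suc] by (rule word_span_cong) (auto simp: mult_ac)
qed

lemma word_span_sum: "(\<And>i. i \<in> I \<Longrightarrow> word_span e (f i)) \<Longrightarrow> word_span e (\<lambda>p. \<Sum>i\<in>I. f i p)"
  by (induction I rule: infinite_finite_induct) (auto intro: word_span_add word_span_const)

lemma polynomial_on_word_span:
  assumes "polynomial_on complex_sphere f"
  shows "word_span e f"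
proof -
  obtain N a where f: "\<forall>(x, y, z)\<in>complex_sphere. f (x, y, z) = (\<Sum>k\<le>N. \<Sum>l\<le>N. \<Sum>m\<le>N. a k l m * x ^ k * y ^ l * z ^ m)"
    using assms by (auto simp: polynomial_on_def)
  have "word_span e (\<lambda>p. \<Sum>k\<le>N. \<Sum>l\<le>N. \<Sum>m\<le>N. (\<lambda>(x, y, z). a k l m * x ^ k * y ^ l * z ^ m) p)"
    by (intro word_span_sum word_span_monomial)
  then show ?thesis by (rule word_span_cong) (use f in auto)
qed

section \<open>The involution of the path algebra\<close>

lemma path_star_superset:
  assumes "finite P" "Poly_Mapping.keys f \<subseteq> P"
  shows "path_star f = (\<Sum>p\<in>P. Poly_Mapping.single (path_reverse p) (cnj (Poly_Mapping.lookup f p)))"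
  unfolding path_star_def using assms by (intro sum.mono_neutral_left) (auto simp: in_keys_iff)

lemma path_star_add: "path_star (f + g) = path_star f + path_star g"
  using Poly_Mapping.keys_add[of f g]
  by (simp add: path_star_superset[of "Poly_Mapping.keys f \<union> Poly_Mapping.keys g"] lookup_add single_add sum.distrib)

lemma path_star_scale: "path_star (scale c f) = scale (cnj c) (path_star f)"
  using keys_scale[of c f]
  by (simp add: path_star_superset[of "Poly_Mapping.keys f"] path_space.scale_sum_right)

lemma path_star_single: "path_star (Poly_Mapping.single p a) = Poly_Mapping.single (path_reverse p) (cnj a)"
  by (simp add: path_star_def)

lemma path_star_0 [simp]: "path_star 0 = 0"
  by (simp add: path_star_def)

lemma path_star_sum: "path_star (\<Sum>x\<in>X. f x) = (\<Sum>x\<in>X. path_star (f x))"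
  by (induction X rule: infinite_finite_induct) (auto simp: path_star_add)

lemma path_star_diff: "path_star (f - g) = path_star f - path_star g"
  using path_star_add[of "f - g" g] by simp

lemma path_star_mult: "path_star (path_mult f g) = path_mult (path_star g) (path_star f)"
proof (rule linear_induct[of f UNIV], goal_cases)
  case (5 p)
  show ?case
  proof (rule linear_induct[of g UNIV], goal_cases)
    case (5 q)
    show ?case by (cases p; cases q) (auto simp: path_mult_single_single path_star_single)
  qed (simp_all add: path_mult_add_left path_mult_add_right path_star_add path_star_scale)
qed (simp_all add: path_mult_add_left path_mult_add_right path_star_add path_star_scale)

context intertwiners
begin

text \<open>The right-hand side mentions only the point. Hence the matrix of a combination of loops
  does not depend on the choice of u and v, and its entries are polynomial functions on the
  sphere.\<close>

lemma rep_sphere_word: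
  assumes z: "z \<in> hom_paths D i i" and p: "represents p u v"
  shows "rep u v i i z r c = (\<Sum>q\<in>Poly_Mapping.keys z. Poly_Mapping.lookup z q *
    (\<Sum>w\<in>words (length (fst (snd q))). path_tensor w (fst (snd q)) r c * sphere_word (i \<in> Ev) p w))"
  unfolding rep_def linear_ext_def
proof (intro sum.cong refl)
  fix q assume "q \<in> Poly_Mapping.keys z"
  then obtain bs where q: "q = (i, bs, i)" "pre_digraph.cas D i bs i" "set bs \<subseteq> arcs D"
    using hom_paths_key[OF z] by blast
  have "word_value (coord u v i) (coord v u i) w = sphere_word (i \<in> Ev) p w" if "w \<in> words (length bs)" for w
    using word_value_sphere_word[OF p, of w "i \<in> Ev"] cas_parity[OF q(2,3)] that
    by (simp add: words_def coord_def)
  then show "Poly_Mapping.lookup z q * (case q of (i', bs, j') \<Rightarrow> of_bool (i' = i \<and> j' = i) * path_mat u v bs r c)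
    = Poly_Mapping.lookup z q *
    (\<Sum>w\<in>words (length (fst (snd q))). path_tensor w (fst (snd q)) r c * sphere_word (i \<in> Ev) p w)"
    using path_mat_expand[OF q(2,3), of u v r c] by (simp add: q(1))
qed

lemma rep_equivariant:
  assumes z: "z \<in> hom_paths D i j" and g: "g \<in> \<Gamma>" and r: "r < \<delta> j" and c: "c < \<delta> i"
  shows "(\<Sum>m<\<delta> j. \<rho> j g r m * rep u v i j z m c)
    = (\<Sum>m<\<delta> i. rep (act_left g u) (act_right g v) i j z r m * \<rho> i g m c)"
proof -
  have "Poly_Mapping.keys z \<subseteq> {(u, p, v) \<in> paths D. u = i \<and> v = j}" using z by (simp add: hom_paths_def)
  then show ?thesis
  proof (induction z rule: linear_induct)
    case (single q)
    then obtain bs where q: "q = (i, bs, j)" "pre_digraph.cas D i bs j" "set bs \<subseteq> arcs D"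
      by (auto simp: paths_def D.awalk_def)
    show ?case using path_mat_equivariant[OF q(2,3) g r c, of u v] by (simp add: q(1))
  next
    case (scale a f)
    then show ?case by (simp add: mult.left_commute[of _ a] mult.assoc sum_distrib_left[symmetric])
  qed (simp_all add: rep_add distrib_left distrib_right sum.distrib)
qed

lemma path_star_hom_paths:
  assumes z: "z \<in> hom_paths D i j"
  shows "path_star z \<in> hom_paths D j i"
  unfolding path_star_def
proof (rule hom_paths_sum)
  fix q assume "q \<in> Poly_Mapping.keys z"
  then obtain bs where q: "(i, bs, j) \<in> paths D" "q = (i, bs, j)" using z by (auto simp: hom_paths_def)
  then have "D.awalk i bs j" by (simp add: paths_def)
  then have v: "j \<in> verts D" and bs: "pre_digraph.cas D i bs j" "set bs \<subseteq> arcs D"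
    using D.awalk_last_in_verts by (blast, auto simp: D.awalk_def)
  have "set (rev (map reverse_arrow bs)) \<subseteq> arcs D"
    using bs(2) by (auto simp del: double_quiver_simps(2)) (use double_quiver_reverse(1) in force)+
  then have "(j, rev (map reverse_arrow bs), i) \<in> paths D"
    using v cas_reverse[OF bs(1)] by (auto simp: paths_def D.awalk_def)
  then show "Poly_Mapping.single (path_reverse q) (cnj (Poly_Mapping.lookup z q)) \<in> hom_paths D j i"
    by (auto simp: q(2) path_reverse_eq hom_paths_def simp del: path_reverse.simps)
qed

lemma rep_star:
  assumes z: "z \<in> hom_paths D i i" and rc: "r < \<delta> i" "c < \<delta> i"
  shows "rep (\<lambda>k. cnj (v k)) (\<lambda>k. cnj (u k)) i i (path_star z) r c = cnj (rep u v i i z c r)"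
proof -
  have "rep (\<lambda>k. cnj (v k)) (\<lambda>k. cnj (u k)) i i (path_star z) r c
    = (\<Sum>q\<in>Poly_Mapping.keys z. cnj (Poly_Mapping.lookup z q * (case q of (i', bs, j') \<Rightarrow> of_bool (i' = i \<and> j' = i) * path_mat u v bs c r)))"
    unfolding path_star_def rep_sum
  proof (intro sum.cong refl)
    fix q assume "q \<in> Poly_Mapping.keys z"
    then obtain bs where q: "q = (i, bs, i)" "pre_digraph.cas D i bs i" "set bs \<subseteq> arcs D"
      using hom_paths_key[OF z] by blast
    show "rep (\<lambda>k. cnj (v k)) (\<lambda>k. cnj (u k)) i i (Poly_Mapping.single (path_reverse q) (cnj (Poly_Mapping.lookup z q))) r c
      = cnj (Poly_Mapping.lookup z q * (case q of (i', bs, j') \<Rightarrow> of_bool (i' = i \<and> j' = i) * path_mat u v bs c r))"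
      unfolding q(1) path_reverse_eq rep_single using path_mat_reverse[OF q(2,3) rc] by simp
  qed
  then show ?thesis by (simp add: rep_def linear_ext_def)
qed

lemma path_star_local_relation: "path_star (local_relation i) = local_relation i"
proof -
  have "path_star (path_mult (arrow D (reverse_arrow b)) (arrow D b)) = path_mult (arrow D (reverse_arrow b)) (arrow D b)" for b
    unfolding path_mult_reverse_arrow path_star_single path_reverse_eq by simp
  moreover have "path_star (trivial_path i :: ('v, 'e + 'e) path \<Rightarrow>\<^sub>0 complex) = trivial_path i"
    unfolding trivial_path_def path_star_single path_reverse_eq by simp
  ultimately show ?thesis
    unfolding local_relation_def path_star_diff path_star_sum path_star_scale by simp
qed

lemma path_star_carrier:
  assumes "Poly_Mapping.keys x \<subseteq> paths D"
  shows "Poly_Mapping.keys (path_star x) \<subseteq> paths D"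
  using assms
proof (induction x rule: linear_induct)
  case (single q)
  obtain i bs j where q: "q = (i, bs, j)" by (cases q)
  have "Poly_Mapping.single q 1 \<in> hom_paths D i j" using single q by (simp add: hom_paths_def)
  from path_star_hom_paths[OF this] show ?case by (auto simp: hom_paths_def)
qed (simp_all add: path_star_add path_star_scale keys_add_subset keys_scale_subset)

text \<open>The elements whose star lies in \<open>J\<close> form a two-sided ideal because the star
  reverses products, and the local relations are fixed by it.\<close>

lemma path_star_J:
  assumes "x \<in> J"
  shows "path_star x \<in> J"
proof -
  define N where "N = {x. Poly_Mapping.keys x \<subseteq> paths D \<and> path_star x \<in> J}"
  have N_0: "0 \<in> N" by (simp add: N_def J_0)
  have N_add: "x + y \<in> N" if "x \<in> N" "y \<in> N" for x y
    using that by (simp add: N_def path_star_add keys_add_subset J_add)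
  have N_scale: "scale a x \<in> N" if "x \<in> N" for a x
    using that by (simp add: N_def path_star_scale keys_scale_subset J_scale)
  have N_sum: "(\<Sum>x\<in>X. f x) \<in> N" if "\<And>x. x \<in> X \<Longrightarrow> f x \<in> N" for X and f :: "'v \<Rightarrow> _"
    using that by (induction X rule: infinite_finite_induct) (simp_all add: N_0 N_add)
  have "ideal N (path_algebra D)"
    unfolding D.path_algebra_ideal_iff
  proof (intro conjI ballI)
    show "N \<subseteq> carrier (path_algebra D)" by (auto simp: N_def)
    show "0 \<in> N" by (rule N_0)
    show "x + y \<in> N" if "x \<in> N" "y \<in> N" for x y using that by (rule N_add)
    fix x a assume x: "x \<in> carrier (path_algebra D)" and a: "a \<in> N"
    then have aK: "a \<in> carrier (path_algebra D)" by (simp add: N_def)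
    have xs: "Poly_Mapping.keys (path_star x) \<subseteq> paths D" using path_star_carrier x by simp
    show "path_mult x a \<in> N" "path_mult a x \<in> N"
      using D.path_algebra_mult_closed[OF x aK] D.path_algebra_mult_closed[OF aK x] a J_mult[OF _ xs]
      by (simp_all add: N_def path_star_mult)
  qed
  moreover have "preprojective_relation Q lam \<in> N"
    unfolding preprojective_relation_eq
  proof (intro N_sum N_scale)
    fix i assume i: "i \<in> verts Q"
    show "local_relation i \<in> N"
      using J_carrier[OF local_relation_in_J[OF i]] local_relation_in_J[OF i]
      by (simp add: N_def path_star_local_relation)
  qed
  ultimately have "J \<subseteq> N"
    unfolding preprojective_ideal_def by (intro D.genideal_minimal) auto
  then show ?thesis using assms by (auto simp: N_def)
qed

subsection \<open>The corner algebra\<close>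

definition coset where "coset z = J +>\<^bsub>path_algebra D\<^esub> z"

lemma coset_image: "coset z = (\<lambda>j. j + z) ` J"
  by (simp add: coset_def path_coset_def)

lemma coset_eq_iff: "coset z = coset z' \<longleftrightarrow> z - z' \<in> J"
proof
  assume "coset z = coset z'"
  then have "0 + z \<in> (\<lambda>j. j + z') ` J" using J_0 by (metis coset_image image_eqI)
  then show "z - z' \<in> J" by auto
next
  assume d: "z - z' \<in> J"
  have "j + z \<in> (\<lambda>j. j + z') ` J" if "j \<in> J" for j
    using J_add[OF that d] by (intro image_eqI[of _ _ "j + (z - z')"]) auto
  moreover have "j + z' \<in> (\<lambda>j. j + z) ` J" if "j \<in> J" for j
    using J_diff[OF that d] by (intro image_eqI[of _ _ "j - (z - z')"]) auto
  ultimately show "coset z = coset z'" unfolding coset_image by blast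
qed

lemma corner_hom_paths:
  assumes "i \<in> verts Q" "Poly_Mapping.keys y \<subseteq> paths D"
  shows "path_mult (path_mult (trivial_path i) y) (trivial_path i) \<in> hom_paths D i i"
  using assms(2)
proof (induction y rule: linear_induct)
  case (single q)
  obtain j bs k where q: "q = (j, bs, k)" by (cases q)
  have h: "Poly_Mapping.single q 1 \<in> hom_paths D j k" using single q by (simp add: hom_paths_def)
  show ?case
    using h by (auto simp: trivial_path_mult_left[OF h] trivial_path_mult_right[OF h])
qed (simp_all add: path_mult_add_left path_mult_add_right hom_paths_add hom_paths_scale)

abbreviation corner_algebra where
  "corner_algebra i \<equiv> corner (deformed_preprojective_algebra Q lam) (vertex_idempotent Q lam i)"

lemmas algebra_defs = corner_def deformed_preprojective_algebra_def quotient_algebra_def FactRing_def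

lemma coset_mult:
  "Poly_Mapping.keys x \<subseteq> paths D \<Longrightarrow> Poly_Mapping.keys y \<subseteq> paths D \<Longrightarrow>
    rcoset_mult (path_algebra D) J (coset x) (coset y) = coset (path_mult x y)"
  using ideal.rcoset_mult_add[OF ideal_J, of x y] by (simp add: coset_def)

text \<open>Multiplication with the trivial path on both sides kills all paths except the loops at
  \<open>i\<close> and fixes these, so the corner consists of the cosets of combinations of
  loops.\<close>

lemma corner_algebra_carrier:
  assumes i: "i \<in> verts Q"
  shows "carrier (corner_algebra i) = coset ` hom_paths D i i"
proof -
  have e: "Poly_Mapping.keys (trivial_path i) \<subseteq> paths D"
    using D.trivial_hom_paths[of i] i by (auto simp: hom_paths_def)
  have ey: "Poly_Mapping.keys (path_mult (trivial_path i) y) \<subseteq> paths D" if "Poly_Mapping.keys y \<subseteq> paths D" for y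
    using D.path_algebra_mult_closed[of "trivial_path i" y] e that by simp
  have *: "rcoset_mult (path_algebra D) J (rcoset_mult (path_algebra D) J (coset (trivial_path i)) (coset y)) (coset (trivial_path i))
    = coset (path_mult (path_mult (trivial_path i) y) (trivial_path i))" if "Poly_Mapping.keys y \<subseteq> paths D" for y
    using that e ey by (simp add: coset_mult)
  have "carrier (corner_algebra i)
    = (\<lambda>X. rcoset_mult (path_algebra D) J (rcoset_mult (path_algebra D) J (coset (trivial_path i)) X) (coset (trivial_path i)))
      ` carrier (deformed_preprojective_algebra Q lam)"
    by (auto simp: algebra_defs vertex_idempotent_def coset_def)
  also have "carrier (deformed_preprojective_algebra Q lam) = coset ` {y. Poly_Mapping.keys y \<subseteq> paths D}"
    by (auto simp: algebra_defs coset_def A_RCOSETS_def')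
  also have "(\<lambda>X. rcoset_mult (path_algebra D) J (rcoset_mult (path_algebra D) J (coset (trivial_path i)) X) (coset (trivial_path i)))
      ` (coset ` {y. Poly_Mapping.keys y \<subseteq> paths D})
    = (\<lambda>y. coset (path_mult (path_mult (trivial_path i) y) (trivial_path i))) ` {y. Poly_Mapping.keys y \<subseteq> paths D}"
    unfolding image_image by (rule image_cong) (simp_all add: *)
  also have "\<dots> = coset ` hom_paths D i i"
  proof (intro equalityI subsetI)
    fix X assume "X \<in> coset ` hom_paths D i i"
    then obtain z where z: "z \<in> hom_paths D i i" "X = coset z" by blast
    then have "path_mult (path_mult (trivial_path i) z) (trivial_path i) = z"
      using trivial_path_mult_left[OF z(1), of i] trivial_path_mult_right[OF z(1), of i] by simp
    moreover have "Poly_Mapping.keys z \<subseteq> paths D" using hom_paths_carrier[OF z(1)] by simp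
    ultimately show "X \<in> (\<lambda>y. coset (path_mult (path_mult (trivial_path i) y) (trivial_path i))) ` {y. Poly_Mapping.keys y \<subseteq> paths D}"
      using z(2) by force
  qed (use corner_hom_paths[OF i] in auto)
  finally show ?thesis .
qed

lemma corner_algebra_ops:
  assumes "z \<in> hom_paths D i i" "z' \<in> hom_paths D i i"
  shows "coset z \<otimes>\<^bsub>corner_algebra i\<^esub> coset z' = coset (path_mult z z')"
    and "coset z \<oplus>\<^bsub>corner_algebra i\<^esub> coset z' = coset (z + z')"
    and "\<one>\<^bsub>corner_algebra i\<^esub> = coset (trivial_path i)"
    and "a \<odot>\<^bsub>corner_algebra i\<^esub> coset z = coset (scale a z)"
    and "preprojective_star Q lam (coset z) = coset (path_star z)"
proof -
  have k: "Poly_Mapping.keys z \<subseteq> paths D" "Poly_Mapping.keys z' \<subseteq> paths D"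
    using assms[THEN hom_paths_carrier] by simp_all
  show "coset z \<otimes>\<^bsub>corner_algebra i\<^esub> coset z' = coset (path_mult z z')"
    using coset_mult[OF k] by (simp add: algebra_defs)
  show "coset z \<oplus>\<^bsub>corner_algebra i\<^esub> coset z' = coset (z + z')"
    using ideal.a_rcos_sum[OF ideal_J, of z z'] k by (simp add: algebra_defs coset_def)
  show "\<one>\<^bsub>corner_algebra i\<^esub> = coset (trivial_path i)"
    by (simp add: algebra_defs vertex_idempotent_def coset_def)
  have zc: "z \<in> coset z" unfolding coset_image using J_0 by (auto intro: image_eqI[of _ _ 0])
  have diff: "x - z \<in> J" if "x \<in> coset z" for x using that by (auto simp: coset_image)
  have "coset (scale a x) = coset (scale a z)" if "x \<in> coset z" for x
    using J_scale[OF diff[OF that], of a] by (simp add: coset_eq_iff path_space.scale_right_diff_distrib)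
  \<comment> \<open>The operation is defined as a union over representatives; all of them give the
    same coset, so the union collapses to it.\<close>
  then have "(\<Union>x\<in>coset z. coset (scale a x)) = coset (scale a z)" using zc by blast
  then show "a \<odot>\<^bsub>corner_algebra i\<^esub> coset z = coset (scale a z)"
    by (simp add: algebra_defs coset_def[symmetric])
  have "coset (path_star x) = coset (path_star z)" if "x \<in> coset z" for x
    using path_star_J[OF diff[OF that]] by (simp add: coset_eq_iff path_star_diff)
  then have "(\<Union>x\<in>coset z. coset (path_star x)) = coset (path_star z)" using zc by blast
  then show "preprojective_star Q lam (coset z) = coset (path_star z)"
    by (simp add: preprojective_star_def coset_def[symmetric])
qed

end

subsection \<open>The isomorphism\<close>

definition lift_point :: "complex \<times> complex \<times> complex \<Rightarrow> (bool \<Rightarrow> complex) \<times> (bool \<Rightarrow> complex)" where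
  "lift_point p = (SOME uv. represents p (fst uv) (snd uv))"

lemma represents_lift_point: "p \<in> complex_sphere \<Longrightarrow> represents p (fst (lift_point p)) (snd (lift_point p))"
  unfolding lift_point_def using represents_ex[of p] by (intro someI_ex[of "\<lambda>uv. represents p (fst uv) (snd uv)"]) auto

lemma sphere_maps_eqI:
  fixes f g :: "complex \<times> complex \<times> complex \<Rightarrow> complex mat"
  assumes "f \<in> extensional complex_sphere" "g \<in> extensional complex_sphere"
    and "\<And>p. p \<in> complex_sphere \<Longrightarrow> f p \<in> carrier_mat n n"
    and "\<And>p. p \<in> complex_sphere \<Longrightarrow> g p \<in> carrier_mat n n"
    and "\<And>p u v r c. p \<in> complex_sphere \<Longrightarrow> represents p u v \<Longrightarrow> r < n \<Longrightarrow> c < n \<Longrightarrow> f p $$ (r, c) = g p $$ (r, c)"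
  shows "f = g"
proof (rule extensionalityI[OF assms(1,2)])
  fix p assume p: "p \<in> complex_sphere"
  obtain u v where "represents p u v" using represents_ex[OF p] by blast
  then show "f p = g p"
    using assms(5)[OF p] carrier_matD[OF assms(3)[OF p]] carrier_matD[OF assms(4)[OF p]]
    by (intro eq_matI) simp_all
qed

lemma (in mckay_data) uminus_in_group:
  assumes "g \<in> \<Gamma>"
  shows "- g \<in> \<Gamma>" "g * - 1\<^sub>m 2 = - g" "- 1\<^sub>m 2 * g = - g"
proof -
  have c: "g \<in> carrier_mat 2 2" using group_SU2D(2)[OF assms] .
  then show gm: "g * - 1\<^sub>m 2 = - g" "- 1\<^sub>m 2 * g = - g"
    using uminus_mult_right_mat[of g "1\<^sub>m 2"] uminus_mult_left_mat[of "1\<^sub>m 2" g] by auto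
  show "- g \<in> \<Gamma>" using mult_in_group[OF assms minus_one_in_group] gm by simp
qed

locale mckay_vertex = mckay_data Q T v0 Ev \<delta> lam \<Gamma> V
  for Q :: "('v, 'e) pre_digraph" and T v0 Ev \<delta> lam \<Gamma> V +
  fixes i :: 'v
  assumes vertex: "i \<in> verts Q"
begin

abbreviation d where "d \<equiv> \<delta> i"

abbreviation S where "S \<equiv> complex_sphere"

abbreviation H where "H \<equiv> hom_paths D i i"

definition sphere_map where
  "sphere_map z = (\<lambda>p\<in>S. mat d d (\<lambda>(r, c). I.rep (fst (lift_point p)) (snd (lift_point p)) i i z r c))"

lemma sphere_map_carrier: "p \<in> S \<Longrightarrow> sphere_map z p \<in> carrier_mat d d"
  by (simp add: sphere_map_def)

lemma sphere_map_extensional: "sphere_map z \<in> extensional S"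
  by (simp add: sphere_map_def)

text \<open>The arbitrary factorisation in \<open>lift_point\<close> can be traded for any other
  one. This is what allows conjugated and rotated points to be computed with the vectors that belong
  to them naturally.\<close>

lemma sphere_map_index:
  assumes "z \<in> H" "p \<in> S" "represents p u v" "r < d" "c < d"
  shows "sphere_map z p $$ (r, c) = I.rep u v i i z r c"
  using assms(2,4,5)
  by (simp add: sphere_map_def I.rep_sphere_word[OF assms(1,3)] I.rep_sphere_word[OF assms(1) represents_lift_point])

lemma sphere_map_mult:
  assumes z: "z \<in> H" "z' \<in> H"
  shows "sphere_map (path_mult z z') = (\<lambda>p\<in>S. sphere_map z p * sphere_map z' p)"
proof (rule sphere_maps_eqI[of _ _ d])
  fix p u v r c assume p: "p \<in> S" "represents p u v" and rc: "r < d" "c < d"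
  show "sphere_map (path_mult z z') p $$ (r, c) = (\<lambda>p\<in>S. sphere_map z p * sphere_map z' p) p $$ (r, c)"
    unfolding restrict_apply'[OF p(1)] mult_mat_index[OF sphere_map_carrier[OF p(1)] sphere_map_carrier[OF p(1)] rc]
      sphere_map_index[OF I.D.hom_paths_mult[OF z] p rc] I.rep_mult[OF z rc(2)]
    using sphere_map_index[OF z(1) p rc(1)] sphere_map_index[OF z(2) p _ rc(2)] by simp
qed (use sphere_map_carrier[of _ z] sphere_map_carrier[of _ z'] sphere_map_carrier in
  \<open>auto simp: sphere_map_extensional intro!: mult_carrier_mat\<close>)

lemma sphere_map_add:
  assumes z: "z \<in> H" "z' \<in> H"
  shows "sphere_map (z + z') = (\<lambda>p\<in>S. sphere_map z p + sphere_map z' p)"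
proof (rule sphere_maps_eqI[of _ _ d])
  fix p u v r c assume p: "p \<in> S" "represents p u v" and rc: "r < d" "c < d"
  show "sphere_map (z + z') p $$ (r, c) = (\<lambda>p\<in>S. sphere_map z p + sphere_map z' p) p $$ (r, c)"
    using sphere_map_index[OF hom_paths_add[OF z] p rc] sphere_map_index[OF z(1) p rc] sphere_map_index[OF z(2) p rc]
      carrier_matD[OF sphere_map_carrier[OF p(1), of z']] rc p(1)
    by (simp add: I.rep_add)
qed (simp_all add: sphere_map_extensional sphere_map_carrier)

lemma sphere_map_scale:
  assumes z: "z \<in> H"
  shows "sphere_map (scale a z) = (\<lambda>p\<in>S. a \<cdot>\<^sub>m sphere_map z p)"
proof (rule sphere_maps_eqI[of _ _ d])
  fix p u v r c assume p: "p \<in> S" "represents p u v" and rc: "r < d" "c < d"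
  show "sphere_map (scale a z) p $$ (r, c) = (\<lambda>p\<in>S. a \<cdot>\<^sub>m sphere_map z p) p $$ (r, c)"
    using sphere_map_index[OF hom_paths_scale[OF z] p rc] sphere_map_index[OF z p rc]
      carrier_matD[OF sphere_map_carrier[OF p(1), of z]] rc p(1)
    by simp
qed (simp_all add: sphere_map_extensional sphere_map_carrier)

lemma sphere_map_one: "sphere_map (trivial_path i) = (\<lambda>p\<in>S. 1\<^sub>m d)"
proof (rule sphere_maps_eqI[of _ _ d])
  fix p u v r c assume p: "p \<in> S" "represents p u v" and rc: "r < d" "c < d"
  have t: "trivial_path i \<in> H" using I.D.trivial_hom_paths[of i] vertex by simp
  show "sphere_map (trivial_path i) p $$ (r, c) = (\<lambda>p\<in>S. 1\<^sub>m d) p $$ (r, c)"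
    using sphere_map_index[OF t p rc] rc p(1) by (simp add: trivial_path_def)
qed (simp_all add: sphere_map_extensional sphere_map_carrier)

lemma sphere_map_eq_iff:
  assumes z: "z \<in> H" "z' \<in> H"
  shows "sphere_map z = sphere_map z' \<longleftrightarrow> I.coset z = I.coset z'"
proof
  assume eq: "sphere_map z = sphere_map z'"
  have "z - z' \<in> preprojective_ideal Q lam"
  proof (rule I.in_J_if_rep_zero[OF vertex hom_paths_diff[OF z]])
    fix u v :: "bool \<Rightarrow> complex" and r c
    assume uv: "(\<Sum>k\<in>UNIV. u k * v k) = 1" and rc: "r < d" "c < d"
    \<comment> \<open>Every pair with pairing 1 comes from a point, so agreement on the sphere is
      agreement at all pairs, as the injectivity criterion demands.\<close>
    obtain p where p: "p \<in> S" "represents p u v" using represents_point[OF uv] by blast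
    show "I.rep u v i i (z - z') r c = 0"
      using sphere_map_index[OF z(1) p rc] sphere_map_index[OF z(2) p rc] by (simp add: I.rep_diff eq)
  qed
  then show "I.coset z = I.coset z'" by (simp add: I.coset_eq_iff)
next
  assume "I.coset z = I.coset z'"
  then have J: "z - z' \<in> preprojective_ideal Q lam" by (simp add: I.coset_eq_iff)
  show "sphere_map z = sphere_map z'"
  proof (rule sphere_maps_eqI[of _ _ d])
    fix p u v r c assume p: "p \<in> S" "represents p u v" and rc: "r < d" "c < d"
    have "I.rep u v i i (z - z') r c = 0" using I.rep_J[OF represents_sum[OF p(2)] J vertex vertex rc] .
    then show "sphere_map z p $$ (r, c) = sphere_map z' p $$ (r, c)"
      using sphere_map_index[OF z(1) p rc] sphere_map_index[OF z(2) p rc] by (simp add: I.rep_diff)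
  qed (simp_all add: sphere_map_extensional sphere_map_carrier)
qed

lemma sphere_map_star:
  assumes z: "z \<in> H"
  shows "sphere_map (path_star z) = maps_star (sphere_map z)"
proof (rule sphere_maps_eqI[of _ _ d])
  fix p u v r c assume p: "p \<in> S" "represents p u v" and rc: "r < d" "c < d"
  have "I.rep u v i i (path_star z) r c = cnj (I.rep (\<lambda>k. cnj (v k)) (\<lambda>k. cnj (u k)) i i z c r)"
    using I.rep_star[OF z rc, of "\<lambda>k. cnj (u k)" "\<lambda>k. cnj (v k)"] by simp
  then show "sphere_map (path_star z) p $$ (r, c) = maps_star (sphere_map z) p $$ (r, c)"
    using sphere_map_index[OF I.path_star_hom_paths[OF z] p rc]
      sphere_map_index[OF z cnj3_sphere[OF p(1)] represents_cnj3[OF p(2)] rc(2,1)]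
      carrier_matD[OF sphere_map_carrier[OF cnj3_sphere[OF p(1)], of z]] rc p(1)
    by (simp add: maps_star_def)
qed (simp_all add: sphere_map_extensional sphere_map_carrier maps_star_def cnj3_sphere mat_adjoint_carrier)

lemma rep_conj_eq:
  assumes "g \<in> \<Gamma>"
  shows "rep_conj (V i) g M = \<tau> i g * M * mat_adjoint (\<tau> i g)"
  by (simp add: rep_conj_def SU2_inv[OF group_SU2D(1)[OF assms]] rep_adjoint[OF vertex assms])

lemma rep_conj_cancel:
  assumes g: "g \<in> \<Gamma>" and M: "M \<in> carrier_mat d d"
  shows "mat_adjoint (\<tau> i g) * rep_conj (V i) g M * \<tau> i g = M"
proof -
  note u = unitary_mapD[OF unitary[OF vertex] g]
  note [simp] = u(1) mat_adjoint_carrier[OF u(1)] M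
  have "mat_adjoint (\<tau> i g) * rep_conj (V i) g M * \<tau> i g
    = (mat_adjoint (\<tau> i g) * \<tau> i g) * M * (mat_adjoint (\<tau> i g) * \<tau> i g)"
    unfolding rep_conj_eq[OF g]
    by (simp add: assoc_mult_mat[of _ d d _ d _ d] mult_carrier_mat[of _ d d _ d])
  then show ?thesis by (simp add: u(2) left_mult_one_mat[OF M] right_mult_one_mat[OF M])
qed

text \<open>The image of -1 commutes with the irreducible representation, so it is a scalar by
  Schur's lemma; in the conjugation it cancels against its adjoint.\<close>

lemma rep_conj_uminus:
  assumes g: "g \<in> \<Gamma>" and M: "M \<in> carrier_mat d d"
  shows "rep_conj (V i) (- g) M = rep_conj (V i) g M"
proof -
  let ?X = "\<tau> i (- 1\<^sub>m 2)"
  note m = minus_one_in_group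
  note X = unitary_mapD[OF unitary[OF vertex] m] and t = unitary_mapD[OF unitary[OF vertex] g]
  have "?X * \<tau> i h = \<tau> i h * ?X" if h: "h \<in> \<Gamma>" for h
    using rep_mult[OF vertex m h] rep_mult[OF vertex h m] uminus_in_group(2,3)[OF h] by simp
  then have Xi: "intertwiner \<Gamma> d (\<tau> i) d (\<tau> i) ?X"
    unfolding intertwiner_def using X(1) by blast
  obtain a where a: "?X = a \<cdot>\<^sub>m 1\<^sub>m d"
    by (rule schur_scalar[OF irreducible[OF vertex] _ Xi]) (use rep_carrier[OF vertex] in auto)
  have XM: "?X * M = M * ?X"
    unfolding a mult_smult_distrib[OF M one_carrier_mat] mult_smult_assoc_mat[OF one_carrier_mat M]
    using M by simp
  have "rep_conj (V i) (- g) M = (\<tau> i g * ?X) * M * mat_adjoint (\<tau> i g * ?X)"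
    using rep_conj_eq[OF uminus_in_group(1)[OF g]] rep_mult[OF vertex g m] uminus_in_group(2)[OF g] by simp
  also have "\<dots> = \<tau> i g * (?X * M) * mat_adjoint ?X * mat_adjoint (\<tau> i g)"
    unfolding mat_adjoint_mult[OF t(1) X(1)]
    using M X(1) t(1) mat_adjoint_carrier[OF X(1)] mat_adjoint_carrier[OF t(1)]
    by (simp add: assoc_mult_mat[of _ d d _ d _ d] mult_carrier_mat[of _ d d _ d])
  also have "\<dots> = \<tau> i g * M * (?X * mat_adjoint ?X) * mat_adjoint (\<tau> i g)"
    unfolding XM using M X(1) t(1) mat_adjoint_carrier[OF X(1)] mat_adjoint_carrier[OF t(1)]
    by (simp add: assoc_mult_mat[of _ d d _ d _ d] mult_carrier_mat[of _ d d _ d])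
  also have "\<dots> = rep_conj (V i) g M"
    unfolding X(3) rep_conj_eq[OF g] using M t(1) by simp
  finally show ?thesis .
qed

lemma projective_group_carrier: "carrier (projective_group \<Gamma>) = (\<lambda>g. {g, - g}) ` \<Gamma>"
proof -
  have "{1\<^sub>m 2, - 1\<^sub>m 2} #>\<^bsub>G\<^esub> g = {g, - g}" if "g \<in> \<Gamma>" for g
    using uminus_in_group(3)[OF that] group_SU2D(2)[OF that] by (auto simp: r_coset_def)
  then show ?thesis by (auto simp: projective_group_def FactGroup_def RCOSETS_def)
qed

text \<open>Since -1 lies in \<Gamma>, the elements of \<Gamma>' are the pairs {g, -g}. Both members
  act alike, on the sphere and on matrices, so \<open>coset_action\<close> is well defined and the
  condition becomes equivariance under \<Gamma>.\<close>

lemma equivariant_maps_carrier: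
  "f \<in> carrier (equivariant_maps \<Gamma> (V i)) \<longleftrightarrow>
    f \<in> S \<rightarrow>\<^sub>E carrier_mat d d \<and> (\<forall>r<d. \<forall>c<d. polynomial_on S (\<lambda>p. f p $$ (r, c))) \<and>
    (\<forall>g\<in>\<Gamma>. \<forall>p\<in>S. f (rotation g p) = rep_conj (V i) g (f p))"
proof -
  have rot: "coset_action rotation {g, - g} p = rotation g p" if "g \<in> \<Gamma>" "p \<in> S" for g p
    using rotation_uminus[OF that(2) group_SU2D(1)[OF that(1)] group_SU2D(1)[OF uminus_in_group(1)[OF that(1)]]]
    by (simp add: coset_action_def)
  have conj: "coset_action (rep_conj (V i)) {g, - g} M = rep_conj (V i) g M"
    if "g \<in> \<Gamma>" "M \<in> carrier_mat d d" for g M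
    using rep_conj_uminus[OF that] by (simp add: coset_action_def)
  have "(\<forall>C\<in>carrier (projective_group \<Gamma>). \<forall>p\<in>S. f (coset_action rotation C p) = coset_action (rep_conj (V i)) C (f p))
    \<longleftrightarrow> (\<forall>g\<in>\<Gamma>. \<forall>p\<in>S. f (rotation g p) = rep_conj (V i) g (f p))"
    if f: "f \<in> S \<rightarrow>\<^sub>E carrier_mat d d"
  proof -
    have "f (coset_action rotation {g, - g} p) = coset_action (rep_conj (V i)) {g, - g} (f p)
      \<longleftrightarrow> f (rotation g p) = rep_conj (V i) g (f p)" if "g \<in> \<Gamma>" "p \<in> S" for g p
      using rot[OF that] conj[OF that(1), of "f p"] PiE_mem[OF f that(2)] by simp
    then show ?thesis unfolding projective_group_carrier by simp
  qed
  then show ?thesis unfolding equivariant_maps_def Let_def mckayD(2)[OF vertex] by auto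
qed

lemma sphere_map_equivariant:
  assumes z: "z \<in> H" and g: "g \<in> \<Gamma>" and p: "p \<in> S"
  shows "sphere_map z (rotation g p) = rep_conj (V i) g (sphere_map z p)"
proof -
  obtain u v where uv: "represents p u v" using represents_ex[OF p] by blast
  note R = represents_rotation[OF uv group_SU2D(1)[OF g]]
  note t = unitary_mapD[OF unitary[OF vertex] g]
  let ?A = "sphere_map z (rotation g p)" and ?M = "sphere_map z p"
  note A = sphere_map_carrier[OF R(2), of z] and M = sphere_map_carrier[OF p, of z]
  have "\<tau> i g * ?M = ?A * \<tau> i g"
  proof (rule eq_matI)
    fix r c assume "r < dim_row (?A * \<tau> i g)" "c < dim_col (?A * \<tau> i g)"
    then have rc: "r < d" "c < d" using A t(1) by auto
    show "(\<tau> i g * ?M) $$ (r, c) = (?A * \<tau> i g) $$ (r, c)"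
      unfolding mult_mat_index[OF t(1) M rc] mult_mat_index[OF A t(1) rc]
      using I.rep_equivariant[OF z g rc, of u v] sphere_map_index[OF z p uv _ rc(2)] sphere_map_index[OF z R(2,1) rc(1)]
      by simp
  qed (use A M t(1) in auto)
  then have "rep_conj (V i) g ?M = ?A * (\<tau> i g * mat_adjoint (\<tau> i g))"
    unfolding rep_conj_eq[OF g] using assoc_mult_mat[OF A t(1) mat_adjoint_carrier[OF t(1)]] by simp
  then show ?thesis unfolding t(3) right_mult_one_mat[OF A] ..
qed

lemma sphere_map_polynomial:
  assumes z: "z \<in> H" and rc: "r < d" "c < d"
  shows "polynomial_on S (\<lambda>p. sphere_map z p $$ (r, c))"
proof -
  have "polynomial_on S (\<lambda>p. \<Sum>q\<in>Poly_Mapping.keys z. Poly_Mapping.lookup z q *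
    (\<Sum>w\<in>words (length (fst (snd q))). I.path_tensor w (fst (snd q)) r c * sphere_word (i \<in> Ev) p w))"
    by (intro polynomial_on_sum polynomial_on_cmult polynomial_on_sphere_word)
  then show ?thesis
  proof (rule polynomial_on_cong)
    fix p assume p: "p \<in> S"
    note l = represents_lift_point[OF p]
    show "sphere_map z p $$ (r, c) = (\<Sum>q\<in>Poly_Mapping.keys z. Poly_Mapping.lookup z q *
      (\<Sum>w\<in>words (length (fst (snd q))). I.path_tensor w (fst (snd q)) r c * sphere_word (i \<in> Ev) p w))"
      unfolding sphere_map_index[OF z p l rc] by (rule I.rep_sphere_word[OF z l])
  qed
qed

lemma sphere_map_closed: "z \<in> H \<Longrightarrow> sphere_map z \<in> carrier (equivariant_maps \<Gamma> (V i))"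
  unfolding equivariant_maps_carrier
  using sphere_map_carrier[of _ z] sphere_map_extensional[of z] sphere_map_polynomial[of z] sphere_map_equivariant[of z]
  by (auto simp: PiE_iff)

text \<open>Write every entry of \<open>f\<close> as a combination of even words and replace the
  words by word elements. These evaluate to averages over the group, and an equivariant map equals
  its own average.\<close>

lemma sphere_map_surjective:
  assumes f: "f \<in> carrier (equivariant_maps \<Gamma> (V i))"
  shows "\<exists>z\<in>H. sphere_map z = f"
proof -
  have fS: "f \<in> S \<rightarrow>\<^sub>E carrier_mat d d"
    and eq: "g \<in> \<Gamma> \<Longrightarrow> p \<in> S \<Longrightarrow> f (rotation g p) = rep_conj (V i) g (f p)"
    and poly: "r < d \<Longrightarrow> c < d \<Longrightarrow> polynomial_on S (\<lambda>p. f p $$ (r, c))" for g p r c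
    using f unfolding equivariant_maps_carrier by auto
  have fc: "f p \<in> carrier_mat d d" if "p \<in> S" for p using PiE_mem[OF fS that] .
  define P where "P r c W t \<longleftrightarrow> (\<forall>w\<in>W. even (length w)) \<and>
    (\<forall>p\<in>S. f p $$ (r, c) = (\<Sum>w\<in>W. t w * sphere_word (i \<in> Ev) p w))" for r c W t
  define W where "W r c = (SOME W. \<exists>t. P r c W t)" for r c
  define t where "t r c = (SOME t. P r c (W r c) t)" for r c
  have P: "P r c (W r c) (t r c)" if rc: "r < d" "c < d" for r c
  proof -
    obtain W0 t0 where "\<forall>w\<in>W0. even (length w)"
      "\<forall>p\<in>S. f p $$ (r, c) = (\<Sum>w\<in>W0. t0 w * sphere_word (i \<in> Ev) p w)"
      using polynomial_on_word_span[OF poly[OF rc]] by (rule word_spanE)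
    then have "\<exists>W t. P r c W t" unfolding P_def by (intro exI conjI)
    then have "\<exists>t. P r c (W r c) t" unfolding W_def by (rule someI_ex)
    then show ?thesis unfolding t_def by (rule someI_ex)
  qed
  have W: "even (length w)" if "r < d" "c < d" "w \<in> W r c" for r c w
    using P[OF that(1,2)] that(3) unfolding P_def by simp
  have ft: "(\<Sum>w\<in>W r c. t r c w * sphere_word (i \<in> Ev) p w) = f p $$ (r, c)"
    if "r < d" "c < d" "p \<in> S" for r c p
    using P[OF that(1,2)] that(3) unfolding P_def by simp
  \<comment> \<open>The denominator cancels the factor \<delta> in \<open>rep_word_elt\<close>; the
    factor 1 / card \<Gamma> that is left there belongs to the average.\<close>
  define z where "z = (\<Sum>r<d. \<Sum>c<d. \<Sum>w\<in>W r c. scale (t r c w / of_nat d) (I.word_elt w i r i c))"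
  have zH: "z \<in> H"
    unfolding z_def by (intro hom_paths_sum hom_paths_scale I.word_elt_hom_paths vertex)
  have "sphere_map z = f"
  proof (rule sphere_maps_eqI[of _ _ d])
    fix p u v r' c' assume p: "p \<in> S" "represents p u v" and rc': "r' < d" "c' < d"
    note R = represents_rotation[OF p(2) group_SU2D(1)]
    let ?s = "\<lambda>g w. word_value (I.coord (act_left g u) (act_right g v) i) (I.coord (act_right g v) (act_left g u) i) w"
    have s: "?s g w = sphere_word (i \<in> Ev) (rotation g p) w" if "g \<in> \<Gamma>" "even (length w)" for g w
      using word_value_sphere_word[OF R(1)[OF that(1)] that(2), of "i \<in> Ev"] by (simp add: I.coord_def)
    have d0: "(of_nat d :: complex) \<noteq> 0" and n0: "(of_nat (card \<Gamma>) :: complex) \<noteq> 0"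
      using dim_pos[OF vertex] finite_group one_in_group by auto
    have averaged: "(\<Sum>w\<in>W r c. t r c w / of_nat d * I.rep u v i i (I.word_elt w i r i c) r' c')
      = (\<Sum>g\<in>\<Gamma>. cnj (\<tau> i g $$ (r, r')) * f (rotation g p) $$ (r, c) * \<tau> i g $$ (c, c')) / of_nat (card \<Gamma>)"
      if rc: "r < d" "c < d" for r c
    proof -
      have "(\<Sum>w\<in>W r c. t r c w / of_nat d * I.rep u v i i (I.word_elt w i r i c) r' c')
        = (\<Sum>w\<in>W r c. \<Sum>g\<in>\<Gamma>. cnj (\<tau> i g $$ (r, r')) * \<tau> i g $$ (c, c') * (t r c w * sphere_word (i \<in> Ev) (rotation g p) w) / of_nat (card \<Gamma>))"
      proof (rule sum.cong[OF refl])
        fix w assume w: "w \<in> W r c"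
        have "(\<Sum>g\<in>\<Gamma>. cnj (\<tau> i g $$ (r, r')) * \<tau> i g $$ (c, c') * ?s g w)
          = (\<Sum>g\<in>\<Gamma>. cnj (\<tau> i g $$ (r, r')) * \<tau> i g $$ (c, c') * sphere_word (i \<in> Ev) (rotation g p) w)"
          using s W[OF rc w] by simp
        then show "t r c w / of_nat d * I.rep u v i i (I.word_elt w i r i c) r' c'
          = (\<Sum>g\<in>\<Gamma>. cnj (\<tau> i g $$ (r, r')) * \<tau> i g $$ (c, c') * (t r c w * sphere_word (i \<in> Ev) (rotation g p) w) / of_nat (card \<Gamma>))"
          unfolding I.rep_word_elt[OF vertex vertex rc(1) rc'(1) rc(2) rc'(2)]
          using d0 by (simp add: sum_distrib_left sum_divide_distrib mult_ac)
      qed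
      also have "\<dots> = (\<Sum>g\<in>\<Gamma>. cnj (\<tau> i g $$ (r, r')) * \<tau> i g $$ (c, c') *
          (\<Sum>w\<in>W r c. t r c w * sphere_word (i \<in> Ev) (rotation g p) w) / of_nat (card \<Gamma>))"
        by (subst sum.swap) (simp add: sum_distrib_left sum_divide_distrib)
      also have "\<dots> = (\<Sum>g\<in>\<Gamma>. cnj (\<tau> i g $$ (r, r')) * f (rotation g p) $$ (r, c) * \<tau> i g $$ (c, c')) / of_nat (card \<Gamma>)"
        using ft[OF rc R(2)] by (simp add: sum_divide_distrib mult_ac)
      finally show ?thesis .
    qed
    \<comment> \<open>Equivariance undoes the conjugation, so every group element contributes the
      same value.\<close>
    have conj: "(\<Sum>r<d. \<Sum>c<d. cnj (\<tau> i g $$ (r, r')) * f (rotation g p) $$ (r, c) * \<tau> i g $$ (c, c')) = f p $$ (r', c')"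
      if g: "g \<in> \<Gamma>" for g
    proof -
      note u = unitary_mapD(1)[OF unitary[OF vertex] g] and fr = fc[OF R(2)[OF g]]
      have "f p $$ (r', c') = (mat_adjoint (\<tau> i g) * f (rotation g p) * \<tau> i g) $$ (r', c')"
        unfolding eq[OF g p(1)] rep_conj_cancel[OF g fc[OF p(1)]] ..
      also have "\<dots> = (\<Sum>c<d. (\<Sum>r<d. cnj (\<tau> i g $$ (r, r')) * f (rotation g p) $$ (r, c)) * \<tau> i g $$ (c, c'))"
        unfolding mult_mat_index[OF mult_carrier_mat[OF mat_adjoint_carrier[OF u] fr] u rc']
        using u rc' mult_mat_index[OF mat_adjoint_carrier[OF u] fr rc'(1)] by simp
      also have "\<dots> = (\<Sum>r<d. \<Sum>c<d. cnj (\<tau> i g $$ (r, r')) * f (rotation g p) $$ (r, c) * \<tau> i g $$ (c, c'))"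
        unfolding sum_distrib_right by (rule sum.swap)
      finally show ?thesis ..
    qed
    have "sphere_map z p $$ (r', c')
      = (\<Sum>r<d. \<Sum>c<d. \<Sum>w\<in>W r c. t r c w / of_nat d * I.rep u v i i (I.word_elt w i r i c) r' c')"
      unfolding sphere_map_index[OF zH p rc'] by (simp add: z_def I.rep_sum)
    also have "\<dots> = (\<Sum>r<d. \<Sum>c<d. \<Sum>g\<in>\<Gamma>. cnj (\<tau> i g $$ (r, r')) * f (rotation g p) $$ (r, c) * \<tau> i g $$ (c, c')) / of_nat (card \<Gamma>)"
      using averaged by (simp add: sum_divide_distrib)
    also have "(\<Sum>r<d. \<Sum>c<d. \<Sum>g\<in>\<Gamma>. cnj (\<tau> i g $$ (r, r')) * f (rotation g p) $$ (r, c) * \<tau> i g $$ (c, c'))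
      = (\<Sum>r<d. \<Sum>g\<in>\<Gamma>. \<Sum>c<d. cnj (\<tau> i g $$ (r, r')) * f (rotation g p) $$ (r, c) * \<tau> i g $$ (c, c'))"
      by (intro sum.cong refl sum.swap)
    also have "\<dots> = (\<Sum>g\<in>\<Gamma>. \<Sum>r<d. \<Sum>c<d. cnj (\<tau> i g $$ (r, r')) * f (rotation g p) $$ (r, c) * \<tau> i g $$ (c, c'))"
      by (rule sum.swap)
    also have "\<dots> = of_nat (card \<Gamma>) * f p $$ (r', c')" using conj by simp
    finally show "sphere_map z p $$ (r', c') = f p $$ (r', c')" using n0 by simp
  qed (use fS fc in \<open>auto simp: sphere_map_extensional sphere_map_carrier PiE_iff\<close>)
  with zH show ?thesis by blast
qed

theorem corner_algebra_iso:
  "\<exists>\<phi>\<in>algebra_iso (I.corner_algebra i) (equivariant_maps \<Gamma> (V i)).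
    \<forall>X\<in>carrier (I.corner_algebra i). \<phi> (preprojective_star Q lam X) = maps_star (\<phi> X)"
proof -
  note carrier = I.corner_algebra_carrier[OF vertex] and ops = I.corner_algebra_ops
  \<comment> \<open>The value is taken at a chosen representative; \<open>sphere_map_eq_iff\<close>
    makes the choice immaterial in one direction and gives injectivity in the other.\<close>
  define \<phi> where "\<phi> X = sphere_map (SOME z. z \<in> H \<and> X = I.coset z)" for X
  have \<phi>: "\<phi> (I.coset z) = sphere_map z" if "z \<in> H" for z
  proof -
    define z' where "z' = (SOME z'. z' \<in> H \<and> I.coset z = I.coset z')"
    have z': "z' \<in> H \<and> I.coset z = I.coset z'"
      unfolding z'_def by (rule someI[of _ z]) (use that in simp)
    then have "sphere_map z' = sphere_map z" using sphere_map_eq_iff[of z' z] that by simp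
    then show ?thesis unfolding \<phi>_def z'_def .
  qed
  have t: "trivial_path i \<in> H" using I.D.trivial_hom_paths[of i] vertex by simp
  have E: "monoid.mult (equivariant_maps \<Gamma> (V i)) = (\<lambda>f g. \<lambda>p\<in>S. f p * g p)"
    "add (equivariant_maps \<Gamma> (V i)) = (\<lambda>f g. \<lambda>p\<in>S. f p + g p)"
    "one (equivariant_maps \<Gamma> (V i)) = (\<lambda>p\<in>S. 1\<^sub>m d)"
    "module.smult (equivariant_maps \<Gamma> (V i)) = (\<lambda>a f. \<lambda>p\<in>S. a \<cdot>\<^sub>m f p)"
    by (simp_all add: equivariant_maps_def Let_def mckayD(2)[OF vertex])
  have "\<phi> \<in> Ring.ring_hom (I.corner_algebra i) (equivariant_maps \<Gamma> (V i))"
  proof (rule ring_hom_memI)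
    fix X Y assume "X \<in> carrier (I.corner_algebra i)" "Y \<in> carrier (I.corner_algebra i)"
    then obtain z z' where z: "z \<in> H" "z' \<in> H" and XY: "X = I.coset z" "Y = I.coset z'"
      unfolding carrier by blast
    show "\<phi> X \<in> carrier (equivariant_maps \<Gamma> (V i))"
      unfolding XY \<phi>[OF z(1)] by (rule sphere_map_closed[OF z(1)])
    show "\<phi> (X \<otimes>\<^bsub>I.corner_algebra i\<^esub> Y) = \<phi> X \<otimes>\<^bsub>equivariant_maps \<Gamma> (V i)\<^esub> \<phi> Y"
      unfolding XY ops(1)[OF z] \<phi>[OF z(1)] \<phi>[OF z(2)] \<phi>[OF I.D.hom_paths_mult[OF z]] E by (rule sphere_map_mult[OF z])
    show "\<phi> (X \<oplus>\<^bsub>I.corner_algebra i\<^esub> Y) = \<phi> X \<oplus>\<^bsub>equivariant_maps \<Gamma> (V i)\<^esub> \<phi> Y"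
      unfolding XY ops(2)[OF z] \<phi>[OF z(1)] \<phi>[OF z(2)] \<phi>[OF hom_paths_add[OF z]] E by (rule sphere_map_add[OF z])
  next
    show "\<phi> \<one>\<^bsub>I.corner_algebra i\<^esub> = \<one>\<^bsub>equivariant_maps \<Gamma> (V i)\<^esub>"
      unfolding ops(3)[OF t t] \<phi>[OF t] E by (rule sphere_map_one)
  qed
  moreover have "bij_betw \<phi> (carrier (I.corner_algebra i)) (carrier (equivariant_maps \<Gamma> (V i)))"
    unfolding bij_betw_def
  proof
    show "inj_on \<phi> (carrier (I.corner_algebra i))"
    proof (rule inj_onI)
      fix X Y assume "X \<in> carrier (I.corner_algebra i)" "Y \<in> carrier (I.corner_algebra i)" and eq: "\<phi> X = \<phi> Y"
      then obtain z z' where z: "z \<in> H" "z' \<in> H" and XY: "X = I.coset z" "Y = I.coset z'"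
        unfolding carrier by blast
      show "X = Y"
        using eq unfolding XY \<phi>[OF z(1)] \<phi>[OF z(2)] sphere_map_eq_iff[OF z] .
    qed
    show "\<phi> ` carrier (I.corner_algebra i) = carrier (equivariant_maps \<Gamma> (V i))"
    proof
      show "\<phi> ` carrier (I.corner_algebra i) \<subseteq> carrier (equivariant_maps \<Gamma> (V i))"
        unfolding carrier using sphere_map_closed \<phi> by auto
      show "carrier (equivariant_maps \<Gamma> (V i)) \<subseteq> \<phi> ` carrier (I.corner_algebra i)"
      proof
        fix f assume "f \<in> carrier (equivariant_maps \<Gamma> (V i))"
        then obtain z where "z \<in> H" "sphere_map z = f" using sphere_map_surjective by blast
        then show "f \<in> \<phi> ` carrier (I.corner_algebra i)" unfolding carrier using \<phi> by force
      qed
    qed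
  qed
  moreover have "\<phi> (a \<odot>\<^bsub>I.corner_algebra i\<^esub> X) = a \<odot>\<^bsub>equivariant_maps \<Gamma> (V i)\<^esub> \<phi> X"
    "\<phi> (preprojective_star Q lam X) = maps_star (\<phi> X)" if X: "X \<in> carrier (I.corner_algebra i)" for a X
  proof -
    obtain z where z: "z \<in> H" and X: "X = I.coset z" using X unfolding carrier by blast
    show "\<phi> (a \<odot>\<^bsub>I.corner_algebra i\<^esub> X) = a \<odot>\<^bsub>equivariant_maps \<Gamma> (V i)\<^esub> \<phi> X"
      unfolding X ops(4)[OF z z] \<phi>[OF z] \<phi>[OF hom_paths_scale[OF z]] E by (rule sphere_map_scale[OF z])
    show "\<phi> (preprojective_star Q lam X) = maps_star (\<phi> X)"
      unfolding X ops(5)[OF z z] \<phi>[OF z] \<phi>[OF I.path_star_hom_paths[OF z]] by (rule sphere_map_star[OF z])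
  qed
  ultimately show ?thesis by (intro bexI[of _ \<phi>]) (auto simp: algebra_iso_def ring_iso_def)
qed

end

theorem theorem1:
  fixes Q :: "('v, 'e) pre_digraph"
    and T :: affine_type
    and v0 i :: 'v
    and Ev :: "'v set"
    and \<delta> :: "'v \<Rightarrow> nat"
    and lam :: "'v \<Rightarrow> complex"
    and \<Gamma> :: "complex mat set"
    and V :: "'v \<Rightarrow> complex mat rep"
  assumes "extended_dynkin T Q v0"
    and "\<not> (\<exists>n. T = A_tilde n \<and> odd (n + 1))"
    and "minimal_imaginary_root Q \<delta>"
    and "v0 \<in> Ev"
    and "\<forall>a\<in>arcs Q. tail Q a \<notin> Ev \<and> head Q a \<in> Ev"
    and "\<forall>j\<in>verts Q. lam j = (if j \<in> Ev then of_nat (\<delta> j) else - of_nat (\<delta> j))"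
    and "mckay_correspondence Q v0 \<delta> \<Gamma> V"
    and "\<forall>j\<in>verts Q. unitary_rep (SU2_sub \<Gamma>) (V j)"
    and "i \<in> verts Q"
  shows "\<exists>\<phi> \<in> algebra_iso
                (corner (deformed_preprojective_algebra Q lam) (vertex_idempotent Q lam i))
                (equivariant_maps \<Gamma> (V i)).
           \<forall>X \<in> carrier (corner (deformed_preprojective_algebra Q lam) (vertex_idempotent Q lam i)).
             \<phi> (preprojective_star Q lam X) = maps_star (\<phi> X)"
proof -
  interpret mckay_vertex Q T v0 Ev \<delta> lam \<Gamma> V i
    using assms(1,3-9) by unfold_locales
  show ?thesis by (rule corner_algebra_iso)
qed

end
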